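(* Let $p,q$ be integers and $M=\mathbb P(\mathcal O_{\mathbb CP^1\times\mathbb CP^1}\oplus\mathcal O_{\mathbb CP^1\times\mathbb CP^1}(p,q))$. For $(p,q)=(0,0)$, the manifold is the product of three copies of $\mathbb CP^1$ and admits, up to scale, a two-parameter family of constant scalar curvature metrics. If $p>0$ and $q<0$, then the manifold admits at least a one-parameter family of constant scalar curvature metrics within its two-parameter family of extremal Kähler metrics. For $p\ge0$ and $q>0$, the manifold admits no constant scalar curvature Kähler metrics.
   Context: A Kähler metric is extremal if the gradient of its scalar curvature is a holomorphic vector field. The metrics considered on $M$ are the cohomogeneity-one fiberwise Kähler toric metrics: on the dense union of principal orbits, which are principal $S^1$-bundles over $\mathbb CP^1\times\mathbb CP^1$ with connection form $\theta$, $$g=\frac1h\,dx^2+h\,\theta\otimes\theta+(bx+a)\,g_1^*+(dx+c)\,g_2^*,\qquad x\in(-1,1)\ (\text{after translation and scaling}),$$ where $g_1^*,g_2^*$ are the Kähler–Einstein metrics with Einstein constant $1$ on the two factors $\mathbb CP^1$, with Kähler forms $\omega_1^*,\omega_2^*$, $d\theta=b\,\omega_1^*+d\,\omega_2^*$ (pulled back), $b=-\frac p2$, $d=-\frac q2$; $h=h(x)>0$ on $(-1,1)$, $bx+a>0$ and $dx+c>0$ on $[-1,1]$, and $h(\pm1)=0$, $h'(-1)=2$, $h'(1)=-2$. The complex structure maps the $x$-direction to the $S^1$-direction and restricts to the lifted complex structure of $\mathbb CP^1\times\mathbb CP^1$. "Its two-parameter family of extremal Kähler metrics" is the family of extremal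 metrics of this form, parametrized (up to scale) by $(a,c)$: for fixed $(p,q)$, each $(a,c)$ determines uniquely a function $h$ satisfying the extremal equation and the boundary conditions, and this defines a metric whenever $h>0$ on $(-1,1)$ (in particular for $a,c$ sufficiently large). *)

theory Defs
  imports "HOL-Analysis.Analysis"
begin

section \<open>Riemannian geometry in a chart\<close>

text \<open>
  A metric on (an open subset of) a Euclidean space is a function \<open>g\<close> with \<open>g z u v\<close> the
  inner product of the tangent vectors \<open>u\<close>, \<open>v\<close> at \<open>z\<close>.  Tangent vectors \<open>u\<close>, \<open>v\<close>, \<open>w\<close> below are
  also read as constant vector fields, so all Lie brackets vanish.
\<close>

definition dird :: "('a::real_normed_vector \<Rightarrow> 'b::real_normed_vector) \<Rightarrow> 'a \<Rightarrow> 'a \<Rightarrow> 'b" where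
  "dird f z v = frechet_derivative f (at z) v"

primrec Ck_on :: "nat \<Rightarrow> 'a::real_normed_vector set \<Rightarrow> ('a \<Rightarrow> 'b::real_normed_vector) \<Rightarrow> bool" where
  "Ck_on 0 S f = continuous_on S f"
| "Ck_on (Suc k) S f = ((\<forall>z\<in>S. f differentiable (at z)) \<and> (\<forall>v. Ck_on k S (\<lambda>z. dird f z v)))"

text \<open>Only used for open \<open>S\<close> in finite-dimensional spaces.\<close>

definition smooth_on :: "'a::real_normed_vector set \<Rightarrow> ('a \<Rightarrow> 'b::real_normed_vector) \<Rightarrow> bool" where
  "smooth_on S f = (\<forall>k. Ck_on k S f)"

text \<open>The vector representing a linear form with respect to a nondegenerate bilinear form.\<close>

definition sharp :: "('a::euclidean_space \<Rightarrow> 'a \<Rightarrow> real) \<Rightarrow> ('a \<Rightarrow> real) \<Rightarrow> 'a" where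
  "sharp b \<alpha> = (THE v. \<forall>w. b v w = \<alpha> w)"

text \<open>The Levi-Civita derivative of the constant field \<open>v\<close> in direction \<open>u\<close> (Koszul formula).\<close>

definition christoffel :: "('a::euclidean_space \<Rightarrow> 'a \<Rightarrow> 'a \<Rightarrow> real) \<Rightarrow> 'a \<Rightarrow> 'a \<Rightarrow> 'a \<Rightarrow> 'a" where
  "christoffel g z u v = sharp (g z)
     (\<lambda>w. (dird (\<lambda>y. g y v w) z u + dird (\<lambda>y. g y u w) z v - dird (\<lambda>y. g y u v) z w) / 2)"

text \<open>\<open>riemann g z u v w\<close> is $R(u,v)w = \nabla_u\nabla_v w - \nabla_v\nabla_u w$.\<close>

definition riemann :: "('a::euclidean_space \<Rightarrow> 'a \<Rightarrow> 'a \<Rightarrow> real) \<Rightarrow> 'a \<Rightarrow> 'a \<Rightarrow> 'a \<Rightarrow> 'a \<Rightarrow> 'a" where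
  "riemann g z u v w =
     dird (\<lambda>y. christoffel g y v w) z u - dird (\<lambda>y. christoffel g y u w) z v
     + christoffel g z u (christoffel g z v w) - christoffel g z v (christoffel g z u w)"

definition ricci :: "('a::euclidean_space \<Rightarrow> 'a \<Rightarrow> 'a \<Rightarrow> real) \<Rightarrow> 'a \<Rightarrow> 'a \<Rightarrow> 'a \<Rightarrow> real" where
  "ricci g z v w = (\<Sum>e\<in>Basis. riemann g z e v w \<bullet> e)"

text \<open>\<open>Basis\<close> is orthonormal for \<open>\<bullet>\<close>, not for \<open>g\<close>; the sum is the trace of the Ricci endomorphism.\<close>

definition scalar_curvature :: "('a::euclidean_space \<Rightarrow> 'a \<Rightarrow> 'a \<Rightarrow> real) \<Rightarrow> 'a \<Rightarrow> real" where
  "scalar_curvature g z = (\<Sum>e\<in>Basis. sharp (g z) (ricci g z e) \<bullet> e)"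

definition gradient :: "('a::euclidean_space \<Rightarrow> 'a \<Rightarrow> 'a \<Rightarrow> real) \<Rightarrow> ('a \<Rightarrow> real) \<Rightarrow> 'a \<Rightarrow> 'a" where
  "gradient g f z = sharp (g z) (dird f z)"


section \<open>Complex manifolds given by an atlas\<close>

text \<open>Multiplication by \<open>\<i>\<close>: the standard complex structure of $\mathbb C^n$.\<close>

definition J :: "complex^'n \<Rightarrow> complex^'n" where
  "J v = \<i> *s v"

text \<open>Holomorphic maps of several variables on an open set: complex-linear derivatives.\<close>

definition holo_on :: "(complex^'n) set \<Rightarrow> (complex^'n \<Rightarrow> complex^'m) \<Rightarrow> bool" where
  "holo_on S f = (\<forall>z\<in>S. \<exists>f'. (f has_derivative f') (at z) \<and> (\<forall>v. f' (J v) = J (f' v)))"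

text \<open>
  The complex manifolds below all have atlases whose charts are onto $\mathbb C^n$.  An atlas is
  therefore given by the set of the inverse charts, injective maps from $\mathbb C^n$ into the
  set \<open>'m\<close> of points, and the manifold is the union of their ranges.
\<close>

type_synonym ('m, 'n) atlas = "(complex^'n \<Rightarrow> 'm) set"

definition points :: "('m, 'n::finite) atlas \<Rightarrow> 'm set" where
  "points A = (\<Union>\<psi>\<in>A. range \<psi>)"

definition overlap :: "(complex^'n \<Rightarrow> 'm) \<Rightarrow> (complex^'k \<Rightarrow> 'm) \<Rightarrow> (complex^'n) set" where
  "overlap \<psi> \<phi> = {z. \<psi> z \<in> range \<phi>}"

definition transition :: "(complex^'n \<Rightarrow> 'm) \<Rightarrow> (complex^'k \<Rightarrow> 'm) \<Rightarrow> complex^'n \<Rightarrow> complex^'k" where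
  "transition \<psi> \<phi> = inv \<phi> \<circ> \<psi>"

definition complex_atlas :: "('m, 'n::finite) atlas \<Rightarrow> bool" where
  "complex_atlas A =
     ((\<forall>\<psi>\<in>A. inj \<psi>) \<and>
      (\<forall>\<psi>\<in>A. \<forall>\<phi>\<in>A. open (overlap \<psi> \<phi>) \<and> holo_on (overlap \<psi> \<phi>) (transition \<psi> \<phi>)))"

definition holo_map :: "('m, 'n::finite) atlas \<Rightarrow> ('l, 'k::finite) atlas \<Rightarrow> ('m \<Rightarrow> 'l) \<Rightarrow> bool" where
  "holo_map A B f =
     (f ` points A \<subseteq> points B \<and>
      (\<forall>\<psi>\<in>A. \<forall>\<phi>\<in>B. open (overlap (f \<circ> \<psi>) \<phi>) \<and>
                     holo_on (overlap (f \<circ> \<psi>) \<phi>) (transition (f \<circ> \<psi>) \<phi>)))"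

definition biholomorphic :: "('m, 'n::finite) atlas \<Rightarrow> ('l, 'k::finite) atlas \<Rightarrow> bool" where
  "biholomorphic A B =
     (\<exists>f f'. holo_map A B f \<and> holo_map B A f' \<and>
             (\<forall>x\<in>points A. f' (f x) = x) \<and> (\<forall>y\<in>points B. f (f' y) = y))"


section \<open>Kaehler metrics on a complex manifold\<close>

text \<open>
  A metric on the manifold is a family of local metrics indexed by the inverse charts of the
  atlas, subject to the tensor transformation law; its values at indices outside the atlas are
  irrelevant.
\<close>

type_synonym ('m, 'n) metric_field =
  "(complex^'n \<Rightarrow> 'm) \<Rightarrow> complex^'n \<Rightarrow> complex^'n \<Rightarrow> complex^'n \<Rightarrow> real"

definition riemannian_metric :: "('m, 'n::finite) atlas \<Rightarrow> ('m, 'n) metric_field \<Rightarrow> bool" where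
  "riemannian_metric A g =
     ((\<forall>\<psi>\<in>A.
         (\<forall>u v. smooth_on UNIV (\<lambda>z. g \<psi> z u v)) \<and>
         (\<forall>z. bilinear (g \<psi> z) \<and> (\<forall>u v. g \<psi> z u v = g \<psi> z v u) \<and>
              (\<forall>u. u \<noteq> 0 \<longrightarrow> g \<psi> z u u > 0))) \<and>
      (\<forall>\<psi>\<in>A. \<forall>\<phi>\<in>A. \<forall>z\<in>overlap \<psi> \<phi>. \<forall>u v.
         g \<psi> z u v = g \<phi> (transition \<psi> \<phi> z) (dird (transition \<psi> \<phi>) z u)
                                           (dird (transition \<psi> \<phi>) z v)))"

definition fundamental_form ::
    "(complex^'n \<Rightarrow> complex^'n \<Rightarrow> complex^'n \<Rightarrow> real) \<Rightarrow> complex^'n \<Rightarrow> complex^'n \<Rightarrow> complex^'n \<Rightarrow> real" where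
  "fundamental_form g z u v = g z (J u) v"

definition kahler_metric :: "('m, 'n::finite) atlas \<Rightarrow> ('m, 'n) metric_field \<Rightarrow> bool" where
  "kahler_metric A g =
     (riemannian_metric A g \<and>
      (\<forall>\<psi>\<in>A. \<forall>z.
         (\<forall>u v. g \<psi> z (J u) (J v) = g \<psi> z u v) \<and>
         (\<forall>u v w. dird (\<lambda>y. fundamental_form (g \<psi>) y v w) z u
                + dird (\<lambda>y. fundamental_form (g \<psi>) y w u) z v
                + dird (\<lambda>y. fundamental_form (g \<psi>) y u v) z w = 0)))"

definition constant_scalar_curvature :: "('m, 'n::finite) atlas \<Rightarrow> ('m, 'n) metric_field \<Rightarrow> bool" where
  "constant_scalar_curvature A g = (\<exists>s. \<forall>\<psi>\<in>A. \<forall>z. scalar_curvature (g \<psi>) z = s)"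

text \<open>
  A real vector field is holomorphic iff its components with respect to holomorphic coordinates,
  under $T\mathbb C^n = \mathbb C^n \times \mathbb C^n$, are holomorphic functions.
\<close>

definition extremal :: "('m, 'n::finite) atlas \<Rightarrow> ('m, 'n) metric_field \<Rightarrow> bool" where
  "extremal A g = (\<forall>\<psi>\<in>A. holo_on UNIV (gradient (g \<psi>) (scalar_curvature (g \<psi>))))"

definition same_up_to_scale ::
    "('m, 'n::finite) atlas \<Rightarrow> ('m, 'n) metric_field \<Rightarrow> ('m, 'n) metric_field \<Rightarrow> bool" where
  "same_up_to_scale A g g' =
     (\<exists>r>0. \<forall>\<psi>\<in>A. \<forall>z u v. g' \<psi> z u v = r * g \<psi> z u v)"


section \<open>The manifolds\<close>

text \<open>Affine coordinates on the projective line: the $i$-th homogeneous coordinate is 1.\<close>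

definition aff :: "2 \<Rightarrow> complex \<Rightarrow> complex^2" where
  "aff i z = (\<chi> l. if l = i then 1 else z)"

definition CP1_pt :: "complex^2 \<Rightarrow> (complex^2) set" where
  "CP1_pt u = {r *s u | r. r \<noteq> 0}"

definition CP1_cubed :: "((complex^2) set \<times> (complex^2) set \<times> (complex^2) set, 3) atlas" where
  "CP1_cubed =
     {\<lambda>y. (CP1_pt (aff i (y $ 1)), CP1_pt (aff j (y $ 2)), CP1_pt (aff k (y $ 3))) | i j k. True}"

text \<open>
  The line bundle $\mathcal O(p,q)$ over $\mathbb{CP}^1\times\mathbb{CP}^1$ is the quotient of
  $(\mathbb C^2\setminus 0)\times(\mathbb C^2\setminus 0)\times\mathbb C$ by
  $(u,v,t)\sim(lu,mv,l^pm^qt)$, whose sections are the functions that are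
  homogeneous of bidegree $(p,q)$.  A point of
  $\mathbb P(\mathcal O\oplus\mathcal O(p,q))$ is a class of triples $(u,v,f)$ of nonzero vectors,
  $f=(s,t)$ being a fibre element of $\mathcal O\oplus\mathcal O(p,q)$ up to a factor $n$.
\<close>

definition PB_pt :: "int \<Rightarrow> int \<Rightarrow> complex^2 \<Rightarrow> complex^2 \<Rightarrow> complex^2
    \<Rightarrow> ((complex^2) \<times> (complex^2) \<times> (complex^2)) set" where
  "PB_pt p q u v f =
     {(l *s u, m *s v, vector [n * f $ 1, n * (l powi p * m powi q * f $ 2)]) | l m n.
        l \<noteq> 0 \<and> m \<noteq> 0 \<and> n \<noteq> 0}"

type_synonym PB_point = "((complex^2) \<times> (complex^2) \<times> (complex^2)) set"

definition PB_chart :: "int \<Rightarrow> int \<Rightarrow> 2 \<Rightarrow> 2 \<Rightarrow> 2 \<Rightarrow> complex^3 \<Rightarrow> PB_point" where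
  "PB_chart p q i j k y = PB_pt p q (aff i (y $ 1)) (aff j (y $ 2)) (aff k (y $ 3))"

definition PB :: "int \<Rightarrow> int \<Rightarrow> (PB_point, 3) atlas" where
  "PB p q = {PB_chart p q i j k | i j k. True}"


section \<open>The cohomogeneity-one extremal metrics\<close>

text \<open>
  Kaehler--Einstein metric with Einstein constant 1 on the projective line, in an affine
  coordinate: the round metric of curvature 1.
\<close>

definition FS :: "complex \<Rightarrow> complex \<Rightarrow> complex \<Rightarrow> real" where
  "FS z u v = 4 * (u \<bullet> v) / (1 + (cmod z)\<^sup>2)\<^sup>2"

definition FS_form :: "complex \<Rightarrow> complex \<Rightarrow> complex \<Rightarrow> real" where
  "FS_form z u v = FS z (\<i> * u) v"

text \<open>
  The charts \<open>PB_chart p q i j 1\<close> cover $\mathcal O(p,q)$, the third coordinate being linear on the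
  fibres; the principal orbits fill the complement of the zero section there.
\<close>

definition off_zero :: "(complex^3) set" where
  "off_zero = {y. y $ 3 \<noteq> 0}"

definition principal :: "int \<Rightarrow> int \<Rightarrow> PB_point set" where
  "principal p q = {PB_chart p q i j 1 y | i j y. y \<in> off_zero}"

text \<open>Generator of the action of $S^1$ by fibrewise multiplication.\<close>

definition circle_field :: "complex^3 \<Rightarrow> complex^3" where
  "circle_field y = axis 3 (\<i> * y $ 3)"

text \<open>
  The metric \<open>g\<close> has the form
  $\frac1h dx^2+h\,\theta\otimes\theta+(bx+a)g_1^*+(dx+c)g_2^*$ on the principal part, where
  \<open>x\<close> is a function there, constant on the $S^1$-orbits, and \<open>\<theta> i j\<close> is the connection form in
  the chart \<open>PB_chart p q i j 1\<close>.  The equation \<open>dx \<circ> J = - h \<theta>\<close> says that the complex structure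
  maps the $x$-direction to the (positive) circle direction and preserves the horizontal spaces;
  it also forces the \<open>\<theta> i j\<close> to be smooth and to agree on overlaps, and the equation for
  \<open>d\<theta>\<close> together with \<open>\<theta>(K) = 1\<close> makes them $S^1$-invariant.
\<close>

definition cohomogeneity_one_form ::
    "int \<Rightarrow> int \<Rightarrow> real \<Rightarrow> real \<Rightarrow> (real \<Rightarrow> real) \<Rightarrow> (PB_point, 3) metric_field \<Rightarrow> bool" where
  "cohomogeneity_one_form p q a c h g =
    (let b = - real_of_int p / 2; d = - real_of_int q / 2 in
      (\<forall>t\<in>{-1..1}. b * t + a > 0 \<and> d * t + c > 0) \<and>
      smooth_on {-1<..<1} h \<and> (\<forall>t\<in>{-1<..<1}. h t > 0) \<and>
      h (-1) = 0 \<and> h 1 = 0 \<and>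
      (h has_real_derivative 2) (at (-1) within {-1..1}) \<and>
      (h has_real_derivative -2) (at 1 within {-1..1}) \<and>
      (\<exists>(x :: PB_point \<Rightarrow> real) (\<theta> :: 2 \<Rightarrow> 2 \<Rightarrow> complex^3 \<Rightarrow> complex^3 \<Rightarrow> real).
         x ` principal p q = {-1<..<1} \<and>
         (\<forall>i j. let \<psi> = PB_chart p q i j 1; X = x \<circ> \<psi> in
            smooth_on off_zero X \<and>
            (\<forall>y\<in>off_zero.
               dird X y (circle_field y) = 0 \<and>
               \<theta> i j y (circle_field y) = 1 \<and>
               (\<forall>v. dird X y (J v) = - h (X y) * \<theta> i j y v) \<and>
               (\<forall>u v. dird (\<lambda>y. \<theta> i j y v) y u - dird (\<lambda>y. \<theta> i j y u) y v =
                        b * FS_form (y $ 1) (u $ 1) (v $ 1) + d * FS_form (y $ 2) (u $ 2) (v $ 2)) \<and>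
               (\<forall>u v. g \<psi> y u v =
                        dird X y u * dird X y v / h (X y)
                        + h (X y) * \<theta> i j y u * \<theta> i j y v
                        + (b * X y + a) * FS (y $ 1) (u $ 1) (v $ 1)
                        + (d * X y + c) * FS (y $ 2) (u $ 2) (v $ 2))))))"

definition extremal_family ::
    "int \<Rightarrow> int \<Rightarrow> real \<times> real \<Rightarrow> (PB_point, 3) metric_field set" where
  "extremal_family p q ac =
     {g. kahler_metric (PB p q) g \<and> extremal (PB p q) g \<and>
         (\<exists>h. cohomogeneity_one_form p q (fst ac) (snd ac) h g)}"

definition csc_parameters :: "int \<Rightarrow> int \<Rightarrow> (real \<times> real) set" where
  "csc_parameters p q =
     {ac. \<exists>g\<in>extremal_family p q ac. constant_scalar_curvature (PB p q) g}"

text \<open>Metrics of the family with different parameters are not constant multiples of each other.\<close>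

definition parameters_effective :: "int \<Rightarrow> int \<Rightarrow> bool" where
  "parameters_effective p q =
     (\<forall>ac ac' g g'. g \<in> extremal_family p q ac \<and> g' \<in> extremal_family p q ac' \<and> ac \<noteq> ac'
        \<longrightarrow> \<not> same_up_to_scale (PB p q) g g')"


section \<open>The charts form a holomorphic atlas of the projective bundle\<close>

lemma two_cases: fixes i :: 2 obtains "i = 1" | "i = 2"
  using exhaust_2 by blast

lemma PB_pt_rescale:
  assumes "l \<noteq> 0" "m \<noteq> 0" "n \<noteq> 0"
  shows "PB_pt p q (l *s u) (m *s v) (vector [n * f $ 1, n * (l powi p * m powi q * f $ 2)]) = PB_pt p q u v f"
    (is "?A = ?B")
proof (rule set_eqI)
  fix t
  show "t \<in> ?A \<longleftrightarrow> t \<in> ?B"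
  proof
    assume "t \<in> ?A"
    then obtain l' m' n' where *: "l' \<noteq> 0" "m' \<noteq> 0" "n' \<noteq> 0"
      "t = (l' *s (l *s u), m' *s (m *s v), vector [n' * (n * f $ 1), n' * (l' powi p * m' powi q * (n * (l powi p * m powi q * f $ 2)))])"
      by (auto simp: PB_pt_def)
    have "t = ((l'*l) *s u, (m'*m) *s v, vector [(n'*n) * f $ 1, (n'*n) * ((l'*l) powi p * (m'*m) powi q * f $ 2)])"
      unfolding * by (simp add: vector_smult_assoc power_int_mult_distrib mult_ac)
    then show "t \<in> ?B" unfolding PB_pt_def using * assms by (intro CollectI exI[of _ "l'*l"] exI[of _ "m'*m"] exI[of _ "n'*n"]) auto
  next
    assume "t \<in> ?B"
    then obtain l' m' n' where *: "l' \<noteq> 0" "m' \<noteq> 0" "n' \<noteq> 0"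
      "t = (l' *s u, m' *s v, vector [n' * (f $ 1), n' * (l' powi p * m' powi q * (f $ 2))])"
      by (auto simp: PB_pt_def)
    have "t = ((l'/l) *s (l *s u), (m'/m) *s (m *s v), vector [(n'/n) * (n * f $ 1), (n'/n) * ((l'/l) powi p * (m'/m) powi q * (n * (l powi p * m powi q * f $ 2)))])"
      unfolding * using assms by (simp add: vector_smult_assoc power_int_divide_distrib field_simps)
    then show "t \<in> ?A" unfolding PB_pt_def using * assms by (intro CollectI exI[of _ "l'/l"] exI[of _ "m'/m"] exI[of _ "n'/n"]) auto
  qed
qed

lemma PB_pt_self: "(u, v, f) \<in> PB_pt p q u v f"
proof -
  have "f = vector [f $ 1, f $ 2]" by (simp add: vec_eq_iff forall_2)
  then show ?thesis unfolding PB_pt_def by (intro CollectI exI[of _ 1]) (auto simp: vector_smult_lid)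
qed

lemma PB_pt_eqD:
  assumes "PB_pt p q u v f = PB_pt p q u' v' f'"
  obtains l m n where "l \<noteq> 0" "m \<noteq> 0" "n \<noteq> 0" "u' = l *s u" "v' = m *s v"
    "f' = vector [n * f $ 1, n * (l powi p * m powi q * f $ 2)]"
  using PB_pt_self[of u' v' f' p q] unfolding assms[symmetric] by (auto simp: PB_pt_def)

definition other :: "2 \<Rightarrow> 2" where "other i = (if i = 1 then 2 else 1)"

definition fibre_coord :: "int \<Rightarrow> int \<Rightarrow> 2 \<Rightarrow> 2 \<Rightarrow> 2 \<Rightarrow> 2 \<Rightarrow> 2 \<Rightarrow> complex^3 \<Rightarrow> 2 \<Rightarrow> complex" where
  "fibre_coord p q i j k i' j' y r =
     (if r = 1 then aff k (y$3) $ 1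
      else inverse (aff i (y$1) $ i') powi p * inverse (aff j (y$2) $ j') powi q * aff k (y$3) $ 2)"

definition PB_trans :: "int \<Rightarrow> int \<Rightarrow> 2 \<Rightarrow> 2 \<Rightarrow> 2 \<Rightarrow> 2 \<Rightarrow> 2 \<Rightarrow> 2 \<Rightarrow> complex^3 \<Rightarrow> complex^3" where
  "PB_trans p q i j k i' j' k' y = vector
     [aff i (y$1) $ other i' * inverse (aff i (y$1) $ i'), aff j (y$2) $ other j' * inverse (aff j (y$2) $ j'),
      fibre_coord p q i j k i' j' y (other k') * inverse (fibre_coord p q i j k i' j' y k')]"

definition PB_overlap :: "2 \<Rightarrow> 2 \<Rightarrow> 2 \<Rightarrow> 2 \<Rightarrow> 2 \<Rightarrow> 2 \<Rightarrow> (complex^3) set" where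
  "PB_overlap i j k i' j' k' = {y. aff i (y$1) $ i' \<noteq> 0 \<and> aff j (y$2) $ j' \<noteq> 0 \<and> aff k (y$3) $ k' \<noteq> 0}"

lemma aff_scale: "u $ i \<noteq> 0 \<Longrightarrow> aff i (u $ other i * inverse (u $ i)) = inverse (u $ i) *s u"
  by (cases i rule: two_cases) (auto simp: aff_def vec_eq_iff forall_2 other_def mult_ac)

lemma PB_chart_tr:
  assumes "y \<in> PB_overlap i j k i' j' k'"
  shows "PB_chart p q i' j' k' (PB_trans p q i j k i' j' k' y) = PB_chart p q i j k y"
proof -
  define u v f where uvf: "u = aff i (y$1)" "v = aff j (y$2)" "f = aff k (y$3)"
  define F where "F = (\<chi> r. fibre_coord p q i j k i' j' y r)"
  have nz: "u $ i' \<noteq> 0" "v $ j' \<noteq> 0" "F $ k' \<noteq> 0"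
    using assms by (auto simp: PB_overlap_def uvf F_def fibre_coord_def, (cases k' rule: two_cases, auto)+)
  have "aff k' (F $ other k' * inverse (F $ k')) = vector [inverse (F $ k') * f $ 1, inverse (F $ k') * (inverse (u $ i') powi p * inverse (v $ j') powi q * f $ 2)]"
    unfolding aff_scale[OF nz(3)]
    by (simp add: vec_eq_iff forall_2) (simp add: F_def fibre_coord_def uvf)
  then show ?thesis
    using PB_pt_rescale[of "inverse (u $ i')" "inverse (v $ j')" "inverse (F $ k')" p q u v f] nz
      aff_scale[OF nz(1)] aff_scale[OF nz(2)]
    by (simp add: PB_chart_def PB_trans_def uvf F_def)
qed

lemma aff_nz: "aff i z $ i = 1" by (simp add: aff_def)

lemma inj_PB_chart: "inj (PB_chart p q i j k)"
proof (rule injI)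
  fix y y' assume "PB_chart p q i j k y = PB_chart p q i j k y'"
  then obtain l m n where *: "l \<noteq> 0" "m \<noteq> 0" "n \<noteq> 0" "aff i (y'$1) = l *s aff i (y$1)" "aff j (y'$2) = m *s aff j (y$2)"
    "aff k (y'$3) = vector [n * aff k (y$3) $ 1, n * (l powi p * m powi q * aff k (y$3) $ 2)]"
    unfolding PB_chart_def by (rule PB_pt_eqD)
  have l: "l = 1" using arg_cong[OF *(4), of "\<lambda>u. u $ i"] by (simp add: aff_nz)
  have m: "m = 1" using arg_cong[OF *(5), of "\<lambda>u. u $ j"] by (simp add: aff_nz)
  have n: "n = 1" using arg_cong[OF *(6), of "\<lambda>u. u $ k"] l m
    by (cases k rule: two_cases) (auto simp: aff_nz)
  have "y $ 1 = y' $ 1" using arg_cong[OF *(4), of "\<lambda>u. u $ other i"] l by (cases i rule: two_cases) (auto simp: aff_def other_def)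
  moreover have "y $ 2 = y' $ 2" using arg_cong[OF *(5), of "\<lambda>u. u $ other j"] m by (cases j rule: two_cases) (auto simp: aff_def other_def)
  moreover have "y $ 3 = y' $ 3" using arg_cong[OF *(6), of "\<lambda>u. u $ other k"] l m n by (cases k rule: two_cases) (auto simp: aff_def other_def)
  ultimately show "y = y'" by (simp add: vec_eq_iff forall_3)
qed

lemma overlap_PB: "overlap (PB_chart p q i j k) (PB_chart p q i' j' k') = PB_overlap i j k i' j' k'"
proof (intro equalityI subsetI)
  fix y assume "y \<in> overlap (PB_chart p q i j k) (PB_chart p q i' j' k')"
  then obtain y' where "PB_chart p q i j k y = PB_chart p q i' j' k' y'" by (auto simp: overlap_def)
  then obtain l m n where *: "l \<noteq> 0" "m \<noteq> 0" "n \<noteq> 0" "aff i' (y'$1) = l *s aff i (y$1)" "aff j' (y'$2) = m *s aff j (y$2)"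
    "aff k' (y'$3) = vector [n * aff k (y$3) $ 1, n * (l powi p * m powi q * aff k (y$3) $ 2)]"
    unfolding PB_chart_def by (rule PB_pt_eqD)
  have "aff i (y$1) $ i' \<noteq> 0" using arg_cong[OF *(4), of "\<lambda>u. u $ i'"] by (auto simp: aff_nz)
  moreover have "aff j (y$2) $ j' \<noteq> 0" using arg_cong[OF *(5), of "\<lambda>u. u $ j'"] by (auto simp: aff_nz)
  moreover have "aff k (y$3) $ k' \<noteq> 0" using arg_cong[OF *(6), of "\<lambda>u. u $ k'"]
    by (cases k' rule: two_cases) (auto simp: aff_nz)
  ultimately show "y \<in> PB_overlap i j k i' j' k'" by (simp add: PB_overlap_def)
next
  fix y assume "y \<in> PB_overlap i j k i' j' k'"
  from PB_chart_tr[OF this] show "y \<in> overlap (PB_chart p q i j k) (PB_chart p q i' j' k')"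
    unfolding overlap_def by (metis mem_Collect_eq rangeI)
qed

lemma transition_PB: "y \<in> PB_overlap i j k i' j' k' \<Longrightarrow>
   transition (PB_chart p q i j k) (PB_chart p q i' j' k') y = PB_trans p q i j k i' j' k' y"
  using PB_chart_tr[of y i j k i' j' k' p q] inj_PB_chart[of p q i' j' k']
  by (simp add: transition_def inv_f_eq)

definition hol1 :: "(complex^3 \<Rightarrow> complex) \<Rightarrow> complex^3 \<Rightarrow> bool" where
  "hol1 f z = (\<exists>f'. (f has_derivative f') (at z) \<and> (\<forall>v. f' (J v) = \<i> * f' v))"

lemma hol1_const: "hol1 (\<lambda>y. c) z" unfolding hol1_def by (intro exI[of _ "\<lambda>_. 0"]) auto
lemma hol1_nth: "hol1 (\<lambda>y. y $ r) z" unfolding hol1_def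
  by (intro exI[of _ "\<lambda>y. y $ r"]) (auto simp: J_def bounded_linear_imp_has_derivative bounded_linear_vec_nth)
lemma hol1_mult: "hol1 f z \<Longrightarrow> hol1 g z \<Longrightarrow> hol1 (\<lambda>y. f y * g y) z"
  unfolding hol1_def apply clarify subgoal for f' g'
  by (rule exI[of _ "\<lambda>h. f z * g' h + f' h * g z"]) (auto intro: has_derivative_mult simp: algebra_simps) done
lemma hol1_inverse: "hol1 f z \<Longrightarrow> f z \<noteq> 0 \<Longrightarrow> hol1 (\<lambda>y. inverse (f y)) z"
  unfolding hol1_def apply clarify subgoal for f'
  by (rule exI[of _ "\<lambda>h. - (inverse (f z) * f' h * inverse (f z))"]) (auto intro!: Deriv.has_derivative_inverse) done
lemma hol1_powi: "hol1 f z \<Longrightarrow> f z \<noteq> 0 \<Longrightarrow> hol1 (\<lambda>y. f y powi r) z"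
  unfolding hol1_def apply clarify subgoal for f'
  by (rule exI[of _ "\<lambda>h. f' h * (of_int r * f z powi (r - 1))"]) (auto intro!: has_derivative_power_int) done
lemma hol1_aff: "hol1 (\<lambda>y. aff i (y $ r) $ s) z"
  by (cases "s = i") (auto simp: aff_def hol1_const hol1_nth)

lemma hol1_fibre_coord: "y \<in> PB_overlap i j k i' j' k' \<Longrightarrow> hol1 (\<lambda>y. fibre_coord p q i j k i' j' y r) y"
  unfolding fibre_coord_def by (cases "r = 1") (auto simp: PB_overlap_def intro!: hol1_mult hol1_powi hol1_inverse hol1_aff)

lemma holo_on_PB_trans: "holo_on (PB_overlap i j k i' j' k') (PB_trans p q i j k i' j' k')"
  unfolding holo_on_def
proof
  fix z assume z: "z \<in> PB_overlap i j k i' j' k'"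
  have tw0: "fibre_coord p q i j k i' j' z k' \<noteq> 0" using z
    by (cases k' rule: two_cases) (auto simp: PB_overlap_def fibre_coord_def)
  have "\<forall>r. hol1 (\<lambda>y. PB_trans p q i j k i' j' k' y $ r) z"
    unfolding forall_3 PB_trans_def vector_3 using z tw0
    by (intro conjI hol1_mult hol1_inverse hol1_aff hol1_fibre_coord) (auto simp: PB_overlap_def)
  then obtain f' where f': "\<And>r. ((\<lambda>y. PB_trans p q i j k i' j' k' y $ r) has_derivative f' r) (at z)" "\<And>r v. f' r (J v) = \<i> * f' r v"
    unfolding hol1_def by metis
  have "(PB_trans p q i j k i' j' k' has_derivative (\<lambda>v. \<chi> r. f' r v)) (at z)"
  proof (subst has_derivative_componentwise_within, intro ballI)
    fix b :: "complex^3" assume "b \<in> Basis"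
    then obtain r c where b: "b = axis r c" by (auto simp: Basis_vec_def)
    show "((\<lambda>x. PB_trans p q i j k i' j' k' x \<bullet> b) has_derivative (\<lambda>x. (\<chi> r. f' r x) \<bullet> b)) (at z)"
      unfolding b inner_axis by (simp) (rule has_derivative_inner_left[OF f'(1)])
  qed
  then show "\<exists>f'. (PB_trans p q i j k i' j' k' has_derivative f') (at z) \<and> (\<forall>v. f' (J v) = J (f' v))"
    by (rule exI[of _ "\<lambda>v. \<chi> r. f' r v", OF conjI]) (auto simp: f'(2)[unfolded J_def] J_def vec_eq_iff)
qed

lemma open_PB_overlap: "open (PB_overlap i j k i' j' k')"
proof -
  have "continuous_on UNIV (\<lambda>y::complex^3. aff i (y$r) $ s)" for i s :: 2 and r
    by (cases "s = i") (auto simp: aff_def intro!: continuous_intros)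
  from this show ?thesis unfolding PB_overlap_def
    by (intro open_Collect_conj open_Collect_neq continuous_on_const) auto
qed

theorem complex_atlas_PB: "complex_atlas (PB p q)"
proof -
  have "holo_on (PB_overlap i j k i' j' k') (transition (PB_chart p q i j k) (PB_chart p q i' j' k'))" for i j k i' j' k'
    unfolding holo_on_def
  proof
    fix z assume z: "z \<in> PB_overlap i j k i' j' k'"
    with holo_on_PB_trans[of i j k i' j' k' p q] obtain f' where "(PB_trans p q i j k i' j' k' has_derivative f') (at z)" "\<forall>v. f' (J v) = J (f' v)"
      unfolding holo_on_def by blast
    moreover have "(transition (PB_chart p q i j k) (PB_chart p q i' j' k') has_derivative f') (at z)"
      by (rule has_derivative_transform_within_open[OF calculation(1) open_PB_overlap z]) (simp add: transition_PB)
    ultimately show "\<exists>f'. (transition (PB_chart p q i j k) (PB_chart p q i' j' k') has_derivative f') (at z) \<and> (\<forall>v. f' (J v) = J (f' v))"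
      by blast
  qed
  then show ?thesis
    by (auto simp: complex_atlas_def PB_def overlap_PB open_PB_overlap inj_PB_chart)
qed

lemma points_PB: "points (PB p q) = {PB_pt p q u v f | u v f. u \<noteq> 0 \<and> v \<noteq> 0 \<and> f \<noteq> 0}"
proof (intro equalityI subsetI)
  fix t assume "t \<in> points (PB p q)"
  moreover have "aff i z \<noteq> 0" for i z using aff_nz[of i z] by (metis zero_index zero_neq_one)
  ultimately show "t \<in> {PB_pt p q u v f | u v f. u \<noteq> 0 \<and> v \<noteq> 0 \<and> f \<noteq> 0}"
    unfolding points_def PB_def PB_chart_def by blast
next
  fix t assume "t \<in> {PB_pt p q u v f | u v f. u \<noteq> 0 \<and> v \<noteq> 0 \<and> f \<noteq> 0}"
  then obtain u v f where t: "t = PB_pt p q u v f" "u \<noteq> 0" "v \<noteq> 0" "f \<noteq> 0" by blast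
  obtain i j k where nz: "u $ i \<noteq> 0" "v $ j \<noteq> 0" "f $ k \<noteq> 0" using t by (auto simp: vec_eq_iff)
  define F :: "complex^2" where "F = vector [f $ 1, inverse (u $ i) powi p * inverse (v $ j) powi q * f $ 2]"
  have Fk: "F $ k \<noteq> 0" using nz by (cases k rule: two_cases) (auto simp: F_def)
  have "vector [inverse (F $ k) * f $ 1, inverse (F $ k) * (inverse (u $ i) powi p * inverse (v $ j) powi q * f $ 2)] = aff k (F $ other k * inverse (F $ k))"
    unfolding aff_scale[OF Fk] by (simp add: vec_eq_iff forall_2) (simp add: F_def)
  then have "t = PB_chart p q i j k (vector [u $ other i * inverse (u $ i), v $ other j * inverse (v $ j), F $ other k * inverse (F $ k)])"
    using PB_pt_rescale[of "inverse (u $ i)" "inverse (v $ j)" "inverse (F $ k)" p q u v f] nz Fk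
      aff_scale[OF nz(1)] aff_scale[OF nz(2)] t(1) by (simp add: PB_chart_def)
  then show "t \<in> points (PB p q)" unfolding points_def PB_def by blast
qed


section \<open>The round metric has Einstein constant 1\<close>

lemma sharp_eqI:
  assumes "\<And>w. b v w = \<alpha> w" "\<And>v'. (\<And>w. b v' w = b v w) \<Longrightarrow> v' = v"
  shows "sharp b \<alpha> = v"
  unfolding sharp_def using assms by (intro the_equality) auto

lemma dird_eqI: "(f has_derivative f') (at z) \<Longrightarrow> dird f z v = f' v"
  unfolding dird_def by (metis frechet_derivative_at)

lemma one_plus_inner_ne: "1 + z \<bullet> z \<noteq> 0" for z :: complex
  using inner_ge_zero[of z] by linarith

lemma FS_alt: "FS z u v = 4 * (u \<bullet> v) * (inverse (1 + z \<bullet> z))\<^sup>2"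
  by (simp add: FS_def dot_square_norm divide_inverse power_inverse)

lemma dird_FS: "dird (\<lambda>y. FS y v w) z u = - 16 * (v \<bullet> w) * (z \<bullet> u) * (inverse (1 + z \<bullet> z)) ^ 3"
proof (rule dird_eqI)
  show "((\<lambda>y. FS y v w) has_derivative (\<lambda>u. - 16 * (v \<bullet> w) * (z \<bullet> u) * (inverse (1 + z \<bullet> z)) ^ 3)) (at z)"
    unfolding FS_alt
    apply (rule derivative_eq_intros refl one_plus_inner_ne)+
    apply (rule ext) by (simp add: power2_eq_square power3_eq_cube inner_commute algebra_simps)
qed

definition FS_christoffel :: "complex \<Rightarrow> complex \<Rightarrow> complex \<Rightarrow> complex" where
  "FS_christoffel z u v = (- 2 * inverse (1 + z \<bullet> z)) *\<^sub>R ((z \<bullet> u) *\<^sub>R v + (z \<bullet> v) *\<^sub>R u - (u \<bullet> v) *\<^sub>R z)"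

lemma christoffel_FS: "christoffel FS z u v = FS_christoffel z u v"
  unfolding christoffel_def
proof (rule sharp_eqI)
  fix w show "FS z (FS_christoffel z u v) w = (dird (\<lambda>y. FS y v w) z u + dird (\<lambda>y. FS y u w) z v - dird (\<lambda>y. FS y u v) z w) / 2"
    unfolding dird_FS unfolding FS_alt FS_christoffel_def
    by (simp add: inner_add_left inner_diff_left power2_eq_square power3_eq_cube algebra_simps)
next
  fix v' assume *: "\<And>w. FS z v' w = FS z (FS_christoffel z u v) w"
  have "v' \<bullet> w = FS_christoffel z u v \<bullet> w" for w using *[of w] one_plus_inner_ne[of z] by (simp add: FS_alt)
  then show "v' = FS_christoffel z u v" by (metis vector_eq_rdot)
qed

lemma dird_FS_christoffel: "dird (\<lambda>y. FS_christoffel y v w) z u =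
   (4 * (inverse (1 + z \<bullet> z))\<^sup>2 * (z \<bullet> u)) *\<^sub>R ((z \<bullet> v) *\<^sub>R w + (z \<bullet> w) *\<^sub>R v - (v \<bullet> w) *\<^sub>R z)
   + (- 2 * inverse (1 + z \<bullet> z)) *\<^sub>R ((u \<bullet> v) *\<^sub>R w + (u \<bullet> w) *\<^sub>R v - (v \<bullet> w) *\<^sub>R u)" (is "_ = ?D u")
proof (rule dird_eqI)
  show "((\<lambda>y. FS_christoffel y v w) has_derivative ?D) (at z)"
    unfolding FS_christoffel_def
    apply (rule derivative_eq_intros refl one_plus_inner_ne)+
    apply (rule ext) by (simp add: power2_eq_square inner_commute algebra_simps)
qed

lemma riemann_FS: "riemann FS z u v w = (4 * (inverse (1 + z \<bullet> z))\<^sup>2) *\<^sub>R ((v \<bullet> w) *\<^sub>R u - (u \<bullet> w) *\<^sub>R v)"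
proof -
  define s where "s = inverse (1 + z \<bullet> z)"
  have s: "s * (1 + (Re z * Re z + Im z * Im z)) = 1" using one_plus_inner_ne[of z] by (simp add: s_def inner_complex_def)
  show ?thesis
    unfolding riemann_def christoffel_FS dird_FS_christoffel unfolding FS_christoffel_def s_def[symmetric]
    unfolding complex_eq_iff inner_complex_def
    apply (simp add: )
    using s by algebra
qed

theorem FS_einstein: "ricci FS z v w = FS z v w"
  unfolding ricci_def riemann_FS FS_alt Basis_complex_def
  by (simp add: inner_complex_def algebra_simps)

end

theory Submission
  imports Defs "HOL-Complex_Analysis.Conformal_Mappings"
begin

text \<open>
  Nonexistence is Matsushima's argument applied to a few vector fields.  For \<open>p \<ge> 0\<close>, \<open>q > 0\<close> the sections
  of \<open>O(p, q)\<close> give holomorphic fields tangent to the fibres, which are metric gradients of complex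
  potentials \<open>f\<close>.  If the scalar curvature is constant, the Lichnerowicz identity writes the squared
  norm of the \<open>\<partial>\<close>-bar derivative of the gradient \<open>W\<close> of \<open>cnj f\<close> as a divergence, which integrates to \<open>0\<close>
  over a decomposition into polydiscs.  So \<open>W\<close> is holomorphic as well.  Along a line of the second
  factor in the section at infinity, its fibre component is a section of \<open>O(-q)\<close>, hence vanishes, and
  the Taylor expansion of \<open>cnj f\<close> at a point there gives a contradiction.

  Existence: the metrics have momentum profile \<open>h = (1 - x\<^sup>2) E / Q\<close> with \<open>Q = (b x + a) (d x + c)\<close>.
  Constant scalar curvature amounts to one algebraic equation for \<open>(a, c)\<close>, which for \<open>p > 0 > q\<close> is
  quadratic in one of the parameters and solvable when the other is large.
\<close>

text \<open>Everything global has to be assembled from charts, and this shapes the nonexistence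
  part. Complex potentials occur because the vertical field of a section need not be the gradient of
  a real function. They exist because contracting a holomorphic field with a Kaehler metric gives a
  dbar-closed form; on a bundle of projective lines this form is integrated along the fibres,
  normalised to vanish on the section at infinity. The normalisation makes the potential unique, so
  local solutions glue, and it kills its tangential derivatives there. The unit polydiscs of the
  eight charts fill the manifold and coordinate inversion identifies their faces in pairs, so a
  vector density has total flux zero. Hence the Lichnerowicz argument is run pointwise, with
  explicit densities. The signs enter twice: \<open>p \<ge> 0\<close> and \<open>q > 0\<close>
  supply a monomial section of O(p, q), and \<open>q > 0\<close> leaves no nonzero section of O(-q)
  on the line. For existence, the section at infinity is the zero section of O(-p, -q), so one local
  construction, with signs reversed, serves both ends of the fibre.\<close>

abbreviation smooth :: "('a::real_normed_vector => 'b::real_normed_vector) => bool" where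
  "smooth \<equiv> smooth_on UNIV"

abbreviation Sum_UNIV :: "('a => 'b::comm_monoid_add) => 'b" (binder "SUM " 10) where
  "Sum_UNIV f \<equiv> sum f UNIV"

section \<open>Smooth functions\<close>

lemma has_derivative_dird: "f differentiable (at z) ==> (f has_derivative dird f z) (at z)"
  unfolding dird_def[abs_def] using frechet_derivative_works by blast

lemma dird_cong_open:
  assumes "open S" "z \<in> S" "\<And>y. y \<in> S ==> f y = g y"
  shows "dird f z = dird g z"
proof -
  have "(f has_derivative d) (at z) = (g has_derivative d) (at z)" for d
    using assms has_derivative_transform_within_open[of f d z UNIV S g]
      has_derivative_transform_within_open[of g d z UNIV S f] by auto
  then show ?thesis unfolding dird_def[abs_def] frechet_derivative_def by simp
qed

lemma differentiable_cong_open: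
  assumes "open S" "z \<in> S" "\<And>y. y \<in> S ==> f y = g y"
  shows "f differentiable (at z) \<longleftrightarrow> g differentiable (at z)"
  unfolding differentiable_def
    using assms has_derivative_transform_within_open[of f _ z UNIV S g]
      has_derivative_transform_within_open[of g _ z UNIV S f] by metis

lemma Ck_on_cong: "open S ==> (\<And>y. y \<in> S ==> f y = g y) ==> Ck_on k S f = Ck_on k S g"
proof (induction k arbitrary: f g)
  case 0 then show ?case by (auto cong: continuous_on_cong)
next
  case (Suc k)
  have "Ck_on k S (%z. dird f z v) = Ck_on k S (%z. dird g z v)" for v
    by (rule Suc.IH[OF Suc.prems(1)]) (use dird_cong_open[OF Suc.prems(1) _ Suc.prems(2)] in auto)
  then show ?case using differentiable_cong_open[OF Suc.prems(1) _ Suc.prems(2)] by auto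
qed

lemma Ck_on_subset: "Ck_on k S f ==> T \<subseteq> S ==> Ck_on k T f"
  by (induction k arbitrary: f) (auto intro: continuous_on_subset)

lemma Ck_on_Suc_imp: "Ck_on (Suc k) S f ==> Ck_on k S f"
proof (induction k arbitrary: f)
  case 0
  then show ?case by (auto intro!: continuous_at_imp_continuous_on differentiable_imp_continuous_within)
next
  case (Suc k) then show ?case by (metis Ck_on.simps(2))
qed

lemma Ck_on_continuous: "Ck_on k S f ==> continuous_on S f"
  by (induction k arbitrary: f) (auto intro!: continuous_at_imp_continuous_on differentiable_imp_continuous_within)

lemma Ck_on_open_Union: "(\<And>z. z \<in> S ==> \<exists>T. open T \<and> z \<in> T \<and> Ck_on k T f) ==> Ck_on k S f"
proof (induction k arbitrary: f)
  case 0
  show ?case unfolding Ck_on.simps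
  proof (rule continuous_at_imp_continuous_on, rule ballI)
    fix x assume "x \<in> S"
    then obtain T where "open T" "x \<in> T" "continuous_on T f" using 0 by auto
    then show "continuous (at x) f" using continuous_on_eq_continuous_at by blast
  qed
next
  case (Suc k)
  then show ?case unfolding Ck_on.simps by meson
qed

text \<open>On an open set an explicit derivative \<open>f'\<close> agrees with \<open>dird\<close>,
  so inductions on \<open>k\<close> can work with formulas for the derivative.\<close>

lemma Ck_on_SucI:
  assumes "open S" "\<And>z. z \<in> S ==> (f has_derivative f' z) (at z)" "\<And>v. Ck_on k S (%z. f' z v)"
  shows "Ck_on (Suc k) S f"
proof -
  have "Ck_on k S (%z. dird f z v) = Ck_on k S (%z. f' z v)" for v
    by (rule Ck_on_cong[OF assms(1)]) (rule dird_eqI[OF assms(2)])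
  moreover have "f differentiable (at z)" if "z \<in> S" for z
    by (rule differentiableI[OF assms(2)[OF that]])
  ultimately show ?thesis using assms(3) by simp
qed

lemma Ck_on_SucD:
  assumes "Ck_on (Suc k) S f"
  shows "z \<in> S ==> (f has_derivative dird f z) (at z)" "Ck_on k S (%z. dird f z v)" "Ck_on k S f"
  using has_derivative_dird[of f z] assms Ck_on_Suc_imp[OF assms] by simp_all

lemma Ck_on_const: "open S ==> Ck_on k S (%_. c)"
proof (induction k arbitrary: c)
  case (Suc k)
  show ?case by (rule Ck_on_SucI[of _ _ "%_ _. 0"]) (use Suc in auto)
qed auto

lemma Ck_on_linear:
  assumes "open S" "bounded_linear L" shows "Ck_on k S f ==> Ck_on k S (%x. L (f x))"
proof (induction k arbitrary: f)
  case 0 then show ?case using assms by (auto intro: bounded_linear.continuous_on)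
next
  case (Suc k)
  show ?case
    by (rule Ck_on_SucI[OF assms(1) bounded_linear.has_derivative[OF assms(2) Ck_on_SucD(1)[OF Suc.prems]]
          Suc.IH[OF Ck_on_SucD(2)[OF Suc.prems]]])
qed

lemma Ck_on_add: "open S ==> Ck_on k S f ==> Ck_on k S g ==> Ck_on k S (%x. f x + g x)"
proof (induction k arbitrary: f g)
  case 0 then show ?case by (simp add: continuous_on_add)
next
  case (Suc k)
  show ?case
    by (rule Ck_on_SucI[OF Suc.prems(1) has_derivative_add[OF Ck_on_SucD(1)[OF Suc.prems(2)] Ck_on_SucD(1)[OF Suc.prems(3)]]
          Suc.IH[OF Suc.prems(1) Ck_on_SucD(2)[OF Suc.prems(2)] Ck_on_SucD(2)[OF Suc.prems(3)]]])
qed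

lemma Ck_on_bilinear:
  assumes "open S" "bounded_bilinear B" shows "Ck_on k S f ==> Ck_on k S g ==> Ck_on k S (%x. B (f x) (g x))"
proof (induction k arbitrary: f g)
  case 0 then show ?case using assms by (auto intro: bounded_bilinear.continuous_on)
next
  case (Suc k)
  note f = Ck_on_SucD[OF Suc.prems(1)] and g = Ck_on_SucD[OF Suc.prems(2)]
  show ?case
    by (rule Ck_on_SucI[OF assms(1) bounded_bilinear.FDERIV[OF assms(2) f(1) g(1)]
        Ck_on_add[OF assms(1) Suc.IH[OF f(3) g(2)] Suc.IH[OF f(2) g(3)]]])
qed

lemma Ck_on_sum: "open S ==> (\<And>i. i \<in> I ==> Ck_on k S (f i)) ==> Ck_on k S (%x. \<Sum>i\<in>I. f i x)"
proof (induction I rule: infinite_finite_induct)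
  case (insert i I)
  then have "Ck_on k S (%x. f i x + (\<Sum>i\<in>I. f i x))" by (intro Ck_on_add) auto
  with insert show ?case by simp
qed (simp_all add: Ck_on_const)

lemma dird_linear: "f differentiable (at z) ==> linear (dird f z)"
  using has_derivative_dird has_derivative_linear by blast

lemma dird_euclidean:
  fixes f :: "'a::euclidean_space => 'b::real_normed_vector"
  assumes "f differentiable (at z)"
  shows "dird f z v = (\<Sum>b\<in>Basis. (v \<bullet> b) *\<^sub>R dird f z b)"
proof -
  interpret linear "dird f z" by (rule dird_linear[OF assms])
  have "dird f z (\<Sum>b\<in>Basis. (v \<bullet> b) *\<^sub>R b) = (\<Sum>b\<in>Basis. (v \<bullet> b) *\<^sub>R dird f z b)" by (simp only: sum scaleR)
  then show ?thesis by (simp only: euclidean_representation)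
qed

lemma has_derivative_dird_compose:
  fixes F :: "'b::euclidean_space => 'c::real_normed_vector" and m :: "'a::real_normed_vector => 'b"
  assumes "m differentiable (at z)" "F differentiable (at (m z))"
  shows "((%x. F (m x)) has_derivative (%v. \<Sum>b\<in>Basis. (dird m z v \<bullet> b) *\<^sub>R dird F (m z) b)) (at z)"
proof -
  have "dird F (m z) \<circ> dird m z = (%v. \<Sum>b\<in>Basis. (dird m z v \<bullet> b) *\<^sub>R dird F (m z) b)"
    by (rule ext, unfold o_def) (rule dird_euclidean[OF assms(2)])
  with diff_chain_at[OF has_derivative_dird[OF assms(1)] has_derivative_dird[OF assms(2)]]
  show ?thesis by (simp add: o_def)
qed

text \<open>By the chain rule the derivative is a sum over \<open>Basis\<close> of
  \<open>dird F b\<close> composed with \<open>m\<close>, times a component of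
  \<open>dird m\<close>. The induction on \<open>k\<close> is therefore arbitrary in
  \<open>F\<close> while \<open>m\<close> stays fixed.\<close>

lemma Ck_on_compose:
  fixes F :: "'b::euclidean_space => 'c::real_normed_vector" and m :: "'a::real_normed_vector => 'b"
  assumes "open S" "open T" "m ` S \<subseteq> T"
  shows "Ck_on k T F ==> Ck_on k S m ==> Ck_on k S (%x. F (m x))"
proof (induction k arbitrary: F)
  case 0
  then have "continuous_on T F" "continuous_on S m" by auto
  then show ?case using continuous_on_compose2[OF _ _ assms(3)] by auto
next
  case (Suc k)
  note m = Ck_on_SucD[OF Suc.prems(2)] and F = Ck_on_SucD[OF Suc.prems(1)]
  show ?case
  proof (rule Ck_on_SucI[OF assms(1)])
    fix z assume "z \<in> S"
    then show "((%x. F (m x)) has_derivative (%v. \<Sum>b\<in>Basis. (dird m z v \<bullet> b) *\<^sub>R dird F (m z) b)) (at z)"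
      using Suc.prems assms(3) by (intro has_derivative_dird_compose) auto
  next
    fix v
    have "Ck_on k S (%z. dird m z v \<bullet> b)" for b
      by (rule Ck_on_linear[OF assms(1) bounded_linear_inner_left m(2)])
    then show "Ck_on k S (%z. \<Sum>b\<in>Basis. (dird m z v \<bullet> b) *\<^sub>R dird F (m z) b)"
      by (intro Ck_on_sum Ck_on_bilinear[OF _ bounded_bilinear_scaleR] assms(1) Suc.IH F m)
  qed
qed

lemma smooth_on_cong: "open S ==> (\<And>y. y \<in> S ==> f y = g y) ==> smooth_on S f = smooth_on S g"
  unfolding smooth_on_def using Ck_on_cong by blast

lemma smooth_on_subset: "smooth_on S f ==> T \<subseteq> S ==> smooth_on T f"
  unfolding smooth_on_def using Ck_on_subset by blast

lemma smooth_on_locally: "(\<And>z. z \<in> S ==> \<exists>T. open T \<and> z \<in> T \<and> smooth_on T f) ==> smooth_on S f"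
  unfolding smooth_on_def by (meson Ck_on_open_Union)

lemma smooth_on_continuous: "smooth_on S f ==> continuous_on S f"
  unfolding smooth_on_def using Ck_on_continuous by blast

lemma smooth_onD: "smooth_on S f ==> z \<in> S ==> f differentiable (at z)"
  unfolding smooth_on_def using Ck_on.simps(2)[of 0 S f] by blast

lemma smooth_on_has_derivative: "smooth_on S f ==> z \<in> S ==> (f has_derivative dird f z) (at z)"
  by (simp add: has_derivative_dird smooth_onD)

lemma smooth_on_dird: "smooth_on S f ==> smooth_on S (%z. dird f z v)"
  unfolding smooth_on_def
proof
  fix k assume "\<forall>k. Ck_on k S f"
  then have "Ck_on (Suc k) S f" by blast
  then show "Ck_on k S (%z. dird f z v)" by simp
qed

lemma smooth_on_derivI:
  assumes "open S" "\<And>z. z \<in> S ==> (f has_derivative f' z) (at z)" "\<And>v. smooth_on S (%z. f' z v)"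
  shows "smooth_on S f"
  unfolding smooth_on_def
proof
  fix k
  have "Ck_on (Suc k) S f" by (rule Ck_on_SucI[OF assms(1,2)]) (use assms(3) in \<open>auto simp: smooth_on_def\<close>)
  then show "Ck_on k S f" by (rule Ck_on_SucD(3))
qed

named_theorems smooth_intros

lemma smooth_on_const [smooth_intros]: "open S ==> smooth_on S (%_. c)"
  unfolding smooth_on_def using Ck_on_const by blast

lemma smooth_on_linear: "open S ==> bounded_linear L ==> smooth_on S f ==> smooth_on S (%x. L (f x))"
  unfolding smooth_on_def by (rule allI, rule Ck_on_linear) auto

lemma smooth_on_id: "open S ==> smooth_on S (%x. x)"
  by (rule smooth_on_derivI[of _ _ "%_ v. v"]) (auto intro: smooth_on_const)

lemma smooth_on_bounded_linear: "open S ==> bounded_linear L ==> smooth_on S L"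
  by (rule smooth_on_linear[OF _ _ smooth_on_id])

lemma smooth_on_bilinear: "open S ==> bounded_bilinear B ==> smooth_on S f ==> smooth_on S g ==> smooth_on S (%x. B (f x) (g x))"
  unfolding smooth_on_def by (rule allI, rule Ck_on_bilinear) auto

lemma smooth_on_add [smooth_intros]: "open S ==> smooth_on S f ==> smooth_on S g ==> smooth_on S (%x. f x + g x)"
  unfolding smooth_on_def by (rule allI, rule Ck_on_add) auto

lemma smooth_on_minus [smooth_intros]: "open S ==> smooth_on S f ==> smooth_on S (%x. - f x)"
  using smooth_on_linear[OF _ bounded_linear_minus[OF bounded_linear_ident]] .

lemma smooth_on_diff [smooth_intros]: "open S ==> smooth_on S f ==> smooth_on S g ==> smooth_on S (%x. f x - g x)"
  using smooth_on_add[OF _ _ smooth_on_minus, of S f g] by simp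

lemma smooth_on_sum [smooth_intros]:
  "open S ==> (\<And>i. i \<in> I ==> smooth_on S (f i)) ==> smooth_on S (%x. \<Sum>i\<in>I. f i x)"
  unfolding smooth_on_def by (rule allI, rule Ck_on_sum) auto

lemma smooth_on_mult [smooth_intros]:
  fixes f g :: "'a::real_normed_vector => 'b::real_normed_algebra"
  shows "open S ==> smooth_on S f ==> smooth_on S g ==> smooth_on S (%x. f x * g x)"
  by (rule smooth_on_bilinear[OF _ bounded_bilinear_mult])

lemma smooth_on_scaleR [smooth_intros]:
  "open S ==> smooth_on S f ==> smooth_on S g ==> smooth_on S (%x. f x *\<^sub>R g x)"
  by (rule smooth_on_bilinear[OF _ bounded_bilinear_scaleR])

lemma smooth_on_power [smooth_intros]:
  fixes f :: "'a::real_normed_vector => 'b::real_normed_algebra_1"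
  shows "open S ==> smooth_on S f ==> smooth_on S (%x. f x ^ n)"
  by (induction n) (simp_all add: smooth_on_const smooth_on_mult)

lemma smooth_on_compose:
  fixes F :: "'b::euclidean_space => 'c::real_normed_vector" and m :: "'a::real_normed_vector => 'b"
  assumes "open S" "open T" "m ` S \<subseteq> T" "smooth_on T F" "smooth_on S m"
  shows "smooth_on S (%x. F (m x))"
  unfolding smooth_on_def
  by (rule allI, rule Ck_on_compose[OF assms(1-3)]) (use assms(4,5) in \<open>simp_all add: smooth_on_def\<close>)

lemma smooth_on_linears [smooth_intros]:
  assumes "open S"
  shows "smooth_on S f ==> smooth_on S (%x. cnj (f x))" "smooth_on S f ==> smooth_on S (%x. Re (f x))"
    "smooth_on S f ==> smooth_on S (%x. Im (f x))"
    "smooth_on S r ==> smooth_on S (%x. complex_of_real (r x))"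
    "smooth_on S F ==> smooth_on S (%x. F x $ i)"
    "smooth_on S k ==> smooth_on S (%x. k x \<bullet> b)"
  by (erule smooth_on_linear[OF assms bounded_linear_cnj] smooth_on_linear[OF assms bounded_linear_Re]
    smooth_on_linear[OF assms bounded_linear_Im] smooth_on_linear[OF assms bounded_linear_of_real]
    smooth_on_linear[OF assms bounded_linear_vec_nth] smooth_on_linear[OF assms bounded_linear_inner_left])+

lemma smooth_on_nth [smooth_intros]: "open S ==> smooth_on S (%x. x $ i)"
  by (rule smooth_on_bounded_linear[OF _ bounded_linear_vec_nth])

lemma has_derivative_vec_nth:
  fixes f :: "'a::real_normed_vector => complex^'n::finite"
  assumes "\<And>i. ((%x. f x $ i) has_derivative (%v. f' v $ i)) (at z)"
  shows "(f has_derivative f') (at z)"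
proof (subst has_derivative_componentwise_within, intro ballI)
  fix b :: "complex^'n" assume "b \<in> Basis"
  then obtain r c where b: "b = axis r c" by (auto simp: Basis_vec_def)
  show "((%x. f x \<bullet> b) has_derivative (%x. f' x \<bullet> b)) (at z)"
    unfolding b inner_axis by (rule has_derivative_inner_left[OF assms])
qed

lemma smooth_on_vec:
  fixes f :: "'a::real_normed_vector => complex^'n::finite"
  assumes "open S" "\<And>i. smooth_on S (%x. f x $ i)" shows "smooth_on S f"
proof -
  have eq: "(%x. \<Sum>b\<in>Basis. (f x \<bullet> b) *\<^sub>R b) = f" by (simp add: euclidean_representation)
  have "smooth_on S (%x. \<Sum>b\<in>Basis. (f x \<bullet> b) *\<^sub>R b)"
  proof (intro smooth_on_sum smooth_on_scaleR smooth_on_const assms(1))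
    fix b :: "complex^'n" assume "b \<in> Basis"
    then obtain r c where b: "b = axis r c" by (auto simp: Basis_vec_def)
    show "smooth_on S (%x. f x \<bullet> b)"
      unfolding b inner_axis by (rule smooth_on_linears(6)[OF assms])
  qed
  then show ?thesis by (simp only: eq)
qed

lemma Ck_on_inverse:
  fixes f :: "'a::real_normed_vector => 'b::real_normed_field"
  assumes "open S" "\<And>x. x \<in> S ==> f x \<noteq> 0"
  shows "Ck_on k S f ==> Ck_on k S (%x. inverse (f x))"
proof (induction k)
  case 0 then show ?case using assms by (simp add: continuous_on_inverse)
next
  case (Suc k)
  note f = Ck_on_SucD[OF Suc.prems]
  note m = Ck_on_bilinear[OF assms(1) bounded_bilinear_mult]
  show ?case
    by (rule Ck_on_SucI[OF assms(1) Deriv.has_derivative_inverse[OF assms(2) f(1)]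
       Ck_on_linear[OF assms(1) bounded_linear_minus[OF bounded_linear_ident] m[OF m[OF Suc.IH[OF f(3)] f(2)] Suc.IH[OF f(3)]]]])
qed

lemma smooth_on_inverse [smooth_intros]:
  fixes f :: "'a::real_normed_vector => 'b::real_normed_field"
  shows "open S ==> smooth_on S f ==> (\<And>x. x \<in> S ==> f x \<noteq> 0) ==> smooth_on S (%x. inverse (f x))"
  unfolding smooth_on_def by (rule allI, rule Ck_on_inverse) auto

lemma smooth_on_divide [smooth_intros]:
  fixes f g :: "'a::real_normed_vector => 'b::real_normed_field"
  shows "open S ==> smooth_on S f ==> smooth_on S g ==> (\<And>x. x \<in> S ==> g x \<noteq> 0) ==> smooth_on S (%x. f x / g x)"
  unfolding divide_inverse by (intro smooth_intros)

text \<open>Bootstrapping: if \<open>f\<close> is k times differentiable, so is its derivative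
  \<open>D (f x)\<close>, hence \<open>f\<close> gains one order. It serves for the exponential and
  for the inverse function in the momentum profile.\<close>

lemma smooth_on_ode:
  fixes f :: "real => real"
  assumes "open S" "open T" "f ` S \<subseteq> T" "smooth_on T D"
    and "\<And>x. x \<in> S ==> (f has_real_derivative D (f x)) (at x)"
  shows "smooth_on S f"
  unfolding smooth_on_def
proof
  fix k show "Ck_on k S f"
  proof (induction k)
    case 0
    then show ?case using assms(5)
      by (auto intro!: continuous_at_imp_continuous_on DERIV_isCont)
  next
    case (Suc k)
    have "Ck_on k S (%z. D (f z))"
      by (rule Ck_on_compose[OF assms(1-3)]) (use assms Suc in \<open>auto simp: smooth_on_def\<close>)
    then have "Ck_on k S (%z. D (f z) * v)" for v
      by (intro Ck_on_bilinear[OF assms(1) bounded_bilinear_mult] Ck_on_const assms(1))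
    then show ?case
      using Ck_on_SucI[OF assms(1), of f "%z v. D (f z) * v"] assms(5) by (auto simp: has_field_derivative_def)
  qed
qed

lemma smooth_on_real_derivI:
  fixes f :: "real => real"
  assumes "open S" "\<And>x. x \<in> S ==> (f has_real_derivative f' x) (at x)" "smooth_on S f'"
  shows "smooth_on S f"
  by (rule smooth_on_derivI[OF assms(1), of f "%z v. f' z * v"])
    (use assms in \<open>simp_all add: has_field_derivative_def smooth_on_mult smooth_on_const\<close>)

lemma smooth_on_exp_real: "smooth (exp :: real => real)"
  by (rule smooth_on_ode[of _ UNIV _ "%x. x"]) (auto intro: smooth_on_id)

lemma smooth_on_exp [smooth_intros]: "open S ==> smooth_on S f ==> smooth_on S (%x. exp (f x :: real))"
  by (rule smooth_on_compose[of S UNIV f exp]) (auto intro: smooth_on_exp_real)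

lemma smooth_on_ln [smooth_intros]:
  "open S ==> smooth_on S f ==> (\<And>x. x \<in> S ==> f x > 0) ==> smooth_on S (%x. ln (f x :: real))"
  by (rule smooth_on_compose[of S "{0<..}" f ln])
    (auto intro!: smooth_on_real_derivI[of _ _ "%x. inverse x"] smooth_on_inverse smooth_on_id DERIV_ln)

lemma smooth_on_cis_real: "smooth cis"
  unfolding smooth_on_def
proof
  fix k :: nat
  show "Ck_on k UNIV cis"
  proof (induction k)
    case 0 then show ?case by (simp add: continuous_on_cis continuous_on_id)
  next
    case (Suc k)
    have "Ck_on k UNIV (%\<theta>. (v *\<^sub>R \<i>) * cis \<theta>)" for v
      by (intro Ck_on_bilinear[OF open_UNIV bounded_bilinear_mult] Ck_on_const Suc open_UNIV)
    then show ?case using has_derivative_cis[OF has_derivative_ident]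
      by (intro Ck_on_SucI[of UNIV cis "%\<theta> v. v *\<^sub>R (\<i> * cis \<theta>)"]) simp_all
  qed
qed

lemma smooth_on_cis [smooth_intros]: "open S ==> smooth_on S f ==> smooth_on S (%x. cis (f x))"
  by (rule smooth_on_compose[of S UNIV f cis]) (auto intro: smooth_on_cis_real)

section \<open>Symmetry of second derivatives and smoothness of parameter integrals\<close>

lemma has_vector_derivative_dird:
  assumes "f differentiable (at (g t))" "(g has_vector_derivative u) (at t within T)"
  shows "((%s. f (g s)) has_vector_derivative dird f (g t) u) (at t within T)"
proof -
  have "(f \<circ> g has_derivative dird f (g t) \<circ> (%x. x *\<^sub>R u)) (at t within T)"
    using diff_chain_within[of g "%x. x *\<^sub>R u" t T f "dird f (g t)"] assms has_derivative_dird[OF assms(1)]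
      has_derivative_at_withinI unfolding has_vector_derivative_def by blast
  moreover have "dird f (g t) \<circ> (%x. x *\<^sub>R u) = (%x. x *\<^sub>R dird f (g t) u)"
    using dird_linear[OF assms(1)] by (auto simp: linear_cmul)
  ultimately show ?thesis unfolding has_vector_derivative_def o_def by simp
qed

lemma vector_derivative_unique_within_Icc:
  fixes a b x :: real
  assumes "a < b" "x \<in> {a..b}"
    "(f has_vector_derivative f') (at x within {a..b})" "(f has_vector_derivative f'') (at x within {a..b})"
  shows "f' = f''"
  using vector_derivative_unique_within_closed_interval[of a b x f f' f''] assms by (simp add: box_real)

text \<open>Both sides are derivatives of \<open>t \<mapsto> dird f (z + t v) u - dird f z u\<close> at \<open>0\<close>, which is
  \<open>\<integral> dird (dird f v) (z + s v) u\<close> over \<open>[0, t]\<close> by differentiating under the integral.\<close>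

lemma dird_commute:
  fixes f :: "'a::real_normed_vector => 'b::banach"
  assumes "open S" "z \<in> S" "smooth_on S f"
  shows "dird (%y. dird f y u) z v = dird (%y. dird f y v) z u"
proof -
  obtain r where r: "r > 0" "ball z r \<subseteq> S" using assms open_contains_ball by blast
  define N where "N = norm u + norm v + 1"
  \<comment> \<open>With this size the parallelogram with sides \<open>e u\<close> and
    \<open>e v\<close> at \<open>z\<close> stays within distance \<open>r / 2\<close> of
    \<open>z\<close>, hence inside \<open>S\<close>.\<close>
  define e where "e = r / (2 * N)"
  have N: "N > 0" using norm_ge_zero[of u] norm_ge_zero[of v] unfolding N_def by linarith
  have e0: "e > 0" using r N by (simp add: e_def)
  have in_S: "z + s *\<^sub>R u + t *\<^sub>R v \<in> S" if "\<bar>s\<bar> \<le> e" "\<bar>t\<bar> \<le> e" for s t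
  proof -
    have "norm (s *\<^sub>R u + t *\<^sub>R v) \<le> \<bar>s\<bar> * norm u + \<bar>t\<bar> * norm v"
      by (metis norm_scaleR norm_triangle_ineq)
    also have "\<dots> \<le> e * norm u + e * norm v" using that by (intro add_mono mult_right_mono) auto
    also have "\<dots> \<le> e * N" using e0 by (simp add: algebra_simps N_def)
    also have "\<dots> = r / 2" using N by (simp add: e_def)
    also have "\<dots> < r" using r by simp
    finally have "z + (s *\<^sub>R u + t *\<^sub>R v) \<in> ball z r" by (simp only: mem_ball dist_norm norm_minus_commute[of z] add_diff_cancel_left')
    then show ?thesis using r(2) by (auto simp: add.assoc)
  qed
  note df = smooth_onD[OF assms(3)]
  note ddf = smooth_onD[OF smooth_on_dird[OF assms(3)]]
  have cont: "continuous_on S (%y. dird (%y. dird f y v) y u)"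
    by (intro smooth_on_continuous smooth_on_dird assms)
  have eq: "integral {0..t} (%\<tau>. dird (%y. dird f y v) (z + \<tau> *\<^sub>R v) u) = dird f (z + t *\<^sub>R v) u - dird f z u"
    if t: "0 \<le> t" "t \<le> e" for t
  proof -
    have tt: "\<bar>\<tau>\<bar> \<le> e" if "\<tau> \<in> {0..t}" for \<tau> using that t by auto
    have 1: "integral (cbox 0 t) (%\<tau>. dird f (z + s *\<^sub>R u + \<tau> *\<^sub>R v) v) = f (z + s *\<^sub>R u + t *\<^sub>R v) - f (z + s *\<^sub>R u)"
      if s: "s \<in> {-e..e}" for s
    proof -
      have "((%\<tau>. dird f (z + s *\<^sub>R u + \<tau> *\<^sub>R v) v) has_integral f (z + s *\<^sub>R u + t *\<^sub>R v) - f (z + s *\<^sub>R u + 0 *\<^sub>R v)) {0..t}"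
      proof (rule fundamental_theorem_of_calculus[OF t(1)])
        fix x assume "x \<in> {0..t}"
        with in_S[of s x] tt[of x] s have "z + s *\<^sub>R u + x *\<^sub>R v \<in> S" by auto
        then show "((%\<tau>. f (z + s *\<^sub>R u + \<tau> *\<^sub>R v)) has_vector_derivative dird f (z + s *\<^sub>R u + x *\<^sub>R v) v) (at x within {0..t})"
          by (intro has_vector_derivative_dird df) (auto intro!: derivative_eq_intros)
      qed
      then show ?thesis by (simp add: integral_unique)
    qed
    have L: "((%s. integral (cbox 0 t) (%\<tau>. dird f (z + s *\<^sub>R u + \<tau> *\<^sub>R v) v)) has_vector_derivative
          integral (cbox 0 t) (%\<tau>. dird (%y. dird f y v) (z + 0 *\<^sub>R u + \<tau> *\<^sub>R v) u)) (at 0 within {-e..e})"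
    proof (rule leibniz_rule_vector_derivative)
      fix s x assume "s \<in> {-e..e}" "x \<in> cbox 0 t"
      then have "z + s *\<^sub>R u + x *\<^sub>R v \<in> S" using in_S[of s x] tt[of x] by auto
      then show "((%s. dird f (z + s *\<^sub>R u + x *\<^sub>R v) v) has_vector_derivative dird (%y. dird f y v) (z + s *\<^sub>R u + x *\<^sub>R v) u) (at s within {-e..e})"
        by (intro has_vector_derivative_dird ddf) (auto intro!: derivative_eq_intros)
    next
      fix s assume s: "s \<in> {-e..e}"
      have "continuous_on S (%y. dird f y v)" by (intro smooth_on_continuous smooth_on_dird assms)
      then show "(%\<tau>. dird f (z + s *\<^sub>R u + \<tau> *\<^sub>R v) v) integrable_on cbox 0 t"
        using in_S[of s] tt s
        by (intro integrable_continuous, elim continuous_on_compose2[where f = "%\<tau>. z + s *\<^sub>R u + \<tau> *\<^sub>R v"]) (auto intro!: continuous_intros)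
    next
      have "(%p. z + fst p *\<^sub>R u + snd p *\<^sub>R v) ` ({-e..e} \<times> cbox 0 t) \<subseteq> S"
        using in_S tt by auto
      then show "continuous_on ({-e..e} \<times> cbox 0 t) (%(s, \<tau>). dird (%y. dird f y v) (z + s *\<^sub>R u + \<tau> *\<^sub>R v) u)"
        unfolding split_beta
        by (rule continuous_on_compose2[OF cont, where f = "%p. z + fst p *\<^sub>R u + snd p *\<^sub>R v", rotated]) (intro continuous_intros)
    qed (use e0 in auto)
    have R: "((%s. f (z + s *\<^sub>R u + t *\<^sub>R v) - f (z + s *\<^sub>R u)) has_vector_derivative
        dird f (z + t *\<^sub>R v) u - dird f z u) (at 0 within {-e..e})"
    proof (rule has_vector_derivative_diff)
      have "((%s. f (z + s *\<^sub>R u + t *\<^sub>R v)) has_vector_derivative dird f (z + 0 *\<^sub>R u + t *\<^sub>R v) u) (at 0 within {-e..e})"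
        using in_S[of 0 t] t e0 by (intro has_vector_derivative_dird df) (auto intro!: derivative_eq_intros)
      then show "((%s. f (z + s *\<^sub>R u + t *\<^sub>R v)) has_vector_derivative dird f (z + t *\<^sub>R v) u) (at 0 within {-e..e})" by simp
      have "((%s. f (z + s *\<^sub>R u)) has_vector_derivative dird f (z + 0 *\<^sub>R u) u) (at 0 within {-e..e})"
        using in_S[of 0 0] t e0 by (intro has_vector_derivative_dird df) (auto intro!: derivative_eq_intros)
      then show "((%s. f (z + s *\<^sub>R u)) has_vector_derivative dird f z u) (at 0 within {-e..e})" by simp
    qed
    have M: "((%s. integral (cbox 0 t) (%\<tau>. dird f (z + s *\<^sub>R u + \<tau> *\<^sub>R v) v)) has_vector_derivative
        dird f (z + t *\<^sub>R v) u - dird f z u) (at 0 within {-e..e})"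
      by (rule has_vector_derivative_transform[OF _ 1 R]) (use e0 in auto)
    have "integral (cbox 0 t) (%\<tau>. dird (%y. dird f y v) (z + 0 *\<^sub>R u + \<tau> *\<^sub>R v) u) = dird f (z + t *\<^sub>R v) u - dird f z u"
      by (rule vector_derivative_unique_within_Icc[OF _ _ L M]) (use e0 in auto)
    then show ?thesis by (simp only: box_real scaleR_zero_left add_0_right)
  qed
  have zS: "z + \<tau> *\<^sub>R v \<in> S" if "\<tau> \<in> {0..e}" for \<tau> using in_S[of 0 \<tau>] that e0 by simp
  have "((%t. integral {0..t} (%\<tau>. dird (%y. dird f y v) (z + \<tau> *\<^sub>R v) u)) has_vector_derivative
      dird (%y. dird f y v) (z + 0 *\<^sub>R v) u) (at 0 within {0..e})"
  proof (rule integral_has_vector_derivative)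
    show "continuous_on {0..e} (%\<tau>. dird (%y. dird f y v) (z + \<tau> *\<^sub>R v) u)"
      by (rule continuous_on_compose2[OF cont, where f = "%\<tau>. z + \<tau> *\<^sub>R v"]) (use zS in \<open>auto intro!: continuous_intros\<close>)
  qed (use e0 in auto)
  moreover have "((%t. integral {0..t} (%\<tau>. dird (%y. dird f y v) (z + \<tau> *\<^sub>R v) u)) has_vector_derivative
      dird (%y. dird f y u) (z + 0 *\<^sub>R v) v) (at 0 within {0..e})"
  proof (rule has_vector_derivative_transform)
    show "integral {0..t} (%\<tau>. dird (%y. dird f y v) (z + \<tau> *\<^sub>R v) u) = dird f (z + t *\<^sub>R v) u - dird f z u" if "t \<in> {0..e}" for t
      using eq that by auto
    have Q: "((%t. dird f (z + t *\<^sub>R v) u) has_vector_derivative dird (%y. dird f y u) (z + 0 *\<^sub>R v) v) (at 0 within {0..e})"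
      using zS[of 0] e0 by (intro has_vector_derivative_dird[where f = "%y. dird f y u"] ddf) (auto intro!: derivative_eq_intros)
    show "((%t. dird f (z + t *\<^sub>R v) u - dird f z u) has_vector_derivative dird (%y. dird f y u) (z + 0 *\<^sub>R v) v) (at 0 within {0..e})"
      using has_vector_derivative_diff[OF Q has_vector_derivative_const[of "dird f z u"]] by simp
  qed (use e0 in auto)
  ultimately have "dird (%y. dird f y v) (z + 0 *\<^sub>R v) u = dird (%y. dird f y u) (z + 0 *\<^sub>R v) v"
    by (rule vector_derivative_unique_within_Icc[rotated 2]) (use e0 in auto)
  then show ?thesis by simp
qed

lemma has_derivative_integral:
  fixes \<Phi> :: "'a::euclidean_space \<times> 'b::euclidean_space => 'c::banach"
  assumes "open S" "open T" "cbox a b \<subseteq> T" "smooth_on (S \<times> T) \<Phi>" "x \<in> S"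
  shows "((%x. integral (cbox a b) (%t. \<Phi> (x, t))) has_derivative
     (%v. integral (cbox a b) (%t. dird \<Phi> (x, t) (v, 0)))) (at x)"
proof -
  obtain r where r: "r > 0" "ball x r \<subseteq> S" using assms open_contains_ball by blast
  \<comment> \<open>The Leibniz rule takes the derivative as a continuous map into bounded linear
    functions; its continuity is checked on each vector, where it is that of
    \<open>dird\<close>.\<close>
  define fx where "fx y t = Blinfun (%v. dird \<Phi> (y, t) (v, 0))" for y t
  have D: "((%y. \<Phi> (y, t)) has_derivative (%v. dird \<Phi> (y, t) (v, 0))) (at y)" if "y \<in> S" "t \<in> T" for y t
  proof -
    have "((%y. (y, t)) has_derivative (%v. (v, 0))) (at y)" by (auto intro!: derivative_eq_intros)
    from diff_chain_at[OF this smooth_on_has_derivative[OF assms(4), of "(y, t)"]] that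
    show ?thesis by (simp add: o_def)
  qed
  have fx: "blinfun_apply (fx y t) = (%v. dird \<Phi> (y, t) (v, 0))" if "y \<in> S" "t \<in> T" for y t
    unfolding fx_def using bounded_linear_Blinfun_apply has_derivative_bounded_linear[OF D[OF that]] by blast
  have c: "continuous_on (S \<times> T) \<Phi>" by (rule smooth_on_continuous[OF assms(4)])
  have cfx: "continuous_on (ball x r \<times> cbox a b) (%(y, t). fx y t)"
  proof (rule continuous_on_blinfun_componentwise)
    fix i :: 'a
    have "continuous_on (S \<times> T) (%p. dird \<Phi> p (i, 0))" by (intro smooth_on_continuous smooth_on_dird assms(4))
    then have "continuous_on (ball x r \<times> cbox a b) (%p. dird \<Phi> p (i, 0))"
      by (rule continuous_on_subset) (use r assms(3) in auto)
    then show "continuous_on (ball x r \<times> cbox a b) (%p. blinfun_apply (case p of (y, t) => fx y t) i)"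
      by (rule continuous_on_eq) (use fx r(2) assms(3) in \<open>auto simp: subset_iff\<close>)
  qed
  have cfx1: "continuous_on (cbox a b) (fx x)"
    using continuous_on_compose2[OF cfx continuous_on_Pair[OF continuous_on_const continuous_on_id], of x "cbox a b"] r
    by (simp add: image_subset_iff)
  have "((%x. integral (cbox a b) (%t. \<Phi> (x, t))) has_derivative integral (cbox a b) (fx x)) (at x within ball x r)"
  proof (rule leibniz_rule[OF _ _ cfx])
    fix y t assume "y \<in> ball x r" "t \<in> cbox a b"
    then show "((%x. \<Phi> (x, t)) has_derivative blinfun_apply (fx y t)) (at y within ball x r)"
      using D[of y t] fx[of y t] r(2) assms(3) has_derivative_at_withinI by (auto simp: subset_iff)
  next
    fix y assume "y \<in> ball x r"
    then show "(%t. \<Phi> (y, t)) integrable_on cbox a b"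
      using r(2) assms(3) by (intro integrable_continuous, intro continuous_on_compose2[OF c, of _ "%t. (y, t)"]) (auto intro!: continuous_intros)
  qed (use r in auto)
  moreover have "blinfun_apply (integral (cbox a b) (fx x)) v = integral (cbox a b) (%t. dird \<Phi> (x, t) (v, 0))" for v
  proof -
    have "blinfun_apply (integral (cbox a b) (fx x)) v = integral (cbox a b) (%t. blinfun_apply (fx x t) v)"
      by (rule blinfun_apply_integral) (rule integrable_continuous[OF cfx1])
    also have "\<dots> = integral (cbox a b) (%t. dird \<Phi> (x, t) (v, 0))"
      by (rule integral_cong) (use fx assms in auto)
    finally show ?thesis .
  qed
  then have "blinfun_apply (integral (cbox a b) (fx x)) = (%v. integral (cbox a b) (%t. dird \<Phi> (x, t) (v, 0)))" by blast
  ultimately have "((%x. integral (cbox a b) (%t. \<Phi> (x, t))) has_derivative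
     (%v. integral (cbox a b) (%t. dird \<Phi> (x, t) (v, 0)))) (at x within ball x r)"
    by (simp only:)
  then show ?thesis using r(1) at_within_open[of x "ball x r"] by auto
qed

text \<open>The derivative is again a parameter integral, with integrand
  \<open>dird \<Phi> p (v, 0)\<close>, so the induction on \<open>k\<close> runs over all smooth
  integrands at once.\<close>

lemma smooth_on_integral:
  fixes \<Phi> :: "'a::euclidean_space \<times> 'b::euclidean_space => 'c::banach"
  assumes "open S" "open T" "cbox a b \<subseteq> T" "smooth_on (S \<times> T) \<Phi>"
  shows "smooth_on S (%x. integral (cbox a b) (%t. \<Phi> (x, t)))"
proof -
  have *: "\<forall>\<Phi> :: 'a \<times> 'b => 'c. smooth_on (S \<times> T) \<Phi> \<longrightarrow> Ck_on k S (%x. integral (cbox a b) (%t. \<Phi> (x, t)))" for k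
  proof (induction k)
    case 0
    show ?case
    proof (intro allI impI)
      fix \<Phi> :: "'a \<times> 'b => 'c" assume "smooth_on (S \<times> T) \<Phi>"
      then have "continuous_on (S \<times> cbox a b) \<Phi>"
        by (rule continuous_on_subset[OF smooth_on_continuous]) (use assms(3) in auto)
      then have "continuous_on (S \<times> cbox a b) (%(x, t). \<Phi> (x, t))" by simp
      then show "Ck_on 0 S (%x. integral (cbox a b) (%t. \<Phi> (x, t)))"
        unfolding Ck_on.simps by (rule integral_continuous_on_param)
    qed
  next
    case (Suc k)
    show ?case
    proof (intro allI impI)
      fix \<Phi> :: "'a \<times> 'b => 'c" assume *: "smooth_on (S \<times> T) \<Phi>"
      show "Ck_on (Suc k) S (%x. integral (cbox a b) (%t. \<Phi> (x, t)))"
        by (rule Ck_on_SucI[OF assms(1) has_derivative_integral[OF assms(1-3) *]])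
          (assumption, rule Suc[rule_format, OF smooth_on_dird[OF *]])
    qed
  qed
  show ?thesis unfolding smooth_on_def[of S] by (rule allI) (rule *[rule_format, OF assms(4)])
qed

section \<open>Wirtinger derivatives\<close>

text \<open>The operator \<partial>/\<partial>z_i, with \<open>axis i \<i>\<close> the direction of
  the imaginary part of z_i; \<open>pb\<close> is its conjugate operator.\<close>

definition pd :: "'n::finite => (complex^'n => complex) => complex^'n => complex" where
  "pd i F z = (dird F z (axis i 1) - \<i> * dird F z (axis i \<i>)) / 2"

definition pb :: "'n::finite => (complex^'n => complex) => complex^'n => complex" where
  "pb i F z = (dird F z (axis i 1) + \<i> * dird F z (axis i \<i>)) / 2"

lemma pd_pb_eqI:
  assumes "(F has_derivative F') (at z)"
  shows "pd i F z = (F' (axis i 1) - \<i> * F' (axis i \<i>)) / 2" "pb i F z = (F' (axis i 1) + \<i> * F' (axis i \<i>)) / 2"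
  unfolding pd_def pb_def dird_eqI[OF assms] by auto

lemma dird_pd_pb:
  fixes F :: "complex^'n::finite => complex"
  assumes "F differentiable (at z)"
  shows "dird F z v = (SUM i. pd i F z * v $ i + pb i F z * cnj (v $ i))"
proof -
  interpret linear "dird F z" by (rule dird_linear[OF assms])
  have "v = (SUM i. Re (v $ i) *\<^sub>R axis i 1 + Im (v $ i) *\<^sub>R axis i \<i>)"
    by (simp add: vec_eq_iff axis_def sum.distrib if_distrib if_distribR complex_eq_iff cong: if_cong)
  then have "dird F z v = (SUM i. Re (v $ i) *\<^sub>R dird F z (axis i 1) + Im (v $ i) *\<^sub>R dird F z (axis i \<i>))"
    by (metis (no_types, lifting) add scaleR sum sum.cong)
  also have "\<dots> = (SUM i. pd i F z * v $ i + pb i F z * cnj (v $ i))"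
  proof (rule sum.cong[OF refl])
    fix i
    have 1: "v $ i = of_real (Re (v $ i)) + \<i> * of_real (Im (v $ i))" "cnj (v $ i) = of_real (Re (v $ i)) - \<i> * of_real (Im (v $ i))"
      by (simp_all add: complex_eq_iff)
    show "Re (v $ i) *\<^sub>R dird F z (axis i 1) + Im (v $ i) *\<^sub>R dird F z (axis i \<i>) = pd i F z * v $ i + pb i F z * cnj (v $ i)"
      unfolding pd_def pb_def scaleR_conv_of_real
      by (subst (3) 1(1), subst 1(2)) (simp add: algebra_simps add_divide_distrib diff_divide_distrib)
  qed
  finally show ?thesis .
qed

lemma pd_cong_open:
  assumes "open S" "z \<in> S" "\<And>y. y \<in> S ==> f y = g y"
  shows "pd i f z = pd i g z" "pb i f z = pb i g z"
  using dird_cong_open[OF assms] by (simp_all only: pd_def pb_def)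

lemma smooth_on_pd [smooth_intros]: "open S ==> smooth_on S f ==> smooth_on S (%z. pd i f z)"
  and smooth_on_pb [smooth_intros]: "open S ==> smooth_on S f ==> smooth_on S (%z. pb i f z)"
  unfolding pd_def pb_def
  by (intro smooth_on_divide smooth_on_diff smooth_on_add smooth_on_mult smooth_on_const smooth_on_dird; simp)+

lemma pd_const: "pd i (%_. c) z = 0" "pb i (%_. c) z = 0"
  using pd_pb_eqI[OF has_derivative_const] by auto

lemma pd_nth: fixes z :: "complex^'n::finite" shows "pd i (%y. y $ j) z = (if i = j then 1 else 0)" "pb i (%y. y $ j) z = 0"
proof -
  have D: "((%y::complex^'n. y $ j) has_derivative (%v. v $ j)) (at z)" for z :: "complex^'n"
    by (rule bounded_linear_imp_has_derivative[OF bounded_linear_vec_nth])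
  show "pd i (%y. y $ j) z = (if i = j then 1 else 0)" "pb i (%y. y $ j) z = 0"
    unfolding pd_pb_eqI[OF D] by (auto simp: axis_def)
qed

context
  fixes f g :: "complex^'n::finite => complex" and z
  assumes f: "f differentiable (at z)"
begin

lemma pd_uminus: "pd i (%y. - f y) z = - pd i f z" "pb i (%y. - f y) z = - pb i f z"
  unfolding pd_pb_eqI[OF has_derivative_minus[OF has_derivative_dird[OF f]]]
  by (simp_all add: pd_def pb_def field_simps)

lemma pd_cnj: "pd i (%y. cnj (f y)) z = cnj (pb i f z)" "pb i (%y. cnj (f y)) z = cnj (pd i f z)"
  unfolding pd_pb_eqI[OF has_derivative_cnj[OF has_derivative_dird[OF f]]]
  by (simp_all add: pd_def pb_def)

lemma pd_inverse:
  assumes "f z \<noteq> 0"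
  shows "pd i (%y. inverse (f y)) z = - pd i f z * (inverse (f z))\<^sup>2" "pb i (%y. inverse (f y)) z = - pb i f z * (inverse (f z))\<^sup>2"
  unfolding pd_pb_eqI[OF Deriv.has_derivative_inverse[OF assms has_derivative_dird[OF f]]]
  by (simp_all add: pd_def pb_def power2_eq_square algebra_simps diff_divide_distrib add_divide_distrib)

text \<open>\<open>pd\<close> and \<open>pb\<close> act on complex-valued functions, so a real
  function \<open>r\<close> is differentiated through its complexification \<open>f\<close>. Used
  for logarithms, exponentials and the momentum coordinate.\<close>

lemma pd_of_real_compose:
  assumes "\<And>y. f y = of_real (r y)" "(\<phi> has_real_derivative d) (at (r z))"
  shows "pd i (%y. of_real (\<phi> (r y))) z = of_real d * pd i f z" "pb i (%y. of_real (\<phi> (r y))) z = of_real d * pb i f z"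
proof -
  have f': "f = (%y. of_real (r y))" using assms by auto
  have "((%y. Re (f y)) has_derivative (%v. Re (dird f z v))) (at z)"
    by (rule has_derivative_Re[OF has_derivative_dird[OF f]])
  then have r: "(r has_derivative (%v. Re (dird f z v))) (at z)" by (simp add: f')
  have fr: "(f has_derivative (%v. of_real (Re (dird f z v)))) (at z)"
    unfolding f' by (rule has_derivative_of_real[OF r[unfolded f']])
  have "((%y. \<phi> (r y)) has_derivative (%v. d * Re (dird f z v))) (at z)"
    using diff_chain_at[OF r assms(2)[unfolded has_field_derivative_def]] by (simp add: o_def)
  from has_derivative_of_real[OF this]
  have D: "((%y. complex_of_real (\<phi> (r y))) has_derivative (%v. of_real d * of_real (Re (dird f z v)))) (at z)" by simp
  show "pd i (%y. of_real (\<phi> (r y))) z = of_real d * pd i f z" "pb i (%y. of_real (\<phi> (r y))) z = of_real d * pb i f z"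
    unfolding pd_pb_eqI[OF D] pd_pb_eqI[OF fr] by (simp_all add: algebra_simps)
qed

context assumes g: "g differentiable (at z)"
begin

lemma pd_add: "pd i (%y. f y + g y) z = pd i f z + pd i g z" "pb i (%y. f y + g y) z = pb i f z + pb i g z"
  unfolding pd_pb_eqI[OF has_derivative_add[OF has_derivative_dird[OF f] has_derivative_dird[OF g]]]
  by (simp_all add: pd_def pb_def field_simps)

lemma pd_diff: "pd i (%y. f y - g y) z = pd i f z - pd i g z" "pb i (%y. f y - g y) z = pb i f z - pb i g z"
  unfolding pd_pb_eqI[OF has_derivative_diff[OF has_derivative_dird[OF f] has_derivative_dird[OF g]]]
  by (simp_all add: pd_def pb_def field_simps)

lemma pd_mult: "pd i (%y. f y * g y) z = pd i f z * g z + f z * pd i g z" "pb i (%y. f y * g y) z = pb i f z * g z + f z * pb i g z"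
  unfolding pd_pb_eqI[OF has_derivative_mult[OF has_derivative_dird[OF f] has_derivative_dird[OF g]]]
  by (simp_all add: pd_def pb_def field_simps)

end
end

lemma pd_sum:
  fixes f :: "'k => complex^'n::finite => complex"
  assumes "\<And>a. a \<in> A ==> f a differentiable (at z)"
  shows "pd i (%y. \<Sum>a\<in>A. f a y) z = (\<Sum>a\<in>A. pd i (f a) z)" "pb i (%y. \<Sum>a\<in>A. f a y) z = (\<Sum>a\<in>A. pb i (f a) z)"
proof -
  have D: "((%y. \<Sum>a\<in>A. f a y) has_derivative (%v. \<Sum>a\<in>A. dird (f a) z v)) (at z)"
    by (rule has_derivative_sum) (rule has_derivative_dird[OF assms])
  show "pd i (%y. \<Sum>a\<in>A. f a y) z = (\<Sum>a\<in>A. pd i (f a) z)" "pb i (%y. \<Sum>a\<in>A. f a y) z = (\<Sum>a\<in>A. pb i (f a) z)"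
    unfolding pd_pb_eqI[OF D]
    by (simp_all add: pd_def pb_def sum_distrib_left sum.distrib sum_subtractf sum_divide_distrib diff_divide_distrib add_divide_distrib)
qed

lemma dird_pd_commute:
  fixes F :: "complex^'n::finite => complex"
  assumes "open S" "z \<in> S" "smooth_on S F"
  shows "dird (%y. pd i F y) z v = (dird (%y. dird F y v) z (axis i 1) - \<i> * dird (%y. dird F y v) z (axis i \<i>)) / 2"
    "dird (%y. pb i F y) z v = (dird (%y. dird F y v) z (axis i 1) + \<i> * dird (%y. dird F y v) z (axis i \<i>)) / 2"
proof -
  have D: "((%y. dird F y w) has_derivative dird (%y. dird F y w) z) (at z)" for w
    by (rule smooth_on_has_derivative[OF smooth_on_dird[OF assms(3)] assms(2)])
  note c = dird_commute[OF assms, of v]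
  have "((%y. (dird F y (axis i 1) - \<i> * dird F y (axis i \<i>)) / 2) has_derivative
     (%v. (dird (%y. dird F y (axis i 1)) z v - \<i> * dird (%y. dird F y (axis i \<i>)) z v) / 2)) (at z)"
    unfolding divide_inverse by (intro has_derivative_mult_left has_derivative_diff has_derivative_mult_right D)
  from dird_eqI[OF this] show "dird (%y. pd i F y) z v = (dird (%y. dird F y v) z (axis i 1) - \<i> * dird (%y. dird F y v) z (axis i \<i>)) / 2"
    unfolding pd_def[abs_def] c .
  have "((%y. (dird F y (axis i 1) + \<i> * dird F y (axis i \<i>)) / 2) has_derivative
     (%v. (dird (%y. dird F y (axis i 1)) z v + \<i> * dird (%y. dird F y (axis i \<i>)) z v) / 2)) (at z)"
    unfolding divide_inverse by (intro has_derivative_mult_left has_derivative_add has_derivative_mult_right D)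
  from dird_eqI[OF this] show "dird (%y. pb i F y) z v = (dird (%y. dird F y v) z (axis i 1) + \<i> * dird (%y. dird F y v) z (axis i \<i>)) / 2"
    unfolding pb_def[abs_def] c .
qed

lemma pd_dird_commute:
  fixes F :: "complex^'n::finite => complex"
  assumes "open S" "z \<in> S" "smooth_on S F"
  shows "dird (%y. pd i F y) z v = pd i (%y. dird F y v) z" "dird (%y. pb i F y) z v = pb i (%y. dird F y v) z"
  by (simp_all only: dird_pd_commute[OF assms]) (simp_all only: pd_def pb_def)

lemma pd_commute:
  fixes F :: "complex^'n::finite => complex"
  assumes "open S" "z \<in> S" "smooth_on S F"
  shows "pd i (%y. pd j F y) z = pd j (%y. pd i F y) z"
    "pb i (%y. pb j F y) z = pb j (%y. pb i F y) z"
    "pb i (%y. pd j F y) z = pd j (%y. pb i F y) z"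
proof -
  have D: "(%y. dird F y w) differentiable (at z)" for w
    by (rule smooth_onD[OF smooth_on_dird[OF assms(3)] assms(2)])
  note c = pd_dird_commute[OF assms]
  have m: "pd j (%y. c * f y / 2) z = c * pd j f z / 2" "pb j (%y. c * f y / 2) z = c * pb j f z / 2"
    if "f differentiable (at z)" for c f and j :: 'n
    using pd_mult[OF differentiable_const that, of _ "c/2"] by (simp_all add: pd_const)
  note d = differentiable_mult[OF differentiable_const D] differentiable_divide[OF differentiable_mult[OF differentiable_const D] differentiable_const]
  have e: "(%y. pd i F y) = (%y. 1 * dird F y (axis i 1) / 2 + (- \<i>) * dird F y (axis i \<i>) / 2)"
     "(%y. pb i F y) = (%y. 1 * dird F y (axis i 1) / 2 + \<i> * dird F y (axis i \<i>) / 2)" for i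
    by (simp_all add: pd_def pb_def fun_eq_iff field_simps)
  have dd: "(%y. c * dird F y w / 2) differentiable (at z)" for c w
    by (rule differentiable_divide[OF differentiable_mult[OF differentiable_const D] differentiable_const]) simp
  show "pd i (%y. pd j F y) z = pd j (%y. pd i F y) z"
    unfolding e(1)[of i] pd_add[OF dd dd] m[OF D] c[symmetric] by (simp add: pd_def[of i] field_simps)
  show "pb i (%y. pb j F y) z = pb j (%y. pb i F y) z"
    unfolding e(2)[of i] pd_add[OF dd dd] m[OF D] c[symmetric] by (simp add: pb_def[of i] field_simps)
  show "pb i (%y. pd j F y) z = pd j (%y. pb i F y) z"
    unfolding e(2)[of i] pd_add[OF dd dd] m[OF D] c[symmetric] by (simp add: pb_def[of i] field_simps)
qed

lemma axis_i: "axis i \<i> = J (axis i 1)"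
  by (simp add: J_def vec_eq_iff axis_def)

text \<open>Complex linearity of \<open>T'\<close> removes the mixed terms of the chain rule:
  \<open>pd\<close> is transformed by the complex Jacobian and \<open>pb\<close> by its
  conjugate.\<close>

lemma pd_compose_holo:
  fixes F :: "complex^'m::finite => complex" and T :: "complex^'n::finite => complex^'m"
  assumes T: "(T has_derivative T') (at z)" "\<And>v. T' (J v) = J (T' v)" and F: "F differentiable (at (T z))"
  shows "pd i (%y. F (T y)) z = (SUM a. pd a F (T z) * T' (axis i 1) $ a)"
    "pb i (%y. F (T y)) z = (SUM a. pb a F (T z) * cnj (T' (axis i 1) $ a))"
proof -
  have D: "((%y. F (T y)) has_derivative (%v. dird F (T z) (T' v))) (at z)"
    using diff_chain_at[OF T(1) has_derivative_dird[OF F]] by (simp add: o_def)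
  have J': "J w $ a = \<i> * w $ a" for w :: "complex^'m" and a by (simp add: J_def)
  show "pd i (%y. F (T y)) z = (SUM a. pd a F (T z) * T' (axis i 1) $ a)"
    unfolding pd_pb_eqI[OF D] axis_i T(2) dird_pd_pb[OF F] J' sum_distrib_left
    by (simp add: sum_subtractf[symmetric] sum_divide_distrib) (rule sum.cong, auto simp: algebra_simps)
  show "pb i (%y. F (T y)) z = (SUM a. pb a F (T z) * cnj (T' (axis i 1) $ a))"
    unfolding pd_pb_eqI[OF D] axis_i T(2) dird_pd_pb[OF F] J' sum_distrib_left
    by (simp add: sum.distrib[symmetric] sum_divide_distrib) (rule sum.cong, auto simp: algebra_simps)
qed

section \<open>The scalar curvature of a Kaehler metric in a chart\<close>

lemma sum3_bca: "(\<Sum>a\<in>A. \<Sum>b\<in>B. \<Sum>c\<in>D. f a b c) = (\<Sum>b\<in>B. \<Sum>c\<in>D. \<Sum>a\<in>A. f a b c :: 'v::comm_monoid_add)"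
  by (subst sum.swap) (intro sum.cong refl sum.swap)

lemma sum4_bcda: "(\<Sum>a\<in>A. \<Sum>b\<in>B. \<Sum>c\<in>D. \<Sum>d\<in>E. f a b c d) = (\<Sum>b\<in>B. \<Sum>c\<in>D. \<Sum>d\<in>E. \<Sum>a\<in>A. f a b c d :: 'v::comm_monoid_add)"
  by (subst sum.swap) (intro sum.cong refl sum3_bca)

lemma J_nth: "J v $ k = \<i> * v $ k" by (simp add: J_def)

lemma J_J: "J (J v) = - v" by (simp add: J_def vec_eq_iff)

text \<open>\<open>Basis\<close> consists of \<open>axis k 1\<close> and \<open>axis k \<i>\<close>;
  pairing with the latter takes an imaginary part, which is the real part after multiplication by
  \<open>-\<i>\<close>. Real traces in \<open>ricci\<close> and \<open>scalar_curvature\<close>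
  become complex ones in this way.\<close>

lemma trace_Basis:
  fixes r :: "complex^'n::finite => complex^'n"
  shows "(\<Sum>e\<in>Basis. r e \<bullet> e) = Re (SUM k. r (axis k 1) $ k - \<i> * r (J (axis k 1)) $ k)"
proof -
  have B: "(Basis :: (complex^'n) set) = (%(k, c). axis k c) ` (UNIV \<times> {1, \<i>})"
    by (auto simp: Basis_vec_def Basis_complex_def)
  have "(\<Sum>e\<in>Basis. r e \<bullet> e) = (\<Sum>(k, c)\<in>UNIV \<times> {1, \<i>}. r (axis k c) \<bullet> axis k c)"
    unfolding B by (subst sum.reindex) (auto simp: inj_on_def axis_eq_axis split_beta)
  also have "\<dots> = (SUM k. \<Sum>c\<in>{1, \<i>}. r (axis k c) \<bullet> axis k c)" by (rule sum.cartesian_product[symmetric])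
  also have "\<dots> = (SUM k. Re (r (axis k 1) $ k - \<i> * r (J (axis k 1)) $ k))"
    by (rule sum.cong) (auto simp: inner_axis inner_complex_def axis_i[symmetric])
  finally show ?thesis by simp
qed

text \<open>The entries of the Hermitian form with real part \<open>g\<close>, complex linear in the
  first slot: its imaginary part at (u, v) is g(u, J v).\<close>

definition herm :: "(complex^'n::finite => complex^'n => complex^'n => real) => 'n => 'n => complex^'n => complex" where
  "herm g k l z = complex_of_real (g z (axis k 1) (axis l 1)) + \<i> * complex_of_real (g z (axis k 1) (J (axis l 1)))"

text \<open>The conditions of \<open>kahler_metric\<close> on one chart. The domain is all of the
  coordinate space because the charts of the atlas are onto.\<close>

locale kahler_chart =
  fixes g :: "complex^'n::finite => complex^'n => complex^'n => real"
  assumes smooth: "smooth (%z. g z u v)"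
    and bilinear: "bilinear (g z)"
    and sym: "g z u v = g z v u"
    and pos: "u \<noteq> 0 ==> g z u u > 0"
    and J_inv: "g z (J u) (J v) = g z u v"
    and closed: "dird (%y. fundamental_form g y v w) z u + dird (%y. fundamental_form g y w u) z v
                + dird (%y. fundamental_form g y u v) z w = 0"
begin

abbreviation "H \<equiv> herm g"

lemma g_J: "g z (J u) v = - g z u (J v)"
  using J_inv[of z "J u" v] bilinear[of z] by (simp add: J_J bilinear_lneg)

lemma H_cnj: "cnj (H k l z) = H l k z"
  using g_J[of z "axis k 1" "axis l 1"] sym[of z] by (simp add: herm_def)

lemma smooth_H: "smooth (H k l)"
  unfolding herm_def[abs_def] by (intro smooth_intros smooth open_UNIV)

lemma H_diff: "H k l differentiable (at z)"
  by (rule smooth_onD[OF smooth_H]) simp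

lemma g_eq: "g z u v = Re (SUM k l. H k l z * u $ k * cnj (v $ l))"
proof -
  interpret b: bounded_bilinear "g z" using bilinear bilinear_conv_bounded_bilinear by blast
  have dec: "w = (SUM k. Re (w $ k) *\<^sub>R axis k 1 + Im (w $ k) *\<^sub>R J (axis k 1))" for w :: "complex^'n"
    by (simp add: vec_eq_iff axis_def J_def sum.distrib if_distrib if_distribR complex_eq_iff cong: if_cong)
  have "g z u v = (SUM k l. g z (Re (u $ k) *\<^sub>R axis k 1 + Im (u $ k) *\<^sub>R J (axis k 1)) (Re (v $ l) *\<^sub>R axis l 1 + Im (v $ l) *\<^sub>R J (axis l 1)))"
    by (subst dec[of u], subst dec[of v]) (simp only: b.sum_left b.sum_right, rule sum.swap)
  also have "\<dots> = (SUM k l. Re (H k l z * u $ k * cnj (v $ l)))"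
    by (intro sum.cong refl)
      (simp add: b.add_left b.add_right b.scaleR_left b.scaleR_right J_J b.minus_right g_J herm_def algebra_simps)
  finally show ?thesis by simp
qed

lemma dird_linear_g: "dird (%y. - g y u v) z w = - dird (%y. g y u v) z w"
proof -
  have "((%y. - g y u v) has_derivative (%w. - dird (%y. g y u v) z w)) (at z)"
    by (rule has_derivative_minus[OF smooth_on_has_derivative[OF smooth]]) simp
  from dird_eqI[OF this] show ?thesis .
qed

lemma dird_H: "dird (H k l) z w = complex_of_real (dird (%y. g y (axis k 1) (axis l 1)) z w) + \<i> * complex_of_real (dird (%y. g y (axis k 1) (J (axis l 1))) z w)"
  unfolding herm_def[abs_def]
  by (rule dird_eqI) (intro has_derivative_add has_derivative_mult_right has_derivative_of_real
      smooth_on_has_derivative[OF smooth]; simp)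

text \<open>This is the (2,1) part of d\<omega> = 0. Closedness is evaluated on four triples of
  basis vectors with \<open>J\<close> inserted; their combinations are the real and imaginary parts
  of the claimed symmetry.\<close>

lemma pd_H_commute: "pd i (H j l) z = pd j (H i l) z"
proof -
  define e where "e k = axis k (1::complex)" for k :: 'n
  define a where "a k l w = dird (%y. g y (e k) (e l)) z w" for k l w
  define b where "b k l w = dird (%y. g y (e k) (J (e l))) z w" for k l w
  have neg: "bilinear (g y) ==> g y (- u) v = - g y u v" for y u v by (rule bilinear_lneg)
  have om: "dird (%y. fundamental_form g y (e k) (e l)) z w = - b k l w"
     "dird (%y. fundamental_form g y (e k) (J (e l))) z w = a k l w"
     "dird (%y. fundamental_form g y (J (e k)) (e l)) z w = - a k l w"
     "dird (%y. fundamental_form g y (J (e k)) (J (e l))) z w = - b k l w" for k l w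
    unfolding fundamental_form_def a_def b_def J_J J_inv
    by (simp_all add: g_J neg[OF bilinear] dird_linear_g)
  have sy: "a k l w = a l k w" for k l w unfolding a_def using sym by (intro arg_cong[of _ _ "%f. dird f z w"]) auto
  have asy: "b k l w = - b l k w" for k l w
  proof -
    have "(%y. g y (e k) (J (e l))) = (%y. - g y (e l) (J (e k)))" using g_J sym by (metis minus_minus)
    then show ?thesis unfolding b_def by (simp add: dird_linear_g)
  qed
  have H': "dird (H k l) z w = complex_of_real (a k l w) + \<i> * complex_of_real (b k l w)" for k l w
    unfolding dird_H a_def b_def e_def by simp
  have i: "axis i \<i> = J (e i)" for i :: 'n by (simp add: e_def axis_i)
  have "b j l (e i) + b l i (e j) + b i j (e l) = 0" using closed[of "e j" "e l" z "e i"] unfolding om by simp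
  moreover have "- a j l (J (e i)) + a l i (J (e j)) - b i j (e l) = 0"
    using closed[of "J (e j)" "e l" z "J (e i)"] unfolding om by simp
  moreover have "a j l (e i) - a l i (e j) - b i j (J (e l)) = 0"
    using closed[of "e j" "J (e l)" z "e i"] unfolding om by simp
  moreover have "b j l (J (e i)) + b l i (J (e j)) + b i j (J (e l)) = 0"
    using closed[of "J (e j)" "J (e l)" z "J (e i)"] unfolding om by simp
  ultimately have "a j l (e i) + b j l (J (e i)) = a i l (e j) + b i l (J (e j)) \<and> b j l (e i) - a j l (J (e i)) = b i l (e j) - a i l (J (e j))"
    using sy[of i l] asy[of l i] by (auto simp: algebra_simps)
  then show ?thesis unfolding pd_def H' i e_def[symmetric] by (simp add: complex_eq_iff)
qed

lemma H_fun_cnj: "(%y. cnj (H k l y)) = H l k" by (simp add: H_cnj fun_eq_iff)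

lemma pb_H_cnj: "pb i (H j l) z = cnj (pd i (H l j) z)"
  using pd_cnj(2)[OF H_diff, of i l j z] by (simp add: H_fun_cnj)

lemma pb_H_commute: "pb i (H j l) z = pb l (H j i) z"
  unfolding pb_H_cnj by (subst pd_H_commute) simp

lemma g_unique: "(\<And>w. g z v w = g z v' w) ==> v = v'"
proof -
  assume *: "\<And>w. g z v w = g z v' w"
  have "g z (v - v') (v - v') = 0" using *[of "v - v'"] bilinear[of z] by (simp add: bilinear_lsub)
  then show "v = v'" using pos[of "v - v'" z] by fastforce
qed

lemma sharp_g: "(\<And>w. g z v w = \<alpha> w) ==> sharp (g z) \<alpha> = v"
proof (rule sharp_eqI)
  fix v' assume "\<And>w. g z v w = \<alpha> w" "\<And>w. g z v' w = g z v w"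
  then show "v' = v" using g_unique[of z v' v] by simp
qed

definition K :: "'n => 'n => complex^'n => complex" where
  "K l m z = matrix_inv (\<chi> k l. H k l z) $ l $ m"

text \<open>A kernel vector \<open>x\<close> would make its conjugate \<open>u\<close> a null vector
  of the positive definite \<open>g\<close>.\<close>

lemma invertible_H: "invertible (\<chi> k l. H k l z)"
proof -
  have "x = 0" if x: "(\<chi> k l. H k l z) *v x = 0" for x :: "complex^'n"
  proof (rule ccontr)
    assume "x \<noteq> 0"
    define u where "u = (\<chi> l. cnj (x $ l))"
    have "u \<noteq> 0" using \<open>x \<noteq> 0\<close> by (auto simp: u_def vec_eq_iff)
    have z: "(SUM l. H k l z * x $ l) = 0" for k using arg_cong[OF x, of "%v. v $ k"] by (simp add: matrix_vector_mult_def)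
    have "(SUM k l. H k l z * u $ k * cnj (u $ l)) = (SUM k. u $ k * (SUM l. H k l z * x $ l))"
      unfolding sum_distrib_left by (intro sum.cong refl) (simp add: u_def)
    then have "g z u u = 0" by (subst g_eq) (simp add: z)
    with pos[OF \<open>u \<noteq> 0\<close>, of z] show False by simp
  qed
  then show ?thesis unfolding invertible_left_inverse matrix_left_invertible_ker by blast
qed

lemma H_matrix_inv:
  "(\<chi> k l. H k l z) ** matrix_inv (\<chi> k l. H k l z) = mat 1 \<and> matrix_inv (\<chi> k l. H k l z) ** (\<chi> k l. H k l z) = mat 1"
  using invertible_H[of z] unfolding invertible_def matrix_inv_def by (rule someI_ex)

lemma H_K: "(SUM l. H k l z * K l m z) = (if k = m then 1 else 0)"
  using arg_cong[OF H_matrix_inv[of z, THEN conjunct1], of "%M. M $ k $ m"]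
  by (simp add: matrix_matrix_mult_def mat_def K_def)

lemma K_H: "(SUM l. K k l z * H l m z) = (if k = m then 1 else 0)"
  using arg_cong[OF H_matrix_inv[of z, THEN conjunct2], of "%M. M $ k $ m"]
  by (simp add: matrix_matrix_mult_def mat_def K_def)

lemma delta_mult_sum: "(\<Sum>i\<in>(UNIV::'n set). (if i = m then 1 else 0) * f i) = (f m :: complex)"
  "(\<Sum>i\<in>(UNIV::'n set). (if m = i then 1 else 0) * f i) = f m"
  "(\<Sum>i\<in>(UNIV::'n set). f i * (if i = m then 1 else 0)) = f m"
  "(\<Sum>i\<in>(UNIV::'n set). f i * (if m = i then 1 else 0)) = f m"
  by (simp_all add: if_distrib if_distribR cong: if_cong)

lemma K_unique:
  assumes "\<And>k m. (SUM l. H k l z * K' l m) = (if k = m then 1 else 0)"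
  shows "K k m z = K' k m"
proof -
  have "K k m z = (SUM l. K k l z * (SUM i. H l i z * K' i m))"
    by (simp only: assms delta_mult_sum)
  also have "\<dots> = (SUM i. (SUM l. K k l z * H l i z) * K' i m)"
    by (simp only: sum_distrib_left sum_distrib_right mult.assoc) (rule sum.swap)
  also have "\<dots> = K' k m" by (simp only: K_H delta_mult_sum)
  finally show ?thesis .
qed

lemma K_cnj: "cnj (K k m z) = K m k z"
proof (rule K_unique[of z "%k m. cnj (K m k z)", symmetric])
  fix k m
  have "(SUM l. H k l z * cnj (K m l z)) = cnj (SUM l. K m l z * H l k z)"
    by (simp add: H_cnj mult.commute)
  then show "(SUM l. H k l z * cnj (K m l z)) = (if k = m then 1 else 0)" by (simp add: K_H)
qed

text \<open>Cramer's rule writes each entry of the inverse as a quotient of determinants in the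
  smooth entries of \<open>H\<close>.\<close>

lemma smooth_K: "smooth (K l m)"
proof -
  have det: "smooth (%z. det (\<chi> i j. M z i j))" if "\<And>i j. smooth (%z. M z i j)" for M :: "complex^'n => 'n => 'n => complex"
  proof -
    have p: "smooth (%z. \<Prod>i\<in>A. M z i (f i))" for A and f :: "'n => 'n"
      by (induction A rule: infinite_finite_induct) (simp_all add: smooth_on_const smooth_on_mult that)
    show ?thesis unfolding det_def by (simp, intro smooth_on_sum smooth_on_mult smooth_on_const p open_UNIV)
  qed
  have d: "det (\<chi> k l. H k l z) \<noteq> 0" for z using invertible_H[of z] by (simp add: invertible_det_nz)
  have "K l m z = det (\<chi> i j. if j = l then (if i = m then 1 else 0) else H i j z) / det (\<chi> i j. H i j z)" for z
  proof -
    have "(\<chi> k l. H k l z) *v (\<chi> l. K l m z) = axis m 1"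
      by (simp add: vec_eq_iff matrix_vector_mult_def H_K axis_def)
    then have "(\<chi> l. K l m z) = (\<chi> k. det (\<chi> i j. if j = k then axis m 1 $ i else (\<chi> k l. H k l z) $ i $ j) / det (\<chi> k l. H k l z))"
      using cramer[OF d] by blast
    from arg_cong[OF this, of "%v. v $ l"] show ?thesis by (simp add: axis_def cong: if_cong)
  qed
  then have "K l m = (%z. det (\<chi> i j. if j = l then (if i = m then 1 else 0) else H i j z) / det (\<chi> i j. H i j z))" by auto
  moreover have "smooth (%z. if j = l then (if i = m then 1 else 0) else H i j z)" for i j
    by (cases "j = l") (simp_all add: smooth_on_const smooth_H)
  ultimately show ?thesis
    by (auto intro!: smooth_on_divide det smooth_H simp: d)
qed

lemma K_diff: "K k l differentiable (at z)"
  by (rule smooth_onD[OF smooth_K]) simp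

text \<open>The holomorphic Christoffel symbols; those of mixed type vanish.\<close>

definition C :: "'n => 'n => 'n => complex^'n => complex" where
  "C k i j z = (SUM l. pd i (H j l) z * K l k z)"

lemma smooth_C: "smooth (C k i j)"
  unfolding C_def[abs_def] by (intro smooth_on_sum smooth_on_mult smooth_on_pd smooth_H smooth_K open_UNIV)

lemma dird_g: "dird (%y. g y v w) z u =
   Re (SUM j l. (SUM i. pd i (H j l) z * u $ i + pb i (H j l) z * cnj (u $ i)) * v $ j * cnj (w $ l))"
proof -
  have D: "((%y. g y v w) has_derivative (%u. Re (SUM j l. dird (H j l) z u * v $ j * cnj (w $ l)))) (at z)"
    by (subst g_eq) (intro has_derivative_Re has_derivative_sum has_derivative_mult_left has_derivative_dird H_diff)
  show ?thesis unfolding dird_eqI[OF D] dird_pd_pb[OF H_diff] ..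
qed

text \<open>Split the derivative of \<open>g\<close> into its (1,0) part \<open>P\<close> and (0,1)
  part \<open>Q\<close>. In the Koszul formula, the symmetry of \<open>P\<close> in its first two
  slots, that of \<open>Q\<close> in its outer slots and the conjugation \<open>PQ\<close> cancel
  four of the six terms in pairs; the remaining two are equal.\<close>

lemma christoffel_eq: "christoffel g z u v = (\<chi> k. SUM i j. C k i j z * u $ i * v $ j)"
  unfolding christoffel_def
proof (rule sharp_g)
  fix w
  define P where "P u v w = (SUM j l i. pd i (H j l) z * u $ i * v $ j * cnj (w $ l))" for u v w :: "complex^'n"
  define Q where "Q u v w = (SUM j l i. pb i (H j l) z * cnj (u $ i) * v $ j * cnj (w $ l))" for u v w :: "complex^'n"
  have d: "dird (%y. g y v w) z u = Re (P u v w) + Re (Q u v w)" for u v w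
    unfolding dird_g P_def Q_def
    by (simp only: sum.distrib sum_distrib_right distrib_right plus_complex.sel)
  have P_sym: "P u v w = P v u w" for u v w
  proof -
    have "P u v w = (SUM j i l. pd i (H j l) z * u $ i * v $ j * cnj (w $ l))"
      unfolding P_def by (intro sum.cong refl sum.swap)
    also have "\<dots> = (SUM i j l. pd i (H j l) z * u $ i * v $ j * cnj (w $ l))"
      by (rule sum.swap)
    also have "\<dots> = (SUM i j l. pd j (H i l) z * v $ j * u $ i * cnj (w $ l))"
      by (intro sum.cong refl) (subst pd_H_commute, simp)
    also have "\<dots> = P v u w" unfolding P_def by (intro sum.cong refl sum.swap)
    finally show ?thesis .
  qed
  have Q_sym: "Q u v w = Q w v u" for u v w
  proof -
    have "Q u v w = (SUM j i l. pb i (H j l) z * cnj (u $ i) * v $ j * cnj (w $ l))"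
      unfolding Q_def by (intro sum.cong refl sum.swap)
    also have "\<dots> = (SUM j i l. pb l (H j i) z * cnj (w $ l) * v $ j * cnj (u $ i))"
      by (intro sum.cong refl) (subst pb_H_commute, simp)
    finally show ?thesis unfolding Q_def .
  qed
  have PQ: "cnj (P u v w) = Q u w v" for u v w
  proof -
    have "cnj (P u v w) = (SUM j l i. pb i (H l j) z * cnj (u $ i) * w $ l * cnj (v $ j))"
      unfolding P_def by (simp add: pb_H_cnj mult_ac)
    also have "\<dots> = Q u w v" unfolding Q_def by (rule sum.swap)
    finally show ?thesis .
  qed
  have "g z (\<chi> k. SUM i j. C k i j z * u $ i * v $ j) w = Re (P u v w)"
  proof -
    have "(SUM k m. H k m z * (SUM i j. C k i j z * u $ i * v $ j) * cnj (w $ m))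
       = (SUM k m i j. H k m z * C k i j z * u $ i * v $ j * cnj (w $ m))"
      by (simp only: sum_distrib_left sum_distrib_right mult.assoc)
    also have "\<dots> = (SUM m i j. (SUM k. H k m z * C k i j z) * u $ i * v $ j * cnj (w $ m))"
      unfolding sum_distrib_right by (rule sum4_bcda)
    also have "\<dots> = (SUM m i j. pd i (H j m) z * u $ i * v $ j * cnj (w $ m))"
    proof -
      have "(SUM k. H k m z * C k i j z) = pd i (H j m) z" for m i j
      proof -
        have "(SUM k. H k m z * C k i j z) = (SUM l. pd i (H j l) z * (SUM k. K l k z * H k m z))"
          unfolding C_def sum_distrib_left by (subst sum.swap) (intro sum.cong refl, simp add: algebra_simps)
        then show ?thesis by (simp only: K_H delta_mult_sum)
      qed
      then show ?thesis by simp
    qed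
    also have "\<dots> = P u v w" unfolding P_def
      by (rule sum3_bca[symmetric])
    finally show ?thesis by (simp add: g_eq)
  qed
  moreover have "Re (Q u v w) = Re (P u w v)" for u v w unfolding PQ[of u w v, symmetric] by simp
  ultimately show "g z (\<chi> k. SUM i j. C k i j z * u $ i * v $ j) w =
    (dird (%y. g y v w) z u + dird (%y. g y u w) z v - dird (%y. g y u v) z w) / 2"
    unfolding d using P_sym[of v u w] Q_sym[of v u w] P_sym[of w u v] by simp
qed

lemma smooth_christoffel: "smooth (%y. christoffel g y v w)"
  unfolding christoffel_eq
  by (rule smooth_on_vec, simp, simp only: vec_lambda_beta)
    (intro smooth_on_sum smooth_on_mult smooth_on_const smooth_C open_UNIV)

lemma christoffel_J: "christoffel g z (J u) v = J (christoffel g z u v)" "christoffel g z u (J v) = J (christoffel g z u v)"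
  unfolding christoffel_eq by (simp_all add: vec_eq_iff J_nth sum_distrib_left mult_ac)

lemma christoffel_lin2: "christoffel g z u (v + w) = christoffel g z u v + christoffel g z u w"
   "christoffel g z u (c *s v) = c *s christoffel g z u v"
  unfolding christoffel_eq by (simp_all add: vec_eq_iff sum_distrib_left mult_ac sum.distrib[symmetric] distrib_left)

lemma vec_sum_axis: "w = (SUM m. (w $ m) *s axis m 1)" for w :: "complex^'n"
  by (simp add: vec_eq_iff axis_def if_distrib cong: if_cong)

text \<open>The complex trace of the curvature: the two real directions of index \<open>k\<close>
  are merged into \<open>pd k\<close>, so that the form becomes complex linear in
  \<open>w\<close>.\<close>

definition ric_form :: "complex^'n => complex^'n => complex^'n => complex" where
  "ric_form z v w = (SUM k. pd k (%y. christoffel g y v w $ k) z - dird (%y. christoffel g y (axis k 1) w $ k) z v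
     + christoffel g z (axis k 1) (christoffel g z v w) $ k - christoffel g z v (christoffel g z (axis k 1) w) $ k)"

lemma dird_nth: "dird (%y. christoffel g y v w) z u $ k = dird (%y. christoffel g y v w $ k) z u"
proof -
  have "((%y. christoffel g y v w $ k) has_derivative (%u. dird (%y. christoffel g y v w) z u $ k)) (at z)"
    by (rule bounded_linear.has_derivative[OF bounded_linear_vec_nth smooth_on_has_derivative[OF smooth_christoffel UNIV_I]])
  from dird_eqI[OF this] show ?thesis by simp
qed

lemma smooth_christoffel_nth: "smooth (%y. christoffel g y v w $ k)"
  by (intro smooth_on_linears smooth_christoffel open_UNIV)

lemma dird_cmult:
  fixes f :: "complex^'n => complex"
  assumes "smooth f" shows "dird (%y. c * f y) z v = c * dird f z v"
  by (rule dird_eqI) (intro has_derivative_mult_right smooth_on_has_derivative[OF assms] UNIV_I)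

text \<open>The Christoffel symbols are complex bilinear. Hence, when the contributions of
  \<open>axis k 1\<close> and \<open>J (axis k 1)\<close> are added, terms with the basis vector
  inside the symbols double and the derivative in its direction becomes twice
  \<open>pd k\<close>.\<close>

lemma ricci_eq: "ricci g z v w = 2 * Re (ric_form z v w)"
proof -
  have "ricci g z v w = Re (SUM k. riemann g z (axis k 1) v w $ k - \<i> * riemann g z (J (axis k 1)) v w $ k)"
    unfolding ricci_def by (rule trace_Basis)
  also have "(SUM k. riemann g z (axis k 1) v w $ k - \<i> * riemann g z (J (axis k 1)) v w $ k) = 2 * ric_form z v w"
    unfolding ric_form_def sum_distrib_left
  proof (rule sum.cong[OF refl])
    fix k
    have "riemann g z (axis k 1) v w $ k - \<i> * riemann g z (J (axis k 1)) v w $ k =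
       (dird (%y. christoffel g y v w $ k) z (axis k 1) - \<i> * dird (%y. christoffel g y v w $ k) z (J (axis k 1)))
       - (dird (%y. christoffel g y (axis k 1) w $ k) z v - \<i> * dird (%y. christoffel g y (J (axis k 1)) w $ k) z v)
       + (christoffel g z (axis k 1) (christoffel g z v w) $ k - \<i> * christoffel g z (J (axis k 1)) (christoffel g z v w) $ k)
       - (christoffel g z v (christoffel g z (axis k 1) w) $ k - \<i> * christoffel g z v (christoffel g z (J (axis k 1)) w) $ k)"
      unfolding riemann_def by (simp add: dird_nth algebra_simps)
    also have "dird (%y. christoffel g y v w $ k) z (axis k 1) - \<i> * dird (%y. christoffel g y v w $ k) z (J (axis k 1))
       = 2 * pd k (%y. christoffel g y v w $ k) z"
      by (simp add: pd_def axis_i)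
    finally show "riemann g z (axis k 1) v w $ k - \<i> * riemann g z (J (axis k 1)) v w $ k =
       2 * (pd k (%y. christoffel g y v w $ k) z - dird (%y. christoffel g y (axis k 1) w $ k) z v
     + christoffel g z (axis k 1) (christoffel g z v w) $ k - christoffel g z v (christoffel g z (axis k 1) w) $ k)"
      by (simp add: christoffel_J J_nth dird_cmult[OF smooth_christoffel_nth] algebra_simps)
  qed
  finally show ?thesis by simp
qed

lemma dird_add_smooth:
  fixes f h :: "complex^'n => complex"
  assumes "smooth f" "smooth h" shows "dird (%y. f y + h y) z v = dird f z v + dird h z v"
  by (rule dird_eqI) (rule has_derivative_add[OF smooth_on_has_derivative[OF assms(1)] smooth_on_has_derivative[OF assms(2)]]; simp)

lemma ric_form_lin: "ric_form z v (w + w') = ric_form z v w + ric_form z v w'" "ric_form z v (c *s w) = c * ric_form z v w"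
proof -
  note d = smooth_onD[OF smooth_christoffel_nth UNIV_I]
  show "ric_form z v (w + w') = ric_form z v w + ric_form z v w'"
    unfolding ric_form_def
    by (simp add: christoffel_lin2 pd_add[OF d d] dird_add_smooth[OF smooth_christoffel_nth smooth_christoffel_nth] sum.distrib sum_subtractf algebra_simps)
  have "pd k (%y. c * f y) z = c * pd k f z" if "f differentiable (at z)" for f k
    using pd_mult(1)[OF differentiable_const[of c] that] by (simp add: pd_const)
  then show "ric_form z v (c *s w) = c * ric_form z v w"
    unfolding ric_form_def sum_distrib_left
    by (intro sum.cong refl) (simp add: christoffel_lin2 d dird_cmult[OF smooth_christoffel_nth] algebra_simps)
qed

lemma ric_form_expand: "ric_form z v w = (SUM m. ric_form z v (axis m 1) * w $ m)"
proof -
  have "ric_form z v (\<Sum>m\<in>A. (w $ m) *s axis m 1) = (\<Sum>m\<in>A. ric_form z v (axis m 1) * w $ m)" for A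
  proof (induction A rule: infinite_finite_induct)
    case empty
    show ?case using ric_form_lin(2)[of z v 0 0] by simp
  qed (use ric_form_lin(2)[of z v 0 0] in \<open>simp_all add: ric_form_lin mult.commute\<close>)
  from this[of UNIV] show ?thesis unfolding vec_sum_axis[symmetric] .
qed

lemma sharp_ricci: "sharp (g z) (ricci g z v) = (\<chi> k. 2 * (SUM m. cnj (ric_form z v (axis m 1)) * K m k z))"
proof (rule sharp_g)
  fix w
  have "(SUM k l. H k l z * (2 * (SUM m. cnj (ric_form z v (axis m 1)) * K m k z)) * cnj (w $ l))
    = (SUM k l m. 2 * cnj (ric_form z v (axis m 1)) * cnj (w $ l) * (K m k z * H k l z))"
    by (simp only: sum_distrib_left sum_distrib_right mult_ac)
  also have "\<dots> = (SUM l m. 2 * cnj (ric_form z v (axis m 1)) * cnj (w $ l) * (SUM k. K m k z * H k l z))"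
    unfolding sum_distrib_left by (rule sum3_bca)
  also have "\<dots> = 2 * cnj (ric_form z v w)"
    unfolding K_H delta_mult_sum by (subst (2) ric_form_expand) (simp add: sum_distrib_left mult_ac)
  finally show "g z (\<chi> k. 2 * (SUM m. cnj (ric_form z v (axis m 1)) * K m k z)) w = ricci g z v w"
    by (simp add: g_eq ricci_eq)
qed

text \<open>The combination picks the antilinear part in the first slot. All terms complex linear
  there drop out, including those quadratic in the Christoffel symbols, and one dbar-derivative of
  the traced symbols survives.\<close>

lemma ric_form_J: "ric_form z (axis k 1) w + \<i> * ric_form z (J (axis k 1)) w = - 2 * pb k (%y. SUM j. christoffel g y (axis j 1) w $ j) z"
proof -
  note d = smooth_onD[OF smooth_christoffel_nth UNIV_I]
  have c: "pd l (%y. c * f y) z = c * pd l f z" if "f differentiable (at z)" for f c l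
    using pd_mult(1)[OF differentiable_const[of c] that] by (simp add: pd_const)
  show ?thesis
    unfolding pd_sum(2)[OF d] ric_form_def sum_distrib_left sum.distrib[symmetric]
    by (intro sum.cong refl) (simp add: christoffel_J J_nth c d pb_def axis_i algebra_simps)
qed

lemma christoffel_axis: "christoffel g z (axis i 1) (axis j 1) $ k = C k i j z"
proof -
  have "(SUM a b. C k a b z * axis i 1 $ a * axis j 1 $ b) = (SUM a. if a = i then C k a j z else 0)"
    by (intro sum.cong refl) (auto simp: axis_def if_distrib cong: if_cong)
  then show ?thesis by (simp add: christoffel_eq)
qed

text \<open>The trace of the Christoffel symbols is \<open>\<partial> ln det H\<close>.\<close>

definition \<tau> :: "'n => complex^'n => complex" where
  "\<tau> m z = (SUM k l. pd m (H k l) z * K l k z)"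

text \<open>With \<tau> the logarithmic derivative of the determinant this is the Kaehler formula
  through \<partial> dbar log det. The 4 is the factor 2 of \<open>sharp_ricci\<close> times the 2
  of \<open>ric_form_J\<close>.\<close>

theorem scalar_curvature_eq:
  "scalar_curvature g z = - 4 * Re (SUM m k. K m k z * pb m (\<tau> k) z)"
proof -
  have t: "(%y. SUM j. christoffel g y (axis j 1) (axis m 1) $ j) = \<tau> m" for m
    unfolding christoffel_axis \<tau>_def[abs_def] C_def by (intro ext sum.cong refl) (simp add: pd_H_commute)
  have "scalar_curvature g z = Re (SUM k. sharp (g z) (ricci g z (axis k 1)) $ k - \<i> * sharp (g z) (ricci g z (J (axis k 1))) $ k)"
    unfolding scalar_curvature_def by (rule trace_Basis)
  also have "(SUM k. sharp (g z) (ricci g z (axis k 1)) $ k - \<i> * sharp (g z) (ricci g z (J (axis k 1))) $ k)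
     = (SUM k m. 2 * K m k z * cnj (ric_form z (axis k 1) (axis m 1) + \<i> * ric_form z (J (axis k 1)) (axis m 1)))"
    unfolding sharp_ricci vec_lambda_beta sum_distrib_left sum_subtractf[symmetric]
    by (intro sum.cong refl) (simp add: algebra_simps)
  also have "\<dots> = (SUM k m. - 4 * cnj (K k m z * pb k (\<tau> m) z))"
    unfolding ric_form_J t by (intro sum.cong refl) (simp add: K_cnj)
  finally show ?thesis by (simp add: sum_negf[symmetric] sum_distrib_left)
qed

end

section \<open>The Lichnerowicz--Matsushima identity\<close>

context kahler_chart
begin

lemma pd_K:
  shows "pd i (K l m) z = - (SUM a b. K l a z * pd i (H a b) z * K b m z)"
proof -
  have 0: "(SUM b. pd i (H a b) z * K b m z + H a b z * pd i (K b m) z) = 0" for a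
  proof -
    have "pd i (%y. SUM b. H a b y * K b m y) z = 0"
      unfolding H_K by (rule pd_const)
    then show ?thesis
      by (simp add: pd_sum(1)[OF differentiable_mult[OF H_diff K_diff]] pd_mult(1)[OF H_diff K_diff])
  qed
  have "pd i (K l m) z = (SUM b. (SUM a. K l a z * H a b z) * pd i (K b m) z)"
    by (simp only: K_H delta_mult_sum)
  also have "\<dots> = (SUM a. K l a z * (SUM b. H a b z * pd i (K b m) z))"
    unfolding sum_distrib_left sum_distrib_right by (subst sum.swap) (simp add: mult.assoc)
  also have "\<dots> = (SUM a. K l a z * - (SUM b. pd i (H a b) z * K b m z))"
    using 0 by (intro sum.cong refl arg_cong2[of _ _ _ _ "(*)"]) (simp add: sum.distrib add_eq_0_iff)
  finally show ?thesis by (simp add: sum_distrib_left sum_negf mult.assoc)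
qed

lemma pd_K_trace: "(SUM i. pd i (K l i) z) = - (SUM a. K l a z * \<tau> a z)"
proof -
  have "(SUM i. pd i (K l i) z) = - (SUM i a b. K l a z * (pd i (H a b) z * K b i z))"
    unfolding pd_K by (simp add: sum_negf mult.assoc)
  also have "(SUM i a b. K l a z * (pd i (H a b) z * K b i z)) = (SUM a i b. K l a z * (pd a (H i b) z * K b i z))"
    by (subst sum.swap) (simp only: pd_H_commute[of _ _ _ z])
  finally show ?thesis by (simp add: \<tau>_def sum_distrib_left)
qed

text \<open>The Kaehler symmetry carried over to the inverse matrix. It exchanges the roles of
  \<open>j\<close> and \<open>k\<close> when the derivative of \<open>K\<close> is moved in the
  contracted Bianchi identity.\<close>

lemma K_pd_K: "(SUM l. K j l z * pd l (K k i) z) = (SUM l. K k l z * pd l (K j i) z)"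
proof -
  have "(SUM l. K j l z * pd l (K k i) z) = - (SUM l a b. K j l z * K k a z * pd l (H a b) z * K b i z)" for j k
    unfolding pd_K by (simp add: sum_distrib_left sum_negf mult.assoc)
  then show ?thesis by (simp only:) (subst sum.swap, simp only: pd_H_commute[of _ _ _ z] mult.commute[of "K j _ z"])
qed

end

text \<open>Complex dimension three, where the determinant and its cofactors are expanded
  explicitly.\<close>

locale kahler_chart3 = kahler_chart g for g :: "complex^3 => complex^3 => complex^3 => real"
begin

text \<open>The Riemannian volume density in the chart. Divergences below are those of vector
  densities, that is, of \<open>G\<close> times a vector field.\<close>

definition G :: "complex^3 => complex" where "G z = det (\<chi> k l. H k l z)"

lemma G_expand: "G = (%z. H 1 1 z * H 2 2 z * H 3 3 z + H 1 2 z * H 2 3 z * H 3 1 z + H 1 3 z * H 2 1 z * H 3 2 z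
   - H 1 1 z * H 2 3 z * H 3 2 z - H 1 2 z * H 2 1 z * H 3 3 z - H 1 3 z * H 2 2 z * H 3 1 z)"
  by (simp add: G_def det_3 fun_eq_iff)

lemma smooth_G: "smooth G"
  unfolding G_expand by (intro smooth_on_diff smooth_on_add smooth_on_mult smooth_H open_UNIV)

lemma G_diff: "G differentiable (at z)"
  by (rule smooth_onD[OF smooth_G]) simp

lemma G_nz: "G z \<noteq> 0"
  using invertible_H[of z] by (simp add: G_def invertible_det_nz)

lemma G_cnj: "cnj (G z) = G z"
  unfolding G_expand by (simp add: H_cnj algebra_simps)

lemma cofactor:
  "G z * K 1 1 z = H 2 2 z * H 3 3 z - H 2 3 z * H 3 2 z"
  "G z * K 2 1 z = H 2 3 z * H 3 1 z - H 2 1 z * H 3 3 z"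
  "G z * K 3 1 z = H 2 1 z * H 3 2 z - H 2 2 z * H 3 1 z"
  "G z * K 1 2 z = H 1 3 z * H 3 2 z - H 1 2 z * H 3 3 z"
  "G z * K 2 2 z = H 1 1 z * H 3 3 z - H 1 3 z * H 3 1 z"
  "G z * K 3 2 z = H 1 2 z * H 3 1 z - H 1 1 z * H 3 2 z"
  "G z * K 1 3 z = H 1 2 z * H 2 3 z - H 1 3 z * H 2 2 z"
  "G z * K 2 3 z = H 1 3 z * H 2 1 z - H 1 1 z * H 2 3 z"
  "G z * K 3 3 z = H 1 1 z * H 2 2 z - H 1 2 z * H 2 1 z"
proof -
  have h: "H k 1 z * K 1 m z + H k 2 z * K 2 m z + H k 3 z * K 3 m z = (if k = m then 1 else 0)" for k m
    using H_K[of k z m] by (simp add: sum_3)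
  note h1 = h[of 1 1, simplified] h[of 2 1, simplified] h[of 3 1, simplified]
  note h2 = h[of 1 2, simplified] h[of 2 2, simplified] h[of 3 2, simplified]
  note h3 = h[of 1 3, simplified] h[of 2 3, simplified] h[of 3 3, simplified]
  show "G z * K 1 1 z = H 2 2 z * H 3 3 z - H 2 3 z * H 3 2 z" unfolding G_expand using h1 by algebra
  show "G z * K 2 1 z = H 2 3 z * H 3 1 z - H 2 1 z * H 3 3 z" unfolding G_expand using h1 by algebra
  show "G z * K 3 1 z = H 2 1 z * H 3 2 z - H 2 2 z * H 3 1 z" unfolding G_expand using h1 by algebra
  show "G z * K 1 2 z = H 1 3 z * H 3 2 z - H 1 2 z * H 3 3 z" unfolding G_expand using h2 by algebra
  show "G z * K 2 2 z = H 1 1 z * H 3 3 z - H 1 3 z * H 3 1 z" unfolding G_expand using h2 by algebra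
  show "G z * K 3 2 z = H 1 2 z * H 3 1 z - H 1 1 z * H 3 2 z" unfolding G_expand using h2 by algebra
  show "G z * K 1 3 z = H 1 2 z * H 2 3 z - H 1 3 z * H 2 2 z" unfolding G_expand using h3 by algebra
  show "G z * K 2 3 z = H 1 3 z * H 2 1 z - H 1 1 z * H 2 3 z" unfolding G_expand using h3 by algebra
  show "G z * K 3 3 z = H 1 1 z * H 2 2 z - H 1 2 z * H 2 1 z" unfolding G_expand using h3 by algebra
qed

text \<open>Jacobi's formula: \<open>G * K\<close> consists of the cofactors, whose products with
  the derivatives of the entries give the derivative of the determinant.\<close>

lemma pd_G: "pd i G z = G z * \<tau> i z"
proof -
  have "G z * \<tau> i z = (SUM k l. pd i (H k l) z * (G z * K l k z))"
    unfolding \<tau>_def sum_distrib_left by (intro sum.cong refl) simp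
  also have "\<dots> = pd i G z"
    unfolding sum_3 cofactor unfolding G_expand
    by (simp add: pd_mult pd_add pd_diff H_diff differentiable_mult differentiable_add differentiable_diff)
       (simp add: algebra_simps)
  finally show ?thesis ..
qed

lemma pb_G: "pb i G z = G z * cnj (\<tau> i z)"
proof -
  have "pb i G z = pb i (%y. cnj (G y)) z" by (simp add: G_cnj)
  also have "\<dots> = cnj (pd i G z)" by (rule pd_cnj(2)[OF G_diff])
  finally show ?thesis by (simp add: pd_G G_cnj)
qed

lemma smooth_tau: "smooth (\<tau> i)"
  unfolding \<tau>_def[abs_def] by (intro smooth_on_sum smooth_on_mult smooth_on_pd smooth_H smooth_K open_UNIV)

lemma tau_diff: "\<tau> i differentiable (at z)"
  by (rule smooth_onD[OF smooth_tau]) simp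

text \<open>\<tau> is \<partial> log det, but the symmetry is read off from the second derivatives
  of \<open>G\<close> itself, so that no logarithm occurs.\<close>

lemma pd_tau_commute: "pd i (\<tau> j) z = pd j (\<tau> i) z"
proof -
  have e: "pd j G = (%z. G z * \<tau> j z)" for j by (simp add: pd_G fun_eq_iff)
  have "pd i (%y. pd j G y) z = pd j (%y. pd i G y) z" by (rule pd_commute(1)[OF open_UNIV UNIV_I smooth_G])
  then show ?thesis unfolding e by (simp add: pd_mult[OF G_diff tau_diff] pd_G G_nz)
qed

text \<open>The matrix of \<partial>_i dbar_j log det, a negative multiple of the Ricci
  form.\<close>

definition \<rho> :: "3 => 3 => complex^3 => complex" where "\<rho> i j z = pb j (\<tau> i) z"

lemma smooth_rho: "smooth (\<rho> i j)"
  unfolding \<rho>_def[abs_def] by (intro smooth_on_pb smooth_tau open_UNIV)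

lemma rho_diff: "\<rho> i j differentiable (at z)"
  by (rule smooth_onD[OF smooth_rho]) simp

lemma rho_cnj: "cnj (\<rho> i j z) = \<rho> j i z"
proof -
  have e: "pd j G = (%z. G z * \<tau> j z)" "pb j G = (%z. G z * cnj (\<tau> j z))" for j by (simp_all add: pd_G pb_G fun_eq_iff)
  have c: "(%y. cnj (\<tau> i y)) differentiable (at z)" for i
    by (rule smooth_onD[OF smooth_on_linears(1)[OF _ smooth_tau]]) simp_all
  have "pb i (%y. pd j G y) z = pd j (%y. pb i G y) z" by (rule pd_commute(3)[OF open_UNIV UNIV_I smooth_G])
  then show ?thesis unfolding e
    by (simp add: pd_mult[OF G_diff tau_diff] pd_mult[OF G_diff c] pd_cnj[OF tau_diff] pd_G pb_G G_nz \<rho>_def)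
qed

lemma pd_rho_commute: "pd l (\<rho> i j) z = pd i (\<rho> l j) z"
proof -
  have "pd l (\<rho> i j) z = pb j (%y. pd l (\<tau> i) y) z" for l i
    unfolding \<rho>_def[abs_def] by (rule pd_commute(3)[OF open_UNIV UNIV_I smooth_tau, symmetric])
  then show ?thesis by (simp add: pd_tau_commute)
qed

lemma GK_diff: "(%y. G y * K l i y) differentiable (at z)"
  by (rule differentiable_mult[OF G_diff K_diff])

text \<open>The Kaehler condition in divergence form: the derivative of \<open>G\<close> compensates
  the trace of the derivative of \<open>K\<close>. It leaves no first-order terms in the divergence
  of a gradient.\<close>

lemma div_GK: "(SUM i. pd i (%y. G y * K l i y) z) = 0"
proof -
  have "(SUM i. pd i (%y. G y * K l i y) z) = (SUM i. G z * (K l i z * \<tau> i z)) + G z * (SUM i. pd i (K l i) z)"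
    by (simp add: pd_mult[OF G_diff K_diff] pd_G sum.distrib sum_distrib_left mult_ac)
  then show ?thesis by (simp add: pd_K_trace sum_distrib_left)
qed

text \<open>The (1,0) gradient: the field W whose contraction with the Hermitian matrix is the
  dbar-derivative of \<open>u\<close>.\<close>

definition grad :: "(complex^3 => complex) => 3 => complex^3 => complex" where
  "grad u i z = (SUM l. pb l u z * K l i z)"

definition lap :: "(complex^3 => complex) => complex^3 => complex" where
  "lap u z = (SUM i l. K l i z * pd i (pb l u) z)"

context
  fixes u :: "complex^3 => complex"
  assumes u: "smooth u"
begin

lemma smooth_grad: "smooth (grad u i)"
  unfolding grad_def[abs_def] by (intro smooth_on_sum smooth_on_mult smooth_on_pb smooth_K u open_UNIV)

lemma smooth_lap: "smooth (lap u)"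
  unfolding lap_def[abs_def] by (intro smooth_on_sum smooth_on_mult smooth_on_pd smooth_on_pb smooth_K u open_UNIV)

lemma pb_u_diff: "pb l u differentiable (at z)"
  by (rule smooth_onD[OF smooth_on_pb[OF _ u]]) simp_all

lemma grad_diff: "grad u i differentiable (at z)"
  by (rule smooth_onD[OF smooth_grad]) simp

lemma div_grad: "(SUM i. pd i (%y. G y * grad u i y) z) = G z * lap u z"
proof -
  have e: "(%y. G y * grad u i y) = (%y. SUM l. pb l u y * (G y * K l i y))" for i
    by (simp add: grad_def sum_distrib_left mult_ac)
  have "pd i (%y. G y * grad u i y) z = (SUM l. pd i (pb l u) z * (G z * K l i z) + pb l u z * pd i (%y. G y * K l i y) z)" for i
    unfolding e
    by (simp add: pd_sum[OF differentiable_mult[OF pb_u_diff GK_diff]] pd_mult[OF pb_u_diff GK_diff])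
  then have "(SUM i. pd i (%y. G y * grad u i y) z) =
     (SUM i l. pd i (pb l u) z * (G z * K l i z)) + (SUM i l. pb l u z * pd i (%y. G y * K l i y) z)"
    by (simp add: sum.distrib)
  also have "(SUM i l. pb l u z * pd i (%y. G y * K l i y) z) = (SUM l. pb l u z * (SUM i. pd i (%y. G y * K l i y) z))"
    unfolding sum_distrib_left by (rule sum.swap)
  finally show ?thesis by (simp add: div_GK lap_def sum_distrib_left mult_ac)
qed

lemma lap_eq: "lap u z = (SUM i. pd i (grad u i) z + grad u i z * \<tau> i z)"
proof -
  have "G z * lap u z = G z * (SUM i. pd i (grad u i) z + grad u i z * \<tau> i z)"
    unfolding div_grad[symmetric] sum_distrib_left
    by (intro sum.cong refl) (simp add: pd_mult[OF G_diff grad_diff] pd_G algebra_simps)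
  then show ?thesis using G_nz by simp
qed

text \<open>A Bochner formula: the Laplacian is the divergence of the gradient, and differentiating
  the factor \<tau> in that divergence produces the curvature term.\<close>

lemma pb_lap: "pb j (lap u) z = (SUM i. pd i (pb j (grad u i)) z + pb j (grad u i) z * \<tau> i z + grad u i z * \<rho> i j z)"
proof -
  have e: "lap u = (%z. SUM i. pd i (grad u i) z + grad u i z * \<tau> i z)" using lap_eq by blast
  have d: "(%z. pd i (grad u i) z) differentiable (at z)" for i
    by (rule smooth_onD[OF smooth_on_pd[OF _ smooth_grad]]) simp_all
  have d': "(%z. grad u i z * \<tau> i z) differentiable (at z)" for i by (rule differentiable_mult[OF grad_diff tau_diff])
  show ?thesis unfolding e pd_sum(2)[OF differentiable_add[OF d d']]
    by (intro sum.cong refl)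
      (simp add: pd_add(2)[OF d d'] pd_mult[OF grad_diff tau_diff] \<rho>_def pd_commute(3)[OF open_UNIV UNIV_I smooth_grad])
qed

lemma grad_cnj: "cnj (grad u j z) = (SUM l. pd l (%y. cnj (u y)) z * K j l z)"
  unfolding grad_def by (simp add: K_cnj pd_cnj(1)[OF smooth_onD[OF u]])

lemma lap_cnj: "lap (%y. cnj (u y)) z = cnj (lap u z)"
proof -
  have c: "pb l (%y. cnj (u y)) = (%y. cnj (pd l u y))" for l
    using pd_cnj(2)[OF smooth_onD[OF u]] by auto
  have d: "pd l u differentiable (at z)" for l
    by (rule smooth_onD[OF smooth_on_pd[OF _ u]]) simp_all
  have "lap (%y. cnj (u y)) z = (SUM i l. cnj (K i l z * pd l (pb i u) z))"
    unfolding lap_def c pd_cnj(1)[OF d] by (simp add: K_cnj pd_commute(3)[OF open_UNIV UNIV_I u])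
  also have "\<dots> = cnj (lap u z)" unfolding lap_def cnj_sum by (rule sum.swap)
  finally show ?thesis .
qed

lemma div_grad_cnj: "(SUM j. pb j (%y. G y * cnj (grad u j y)) z) = G z * cnj (lap u z)"
proof -
  have "pb j (%y. G y * cnj (grad u j y)) z = cnj (pd j (%y. G y * grad u j y) z)" for j
    using pd_cnj(2)[OF differentiable_mult[OF G_diff grad_diff], of j j z] by (simp add: G_cnj)
  then have "(SUM j. pb j (%y. G y * cnj (grad u j y)) z) = cnj (SUM j. pd j (%y. G y * grad u j y) z)" by simp
  then show ?thesis unfolding div_grad by (simp add: G_cnj)
qed

end

text \<open>The matrix \<rho> with both indices raised by \<open>K\<close>.\<close>

definition R :: "3 => 3 => complex^3 => complex" where
  "R l k z = (SUM j i. K j l z * \<rho> i j z * K k i z)"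

lemma smooth_R: "smooth (R l k)"
  unfolding R_def[abs_def] by (intro smooth_on_sum smooth_on_mult smooth_rho smooth_K open_UNIV)

lemma R_diff: "R l k differentiable (at z)"
  by (rule smooth_onD[OF smooth_R]) simp

lemma R_cnj: "cnj (R l k z) = R k l z"
  unfolding R_def by (simp add: K_cnj rho_cnj) (subst sum.swap, simp add: mult_ac)

lemma GR_diff: "(%y. G y * R l k y) differentiable (at z)"
  by (rule differentiable_mult[OF G_diff R_diff])

context
  fixes s :: complex
  assumes const: "\<And>z. (SUM m k. K m k z * \<rho> k m z) = s"
begin

text \<open>The contracted second Bianchi identity for constant scalar curvature.\<close>

lemma div_R: "(SUM l. pd l (%y. G y * R l k y) z) = 0"
proof -
  define N where "N j z = (SUM i. \<rho> i j z * K k i z)" for j z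
  have N: "smooth (N j)" for j
    unfolding N_def[abs_def] by (intro smooth_on_sum smooth_on_mult smooth_rho smooth_K open_UNIV)
  have dN: "N j differentiable (at z)" for j by (rule smooth_onD[OF N]) simp
  have e: "(%y. G y * R l k y) = (%y. SUM j. (G y * K j l y) * N j y)" for l
    by (simp add: R_def N_def sum_distrib_left mult_ac)
  have pN: "pd l (N j) z = (SUM i. pd l (\<rho> i j) z * K k i z + \<rho> i j z * pd l (K k i) z)" for l j
    unfolding N_def[abs_def] pd_sum(1)[OF differentiable_mult[OF rho_diff K_diff]]
    by (simp add: pd_mult[OF rho_diff K_diff])
  have "(SUM l. pd l (%y. G y * R l k y) z)
     = (SUM l j. pd l (%y. G y * K j l y) z * N j z) + (SUM l j. (G z * K j l z) * pd l (N j) z)"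
    unfolding e pd_sum(1)[OF differentiable_mult[OF GK_diff dN]]
    by (simp add: pd_mult(1)[OF GK_diff dN] sum.distrib)
  also have "(SUM l j. pd l (%y. G y * K j l y) z * N j z) = (SUM j. (SUM l. pd l (%y. G y * K j l y) z) * N j z)"
    unfolding sum_distrib_right by (rule sum.swap)
  also have "\<dots> = 0" by (simp add: div_GK)
  also have "(SUM l j. (G z * K j l z) * pd l (N j) z)
     = G z * ((SUM l j i. K j l z * (pd l (\<rho> i j) z * K k i z)) + (SUM l j i. K j l z * (\<rho> i j z * pd l (K k i) z)))"
    unfolding pN by (simp add: sum_distrib_left sum.distrib distrib_left mult_ac)
  also have "(SUM l j i. K j l z * (pd l (\<rho> i j) z * K k i z)) = (SUM i. K k i z * (SUM l j. K j l z * pd i (\<rho> l j) z))"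
    unfolding sum_distrib_left by (subst sum3_bca[symmetric]) (simp add: pd_rho_commute[of _ _ _ z] mult_ac)
  also have "(SUM l j i. K j l z * (\<rho> i j z * pd l (K k i) z)) = (SUM j i. \<rho> i j z * (SUM l. K j l z * pd l (K k i) z))"
    unfolding sum_distrib_left by (subst sum3_bca) (simp add: mult_ac)
  also have "\<dots> = (SUM j i l. \<rho> i j z * (K k l z * pd l (K j i) z))"
    unfolding K_pd_K[of _ z k] sum_distrib_left ..
  also have "\<dots> = (SUM l. K k l z * (SUM i j. pd l (K j i) z * \<rho> i j z))"
    unfolding sum_distrib_left by (subst sum3_bca[symmetric], subst (2) sum.swap) (simp add: mult_ac)
  \<comment> \<open>The two sums are the product rule for the trace of \<rho>, which is the constant
    \<open>s\<close>.\<close>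
  also have "(SUM i. K k i z * (SUM l j. K j l z * pd i (\<rho> l j) z)) + (SUM l. K k l z * (SUM i j. pd l (K j i) z * \<rho> i j z))
     = (SUM i. K k i z * pd i (%y. SUM l j. K j l y * \<rho> l j y) z)"
  proof -
    have d: "(%y. K j l y * \<rho> l j y) differentiable (at z)" for j l by (rule differentiable_mult[OF K_diff rho_diff])
    have d2: "(%y. SUM j. K j l y * \<rho> l j y) differentiable (at z)" for l
      by (rule differentiable_sum) (simp_all add: d)
    show ?thesis unfolding pd_sum(1)[OF d2] pd_sum(1)[OF d] pd_mult(1)[OF K_diff rho_diff]
      by (simp add: sum.distrib distrib_left add.commute)
  qed
  also have "(%y. SUM l j. K j l y * \<rho> l j y) = (%y. s)" using const by (subst sum.swap) auto
  finally show ?thesis by (simp add: pd_const)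
qed

lemma div_R': "(SUM k. pb k (%y. G y * R l k y) z) = 0"
proof -
  have "pb k (%y. G y * R l k y) z = cnj (pd k (%y. G y * R k l y) z)" for k
    using pd_cnj(2)[OF GR_diff, of k k l z] by (simp add: G_cnj R_cnj)
  then show ?thesis using div_R[of l z] by (simp add: cnj_sum[symmetric])
qed

end

end

section \<open>The squared norm of dbar of the gradient as a divergence\<close>

context kahler_chart3
begin

text \<open>Integration by parts kept as pointwise densities: \<open>P\<close> holds what is
  differentiated by \<open>pd\<close>, \<open>Q\<close> what is differentiated by \<open>pb\<close>.
  The parts with \<open>R\<close> rewrite the Ricci term of f as that of its conjugate, which is
  possible because \<open>R\<close> is divergence free.\<close>

definition P :: "(complex^3 => complex) => 3 => complex^3 => complex" where
  "P f i y = (SUM j. (G y * pb j (grad (%y. cnj (f y)) i) y) * cnj (grad (%y. cnj (f y)) j y))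
     - (SUM k. (G y * R i k y) * (cnj (f y) * pb k f y))"

definition Q :: "(complex^3 => complex) => 3 => complex^3 => complex" where
  "Q f j y = (G y * cnj (grad f j y)) * lap f y - (G y * cnj (grad (%y. cnj (f y)) j y)) * lap (%y. cnj (f y)) y
     + (SUM l. (G y * R l j y) * (cnj (f y) * pd l f y))"

context
  fixes s :: complex and f u :: "complex^3 => complex"
  assumes const: "\<And>z. (SUM m k. K m k z * \<rho> k m z) = s" and f: "smooth f" and holo: "\<And>i j z. pb j (grad f i) z = 0"
  defines "u \<equiv> %y. cnj (f y)"
begin

lemma P_u: "P f i = (%y. (SUM j. (G y * pb j (grad u i) y) * cnj (grad u j y)) - (SUM k. (G y * R i k y) * (u y * pb k f y)))"
  and Q_u: "Q f j = (%y. (G y * cnj (grad f j y)) * lap f y - (G y * cnj (grad u j y)) * lap u y + (SUM l. (G y * R l j y) * (u y * pd l f y)))"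
  by (simp_all add: P_def Q_def u_def fun_eq_iff)

lemma smooth_u: "smooth u"
  unfolding u_def by (rule smooth_on_linears(1)[OF open_UNIV f])

lemma smooth_P: "smooth (P f i)" and smooth_Q: "smooth (Q f i)"
  unfolding P_u Q_u
  by (intro smooth_on_sum smooth_on_add smooth_on_diff smooth_on_mult smooth_on_pb smooth_on_pd smooth_on_linears(1) smooth_G smooth_R
       smooth_grad smooth_lap smooth_u f open_UNIV)+

text \<open>Let V and W be the gradients of \<open>f\<close> and of \<open>u = cnj f\<close>. The
  Bochner formula yields the norm minus \<rho>(W, W) for \<open>u\<close>, and plus \<rho>(V, V) for
  \<open>f\<close>; the squares of the Laplacians cancel since they are conjugate. The terms with
  \<open>R\<close> contribute \<rho>(W, W) - \<rho>(V, V), their second derivatives of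
  \<open>f\<close> cancelling each other.\<close>

lemma div_P_Q: "(SUM i. pd i (P f i) z) + (SUM j. pb j (Q f j) z) =
   G z * (SUM i j. pb j (grad u i) z * cnj (pb i (grad u j) z))"
proof -
  note su = smooth_u
  have dW: "(%y. cnj (grad u j y)) differentiable (at z)" "(%y. cnj (grad f j y)) differentiable (at z)" for j
    by (rule smooth_onD[OF smooth_on_linears(1)[OF _ smooth_grad]]; simp add: su f)+
  have sA: "smooth (pb j (grad u i))" for i j by (rule smooth_on_pb[OF open_UNIV smooth_grad[OF su]])
  have dA: "pb j (grad u i) differentiable (at z)" for i j by (rule smooth_onD[OF sA]) simp
  have dlap: "lap u differentiable (at z)" "lap f differentiable (at z)"
    by (rule smooth_onD[OF smooth_lap]; simp add: su f)+
  have df: "f differentiable (at z)" "u differentiable (at z)" "pb k f differentiable (at z)" "pd k f differentiable (at z)" for k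
    by (rule smooth_onD[of UNIV]; simp add: su f smooth_on_pb smooth_on_pd)+
  note GA = differentiable_mult[OF G_diff dA] and GW = differentiable_mult[OF G_diff dW(1)] and GV = differentiable_mult[OF G_diff dW(2)]
  have pdWc: "pd i (%y. cnj (grad u j y)) z = cnj (pb i (grad u j) z)" for i j
    by (rule pd_cnj(1)[OF grad_diff[OF su]])
  have lap_u: "lap u y = cnj (lap f y)" for y unfolding u_def by (rule lap_cnj[OF f])
  have T1: "(SUM i. pd i (%y. SUM j. (G y * pb j (grad u i) y) * cnj (grad u j y)) z)
     = G z * (SUM j. (pb j (lap u) z - (SUM i. grad u i z * \<rho> i j z)) * cnj (grad u j z))
       + G z * (SUM i j. pb j (grad u i) z * cnj (pb i (grad u j) z))"
  proof -
    have "(SUM i. pd i (%y. SUM j. (G y * pb j (grad u i) y) * cnj (grad u j y)) z)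
      = (SUM i j. pd i (%y. G y * pb j (grad u i) y) z * cnj (grad u j z)) + (SUM i j. G z * (pb j (grad u i) z * cnj (pb i (grad u j) z)))"
      unfolding pd_sum(1)[OF differentiable_mult[OF GA dW(1)]] pd_mult(1)[OF GA dW(1)] pdWc sum.distrib
      by (simp only: mult.assoc)
    also have "(SUM i j. pd i (%y. G y * pb j (grad u i) y) z * cnj (grad u j z)) =
      (SUM j. (SUM i. pd i (%y. G y * pb j (grad u i) y) z) * cnj (grad u j z))"
      unfolding sum_distrib_right by (rule sum.swap)
    also have "(SUM j. (SUM i. pd i (%y. G y * pb j (grad u i) y) z) * cnj (grad u j z)) =
      G z * (SUM j. (pb j (lap u) z - (SUM i. grad u i z * \<rho> i j z)) * cnj (grad u j z))"
    proof -
      have "(SUM i. pd i (%y. G y * pb j (grad u i) y) z) = G z * (pb j (lap u) z - (SUM i. grad u i z * \<rho> i j z))" for j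
        unfolding pb_lap[OF su] pd_mult(1)[OF G_diff dA] pd_G
        by (simp add: sum.distrib sum_distrib_left distrib_left right_diff_distrib mult_ac)
      then show ?thesis by (simp only: sum_distrib_left mult.assoc)
    qed
    finally show ?thesis by (simp only: sum_distrib_left)
  qed
  have T2: "(SUM j. pb j (%y. (G y * cnj (grad u j y)) * lap u y) z) = G z * (SUM j. pb j (lap u) z * cnj (grad u j z)) + G z * cnj (lap u z) * lap u z"
  proof -
    have "(SUM j. pb j (%y. (G y * cnj (grad u j y)) * lap u y) z) = (SUM j. pb j (%y. G y * cnj (grad u j y)) z) * lap u z + G z * (SUM j. pb j (lap u) z * cnj (grad u j z))"
      unfolding pd_mult(2)[OF GW dlap(1)] sum.distrib sum_distrib_right sum_distrib_left by (simp only: mult_ac)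
    then show ?thesis unfolding div_grad_cnj[OF su] by simp
  qed
  have T3: "(SUM j. pb j (%y. (G y * cnj (grad f j y)) * lap f y) z) = G z * (SUM j i. grad f i z * \<rho> i j z * cnj (grad f j z)) + G z * cnj (lap f z) * lap f z"
  proof -
    have "(SUM j. pb j (%y. (G y * cnj (grad f j y)) * lap f y) z) = (SUM j. pb j (%y. G y * cnj (grad f j y)) z) * lap f z + G z * (SUM j. pb j (lap f) z * cnj (grad f j z))"
      unfolding pd_mult(2)[OF GV dlap(2)] sum.distrib sum_distrib_right sum_distrib_left by (simp only: mult_ac)
    \<comment> \<open>Here the holomorphy of the gradient of \<open>f\<close> enters: of the Bochner
      formula only the curvature term is left.\<close>
    moreover have "pb j (lap f) z = (SUM i. grad f i z * \<rho> i j z)" for j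
    proof -
      have z: "pb j (grad f i) = (%_. 0)" for i j using holo by auto
      show ?thesis unfolding pb_lap[OF f] z by (simp add: pd_const)
    qed
    ultimately show ?thesis unfolding div_grad_cnj[OF f] by (simp add: sum_distrib_right)
  qed
  \<comment> \<open>\<open>R\<close> applied to differentials equals \<rho> applied to gradients,
    since raising the indices of \<rho> or of the differentials gives the same sum.\<close>
  have RR: "(SUM l k. R l k z * pb k p z * pd l (%y. cnj (r y)) z) = (SUM j i. grad p i z * \<rho> i j z * cnj (grad r j z))"
    if "smooth r" for p r
  proof -
    have "(SUM l k. R l k z * pb k p z * pd l (%y. cnj (r y)) z)
       = (SUM l k j i. (pb k p z * K k i z) * \<rho> i j z * (pd l (%y. cnj (r y)) z * K j l z))"
      unfolding R_def sum_distrib_right by (intro sum.cong refl) simp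
    also have "\<dots> = (SUM k j i l. (pb k p z * K k i z) * \<rho> i j z * (pd l (%y. cnj (r y)) z * K j l z))"
      by (rule sum4_bcda)
    also have "\<dots> = (SUM j i k l. (pb k p z * K k i z) * \<rho> i j z * (pd l (%y. cnj (r y)) z * K j l z))"
      by (rule sum3_bca)
    also have "\<dots> = (SUM j i. grad p i z * \<rho> i j z * cnj (grad r j z))"
      unfolding grad_cnj[OF that] grad_def[of p]
      by (intro sum.cong refl) (simp only: sum_distrib_left[symmetric] sum_distrib_right[symmetric])
    finally show ?thesis .
  qed
  have T4: "(SUM l. pd l (%y. SUM k. (G y * R l k y) * (u y * pb k f y)) z)
     = G z * (SUM l k. R l k z * pb k f z * pd l u z) + G z * (SUM l k. R l k z * (u z * pd l (pb k f) z))"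
  proof -
    note d = differentiable_mult[OF df(2,3)]
    have "(SUM l. pd l (%y. SUM k. (G y * R l k y) * (u y * pb k f y)) z)
      = (SUM l k. pd l (%y. G y * R l k y) z * (u z * pb k f z)) + G z * (SUM l k. R l k z * pb k f z * pd l u z) + G z * (SUM l k. R l k z * (u z * pd l (pb k f) z))"
      unfolding pd_sum(1)[OF differentiable_mult[OF GR_diff d]]
      unfolding pd_mult(1)[OF GR_diff d] pd_mult(1)[OF df(2,3)] sum.distrib sum_distrib_left distrib_left by (simp only: mult_ac add.assoc)
    also have "(SUM l k. pd l (%y. G y * R l k y) z * (u z * pb k f z)) = (SUM k. (SUM l. pd l (%y. G y * R l k y) z) * (u z * pb k f z))"
      unfolding sum_distrib_right by (rule sum.swap)
    finally show ?thesis by (simp add: div_R[OF const])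
  qed
  have T5: "(SUM k. pb k (%y. SUM l. (G y * R l k y) * (u y * pd l f y)) z)
     = G z * (SUM l k. R l k z * pb k u z * pd l f z) + G z * (SUM l k. R l k z * (u z * pd l (pb k f) z))"
  proof -
    note d = differentiable_mult[OF df(2,4)]
    have "(SUM k. pb k (%y. SUM l. (G y * R l k y) * (u y * pd l f y)) z)
      = (SUM k l. pb k (%y. G y * R l k y) z * (u z * pd l f z)) + (SUM k l. G z * (R l k z * pb k u z * pd l f z)) + (SUM k l. G z * (R l k z * (u z * pd l (pb k f) z)))"
      unfolding pd_sum(2)[OF differentiable_mult[OF GR_diff d]]
      unfolding pd_mult(2)[OF GR_diff d] pd_mult(2)[OF df(2,4)] pd_commute(3)[OF open_UNIV UNIV_I f] sum.distrib distrib_left by (simp only: mult_ac add.assoc)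
    also have "(SUM k l. pb k (%y. G y * R l k y) z * (u z * pd l f z)) = (SUM l. (SUM k. pb k (%y. G y * R l k y) z) * (u z * pd l f z))"
      unfolding sum_distrib_right by (rule sum.swap)
    also have "\<dots> = 0" by (simp add: div_R'[OF const])
    also have "(SUM k l. G z * (R l k z * pb k u z * pd l f z)) = G z * (SUM l k. R l k z * pb k u z * pd l f z)"
      unfolding sum_distrib_left by (rule sum.swap)
    also have "(SUM k l. G z * (R l k z * (u z * pd l (pb k f) z))) = G z * (SUM l k. R l k z * (u z * pd l (pb k f) z))"
      unfolding sum_distrib_left by (rule sum.swap)
    finally show ?thesis by simp
  qed
  have RR1: "(SUM l k. R l k z * pb k f z * pd l u z) = (SUM j i. grad f i z * \<rho> i j z * cnj (grad f j z))"
    using RR[OF f, of f] unfolding u_def .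
  have RR2: "(SUM l k. R l k z * pb k u z * pd l f z) = (SUM j i. grad u i z * \<rho> i j z * cnj (grad u j z))"
    using RR[OF su, of u] by (simp add: u_def)
  have dP: "(%y. SUM j. (G y * pb j (grad u i) y) * cnj (grad u j y)) differentiable (at z)" for i
    by (rule differentiable_sum) (simp_all add: differentiable_mult[OF GA dW(1)])
  have dP': "(%y. SUM k. (G y * R i k y) * (u y * pb k f y)) differentiable (at z)" for i
    by (rule differentiable_sum) (simp_all add: differentiable_mult[OF GR_diff differentiable_mult[OF df(2,3)]])
  have dQ: "(%y. SUM l. (G y * R l j y) * (u y * pd l f y)) differentiable (at z)" for j
    by (rule differentiable_sum) (simp_all add: differentiable_mult[OF GR_diff differentiable_mult[OF df(2,4)]])
  note dQ' = differentiable_mult[OF GV dlap(2)] differentiable_mult[OF GW dlap(1)]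
  have "(SUM i. pd i (P f i) z) = (SUM i. pd i (%y. SUM j. (G y * pb j (grad u i) y) * cnj (grad u j y)) z)
     - (SUM l. pd l (%y. SUM k. (G y * R l k y) * (u y * pb k f y)) z)"
    unfolding P_u pd_diff(1)[OF dP dP'] sum_subtractf ..
  moreover have "(SUM j. pb j (Q f j) z) = (SUM j. pb j (%y. (G y * cnj (grad f j y)) * lap f y) z)
     - (SUM j. pb j (%y. (G y * cnj (grad u j y)) * lap u y) z)
     + (SUM k. pb k (%y. SUM l. (G y * R l k y) * (u y * pd l f y)) z)"
    unfolding Q_u pd_add(2)[OF differentiable_diff[OF dQ'] dQ] pd_diff(2)[OF dQ'] sum_subtractf sum.distrib ..
  ultimately show ?thesis
    unfolding T1 T2 T3 T4 T5 RR1 RR2 left_diff_distrib sum_subtractf sum_distrib_right right_diff_distrib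
    by (simp add: lap_u[of z])
qed

end

end

section \<open>Positivity\<close>

text \<open>Removing the rank-one part that belongs to the index \<open>a\<close> leaves the Schur
  complement \<open>S\<close>, which is Hermitian and positive on the remaining indices. The index
  set is a finite set \<open>I\<close> so that an index can be deleted.\<close>

lemma cholesky:
  fixes M :: "'n => 'n => complex"
  assumes "finite I" "\<And>k l. cnj (M k l) = M l k"
    and "\<And>u. (\<exists>k\<in>I. u k \<noteq> 0) ==> Re (\<Sum>k\<in>I. \<Sum>l\<in>I. M k l * u k * cnj (u l)) > 0"
  shows "\<exists>P. \<forall>k\<in>I. \<forall>l\<in>I. M k l = (\<Sum>r\<in>I. P r k * cnj (P r l))"
  using assms
proof (induction I arbitrary: M)
  case empty
  show ?case by simp
next
  case (insert a I)
  note herm = insert.prems(1) and pos = insert.prems(2)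
  define m where "m = Re (M a a)"
  have Maa: "M a a = of_real m" using herm[of a a] by (simp add: m_def complex_eq_iff)
  have form: "(\<Sum>k\<in>insert a I. \<Sum>l\<in>insert a I. M k l * u k * cnj (u l)) =
     M a a * u a * cnj (u a) + u a * (\<Sum>l\<in>I. M a l * cnj (u l)) + cnj (u a) * (\<Sum>k\<in>I. M k a * u k) + (\<Sum>k\<in>I. \<Sum>l\<in>I. M k l * u k * cnj (u l))" for u
    using insert.hyps by (simp add: sum.distrib sum_distrib_left mult_ac)
  have m: "m > 0"
  proof -
    define u :: "'n => complex" where "u k = (if k = a then 1 else 0)" for k
    have u: "u a = 1" "\<And>k. k \<in> I ==> u k = 0" using insert.hyps by (auto simp: u_def)
    have "Re (\<Sum>k\<in>insert a I. \<Sum>l\<in>insert a I. M k l * u k * cnj (u l)) > 0"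
      by (rule pos) (simp add: u)
    also have "(\<Sum>k\<in>insert a I. \<Sum>l\<in>insert a I. M k l * u k * cnj (u l)) = M a a"
      unfolding form by (simp add: u)
    finally show ?thesis by (simp add: m_def)
  qed
  define S where "S k l = M k l - M k a * M a l / of_real m" for k l
  have "\<exists>P. \<forall>k\<in>I. \<forall>l\<in>I. S k l = (\<Sum>r\<in>I. P r k * cnj (P r l))"
  proof (rule insert.IH)
    fix k l show "cnj (S k l) = S l k" by (simp add: S_def herm)
  next
    fix u :: "'n => complex" assume u: "\<exists>k\<in>I. u k \<noteq> 0"
    define X where "X = (\<Sum>k\<in>I. M k a * u k)"
    \<comment> \<open>For fixed remaining coordinates this entry at \<open>a\<close> minimises the
      form of \<open>M\<close>, and the minimum is the form of \<open>S\<close> at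
      \<open>u\<close>.\<close>
    define u' where "u' = u(a := - X / of_real m)"
    have X': "(\<Sum>l\<in>I. M a l * cnj (u l)) = cnj X" by (simp add: X_def herm)
    have "(\<Sum>k\<in>I. \<Sum>l\<in>I. S k l * u k * cnj (u l)) = (\<Sum>k\<in>I. \<Sum>l\<in>I. M k l * u k * cnj (u l)) - (\<Sum>k\<in>I. \<Sum>l\<in>I. (M k a * u k) * (M a l * cnj (u l))) / of_real m"
      unfolding S_def sum_divide_distrib sum_subtractf[symmetric] by (intro sum.cong refl) (simp add: field_simps)
    also have "(\<Sum>k\<in>I. \<Sum>l\<in>I. (M k a * u k) * (M a l * cnj (u l))) = X * cnj X"
      unfolding X_def[symmetric] X'[symmetric] sum_product[symmetric] by (simp add: X_def)
    finally have S: "(\<Sum>k\<in>I. \<Sum>l\<in>I. S k l * u k * cnj (u l)) = (\<Sum>k\<in>I. \<Sum>l\<in>I. M k l * u k * cnj (u l)) - X * cnj X / of_real m" .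
    have u'I: "k \<in> I ==> u' k = u k" for k using insert.hyps by (auto simp: u'_def)
    have "Re (\<Sum>k\<in>insert a I. \<Sum>l\<in>insert a I. M k l * u' k * cnj (u' l)) > 0"
      using u u'I by (intro pos) auto
    also have "(\<Sum>k\<in>insert a I. \<Sum>l\<in>insert a I. M k l * u' k * cnj (u' l)) =
      M a a * u' a * cnj (u' a) + u' a * (\<Sum>l\<in>I. M a l * cnj (u l)) + cnj (u' a) * (\<Sum>k\<in>I. M k a * u k) + (\<Sum>k\<in>I. \<Sum>l\<in>I. M k l * u k * cnj (u l))"
      unfolding form by (simp add: u'I)
    also have "\<dots> = (\<Sum>k\<in>I. \<Sum>l\<in>I. S k l * u k * cnj (u l))"
      unfolding S X' X_def[symmetric] Maa u'_def using m by (simp add: field_simps)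
    finally show "Re (\<Sum>k\<in>I. \<Sum>l\<in>I. S k l * u k * cnj (u l)) > 0" .
  qed
  then obtain P where P: "\<And>k l. k \<in> I ==> l \<in> I ==> S k l = (\<Sum>r\<in>I. P r k * cnj (P r l))" by blast
  \<comment> \<open>The row at \<open>a\<close> carries the rank-one part; the other rows are those
    for \<open>S\<close>, extended by 0 in the column at \<open>a\<close>.\<close>
  define P' where "P' r k = (if r = a then M k a / of_real (sqrt m) else if k = a then 0 else P r k)" for r k
  have sq: "complex_of_real (sqrt m) * of_real (sqrt m) = of_real m" using m by (simp flip: of_real_mult)
  have "M k l = (\<Sum>r\<in>insert a I. P' r k * cnj (P' r l))" if k: "k \<in> insert a I" "l \<in> insert a I" for k l
  proof -
    have I: "(\<Sum>r\<in>I. P' r k * cnj (P' r l)) = (if k = a \<or> l = a then 0 else \<Sum>r\<in>I. P r k * cnj (P r l))"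
      using insert.hyps by (auto simp: P'_def intro!: sum.cong sum.neutral)
    have A: "P' a k * cnj (P' a l) = M k a * M a l / of_real m"
      by (simp add: P'_def herm sq)
    have "(\<Sum>r\<in>insert a I. P' r k * cnj (P' r l)) = M k a * M a l / of_real m + (if k = a \<or> l = a then 0 else \<Sum>r\<in>I. P r k * cnj (P r l))"
      using insert.hyps A I by simp
    also have "\<dots> = M k l"
    proof (cases "k = a \<or> l = a")
      case True then show ?thesis using m Maa by auto
    next
      case False
      with k P[of k l] have "S k l = (\<Sum>r\<in>I. P r k * cnj (P r l))" by auto
      then show ?thesis using False by (simp add: S_def algebra_simps)
    qed
    finally show ?thesis ..
  qed
  then show ?case by blast
qed

definition cm :: "complex^'m^'n => complex^'m^'n" where "cm A = (\<chi> i j. cnj (A $ i $ j))"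

lemma cm_nth: "cm A $ i $ j = cnj (A $ i $ j)" by (simp add: cm_def)
lemma cm_mult: "cm (A ** B) = cm A ** cm B" by (simp add: cm_def matrix_matrix_mult_def vec_eq_iff)
lemma cm_mat_1: "cm (mat 1) = mat 1" by (simp add: cm_def mat_def vec_eq_iff)
lemma cm_cm: "cm (cm A) = A" by (simp add: cm_def vec_eq_iff)

lemma det_cm: "det (cm A) = cnj (det A)" for A :: "complex^'n::finite^'n"
  unfolding det_def cm_nth by simp

text \<open>If \<open>H = P\<^sup>T cnj P\<close> and \<open>H\<^sup>T B\<close> is symmetric, then \<open>B' = P B (cnj P)\<^sup>-\<^sup>1\<close> is symmetric and
  \<open>tr (B cnj B) = tr (B' cnj B')\<close> is the sum of the squares of the entries of \<open>B'\<close>.\<close>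

lemma trace_cm_nonneg:
  fixes H B :: "complex^'n::finite^'n"
  assumes H: "H = transpose P ** cm P" "invertible P" and sym: "transpose (transpose H ** B) = transpose H ** B"
  shows "trace (B ** cm B) \<in> \<real>" "Re (trace (B ** cm B)) \<ge> 0" "trace (B ** cm B) = 0 ==> B = 0"
proof -
  obtain P' where P': "P ** P' = mat 1" "P' ** P = mat 1" using H(2) invertible_def by blast
  define Q where "Q = cm P'"
  have Q: "cm P ** Q = mat 1" "Q ** cm P = mat 1" unfolding Q_def cm_mult[symmetric] P' cm_mat_1 by auto
  define B' where "B' = P ** B ** Q"
  have QT: "transpose Q ** transpose (cm P) = mat 1" by (metis Q(1) matrix_transpose_mul transpose_mat)
  have HT: "transpose H = transpose (cm P) ** P" unfolding H by (simp add: matrix_transpose_mul)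
  have "B' = transpose Q ** (transpose H ** B) ** Q"
    unfolding B'_def HT by (metis QT matrix_mul_assoc matrix_mul_lid)
  then have B'sym: "transpose B' = B'" using sym by (simp add: matrix_transpose_mul matrix_mul_assoc)
  have "B' ** cm B' = P ** B ** (Q ** cm P) ** cm B ** cm Q"
    unfolding B'_def by (simp add: cm_mult matrix_mul_assoc)
  also have "\<dots> = P ** (B ** cm B) ** P'" unfolding Q(2) by (simp add: Q_def cm_cm matrix_mul_assoc)
  finally have "trace (B' ** cm B') = trace (P' ** (P ** (B ** cm B)))" by (simp add: trace_mul_sym[of _ P'])
  then have tr: "trace (B ** cm B) = trace (B' ** cm B')" by (simp add: matrix_mul_assoc P')
  have "trace (B' ** cm B') = (SUM i j. of_real ((cmod (B' $ i $ j))\<^sup>2))"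
    unfolding trace_def matrix_matrix_mult_def
  proof (simp add: cm_nth, intro sum.cong refl)
    fix i j
    have "B' $ j $ i = B' $ i $ j" using arg_cong[OF B'sym, of "%X. X $ i $ j"] by (simp add: transpose_def)
    then show "B' $ i $ j * cnj (B' $ j $ i) = (complex_of_real (cmod (B' $ i $ j)))\<^sup>2" unfolding of_real_power[symmetric] complex_norm_square by simp
  qed
  then have s: "trace (B ** cm B) = of_real (SUM i j. (cmod (B' $ i $ j))\<^sup>2)" unfolding tr by simp
  show "trace (B ** cm B) \<in> \<real>" "Re (trace (B ** cm B)) \<ge> 0" unfolding s by (simp_all add: sum_nonneg)
  assume "trace (B ** cm B) = 0"
  then have "B' = 0" unfolding s of_real_eq_0_iff
    by (simp add: sum_nonneg_eq_0_iff sum_nonneg vec_eq_iff)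
  moreover have "B = P' ** B' ** cm P"
    unfolding B'_def by (metis P'(2) Q(2) matrix_mul_assoc matrix_mul_lid matrix_mul_rid)
  ultimately show "B = 0" by (simp add: matrix_matrix_mult_def vec_eq_iff)
qed

context kahler_chart
begin

definition Hm :: "complex^'n => complex^'n^'n" where "Hm z = (\<chi> k l. H k l z)"

lemma H_cholesky: "\<exists>P :: complex^'n^'n. Hm z = transpose P ** cm P \<and> invertible P"
proof -
  have "\<exists>P :: 'n => 'n => complex. \<forall>k\<in>UNIV. \<forall>l\<in>UNIV. H k l z = (SUM r. P r k * cnj (P r l))"
  proof (rule cholesky)
    fix u :: "'n => complex" assume "\<exists>k\<in>UNIV. u k \<noteq> 0"
    then have "(\<chi> k. u k) \<noteq> 0" by (auto simp: vec_eq_iff)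
    from pos[OF this, of z] show "Re (SUM k l. H k l z * u k * cnj (u l)) > 0"
      by (subst (asm) g_eq) simp
  qed (simp_all add: H_cnj)
  then obtain P :: "'n => 'n => complex" where P: "\<And>k l. H k l z = (SUM r. P r k * cnj (P r l))" by blast
  have e: "Hm z = transpose (\<chi> r k. P r k) ** cm (\<chi> r k. P r k)"
    by (simp add: Hm_def P transpose_def matrix_matrix_mult_def cm_def vec_eq_iff)
  have "det (Hm z) \<noteq> 0" using invertible_H[of z] by (simp add: Hm_def invertible_det_nz)
  then have "invertible (\<chi> r k. P r k)" unfolding e by (auto simp: det_mul det_transpose invertible_det_nz)
  with e show ?thesis by blast
qed

lemma det_H_pos: "\<exists>d>0. det (Hm z) = complex_of_real d"
proof -
  obtain P :: "complex^'n^'n" where P: "Hm z = transpose P ** cm P" "invertible P" using H_cholesky by blast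
  have "det (Hm z) = det P * cnj (det P)" unfolding P by (simp add: det_mul det_transpose det_cm)
  also have "\<dots> = of_real ((cmod (det P))\<^sup>2)" unfolding complex_norm_square ..
  finally show ?thesis using P(2) by (intro exI[of _ "(cmod (det P))\<^sup>2"]) (auto simp: invertible_det_nz)
qed

end

context kahler_chart3
begin

definition dbar_grad :: "(complex^3 => complex) => complex^3 => complex^3^3" where
  "dbar_grad u z = (\<chi> i j. pb j (grad u i) z)"

lemma H_grad: "(SUM i. H i k z * grad u i z) = pb k u z"
proof -
  have "(SUM i. H i k z * grad u i z) = (SUM i l. pb l u z * (K l i z * H i k z))"
    unfolding grad_def sum_distrib_left by (intro sum.cong refl) simp
  also have "\<dots> = (SUM l. pb l u z * (SUM i. K l i z * H i k z))"
    unfolding sum_distrib_left by (rule sum.swap)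
  also have "\<dots> = pb k u z" by (simp only: K_H delta_mult_sum)
  finally show ?thesis .
qed

text \<open>Lowering the index of the gradient gives the dbar-derivative of \<open>u\<close>. So
  this matrix is the second dbar-derivative of \<open>u\<close> minus a term with derivatives of
  \<open>H\<close>; the first is symmetric by commuting derivatives, the second by the Kaehler
  condition.\<close>

lemma dbar_grad_sym:
  assumes "smooth u"
  shows "transpose (transpose (Hm z) ** dbar_grad u z) = transpose (Hm z) ** dbar_grad u z"
proof -
  note d = differentiable_mult[OF H_diff grad_diff[OF assms]]
  have "(SUM i. H i k z * pb j (grad u i) z) = pb j (pb k u) z - (SUM i. pb j (H i k) z * grad u i z)" for k j
  proof -
    have "pb k u = (%z. SUM i. H i k z * grad u i z)" by (simp add: H_grad fun_eq_iff)
    then have "pb j (pb k u) z = (SUM i. pb j (H i k) z * grad u i z + H i k z * pb j (grad u i) z)"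
      by (simp add: pd_sum(2)[OF d] pd_mult(2)[OF H_diff grad_diff[OF assms]])
    then show ?thesis by (simp add: sum.distrib)
  qed
  moreover have "pb j (pb k u) z = pb k (pb j u) z" for j k by (rule pd_commute(2)[OF open_UNIV UNIV_I assms])
  moreover have "pb j (H i k) z = pb k (H i j) z" for i j k by (rule pb_H_commute)
  ultimately show ?thesis
    by (simp add: vec_eq_iff transpose_def matrix_matrix_mult_def Hm_def dbar_grad_def)
qed

text \<open>With its interchanged indices the sum is not visibly a square; the symmetry after
  lowering an index makes it one.\<close>

lemma dbar_grad_norm:
  assumes "smooth u"
  defines "q z \<equiv> G z * (SUM i j. pb j (grad u i) z * cnj (pb i (grad u j) z))"
  shows "q z \<in> \<real>" "Re (q z) \<ge> 0" "q z = 0 ==> pb j (grad u i) z = 0"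
proof -
  obtain P :: "complex^3^3" where P: "Hm z = transpose P ** cm P" "invertible P" using H_cholesky by blast
  note t = trace_cm_nonneg[OF P dbar_grad_sym[OF assms(1)]]
  have e: "trace (dbar_grad u z ** cm (dbar_grad u z)) = (SUM i j. pb j (grad u i) z * cnj (pb i (grad u j) z))"
    by (simp add: trace_def matrix_matrix_mult_def dbar_grad_def cm_nth)
  obtain d where d: "d > 0" "G z = complex_of_real d" using det_H_pos[of z] by (auto simp: G_def Hm_def)
  show "q z \<in> \<real>" "Re (q z) \<ge> 0" unfolding q_def d e[symmetric] using t(1,2) d(1) by (auto simp: complex_is_Real_iff)
  assume "q z = 0"
  then have "dbar_grad u z = 0" using t(3) d unfolding q_def e by simp
  from arg_cong[OF this, of "%M. M $ i $ j"] show "pb j (grad u i) z = 0" by (simp add: dbar_grad_def)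
qed

end

section \<open>Invariance under holomorphic coordinate changes\<close>

context kahler_chart3
begin

definition Km :: "complex^3 => complex^3^3" where "Km z = (\<chi> k l. K k l z)"
definition \<rho>m :: "complex^3 => complex^3^3" where "\<rho>m z = (\<chi> k l. \<rho> k l z)"
definition Rm :: "complex^3 => complex^3^3" where "Rm z = (\<chi> k l. R k l z)"
definition hess :: "(complex^3 => complex) => complex^3 => complex^3^3" where "hess u z = (\<chi> i l. pd i (pb l u) z)"
definition pbv :: "(complex^3 => complex) => complex^3 => complex^3" where "pbv u z = (\<chi> l. pb l u z)"
definition gradv :: "(complex^3 => complex) => complex^3 => complex^3" where "gradv u z = (\<chi> i. grad u i z)"

lemma Hm_Km: "Hm z ** Km z = mat 1" "Km z ** Hm z = mat 1"
  by (simp_all add: Hm_def Km_def matrix_matrix_mult_def mat_def vec_eq_iff H_K K_H)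

lemma gradv_eq: "gradv u z = transpose (Km z) *v pbv u z"
  by (simp add: gradv_def pbv_def Km_def grad_def transpose_def matrix_vector_mult_def vec_eq_iff mult.commute)

lemma lap_eq_trace: "lap u z = trace (Km z ** hess u z)"
  unfolding lap_def trace_def matrix_matrix_mult_def Km_def hess_def by simp (rule sum.swap)

lemma Rm_eq: "Rm z = transpose (Km z) ** transpose (\<rho>m z) ** transpose (Km z)"
proof -
  have "R l k z = (SUM i. (SUM j. K j l z * \<rho> i j z) * K k i z)" for l k
    unfolding R_def sum_distrib_right by (rule sum.swap)
  then show ?thesis by (simp add: Rm_def Km_def \<rho>m_def transpose_def matrix_matrix_mult_def vec_eq_iff)
qed

end

text \<open>A holomorphic isometry from an open part of one chart into another. Holomorphy is stated
  by components through \<open>pb\<close>, and complex linearity of the derivative is then expressed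
  by the Jacobian \<open>M\<close>.\<close>

locale chart_change = c: kahler_chart3 g + c': kahler_chart3 g'
  for g g' :: "complex^3 => complex^3 => complex^3 => real" +
  fixes T :: "complex^3 => complex^3" and O' :: "(complex^3) set"
  assumes open_O: "open O'"
    and smooth_T: "smooth_on O' (%z. T z $ a)"
    and holo_T: "z \<in> O' ==> pb j (%z. T z $ a) z = 0"
    and pullback: "z \<in> O' ==> g z u v = g' (T z) (dird T z u) (dird T z v)"
begin

definition M :: "complex^3 => complex^3^3" where "M z = (\<chi> a i. pd i (%z. T z $ a) z)"

lemma mv_axis: "((A :: complex^3^3) *v axis i 1) $ a = A $ a $ i"
  by (simp add: matrix_vector_mult_def axis_def if_distrib cong: if_cong)

lemma T_derivative:
  assumes "z \<in> O'"
  shows "(T has_derivative (%v. M z *v v)) (at z)"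
proof (rule has_derivative_vec_nth)
  fix a
  have "dird (%x. T x $ a) z = (%v. (M z *v v) $ a)"
    unfolding dird_pd_pb[OF smooth_onD[OF smooth_T assms]] holo_T[OF assms]
    by (simp add: M_def matrix_vector_mult_def)
  then show "((%x. T x $ a) has_derivative (%v. (M z *v v) $ a)) (at z)"
    using smooth_on_has_derivative[OF smooth_T assms, of a] by simp
qed

lemma dird_T: "z \<in> O' ==> dird T z v = M z *v v"
  using dird_eqI[OF T_derivative] .

lemma M_J: "M z *v J v = J (M z *v v)"
  by (simp add: matrix_vector_mult_def J_def vec_eq_iff sum_distrib_left mult_ac)

lemma smooth_M: "smooth_on O' (%z. M z $ a $ i)"
  unfolding M_def by (simp add: smooth_on_pd smooth_T open_O)

lemma M_diff: "z \<in> O' ==> (%z. M z $ a $ i) differentiable (at z)"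
  by (rule smooth_onD[OF smooth_M])

lemma pb_M: "z \<in> O' ==> pb j (%z. M z $ a $ i) z = 0"
proof -
  assume z: "z \<in> O'"
  have "pb j (%z. M z $ a $ i) z = pd i (%y. pb j (%z. T z $ a) y) z"
    unfolding M_def using pd_commute(3)[OF open_O z smooth_T] by simp
  also have "\<dots> = pd i (%y. 0) z" by (rule pd_cong_open(1)[OF open_O z]) (rule holo_T)
  finally show ?thesis by (simp add: pd_const)
qed

lemma pd_T:
  assumes "z \<in> O'" "F differentiable (at (T z))"
  shows "pd i (%y. F (T y)) z = (SUM a. pd a F (T z) * M z $ a $ i)"
    "pb i (%y. F (T y)) z = (SUM a. pb a F (T z) * cnj (M z $ a $ i))"
proof -
  note e = mv_axis
  show "pd i (%y. F (T y)) z = (SUM a. pd a F (T z) * M z $ a $ i)"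
    "pb i (%y. F (T y)) z = (SUM a. pb a F (T z) * cnj (M z $ a $ i))"
    using pd_compose_holo[OF T_derivative[OF assms(1)] M_J assms(2)] by (simp_all add: e)
qed

lemma Hm_eq:
  assumes "z \<in> O'"
  shows "c.Hm z = transpose (M z) ** c'.Hm (T z) ** cm (M z)"
proof -
  \<comment> \<open>The whole Hermitian form is determined by \<open>g\<close> and \<open>J\<close>,
    so a complex linear pullback of \<open>g\<close> pulls back the Hermitian matrix.\<close>
  have cplx: "Complex (g z u v) (g z u (J v)) = (SUM k l. herm g k l z * u $ k * cnj (v $ l))" if "kahler_chart g" for g :: "complex^3 => complex^3 => complex^3 => real" and z u v
  proof -
    interpret kahler_chart g by fact
    have "g z u (J v) = Im (SUM k l. herm g k l z * u $ k * cnj (v $ l))"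
    proof -
      have "(SUM k l. herm g k l z * u $ k * cnj (J v $ l)) = - \<i> * (SUM k l. herm g k l z * u $ k * cnj (v $ l))"
        by (simp add: J_nth sum_distrib_left mult_ac sum_negf)
      then show ?thesis by (subst g_eq) simp
    qed
    moreover have "g z u v = Re (SUM k l. herm g k l z * u $ k * cnj (v $ l))" by (rule g_eq)
    ultimately show ?thesis by (simp add: complex_eq_iff)
  qed
  have "herm g k l z = (SUM a b. herm g' a b (T z) * M z $ a $ k * cnj (M z $ b $ l))" for k l
  proof -
    have "herm g k l z = Complex (g z (axis k 1) (axis l 1)) (g z (axis k 1) (J (axis l 1)))"
      by (simp add: herm_def complex_eq_iff)
    also have "\<dots> = Complex (g' (T z) (M z *v axis k 1) (M z *v axis l 1)) (g' (T z) (M z *v axis k 1) (J (M z *v axis l 1)))"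
      by (simp add: pullback[OF assms] dird_T[OF assms] M_J)
    also have "\<dots> = (SUM a b. herm g' a b (T z) * M z $ a $ k * cnj (M z $ b $ l))"
      unfolding cplx[OF c'.kahler_chart_axioms] by (simp add: mv_axis)
    finally show ?thesis .
  qed
  moreover have "(SUM a b. herm g' a b (T z) * M z $ a $ k * cnj (M z $ b $ l)) = (SUM b. (SUM a. M z $ a $ k * herm g' a b (T z)) * cnj (M z $ b $ l))" for k l
    unfolding sum_distrib_right by (subst sum.swap) (simp add: mult_ac)
  ultimately show ?thesis
    by (simp add: c.Hm_def c'.Hm_def vec_eq_iff transpose_def matrix_matrix_mult_def cm_nth)
qed

lemma G_eq: "z \<in> O' ==> c.G z = c'.G (T z) * (det (M z) * cnj (det (M z)))"
  using Hm_eq[of z] by (simp add: c.G_def c'.G_def c.Hm_def[symmetric] c'.Hm_def[symmetric] det_mul det_transpose det_cm)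

lemma det_M: "z \<in> O' ==> det (M z) \<noteq> 0"
  using G_eq[of z] c.G_nz[of z] by auto

lemma Km_eq:
  assumes "z \<in> O'"
  shows "c'.Km (T z) = cm (M z) ** c.Km z ** transpose (M z)"
proof -
  have "invertible (transpose (M z))" using det_M[OF assms] by (simp add: invertible_det_nz det_transpose)
  then obtain N where N: "N ** transpose (M z) = mat 1" "transpose (M z) ** N = mat 1" unfolding invertible_def by blast
  have "c'.Hm (T z) ** (cm (M z) ** c.Km z ** transpose (M z)) = N ** (transpose (M z) ** c'.Hm (T z) ** cm (M z)) ** c.Km z ** transpose (M z)"
    by (simp add: matrix_mul_assoc N)
  also have "\<dots> = N ** (c.Hm z ** c.Km z) ** transpose (M z)" unfolding Hm_eq[OF assms, symmetric] by (simp only: matrix_mul_assoc)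
  also have "\<dots> = mat 1" by (simp add: c.Hm_Km N)
  finally have "c'.Km (T z) ** (c'.Hm (T z) ** (cm (M z) ** c.Km z ** transpose (M z))) = c'.Km (T z)" by simp
  then show ?thesis by (simp add: matrix_mul_assoc c'.Hm_Km)
qed

lemma tau_eq: "z \<in> O' ==> c.\<tau> i z = (SUM a. c'.\<tau> a (T z) * M z $ a $ i) + pd i (%z. det (M z)) z / det (M z)"
proof -
  assume z: "z \<in> O'"
  define D where "D = (%z. det (M z))"
  have sD: "smooth_on O' D" unfolding D_def det_3
    by (intro smooth_on_diff smooth_on_add smooth_on_mult smooth_M open_O)
  have dD: "y \<in> O' ==> D differentiable (at y)" for y by (rule smooth_onD[OF sD])
  have pbD: "pb i D y = 0" if "y \<in> O'" for y i
    unfolding D_def det_3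
    by (simp add: pd_mult pd_add pd_diff M_diff that pb_M differentiable_mult differentiable_add differentiable_diff)
  have dG: "(%y. c'.G (T y)) differentiable (at z)"
    using differentiable_chain_at[OF differentiableI[OF T_derivative[OF z]] c'.G_diff] by (simp add: o_def)
  have dc: "(%y. cnj (D y)) differentiable (at z)"
    by (rule smooth_onD[OF smooth_on_linears(1)[OF open_O sD] z])
  have "c.G z * c.\<tau> i z = pd i c.G z" by (simp add: c.pd_G)
  also have "\<dots> = pd i (%y. c'.G (T y) * (D y * cnj (D y))) z"
    by (rule pd_cong_open(1)[OF open_O z]) (simp add: G_eq D_def)
  also have "\<dots> = pd i (%y. c'.G (T y)) z * (D z * cnj (D z)) + c'.G (T z) * (pd i D z * cnj (D z))"
    by (simp add: pd_mult[OF dG differentiable_mult[OF dD[OF z] dc]] pd_mult[OF dD[OF z] dc] pd_cnj[OF dD[OF z]] pbD[OF z])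
  also have "pd i (%y. c'.G (T y)) z = c'.G (T z) * (SUM a. c'.\<tau> a (T z) * M z $ a $ i)"
    unfolding pd_T(1)[OF z c'.G_diff] by (simp add: c'.pd_G sum_distrib_left mult_ac)
  finally have "c.G z * c.\<tau> i z = c.G z * ((SUM a. c'.\<tau> a (T z) * M z $ a $ i) + pd i D z / D z)"
    unfolding G_eq[OF z] using det_M[OF z] by (simp add: D_def field_simps)
  then show ?thesis using c.G_nz by (simp add: D_def)
qed

lemma mixed_T:
  assumes z: "z \<in> O'" and F: "\<And>a. smooth (F a)"
  shows "pb j (%y. SUM a. F a (T y) * M y $ a $ i) z = (SUM a b. pb b (F a) (T z) * M z $ a $ i * cnj (M z $ b $ j))"
proof -
  have dF: "F a differentiable (at y)" for a y by (rule smooth_onD[OF F]) simp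
  have dFT: "(%y. F a (T y)) differentiable (at z)" for a
    using differentiable_chain_at[OF differentiableI[OF T_derivative[OF z]] dF] by (simp add: o_def)
  show ?thesis
    unfolding pd_sum(2)[OF differentiable_mult[OF dFT M_diff[OF z]]] pd_mult(2)[OF dFT M_diff[OF z]] pb_M[OF z] pd_T(2)[OF z dF]
    by (simp add: sum_distrib_right sum_distrib_left mult_ac)
qed

text \<open>The inhomogeneous term in \<open>tau_eq\<close> is the logarithmic derivative of the
  holomorphic function det M. It is annihilated by \<open>pb\<close>, so \<rho> is a tensor although
  \<tau> is not.\<close>

lemma rho_eq: "z \<in> O' ==> c.\<rho>m z = transpose (M z) ** c'.\<rho>m (T z) ** cm (M z)"
proof -
  assume z: "z \<in> O'"
  define D where "D = (%z. det (M z))"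
  have sD: "smooth_on O' D" unfolding D_def det_3
    by (intro smooth_on_diff smooth_on_add smooth_on_mult smooth_M open_O)
  have dD: "y \<in> O' ==> D differentiable (at y)" for y by (rule smooth_onD[OF sD])
  have pbD: "pb i D y = 0" if "y \<in> O'" for y i
    unfolding D_def det_3
    by (simp add: pd_mult pd_add pd_diff M_diff that pb_M differentiable_mult differentiable_add differentiable_diff)
  have dpD: "pd i D differentiable (at z)" for i by (rule smooth_onD[OF smooth_on_pd[OF open_O sD] z])
  have Dz: "D z \<noteq> 0" using det_M[OF z] by (simp add: D_def)
  have iD: "(%y. inverse (D y)) differentiable (at z)"
    by (rule smooth_onD[OF smooth_on_inverse[OF open_O sD] z]) (simp add: D_def det_M)
  have pbl: "pb j (%y. pd i D y * inverse (D y)) z = 0" for i j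
  proof -
    have "pb j (pd i D) z = pd i (%y. pb j D y) z" by (rule pd_commute(3)[OF open_O z sD])
    also have "\<dots> = pd i (%y. 0) z" by (rule pd_cong_open(1)[OF open_O z]) (rule pbD)
    finally have "pb j (pd i D) z = 0" by (simp add: pd_const)
    then show ?thesis by (simp add: pd_mult(2)[OF dpD iD] pd_inverse(2)[OF dD[OF z] Dz] pbD[OF z])
  qed
  have ts: "smooth_on O' (%y. SUM a. c'.\<tau> a (T y) * M y $ a $ i)" for i
  proof -
    have "smooth_on O' (%y. c'.\<tau> a (T y))" for a
      by (rule smooth_on_compose[of O' UNIV]) (simp_all add: open_O c'.smooth_tau smooth_on_vec smooth_T)
    then show ?thesis by (intro smooth_on_sum smooth_on_mult smooth_M open_O)
  qed
  note dts = smooth_onD[OF ts z]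
  have "c.\<rho> i j z = (SUM a b. c'.\<rho> a b (T z) * M z $ a $ i * cnj (M z $ b $ j))" for i j
  proof -
    have "c.\<rho> i j z = pb j (%y. (SUM a. c'.\<tau> a (T y) * M y $ a $ i) + pd i D y * inverse (D y)) z"
      unfolding c.\<rho>_def by (rule pd_cong_open(2)[OF open_O z]) (simp add: tau_eq D_def divide_inverse)
    also have "\<dots> = (SUM a b. c'.\<rho> a b (T z) * M z $ a $ i * cnj (M z $ b $ j))"
      by (simp add: pd_add(2)[OF dts differentiable_mult[OF dpD iD]] pbl mixed_T[OF z c'.smooth_tau] c'.\<rho>_def)
    finally show ?thesis .
  qed
  moreover have "(SUM a b. c'.\<rho> a b (T z) * M z $ a $ i * cnj (M z $ b $ j)) = (SUM b. (SUM a. M z $ a $ i * c'.\<rho> a b (T z)) * cnj (M z $ b $ j))" for i j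
    unfolding sum_distrib_right by (subst sum.swap) (simp add: mult_ac)
  ultimately show ?thesis
    by (simp add: c.\<rho>m_def c'.\<rho>m_def vec_eq_iff transpose_def matrix_matrix_mult_def cm_nth)
qed

lemma Rm_eq: "z \<in> O' ==> c'.Rm (T z) = M z ** c.Rm z ** transpose (cm (M z))"
  unfolding c.Rm_eq c'.Rm_eq by (simp add: Km_eq rho_eq matrix_transpose_mul matrix_mul_assoc)

context
  fixes u u' :: "complex^3 => complex"
  assumes u: "smooth u" and u': "smooth u'" and uT: "\<And>z. z \<in> O' ==> u z = u' (T z)"
begin

lemma u'_diff: "u' differentiable (at z)"
  by (rule smooth_onD[OF u']) simp

lemma pbv_eq: "z \<in> O' ==> c.pbv u z = transpose (cm (M z)) *v c'.pbv u' (T z)"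
  using pd_cong_open(2)[OF open_O _ uT] pd_T(2)[OF _ u'_diff]
  by (simp add: c.pbv_def c'.pbv_def vec_eq_iff matrix_vector_mult_def transpose_def cm_nth mult.commute)

lemma gradv_eq: "z \<in> O' ==> c'.gradv u' (T z) = M z *v c.gradv u z"
  unfolding c.gradv_eq c'.gradv_eq
  by (simp only: Km_eq pbv_eq matrix_transpose_mul transpose_transpose matrix_vector_mul_assoc matrix_mul_assoc)

lemma hess_eq:
  assumes z: "z \<in> O'"
  shows "c.hess u z = transpose (M z) ** c'.hess u' (T z) ** cm (M z)"
proof -
  have "pd i (pb l u) z = (SUM a b. pd a (pb b u') (T z) * M z $ a $ i * cnj (M z $ b $ l))" for i l
  proof -
    have "pd i (pb l u) z = pb l (pd i u) z" by (rule pd_commute(3)[OF open_UNIV UNIV_I u, symmetric])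
    also have "\<dots> = pb l (%y. SUM a. pd a u' (T y) * M y $ a $ i) z"
    proof (rule pd_cong_open(2)[OF open_O z])
      fix y assume y: "y \<in> O'"
      show "pd i u y = (SUM a. pd a u' (T y) * M y $ a $ i)"
        using pd_cong_open(1)[OF open_O y uT] pd_T(1)[OF y u'_diff] by simp
    qed
    also have "\<dots> = (SUM a b. pb b (pd a u') (T z) * M z $ a $ i * cnj (M z $ b $ l))"
      by (rule mixed_T[OF z]) (rule smooth_on_pd[OF open_UNIV u'])
    finally show ?thesis by (simp add: pd_commute(3)[OF open_UNIV UNIV_I u'])
  qed
  moreover have "(SUM a b. pd a (pb b u') (T z) * M z $ a $ i * cnj (M z $ b $ l)) = (SUM b. (SUM a. M z $ a $ i * pd a (pb b u') (T z)) * cnj (M z $ b $ l))" for i l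
    unfolding sum_distrib_right by (subst sum.swap) (simp add: mult_ac)
  ultimately show ?thesis
    by (simp add: c.hess_def c'.hess_def vec_eq_iff transpose_def matrix_matrix_mult_def cm_nth)
qed

lemma lap_eq: "z \<in> O' ==> c'.lap u' (T z) = c.lap u z"
  unfolding c.lap_eq_trace c'.lap_eq_trace
  by (simp add: Km_eq hess_eq trace_mul_sym[of "cm (M z)"] matrix_mul_assoc flip: matrix_mul_assoc)

text \<open>Apply \<open>pb\<close> to the transformation law of the gradient; the Jacobian is
  holomorphic and contributes nothing.\<close>

lemma dbar_grad_eq:
  assumes z: "z \<in> O'"
  shows "c'.dbar_grad u' (T z) ** cm (M z) = M z ** c.dbar_grad u z"
proof -
  have d: "c.grad u i differentiable (at z)" "c'.grad u' i differentiable (at (T z))" for i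
    by (rule c.grad_diff[OF u] c'.grad_diff[OF u'])+
  have "(SUM b. pb b (c'.grad u' a) (T z) * cnj (M z $ b $ j)) = (SUM k. M z $ a $ k * pb j (c.grad u k) z)" for a j
  proof -
    have "(SUM b. pb b (c'.grad u' a) (T z) * cnj (M z $ b $ j)) = pb j (%y. c'.grad u' a (T y)) z"
      by (rule pd_T(2)[OF z d(2), symmetric])
    also have "\<dots> = pb j (%y. SUM k. M y $ a $ k * c.grad u k y) z"
    proof (rule pd_cong_open(2)[OF open_O z])
      fix y assume "y \<in> O'"
      from arg_cong[OF gradv_eq[OF this], of "%v. v $ a"]
      show "c'.grad u' a (T y) = (SUM k. M y $ a $ k * c.grad u k y)"
        by (simp add: c.gradv_def c'.gradv_def matrix_vector_mult_def)
    qed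
    also have "\<dots> = (SUM k. M z $ a $ k * pb j (c.grad u k) z)"
      by (simp add: pd_sum(2)[OF differentiable_mult[OF M_diff[OF z] d(1)]] pd_mult(2)[OF M_diff[OF z] d(1)] pb_M[OF z])
    finally show ?thesis .
  qed
  then show ?thesis by (simp add: c.dbar_grad_def c'.dbar_grad_def vec_eq_iff matrix_matrix_mult_def cm_nth)
qed

lemma pbv_eq': "z \<in> O' ==> c'.Rm (T z) *v c'.pbv u' (T z) = M z *v (c.Rm z *v c.pbv u z)"
  by (simp only: Rm_eq pbv_eq matrix_vector_mul_assoc matrix_mul_assoc)

end

definition cv :: "complex^3 => complex^3" where "cv v = (\<chi> i. cnj (v $ i))"

lemma cv_mv: "cv (A *v v) = cm A *v cv v"
  by (simp add: cv_def cm_def matrix_vector_mult_def vec_eq_iff)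

text \<open>\<open>P\<close> is \<open>G\<close> times a (1,0) vector and \<open>Q\<close> is
  \<open>G\<close> times a (0,1) vector, both made of tensors. So they transform by the Jacobian or
  its conjugate, up to the factor |det M|^2 of the volume density.\<close>

lemma P_Q_eq:
  assumes f: "smooth f" and f': "smooth f'" and fT: "\<And>z. z \<in> O' ==> f z = f' (T z)"
    and z: "z \<in> O'"
  shows "c'.P f' a (T z) * (det (M z) * cnj (det (M z))) = (SUM k. M z $ a $ k * c.P f k z)"
    "c'.Q f' a (T z) * (det (M z) * cnj (det (M z))) = (SUM k. cnj (M z $ a $ k) * c.Q f k z)"
proof -
  define u where "u = (%y. cnj (f y))"
  define u' where "u' = (%y. cnj (f' y))"
  have u: "smooth u" "smooth u'" "\<And>z. z \<in> O' ==> u z = u' (T z)"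
    unfolding u_def u'_def using f f' fT smooth_on_linears(1)[OF open_UNIV] by auto
  have pdf: "pd l f z = cnj (pb l (%y. cnj (f y)) z)" if "smooth f" for f :: "complex^3 => complex" and l z
    using pd_cnj(2)[OF smooth_onD[OF that UNIV_I], of l z] by simp
  have P: "kahler_chart3.P g f a z = kahler_chart3.G g z * ((kahler_chart3.dbar_grad g (%y. cnj (f y)) z *v cv (kahler_chart3.gradv g (%y. cnj (f y)) z)) $ a - cnj (f z) * (kahler_chart3.Rm g z *v kahler_chart3.pbv f z) $ a)"
    "kahler_chart3.Q g f a z = kahler_chart3.G g z * (cnj (kahler_chart3.gradv g f z $ a) * kahler_chart3.lap g f z
      - cnj (kahler_chart3.gradv g (%y. cnj (f y)) z $ a) * kahler_chart3.lap g (%y. cnj (f y)) z + cnj (f z) * cnj ((kahler_chart3.Rm g z *v kahler_chart3.pbv (%y. cnj (f y)) z) $ a))"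
    if "kahler_chart3 g" "smooth f" for g f z a
  proof -
    interpret kahler_chart3 g by fact
    show "P f a z = G z * ((dbar_grad (%y. cnj (f y)) z *v cv (gradv (%y. cnj (f y)) z)) $ a - cnj (f z) * (Rm z *v pbv f z) $ a)"
      by (simp add: P_def dbar_grad_def gradv_def cv_def Rm_def pbv_def matrix_vector_mult_def sum_distrib_left right_diff_distrib mult_ac)
    show "Q f a z = G z * (cnj (gradv f z $ a) * lap f z - cnj (gradv (%y. cnj (f y)) z $ a) * lap (%y. cnj (f y)) z + cnj (f z) * cnj ((Rm z *v pbv (%y. cnj (f y)) z) $ a))"
      by (simp add: Q_def gradv_def Rm_def pbv_def matrix_vector_mult_def sum_distrib_left right_diff_distrib distrib_left pdf[OF that(2)] R_cnj mult_ac)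
  qed
  note P = P[folded u_def] P[folded u'_def]
  have Pc: "(SUM k. M z $ a $ k * c.P f k z) = c.G z * ((M z *v (c.dbar_grad u z *v cv (c.gradv u z))) $ a - u z * (M z *v (c.Rm z *v c.pbv f z)) $ a)"
    unfolding P(1)[OF c.kahler_chart3_axioms f]
    by (simp add: matrix_vector_mult_def sum_distrib_left sum_subtractf right_diff_distrib u_def mult_ac)
  have "M z *v (c.dbar_grad u z *v cv (c.gradv u z)) = c'.dbar_grad u' (T z) *v cv (c'.gradv u' (T z))"
    using gradv_eq[OF u z] dbar_grad_eq[OF u z] by (simp add: cv_mv matrix_vector_mul_assoc)
  then show "c'.P f' a (T z) * (det (M z) * cnj (det (M z))) = (SUM k. M z $ a $ k * c.P f k z)"
    unfolding Pc P(3)[OF c'.kahler_chart3_axioms f'] G_eq[OF z]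
    using pbv_eq'[OF f f' fT z] u(3)[OF z] by (simp add: u'_def)
  have g: "(SUM k. cnj (M z $ a $ k) * cnj (v $ k)) = cnj ((M z *v v) $ a)" for v
    by (simp add: matrix_vector_mult_def)
  have Qc: "(SUM k. cnj (M z $ a $ k) * c.Q f k z) = c.G z * (cnj ((M z *v c.gradv f z) $ a) * c.lap f z - cnj ((M z *v c.gradv u z) $ a) * c.lap u z + u z * cnj ((M z *v (c.Rm z *v c.pbv u z)) $ a))"
    unfolding P(2)[OF c.kahler_chart3_axioms f] g[symmetric] sum_distrib_left sum_distrib_right sum_subtractf[symmetric] sum.distrib[symmetric]
    by (intro sum.cong refl) (simp add: u_def algebra_simps)
  show "c'.Q f' a (T z) * (det (M z) * cnj (det (M z))) = (SUM k. cnj (M z $ a $ k) * c.Q f k z)"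
    unfolding Qc P(4)[OF c'.kahler_chart3_axioms f'] G_eq[OF z]
    using pbv_eq'[OF u z] gradv_eq[OF u z] gradv_eq[OF f f' fT z] lap_eq[OF u z] lap_eq[OF f f' fT z] u(3)[OF z]
    by (simp add: u'_def)
qed

end

section \<open>Integration over polydiscs in polar coordinates\<close>

text \<open>The area integral over the unit disc, written in polar coordinates with Jacobian
  \<open>fst t\<close>; both Stokes' theorem and rotation invariance are direct in this
  form.\<close>

definition disc :: "(complex => complex) => complex" where
  "disc F = integral (cbox (0, 0) (1, 2 * pi)) (%t. of_real (fst t) * F (of_real (fst t) * cis (snd t)))"

definition circ :: "(complex => complex) => complex" where
  "circ F = integral (cbox 0 (2 * pi)) (%\<theta>. F (cis \<theta>))"

lemma continuous_polar:
  fixes f :: "'a::topological_space => complex => complex"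
  assumes "continuous_on UNIV (%p. f (fst p) (snd p))"
  shows "continuous_on S (%p. of_real (fst (snd p)) * f (fst p) (of_real (fst (snd p)) * cis (snd (snd p))))"
proof -
  have "continuous_on S (%p::'a \<times> real \<times> real. (fst p, complex_of_real (fst (snd p)) * cis (snd (snd p))))"
    by (intro continuous_intros)
  from continuous_on_compose2[OF assms this] show ?thesis by (auto intro!: continuous_intros)
qed

lemma continuous_disc:
  fixes f :: "'a::topological_space => complex => complex"
  assumes "continuous_on UNIV (%p. f (fst p) (snd p))"
  shows "continuous_on UNIV (%x. disc (f x))"
  unfolding disc_def
  by (rule integral_continuous_on_param) (use continuous_polar[OF assms] in \<open>simp add: split_beta\<close>)

lemma disc_swap_integral:
  fixes f :: "complex => 'b::euclidean_space => complex" and a b :: 'b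
  assumes "continuous_on UNIV (%p. f (fst p) (snd p))"
  shows "disc (%z. integral (cbox a b) (f z)) = integral (cbox a b) (%t. disc (%z. f z t))"
proof -
  have c: "continuous_on (cbox ((0, 0), a) ((1, 2 * pi), b)) (%(x, y). of_real (fst x) * f (of_real (fst x) * cis (snd x)) y)"
  proof -
    have "continuous_on (cbox ((0, 0), a) ((1, 2 * pi), b)) (%p::(real \<times> real) \<times> 'b. (complex_of_real (fst (fst p)) * cis (snd (fst p)), snd p))"
      by (intro continuous_intros)
    from continuous_on_compose2[OF assms this] show ?thesis by (auto intro!: continuous_intros simp: split_beta)
  qed
  have "disc (%z. integral (cbox a b) (f z)) = integral (cbox (0, 0) (1, 2 * pi)) (%x. integral (cbox a b) (%y. of_real (fst x) * f (of_real (fst x) * cis (snd x)) y))"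
    unfolding disc_def by simp
  also have "\<dots> = integral (cbox a b) (%t. disc (%z. f z t))"
    unfolding disc_def by (rule integral_swap_continuous[OF c])
  finally show ?thesis .
qed

lemma disc_cmult: "disc (%z. c * f z) = c * disc f"
  unfolding disc_def by (simp add: mult.left_commute[of _ c])

lemma disc_swap:
  assumes "continuous_on UNIV (%p. f (fst p) (snd p))"
  shows "disc (%z. disc (f z)) = disc (%w. disc (%z. f z w))"
proof -
  have "continuous_on UNIV (%p. of_real (fst (snd p)) * f (fst p) (of_real (fst (snd p)) * cis (snd (snd p))))"
    by (rule continuous_polar[OF assms])
  note sw = disc_swap_integral[OF this, of "(0, 0)" "(1, 2 * pi)"]
  have "disc (%z. disc (f z)) = disc (%z. integral (cbox (0, 0) (1, 2 * pi)) (%t. of_real (fst t) * f z (of_real (fst t) * cis (snd t))))"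
    by (simp only: disc_def[of "f _"])
  also have "\<dots> = integral (cbox (0, 0) (1, 2 * pi)) (%t. of_real (fst t) * disc (%z. f z (of_real (fst t) * cis (snd t))))"
    using sw by (simp add: disc_cmult)
  also have "\<dots> = disc (%w. disc (%z. f z w))" by (rule disc_def[symmetric])
  finally show ?thesis .
qed

lemma disc_circ_swap:
  assumes "continuous_on UNIV (%p. f (fst p) (snd p))"
  shows "disc (%z. circ (f z)) = circ (%w. disc (%z. f z w))"
proof -
  have "continuous_on UNIV (%p::complex \<times> real. (fst p, cis (snd p)))" by (intro continuous_intros)
  from continuous_on_compose2[OF assms this] have "continuous_on UNIV (%p. f (fst p) (cis (snd p)))" by simp
  from disc_swap_integral[OF this] show ?thesis unfolding circ_def .
qed

lemma circ_cmult: "circ (%z. c * f z) = c * circ f"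
  unfolding circ_def by simp

lemma disc_add:
  assumes "continuous_on UNIV f" "continuous_on UNIV g"
  shows "disc (%z. f z + g z) = disc f + disc g"
proof -
  have i: "(%t. of_real (fst t) * f (of_real (fst t) * cis (snd t))) integrable_on cbox (0, 0) (1, 2 * pi)"
    if "continuous_on UNIV f" for f :: "complex => complex"
  proof (rule integrable_continuous)
    have "continuous_on (cbox (0, 0) (1, 2 * pi)) (%t::real \<times> real. complex_of_real (fst t) * cis (snd t))" by (intro continuous_intros)
    from continuous_on_compose2[OF that this]
    show "continuous_on (cbox (0, 0) (1, 2 * pi)) (%t. of_real (fst t) * f (of_real (fst t) * cis (snd t)))"
      by (auto intro!: continuous_intros)
  qed
  show ?thesis unfolding disc_def distrib_left by (rule integral_add[OF i[OF assms(1)] i[OF assms(2)]])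
qed

lemma periodic_shift:
  fixes p :: "real => complex"
  assumes c: "continuous_on UNIV p" and per: "\<And>x. p (x + 2 * pi) = p x" and \<alpha>: "0 \<le> \<alpha>" "\<alpha> \<le> 2 * pi"
  shows "integral {0..2 * pi} (%x. p (x + \<alpha>)) = integral {0..2 * pi} p"
proof -
  have i: "p integrable_on {a..b}" for a b by (rule integrable_continuous_real[OF continuous_on_subset[OF c]]) simp
  have "integral {0..2 * pi} (%x. p (x + \<alpha>)) = integral {\<alpha>..2 * pi + \<alpha>} p"
    using integral_shift_Icc_real[of 0 "2 * pi" p \<alpha>] by (simp add: o_def add.commute)
  also have "\<dots> = integral {\<alpha>..2 * pi} p + integral {2 * pi..2 * pi + \<alpha>} p"
    using Henstock_Kurzweil_Integration.integral_combine[OF _ _ i, of \<alpha> "2 * pi" "2 * pi + \<alpha>"] \<alpha> by simp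
  also have "integral {2 * pi..2 * pi + \<alpha>} p = integral {0..\<alpha>} p"
  proof -
    have "integral {0..\<alpha>} (%x. p (x + 2 * pi)) = integral {0 + 2 * pi..\<alpha> + 2 * pi} p"
      using integral_shift_Icc_real[of 0 \<alpha> p "2 * pi"] by (simp add: o_def add.commute)
    then show ?thesis unfolding per by (simp add: add.commute)
  qed
  also have "integral {\<alpha>..2 * pi} p + integral {0..\<alpha>} p = integral {0..2 * pi} p"
    using Henstock_Kurzweil_Integration.integral_combine[OF _ _ i, of 0 \<alpha> "2 * pi"] \<alpha> by (simp add: add.commute)
  finally show ?thesis .
qed

lemma integral_rotate:
  fixes F :: "complex => complex"
  assumes c: "continuous_on UNIV F" and w: "cmod w = 1"
  shows "integral {0..2 * pi} (%\<theta>. F (r * (w * cis \<theta>))) = integral {0..2 * pi} (%\<theta>. F (r * cis \<theta>))"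
proof -
  define \<alpha> where "\<alpha> = Arg2pi w"
  have \<alpha>: "0 \<le> \<alpha>" "\<alpha> \<le> 2 * pi" "w = cis \<alpha>"
    using Arg2pi[of w] w by (auto simp: \<alpha>_def cis_conv_exp is_Arg_def)
  have c': "continuous_on UNIV (%\<theta>::real. r * cis \<theta>)" by (intro continuous_intros)
  have "continuous_on UNIV (%\<theta>. F (r * cis \<theta>))" by (rule continuous_on_compose2[OF c c']) simp
  moreover have "cis (x + 2 * pi) = cis x" for x by (simp add: cis_mult[symmetric])
  ultimately have "integral {0..2 * pi} (%\<theta>. F (r * cis (\<theta> + \<alpha>))) = integral {0..2 * pi} (%\<theta>. F (r * cis \<theta>))"
    using periodic_shift[where p = "%\<theta>. F (r * cis \<theta>)", OF _ _ \<alpha>(1,2)] by simp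
  then show ?thesis by (simp add: \<alpha>(3) cis_mult add.commute)
qed

lemma circ_cnj:
  assumes c: "continuous_on UNIV F"
  shows "circ (%z. F (cnj z)) = circ F"
proof -
  have "integral {0..2 * pi} (%\<theta>. F (cis (- \<theta>))) = integral {- (2 * pi)..- 0} (%\<theta>. F (cis \<theta>))"
    using Henstock_Kurzweil_Integration.integral_reflect_real[of "2 * pi" 0 "%\<theta>. F (cis (- \<theta>))"] by simp
  also have "\<dots> = integral {0..2 * pi} (%\<theta>. F (cis (\<theta> + (- (2 * pi)))))"
    using integral_shift_Icc_real[of 0 "2 * pi" "%\<theta>. F (cis \<theta>)" "- (2 * pi)"] by (simp add: o_def add.commute)
  finally show ?thesis by (simp add: circ_def cis_cnj flip: cis_divide)
qed

text \<open>A rotation shifts the angle in the inner integral. This later absorbs the phase by which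
  the fibre coordinate changes between base charts.\<close>

lemma disc_rotate:
  assumes c: "continuous_on UNIV F" and w: "cmod w = 1"
  shows "disc (%z. F (w * z)) = disc F"
proof -
  have e: "disc F = integral {0..1} (%r. of_real r * integral {0..2 * pi} (%\<theta>. F (of_real r * cis \<theta>)))" if "continuous_on UNIV F" for F
  proof -
    have "continuous_on (cbox (0, 0) (1, 2 * pi)) (%t::real \<times> real. complex_of_real (fst t) * cis (snd t))" by (intro continuous_intros)
    from continuous_on_compose2[OF that this]
    have "continuous_on (cbox (0, 0) (1, 2 * pi)) (%t. of_real (fst t) * F (of_real (fst t) * cis (snd t)))"
      by (auto intro!: continuous_intros)
    from integral_prod_continuous[OF this] show ?thesis unfolding disc_def by simp
  qed
  have "continuous_on UNIV (%z. F (w * z))" by (rule continuous_on_compose2[OF c]) (auto intro!: continuous_intros)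
  from e[OF this] show ?thesis
    unfolding e[OF c] integral_rotate[OF c w, symmetric] by (simp add: mult.left_commute[of w])
qed

text \<open>In polar coordinates \<open>r \<partial>F = (\<partial>\<^sub>r (r e\<^sup>-\<^sup>i\<^sup>\<theta> F) - \<partial>\<^sub>\<theta> (i e\<^sup>-\<^sup>i\<^sup>\<theta> F)) / 2\<close>.\<close>

lemma disc_stokes:
  assumes F: "smooth F"
  shows "disc (%z. (dird F z 1 - \<i> * dird F z \<i>) / 2) = circ (%z. cnj z * F z) / 2"
proof -
  have dF: "F differentiable (at z)" for z by (rule smooth_onD[OF F]) simp
  have lin: "dird F z v = Re v *\<^sub>R dird F z 1 + Im v *\<^sub>R dird F z \<i>" for z v
    using dird_euclidean[OF dF, of z v] by (simp add: Basis_complex_def inner_complex_def)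
  define m where "m t = complex_of_real (fst t) * cis (snd t)" for t
  \<comment> \<open>\<open>U\<close> is the derivative in r of \<open>r e^(-i \<theta>) F\<close>
    and \<open>V\<close> the derivative in \<theta> of \<open>i e^(-i \<theta>) F\<close>.\<close>
  define U where "U t = cis (- snd t) * F (m t) + of_real (fst t) * cis (- snd t) * dird F (m t) (cis (snd t))" for t
  define V where "V t = cis (- snd t) * F (m t) + \<i> * cis (- snd t) * dird F (m t) (of_real (fst t) * (\<i> * cis (snd t)))" for t
  have cm: "continuous_on UNIV m" unfolding m_def[abs_def] by (intro continuous_intros)
  have cF: "continuous_on UNIV F" and cD: "continuous_on UNIV (%z. dird F z v)" for v
    by (rule smooth_on_continuous[OF F], rule smooth_on_continuous[OF smooth_on_dird[OF F]])
  have cFm: "continuous_on UNIV (%t. F (m t))" and cDm: "continuous_on UNIV (%t. dird F (m t) v)" for v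
    by (rule continuous_on_compose2[OF cF cm] continuous_on_compose2[OF cD cm]; simp)+
  have cDm': "continuous_on UNIV (%t. dird F (m t) (v t))" if "continuous_on UNIV v" for v
    unfolding lin[of _ "v _"] by (intro continuous_intros cDm that)
  have cU: "continuous_on UNIV U" and cV: "continuous_on UNIV V"
    unfolding U_def[abs_def] V_def[abs_def] by (intro continuous_intros cFm cDm')+
  have UV: "of_real (fst t) * ((dird F (m t) 1 - \<i> * dird F (m t) \<i>) / 2) = (U t - V t) / 2" for t
  proof -
    have "dird F (m t) (of_real (fst t) * (\<i> * cis (snd t))) = of_real (fst t) * (- of_real (sin (snd t)) * dird F (m t) 1 + of_real (cos (snd t)) * dird F (m t) \<i>)"
      by (subst lin) (simp add: scaleR_conv_of_real algebra_simps)
    moreover have "dird F (m t) (cis (snd t)) = of_real (cos (snd t)) * dird F (m t) 1 + of_real (sin (snd t)) * dird F (m t) \<i>"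
      by (subst lin) (simp add: scaleR_conv_of_real)
    moreover have "cis (- snd t) = of_real (cos (snd t)) - \<i> * of_real (sin (snd t))" by (simp add: complex_eq_iff)
    moreover have "complex_of_real (cos (snd t)) * of_real (cos (snd t)) + of_real (sin (snd t)) * of_real (sin (snd t)) = 1"
      by (metis of_real_1 of_real_add of_real_mult power2_eq_square sin_cos_squared_add2)
    moreover have "\<i> * \<i> = (-1::complex)" by simp
    ultimately show ?thesis unfolding U_def V_def by algebra
  qed
  have cU': "continuous_on S U" and cV': "continuous_on S V" for S
    using cU cV continuous_on_subset by blast+
  have "disc (%z. (dird F z 1 - \<i> * dird F z \<i>) / 2) = integral (cbox (0, 0) (1, 2 * pi)) (%t. (U t - V t) / 2)"
    unfolding disc_def m_def[symmetric] UV ..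
  also have "\<dots> = (integral (cbox (0, 0) (1, 2 * pi)) U - integral (cbox (0, 0) (1, 2 * pi)) V) / 2"
    by (simp add: integral_diff[OF integrable_continuous[OF cU'] integrable_continuous[OF cV']])
  also have "integral (cbox (0, 0) (1, 2 * pi)) V = integral (cbox 0 1) (%r. integral (cbox 0 (2 * pi)) (%\<theta>. V (r, \<theta>)))"
    by (rule integral_prod_continuous[OF cV'])
  also have "integral (cbox 0 1) (%r. integral (cbox 0 (2 * pi)) (%\<theta>. V (r, \<theta>))) = 0"
  proof -
    \<comment> \<open>At fixed radius \<open>V\<close> is the derivative of a periodic function of
      the angle.\<close>
    have "integral (cbox 0 (2 * pi)) (%\<theta>. V (r, \<theta>)) = 0" for r
  proof -
    have "((%\<theta>. V (r, \<theta>)) has_integral (\<i> * cis (- (2 * pi)) * F (of_real r * cis (2 * pi)) - \<i> * cis (- 0) * F (of_real r * cis 0))) {0..2 * pi}"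
    proof (rule fundamental_theorem_of_calculus)
      fix \<theta> :: real
      have 1: "((%\<theta>. F (of_real r * cis \<theta>)) has_vector_derivative dird F (of_real r * cis \<theta>) (of_real r * (\<i> * cis \<theta>))) (at \<theta> within {0..2 * pi})"
        by (rule has_vector_derivative_dird[OF dF])
          (auto simp: has_vector_derivative_def intro!: derivative_eq_intros)
      have 2: "((%\<theta>. \<i> * cis (- \<theta>)) has_vector_derivative cis (- \<theta>)) (at \<theta> within {0..2 * pi})"
        by (auto simp: has_vector_derivative_def intro!: derivative_eq_intros)
      show "((%\<theta>. \<i> * cis (- \<theta>) * F (of_real r * cis \<theta>)) has_vector_derivative V (r, \<theta>)) (at \<theta> within {0..2 * pi})"
        using has_vector_derivative_mult[OF 2 1] by (simp add: V_def m_def add.commute)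
    qed simp
    then show ?thesis by (simp add: integral_unique flip: cis_cnj)
  qed
    then show ?thesis by simp
  qed
  also have "integral (cbox (0, 0) (1, 2 * pi)) U = integral (cbox 0 1) (%r. integral (cbox 0 (2 * pi)) (%\<theta>. U (r, \<theta>)))"
    by (rule integral_prod_continuous[OF cU'])
  also have "\<dots> = integral (cbox 0 (2 * pi)) (%\<theta>. integral (cbox 0 1) (%r. U (r, \<theta>)))"
    by (rule integral_swap_continuous) (simp add: cU')
  also have "(%\<theta>. integral (cbox 0 1) (%r. U (r, \<theta>))) = (%\<theta>. cnj (cis \<theta>) * F (cis \<theta>))"
  proof
    fix \<theta>
    have "((%r. U (r, \<theta>)) has_integral (of_real 1 * (cis (- \<theta>) * F (of_real 1 * cis \<theta>)) - of_real 0 * (cis (- \<theta>) * F (of_real 0 * cis \<theta>)))) {0..1}"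
    proof (rule fundamental_theorem_of_calculus)
      fix r :: real
      have 1: "((%r. F (of_real r * cis \<theta>)) has_vector_derivative dird F (of_real r * cis \<theta>) (cis \<theta>)) (at r within {0..1})"
        by (rule has_vector_derivative_dird[OF dF])
          (auto simp: has_vector_derivative_def scaleR_conv_of_real intro!: derivative_eq_intros)
      have 2: "((%r. of_real r * cis (- \<theta>)) has_vector_derivative cis (- \<theta>)) (at r within {0..1})"
        by (auto simp: has_vector_derivative_def scaleR_conv_of_real intro!: derivative_eq_intros)
      show "((%r. of_real r * (cis (- \<theta>) * F (of_real r * cis \<theta>))) has_vector_derivative U (r, \<theta>)) (at r within {0..1})"
        using has_vector_derivative_mult[OF 2 1] by (simp add: U_def m_def add.commute mult.assoc)
    qed simp
    then show "integral (cbox 0 1) (%r. U (r, \<theta>)) = cnj (cis \<theta>) * F (cis \<theta>)" by (simp add: integral_unique cis_cnj)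
  qed
  finally show ?thesis by (simp add: circ_def)
qed

section \<open>Threefold integrals and the fluxes through the faces of a polydisc\<close>

definition cont3 :: "(complex => complex => complex => complex) => bool" where
  "cont3 f = continuous_on UNIV (%p. f (fst p) (fst (snd p)) (snd (snd p)))"

lemma cont3_compose:
  fixes f :: "complex => complex => complex => complex"
  assumes "cont3 f" "continuous_on S x" "continuous_on S y" "continuous_on S w"
  shows "continuous_on S (%p. f (x p) (y p) (w p))"
  using continuous_on_compose2[OF assms(1)[unfolded cont3_def] continuous_on_Pair[OF assms(2) continuous_on_Pair[OF assms(3,4)]]]
  by simp

lemma cont3_disc:
  assumes "cont3 f"
  shows "continuous_on UNIV (%p. disc (%c. f (fst p) (snd p) c))" "continuous_on UNIV (%a. disc (%b. disc (%c. f a b c)))"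
proof -
  show 1: "continuous_on UNIV (%p. disc (%c. f (fst p) (snd p) c))"
    by (rule continuous_disc) (intro cont3_compose[OF assms] continuous_intros)
  show "continuous_on UNIV (%a. disc (%b. disc (%c. f a b c)))"
    by (rule continuous_disc[OF 1])
qed

definition tri :: "(complex => complex => complex => complex) => complex" where
  "tri f = disc (%a. disc (%b. disc (%c. f a b c)))"

lemma tri_swap12: "cont3 f ==> tri (%a b c. f b a c) = tri f"
  unfolding tri_def by (rule disc_swap[OF cont3_disc(1), symmetric])

lemma tri_swap23:
  assumes "cont3 f" shows "tri (%a b c. f a c b) = tri f"
proof -
  have "disc (%b. disc (%c. f a b c)) = disc (%b. disc (%c. f a c b))" for a
    by (rule disc_swap) (intro cont3_compose[OF assms] continuous_intros)
  then show ?thesis by (simp add: tri_def)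
qed

lemma tri_add:
  assumes "cont3 f" "cont3 g" shows "tri (%a b c. f a b c + g a b c) = tri f + tri g"
proof -
  have c: "continuous_on UNIV (%c. f a b c)" if "cont3 f" for f a b
    by (intro cont3_compose[OF that] continuous_intros)
  have c2: "continuous_on UNIV (%b. disc (%c. f a b c))" if "cont3 f" for f a
    using continuous_on_compose2[OF cont3_disc(1)[OF that] continuous_on_Pair[OF continuous_on_const continuous_on_id], of a UNIV] by simp
  show ?thesis unfolding tri_def
    by (simp add: disc_add[OF c[OF assms(1)] c[OF assms(2)]] disc_add[OF c2[OF assms(1)] c2[OF assms(2)]]
        disc_add[OF cont3_disc(2)[OF assms(1)] cont3_disc(2)[OF assms(2)]])
qed

text \<open>The integral over one face of the unit polydisc, a circle times two discs. The
  distinguished variable comes first; permuting the arguments of \<open>f\<close> gives the other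
  faces.\<close>

definition bdry :: "(complex => complex => complex => complex) => complex" where
  "bdry f = circ (%a. disc (%b. disc (%c. f a b c)))"

text \<open>Fubini moves the differentiated variable innermost, where Stokes on the disc turns it
  into a circle integral, and moves the circle back to the outside.\<close>

lemma tri_stokes:
  assumes f: "cont3 f" "\<And>b c. smooth (%a. f a b c)"
    and df: "cont3 df" "\<And>a b c. df a b c = (dird (%a. f a b c) a 1 - \<i> * dird (%a. f a b c) a \<i>) / 2"
  shows "tri df = bdry (%a b c. cnj a * f a b c) / 2"
proof -
  define h where "h a b c = cnj a * f a b c" for a b c
  have h: "cont3 h" unfolding h_def[abs_def] cont3_def
    by (intro continuous_intros f(1)[unfolded cont3_def])
  have "tri df = tri (%a b c. df a c b)" by (rule tri_swap23[OF df(1), symmetric])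
  also have "\<dots> = tri (%a b c. df b c a)"
    by (rule tri_swap12[symmetric, of "%a b c. df a c b"])
      (unfold cont3_def, intro cont3_compose[OF df(1)] continuous_intros)
  also have "\<dots> = tri (%a b c. df c b a)"
    by (rule tri_swap23[symmetric, of "%a b c. df b c a"])
      (unfold cont3_def, intro cont3_compose[OF df(1)] continuous_intros)
  also have "\<dots> = disc (%c. disc (%b. inverse 2 * circ (%a. h a b c)))"
    unfolding tri_def df(2) h_def disc_stokes[OF f(2)] by (simp only: divide_inverse mult.commute[of _ "inverse 2"])
  also have "\<dots> = inverse 2 * disc (%c. disc (%b. circ (%a. h a b c)))"
    by (simp only: disc_cmult)
  also have "disc (%c. disc (%b. circ (%a. h a b c))) = disc (%c. circ (%a. disc (%b. h a b c)))"
  proof -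
    have "disc (%b. circ (%a. h a b c)) = circ (%a. disc (%b. h a b c))" for c
      by (rule disc_circ_swap) (intro cont3_compose[OF h] continuous_intros)
    then show ?thesis by simp
  qed
  also have "\<dots> = circ (%a. disc (%c. disc (%b. h a b c)))"
  proof (rule disc_circ_swap)
    have "cont3 (%c a b. h a b c)" unfolding cont3_def by (intro cont3_compose[OF h] continuous_intros)
    from cont3_disc(1)[OF this] show "continuous_on UNIV (%p. disc (%b. h (snd p) b (fst p)))" .
  qed
  also have "\<dots> = circ (%a. disc (%b. disc (%c. h a b c)))"
  proof -
    have "disc (%c. disc (%b. h a b c)) = disc (%b. disc (%c. h a b c))" for a
      by (rule disc_swap) (intro cont3_compose[OF h] continuous_intros)
    then show ?thesis by simp
  qed
  finally show ?thesis unfolding bdry_def h_def divide_inverse by (simp only: mult.commute[of _ "inverse 2"])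
qed

lemma disc_cnj: "disc (%z. cnj (F z)) = cnj (disc F)"
  unfolding disc_def by (simp only: integral_cnj complex_cnj_mult complex_cnj_complex_of_real)

lemma tri_cnj: "tri (%a b c. cnj (f a b c)) = cnj (tri f)"
  unfolding tri_def disc_cnj ..

text \<open>The boundary terms of two polydiscs glued along \<open>a' = 1/a\<close>, \<open>c' = w c\<close> with \<open>|w| = 1\<close> cancel.\<close>

lemma bdry_glue:
  assumes f: "cont3 f" "cont3 f'"
    and w: "continuous_on UNIV w" "\<And>a. cmod a = 1 ==> cmod (w a) = 1"
    and glue: "\<And>a b c. cmod a = 1 ==> f' (cnj a) b (w a * c) = - (cnj a)\<^sup>2 * f a b c"
  shows "bdry (%a b c. cnj a * f' a b c) = - bdry (%a b c. cnj a * f a b c)"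
proof -
  have c1: "continuous_on UNIV (%a. disc (%b. disc (%c. cnj a * f' a b c)))"
    by (rule cont3_disc(2)) (unfold cont3_def, intro continuous_intros f(2)[unfolded cont3_def])
  \<comment> \<open>On the unit circle \<open>1/a\<close> is \<open>cnj a\<close>, and reflecting
    the circle preserves its integral.\<close>
  have "bdry (%a b c. cnj a * f' a b c) = circ (%a. disc (%b. disc (%c. cnj (cnj a) * f' (cnj a) b c)))"
    unfolding bdry_def by (rule circ_cnj[OF c1, symmetric])
  also have "\<dots> = circ (%a. disc (%b. disc (%c. - cnj a * f a b c)))"
  proof -
    have "disc (%c. a * f' (cnj a) b c) = disc (%c. - cnj a * f a b c)" if a: "cmod a = 1" for a b
    proof -
      \<comment> \<open>For fixed \<open>a\<close> the factor \<open>w a\<close> is a phase, so the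
        disc in \<open>c\<close> may be rotated by it.\<close>
      have "disc (%c. a * f' (cnj a) b c) = disc (%c. a * f' (cnj a) b (w a * c))"
        by (rule disc_rotate[symmetric, OF _ w(2)[OF a]]) (intro continuous_intros cont3_compose[OF f(2)])
      also have "\<dots> = disc (%c. - cnj a * f a b c)"
      proof -
        have "a * cnj a = 1" using a by (simp add: complex_norm_square[symmetric])
        then have "a * (- (cnj a)\<^sup>2 * x) = - cnj a * x" for x by (simp add: power2_eq_square mult.assoc[symmetric])
        then show ?thesis unfolding glue[OF a] by (simp only:)
      qed
      finally show ?thesis .
    qed
    then show ?thesis by (simp add: circ_def)
  qed
  also have "\<dots> = - bdry (%a b c. cnj a * f a b c)"
    unfolding bdry_def using circ_cmult[of "-1"] disc_cmult[of "-1"] by simp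
  finally show ?thesis .
qed

text \<open>A continuous nonnegative integrand with integral 0 vanishes. Because of the Jacobian
  this gives \<open>F z = 0\<close> only for \<open>z \<noteq> 0\<close>; the centre follows by
  continuity along 1/(n+1).\<close>

lemma disc_zero:
  assumes F: "continuous_on UNIV F" "\<And>z. F z = complex_of_real (\<phi> z)" "\<And>z. \<phi> z \<ge> 0"
  shows "\<exists>d\<ge>0. disc F = of_real d" "disc F = 0 ==> cmod z \<le> 1 ==> F z = 0"
proof -
  define m where "m t = complex_of_real (fst t) * cis (snd t)" for t
  have "continuous_on UNIV (%z. Re (F z))" by (intro continuous_intros F(1))
  then have c\<phi>: "continuous_on UNIV \<phi>" by (simp add: F(2))
  have cm: "continuous_on S m" for S unfolding m_def[abs_def] by (intro continuous_intros)
  have c: "continuous_on S (%t. fst t * \<phi> (m t))" for S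
    using continuous_on_compose2[OF c\<phi> cm] by (auto intro!: continuous_intros)
  have "disc F = integral (cbox (0, 0) (1, 2 * pi)) (%t. complex_of_real (fst t * \<phi> (m t)))"
    by (simp add: disc_def F(2) m_def)
  also have "\<dots> = of_real (integral (cbox (0, 0) (1, 2 * pi)) (%t. fst t * \<phi> (m t)))"
    using integral_linear[OF integrable_continuous[OF c] bounded_linear_of_real] unfolding comp_def .
  finally have d: "disc F = of_real (integral (cbox (0, 0) (1, 2 * pi)) (%t. fst t * \<phi> (m t)))" .
  have pos: "0 \<le> fst t * \<phi> (m t)" if "t \<in> cbox (0, 0) (1, 2 * pi)" for t
    using that F(3) by (auto simp: cbox_Pair_eq)
  show "\<exists>d\<ge>0. disc F = of_real d" unfolding d using integral_nonneg[OF integrable_continuous[OF c] pos] by blast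
  assume 0: "disc F = 0" and z: "cmod z \<le> 1"
  have int0: "integral (cbox (0, 0) (1, 2 * pi)) (%t. fst t * \<phi> (m t)) = 0" using 0 d by simp
  have box: "box (0::real, 0::real) (1, 2 * pi) \<noteq> {}"
  proof -
    have "(1/2, pi) \<in> box (0::real, 0::real) (1, 2 * pi)" by (auto simp: box_def Basis_prod_def)
    then show ?thesis by blast
  qed
  have "fst t * \<phi> (m t) = 0" if "t \<in> cbox (0, 0) (1, 2 * pi)" for t
    using integral_cbox_eq_0_iff[OF c box pos] int0 that by blast
  then have *: "F z = 0" if "cmod z \<le> 1" "z \<noteq> 0" for z
  proof -
    have "(cmod z, Arg2pi z) \<in> cbox (0, 0) (1, 2 * pi)" using that Arg2pi[of z] by (auto simp: cbox_Pair_eq)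
    moreover have "m (cmod z, Arg2pi z) = z" using Arg2pi[of z] by (simp add: m_def is_Arg_def cis_conv_exp)
    ultimately show ?thesis using \<open>\<And>t. t \<in> cbox (0, 0) (1, 2 * pi) ==> fst t * \<phi> (m t) = 0\<close>[of "(cmod z, Arg2pi z)"] that F(2) by simp
  qed
  show "F z = 0"
  proof (cases "z = 0")
    case True
    have "(%n. F (of_real (inverse (real (Suc n))))) \<longlonglongrightarrow> F (of_real 0)"
      by (rule continuous_on_tendsto_compose[OF F(1) tendsto_of_real[OF LIMSEQ_inverse_real_of_nat]]) simp_all
    moreover have "F (of_real (inverse (real (Suc n)))) = 0" for n
    proof (rule *)
      have "cmod (of_real (inverse (real (Suc n)))) = inverse (real (Suc n))" by (simp only: norm_of_real) simp
      also have "\<dots> \<le> 1" by (rule inverse_le_1_iff[THEN iffD2]) simp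
      finally show "cmod (of_real (inverse (real (Suc n)))) \<le> 1" .
      show "complex_of_real (inverse (real (Suc n))) \<noteq> 0" by (simp del: of_nat_Suc)
    qed
    ultimately have "(%n::nat. 0) \<longlonglongrightarrow> F (of_real 0)" by (simp only:)
    then show ?thesis using True by (simp add: LIMSEQ_const_iff)
  qed (use * z in auto)
qed

lemma tri_zero:
  assumes f: "cont3 f" "\<And>a b c. f a b c = complex_of_real (\<phi> a b c)" "\<And>a b c. \<phi> a b c \<ge> 0"
  shows "\<exists>d\<ge>0. tri f = of_real d" "tri f = 0 ==> cmod a \<le> 1 ==> cmod b \<le> 1 ==> cmod c \<le> 1 ==> f a b c = 0"
proof -
  have c: "continuous_on UNIV (%c. f a b c)" for a b
    by (intro cont3_compose[OF f(1)] continuous_intros)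
  have c2: "continuous_on UNIV (%b. disc (%c. f a b c))" for a
    using continuous_on_compose2[OF cont3_disc(1)[OF f(1)] continuous_on_Pair[OF continuous_on_const continuous_on_id], of a UNIV] by simp
  note c1 = cont3_disc(2)[OF f(1)]
  obtain \<phi>2 where p2: "\<And>a b. disc (%c. f a b c) = of_real (\<phi>2 a b)" "\<And>a b. \<phi>2 a b \<ge> 0"
    using disc_zero(1)[OF c f(2,3)] by metis
  obtain \<phi>1 where p1: "\<And>a. disc (%b. disc (%c. f a b c)) = of_real (\<phi>1 a)" "\<And>a. \<phi>1 a \<ge> 0"
    using disc_zero(1)[OF c2 p2] by metis
  show "\<exists>d\<ge>0. tri f = of_real d" unfolding tri_def by (rule disc_zero(1)[OF c1 p1])
  assume *: "tri f = 0" "cmod a \<le> 1" "cmod b \<le> 1" "cmod c \<le> 1"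
  have "disc (%b. disc (%c. f a b c)) = 0" by (rule disc_zero(2)[OF c1 p1 *(1)[unfolded tri_def] *(2)])
  from disc_zero(2)[OF c2 p2 this *(3)] have "disc (%c. f a b c) = 0" .
  from disc_zero(2)[OF c f(2,3) this *(4)] show "f a b c = 0" .
qed

section \<open>The Cauchy-Riemann equation on the fibres\<close>

text \<open>The family p(1/x) exp(-1/x) is closed under differentiation: in y = 1/x the new
  polynomial is y^2 (p - p'). Smoothness at 0 becomes an induction over all
  \<open>p\<close>.\<close>

definition flat_exp :: "real poly => real => real" where
  "flat_exp p x = (if x > 0 then poly p (inverse x) * exp (- inverse x) else 0)"

lemma poly_exp_at_top: "((%y. poly p y * exp (- y)) \<longlongrightarrow> (0::real)) at_top"
proof -
  have "((%y. \<Sum>i\<le>degree p. coeff p i * (y ^ i / exp y)) \<longlongrightarrow> (\<Sum>i\<le>degree p. coeff p i * 0)) at_top"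
    by (intro tendsto_sum tendsto_mult tendsto_const tendsto_power_div_exp_0)
  then show ?thesis
    by (simp add: poly_altdef exp_minus divide_inverse sum_distrib_right mult.assoc)
qed

lemma flat_exp_deriv: "(flat_exp p has_real_derivative flat_exp (pCons 0 (pCons 0 (p - pderiv p))) x) (at x)"
proof -
  consider "x < 0" | "x > 0" | "x = 0" by linarith
  then show ?thesis
  proof cases
    case 1
    have "((%_. 0) has_real_derivative 0) (at x)" by simp
    then have "(flat_exp p has_real_derivative 0) (at x)"
      by (rule has_field_derivative_transform_within_open[of _ _ _ "{..<0}"]) (use 1 in \<open>auto simp: flat_exp_def\<close>)
    then show ?thesis using 1 by (simp add: flat_exp_def)
  next
    case 2
    have "((%x. poly p (inverse x) * exp (- inverse x)) has_real_derivative
        poly p (inverse x) * (exp (- inverse x) * (inverse x)\<^sup>2) + poly (pderiv p) (inverse x) * (- (inverse x)\<^sup>2) * exp (- inverse x)) (at x)"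
      using 2 by (auto intro!: derivative_eq_intros DERIV_chain2[OF poly_DERIV] simp: power2_eq_square)
    then have "(flat_exp p has_real_derivative
        poly p (inverse x) * (exp (- inverse x) * (inverse x)\<^sup>2) + poly (pderiv p) (inverse x) * (- (inverse x)\<^sup>2) * exp (- inverse x)) (at x)"
      by (rule has_field_derivative_transform_within_open[of _ _ _ "{0<..}"]) (use 2 in \<open>auto simp: flat_exp_def\<close>)
    then show ?thesis using 2 by (simp add: flat_exp_def power2_eq_square algebra_simps)
  next
    case 3
    have "((%h. flat_exp p h / h) \<longlongrightarrow> 0) (at 0)"
    proof (rule filterlim_split_at)
      have "eventually (%h::real. h \<in> {..<0}) (at_left 0)" by (simp add: eventually_at_filter)
      then have "eventually (%h. flat_exp p h / h = 0) (at_left 0)" by eventually_elim (simp add: flat_exp_def)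
      then show "((%h. flat_exp p h / h) \<longlongrightarrow> 0) (at_left 0)" by (rule tendsto_eventually)
      have "((%h. poly (pCons 0 p) (inverse h) * exp (- inverse h)) \<longlongrightarrow> 0) (at_right (0::real))"
        by (rule filterlim_compose[OF poly_exp_at_top filterlim_inverse_at_top_right])
      moreover have "eventually (%h::real. h \<in> {0<..}) (at_right 0)" by (simp add: eventually_at_filter)
      then have "eventually (%h. poly (pCons 0 p) (inverse h) * exp (- inverse h) = flat_exp p h / h) (at_right 0)"
        by eventually_elim (simp add: flat_exp_def divide_inverse mult_ac)
      ultimately show "((%h. flat_exp p h / h) \<longlongrightarrow> 0) (at_right 0)" by (rule Lim_transform_eventually)
    qed
    then have "(flat_exp p has_real_derivative 0) (at 0)" by (simp add: DERIV_def flat_exp_def)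
    then show ?thesis using 3 by (simp add: flat_exp_def)
  qed
qed

lemma smooth_flat_exp: "smooth (flat_exp p)"
  unfolding smooth_on_def
proof
  fix k show "Ck_on k UNIV (flat_exp p)"
  proof (induction k arbitrary: p)
    case 0 show ?case by (simp add: continuous_at_imp_continuous_on DERIV_isCont[OF flat_exp_deriv])
  next
    case (Suc k)
    show ?case
      by (rule Ck_on_SucI[OF open_UNIV flat_exp_deriv[unfolded has_field_derivative_def]])
        (intro Ck_on_bilinear[OF open_UNIV bounded_bilinear_mult] Ck_on_const open_UNIV Suc)
  qed
qed

text \<open>As a function of |t|^2 it passes from 1 at 1 to 0 at 2; the two terms of the denominator
  never vanish together.\<close>

definition bump :: "complex => real" where
  "bump t = (let x = (Re t)\<^sup>2 + (Im t)\<^sup>2 in flat_exp 1 (2 - x) / (flat_exp 1 (2 - x) + flat_exp 1 (x - 1)))"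

lemma smooth_bump: "smooth bump"
proof -
  define X where "X t = (Re t)\<^sup>2 + (Im t)\<^sup>2" for t
  have X: "smooth X" unfolding X_def[abs_def]
    by (intro smooth_on_add smooth_on_power smooth_on_linears smooth_on_id open_UNIV)
  have a: "smooth (%t. flat_exp 1 (2 - X t))"
    by (rule smooth_on_compose[of UNIV UNIV "%t. 2 - X t"]) (simp_all add: smooth_flat_exp smooth_on_diff smooth_on_const X)
  have b: "smooth (%t. flat_exp 1 (X t - 1))"
    by (rule smooth_on_compose[of UNIV UNIV "%t. X t - 1"]) (simp_all add: smooth_flat_exp smooth_on_diff smooth_on_const X)
  have "flat_exp 1 (2 - x) + flat_exp 1 (x - 1) \<noteq> 0" for x
    by (auto simp: flat_exp_def add_nonneg_eq_0_iff add_pos_pos[THEN less_imp_neq, symmetric])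
  then show ?thesis unfolding bump_def[abs_def] Let_def X_def[symmetric]
    by (intro smooth_on_divide smooth_on_add a b open_UNIV) auto
qed

lemma bump_1: "cmod t \<le> 1 ==> bump t = 1" and bump_0: "cmod t \<ge> 2 ==> bump t = 0"
proof -
  have e: "(Re t)\<^sup>2 + (Im t)\<^sup>2 = (cmod t)\<^sup>2" by (simp add: cmod_power2)
  show "cmod t \<le> 1 ==> bump t = 1"
    unfolding bump_def Let_def e using power_le_one[of "cmod t" 2] by (auto simp: flat_exp_def)
  assume "cmod t \<ge> 2"
  then have "(cmod t)\<^sup>2 \<ge> 2\<^sup>2" by (intro power_mono) auto
  then show "bump t = 0" unfolding bump_def Let_def e by (simp add: flat_exp_def)
qed

section \<open>The Cauchy transform in the third coordinate\<close>

lemma axis_scaleR: "axis 3 (r *\<^sub>R z) = r *\<^sub>R (axis 3 z :: complex^3)"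
  by (simp add: axis_def vec_eq_iff)

lemma axis_add: "axis 3 (z + w) = (axis 3 z + axis 3 w :: complex^3)"
  by (simp add: axis_def vec_eq_iff)

lemma bounded_linear_axis3: "bounded_linear (%z. axis 3 z :: complex^3)"
  by (simp add: linear_conv_bounded_linear[symmetric] linear_iff axis_scaleR axis_add)

definition polar :: "real \<times> real => complex^3" where "polar t = axis 3 (of_real (fst t) * cis (snd t))"

lemma smooth_polar: "smooth polar"
proof -
  have "smooth (%t::real \<times> real. fst t)" "smooth (%t::real \<times> real. snd t)"
    by (simp_all add: smooth_on_bounded_linear bounded_linear_fst bounded_linear_snd)
  then have "smooth (%t::real \<times> real. of_real (fst t) * cis (snd t))"
    by (intro smooth_on_mult smooth_on_linears(4) smooth_on_cis open_UNIV)
  from smooth_on_linear[OF open_UNIV bounded_linear_axis3 this] show ?thesis by (simp add: polar_def[abs_def])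
qed

lemma smooth_fst_snd: "smooth (fst :: 'a::real_normed_vector \<times> 'b::real_normed_vector => 'a)" "smooth (snd :: 'a \<times> 'b => 'b)"
  by (simp_all add: smooth_on_bounded_linear bounded_linear_fst bounded_linear_snd)

lemma smooth_add_polar: "smooth (%p. fst p + polar (snd p))"
  by (intro smooth_on_add smooth_fst_snd open_UNIV smooth_on_compose[OF open_UNIV open_UNIV _ smooth_polar]) simp

lemma polar_norm: "cmod ((y + polar t) $ 3) \<ge> \<bar>fst t\<bar> - cmod (y $ 3)" "cmod ((y + polar t) $ 3) \<ge> cmod (y $ 3) - \<bar>fst t\<bar>"
proof -
  have "cmod (of_real (fst t) * cis (snd t)) = \<bar>fst t\<bar>" by (simp add: norm_mult)
  then show "cmod ((y + polar t) $ 3) \<ge> \<bar>fst t\<bar> - cmod (y $ 3)" "cmod ((y + polar t) $ 3) \<ge> cmod (y $ 3) - \<bar>fst t\<bar>"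
    using norm_diff_ineq[of "of_real (fst t) * cis (snd t)" "y $ 3"] norm_diff_ineq[of "y $ 3" "of_real (fst t) * cis (snd t)"]
    by (simp_all add: polar_def axis_def add.commute)
qed

lemma integral_cbox_eq_support:
  assumes "\<And>t. t \<in> A ==> t \<notin> B ==> f t = 0" "B \<subseteq> A"
  shows "integral A f = integral B (f :: 'a::euclidean_space => complex)"
proof -
  have "(%x. if x \<in> A then f x else 0) = (%x. if x \<in> B then f x else 0)" using assms by (intro ext) auto
  then show ?thesis by (metis integral_restrict_UNIV)
qed

text \<open>The Cauchy transform, -1/\<pi> times the area integral of \<beta>(y + \<zeta>)/\<zeta>
  with \<zeta> in the third direction. In polar coordinates the Jacobian cancels the singularity;
  the radius is cut at \<open>R\<close> to integrate over a fixed box.\<close>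

definition cauchy_upto :: "real => (complex^3 => complex) => complex^3 => complex" where
  "cauchy_upto R \<beta> y = - integral (cbox (0, 0) (R, 2 * pi)) (%t. \<beta> (y + polar t) * cis (- snd t)) / pi"

lemma smooth_cauchy_upto:
  assumes \<beta>: "smooth \<beta>"
  shows "smooth (cauchy_upto R \<beta>)"
    and "(cauchy_upto R \<beta> has_derivative
      (%v. - integral (cbox (0, 0) (R, 2 * pi)) (%t. dird \<beta> (y + polar t) v * cis (- snd t)) / pi)) (at y)"
proof -
  define \<Phi> where "\<Phi> p = \<beta> (fst p + polar (snd p)) * cis (- snd (snd p))" for p :: "(complex^3) \<times> real \<times> real"
  have sc: "smooth (%p :: (complex^3) \<times> real \<times> real. cis (- snd (snd p)))"
  proof (intro smooth_on_cis smooth_on_minus open_UNIV)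
    show "smooth (%p :: (complex^3) \<times> real \<times> real. snd (snd p))"
      by (intro smooth_on_bounded_linear open_UNIV bounded_linear_compose[OF bounded_linear_snd bounded_linear_snd])
  qed
  have s\<Phi>: "smooth \<Phi>" unfolding \<Phi>_def[abs_def]
    by (intro smooth_on_mult sc open_UNIV smooth_on_compose[OF open_UNIV open_UNIV _ \<beta> smooth_add_polar]) simp
  have cu: "cauchy_upto R \<beta> = (%y. - (1 / pi) * integral (cbox (0, 0) (R, 2 * pi)) (%t. \<Phi> (y, t)))"
    by (simp add: cauchy_upto_def \<Phi>_def fun_eq_iff)
  have s\<Phi>': "smooth_on (UNIV \<times> UNIV) \<Phi>" using s\<Phi> by simp
  show "smooth (cauchy_upto R \<beta>)" unfolding cu
    by (rule smooth_on_mult[OF open_UNIV smooth_on_const[OF open_UNIV] smooth_on_integral[OF open_UNIV open_UNIV _ s\<Phi>']]) simp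
  have "((%y. integral (cbox (0, 0) (R, 2 * pi)) (%t. \<Phi> (y, t))) has_derivative
      (%v. integral (cbox (0, 0) (R, 2 * pi)) (%t. dird \<Phi> (y, t) (v, 0)))) (at y)"
    by (rule has_derivative_integral[OF open_UNIV open_UNIV _ s\<Phi>']) simp_all
  from has_derivative_mult_right[OF this, of "- (1 / pi)"]
  have D: "(cauchy_upto R \<beta> has_derivative (%v. - (1 / pi) * integral (cbox (0, 0) (R, 2 * pi)) (%t. dird \<Phi> (y, t) (v, 0)))) (at y)"
    unfolding cu by simp
  have "dird \<Phi> (y, t) (v, 0) = dird \<beta> (y + polar t) v * cis (- snd t)" for t v
  proof -
    have "((%x. \<beta> (x + polar t) * cis (- snd t)) has_derivative (%v. dird \<beta> (y + polar t) v * cis (- snd t))) (at y)"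
    proof (rule has_derivative_mult_left)
      have "((%x. x + polar t) has_derivative (%v. v)) (at y)" by (auto intro!: derivative_eq_intros)
      from diff_chain_at[OF this smooth_on_has_derivative[OF \<beta> UNIV_I]]
      show "((%x. \<beta> (x + polar t)) has_derivative (%v. dird \<beta> (y + polar t) v)) (at y)" by (simp add: o_def)
    qed
    moreover have "((%x. \<beta> (x + polar t) * cis (- snd t)) has_derivative (%v. dird \<Phi> (y, t) (v, 0))) (at y)"
    proof -
      have "((%x. (x, t)) has_derivative (%v. (v, 0))) (at y)" by (auto intro!: derivative_eq_intros)
      from diff_chain_at[OF this smooth_on_has_derivative[OF s\<Phi> UNIV_I]] show ?thesis by (simp add: o_def \<Phi>_def)
    qed
    ultimately show ?thesis by (blast dest: has_derivative_unique fun_cong)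
  qed
  with D show "(cauchy_upto R \<beta> has_derivative
      (%v. - integral (cbox (0, 0) (R, 2 * pi)) (%t. dird \<beta> (y + polar t) v * cis (- snd t)) / pi)) (at y)" by simp
qed

text \<open>In polar coordinates \<open>(r, \<theta>)\<close> around \<open>y\<close>, \<open>e\<^sup>-\<^sup>i\<^sup>\<theta> \<partial>/\<partial>\<zbar> = (\<partial>\<^sub>r + (i/r) \<partial>\<^sub>\<theta>) / 2\<close>: the radial part
  integrates to \<open>- \<beta> y\<close> and the angular part to \<open>0\<close>.\<close>

lemma pb_cauchy_upto:
  assumes \<beta>: "smooth \<beta>" and supp: "\<And>y. cmod (y $ 3) \<ge> 2 ==> \<beta> y = 0" and R: "R \<ge> cmod (y $ 3) + 2"
  shows "pb 3 (cauchy_upto R \<beta>) y = \<beta> y"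
proof -
  have R0: "R > 0" using R norm_ge_zero[of "y $ 3"] by linarith
  define D where "D t w = dird \<beta> (y + polar t) (axis 3 w)" for t w
  have d\<beta>: "\<beta> differentiable (at z)" for z by (rule smooth_onD[OF \<beta>]) simp
  have cD: "continuous_on S (%t. D t w)" for w S
  proof -
    have "continuous_on UNIV (%z. dird \<beta> z (axis 3 w))" by (rule smooth_on_continuous[OF smooth_on_dird[OF \<beta>]])
    moreover have "continuous_on S (%t. y + polar t)"
      using smooth_on_continuous[OF smooth_polar] by (intro continuous_intros) (rule continuous_on_subset, auto)
    ultimately show ?thesis unfolding D_def by (rule continuous_on_compose2) simp
  qed
  have lin: "D t w = of_real (Re w) * D t 1 + of_real (Im w) * D t \<i>" for t w
  proof -
    interpret linear "dird \<beta> (y + polar t)" by (rule dird_linear[OF d\<beta>])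
    have "w = Re w *\<^sub>R 1 + Im w *\<^sub>R \<i>" by (simp add: complex_eq_iff)
    then have "axis 3 w = Re w *\<^sub>R axis 3 1 + Im w *\<^sub>R (axis 3 \<i> :: complex^3)"
      by (metis axis_add axis_scaleR)
    then show ?thesis unfolding D_def by (simp only: add scaleR) (simp only: scaleR_conv_of_real)
  qed
  define U where "U t = D t (cis (snd t))" for t
  define V where "V t = D t (\<i> * cis (snd t))" for t
  have cU: "continuous_on S U" and cV: "continuous_on S V" for S
    unfolding U_def[abs_def] V_def[abs_def] lin[of _ "cis _"] lin[of _ "\<i> * _"]
    by (intro continuous_intros cD)+
  have UV: "(D t 1 * cis (- snd t) + \<i> * (D t \<i> * cis (- snd t))) = U t + \<i> * V t" for t
    unfolding U_def V_def lin[of t "cis (snd t)"] lin[of t "\<i> * cis (snd t)"]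
    by (simp add: cis.code complex_eq_iff algebra_simps)
  let ?C = "cbox (0, 0) (R, 2 * pi)"
  have iD: "(%t. D t w * cis (- snd t)) integrable_on ?C" for w
    by (intro integrable_continuous continuous_intros cD)
  have "pb 3 (cauchy_upto R \<beta>) y = - (integral ?C (%t. D t 1 * cis (- snd t)) + \<i> * integral ?C (%t. D t \<i> * cis (- snd t))) / (2 * pi)"
    unfolding pd_pb_eqI(2)[OF smooth_cauchy_upto(2)[OF \<beta>]] D_def by (simp add: field_simps)
  also have "integral ?C (%t. D t 1 * cis (- snd t)) + \<i> * integral ?C (%t. D t \<i> * cis (- snd t)) = integral ?C (%t. U t + \<i> * V t)"
    unfolding UV[symmetric] by (subst integral_add) (simp_all add: iD integrable_on_mult_right)
  also have "\<dots> = integral ?C U + \<i> * integral ?C V"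
    by (subst integral_add) (simp_all add: integrable_continuous cU cV integrable_on_mult_right)
  also have "integral ?C V = 0"
  proof -
    have V0: "integral (cbox 0 (2 * pi)) (%\<theta>. V (r, \<theta>)) = 0" if "r \<noteq> 0" for r
    proof -
      have "((%\<theta>. of_real r * V (r, \<theta>)) has_integral (\<beta> (y + polar (r, 2 * pi)) - \<beta> (y + polar (r, 0)))) {0..2 * pi}"
      proof (rule fundamental_theorem_of_calculus)
        fix \<theta> :: real
        have "((%\<theta>. of_real r * cis \<theta>) has_vector_derivative of_real r * (\<i> * cis \<theta>)) (at \<theta> within {0..2 * pi})"
          by (auto simp: has_vector_derivative_def intro!: derivative_eq_intros)
        from bounded_linear.has_vector_derivative[OF bounded_linear_axis3 this]
        have "((%\<theta>. y + polar (r, \<theta>)) has_vector_derivative axis 3 (r *\<^sub>R (\<i> * cis \<theta>))) (at \<theta> within {0..2 * pi})"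
          by (simp add: polar_def has_vector_derivative_add_const scaleR_conv_of_real add.commute[of y])
        from has_vector_derivative_dird[OF d\<beta> this]
        show "((%\<theta>. \<beta> (y + polar (r, \<theta>))) has_vector_derivative of_real r * V (r, \<theta>)) (at \<theta> within {0..2 * pi})"
          unfolding V_def D_def axis_scaleR linear_cmul[OF dird_linear[OF d\<beta>]] by (simp add: scaleR_conv_of_real)
      qed simp
      moreover have "polar (r, 2 * pi) = polar (r, 0)" by (simp add: polar_def)
      ultimately have "integral {0..2 * pi} (%\<theta>. of_real r * V (r, \<theta>)) = 0" by (simp only: integral_unique diff_self)
      then show ?thesis using that by (simp add: box_real(2))
    qed
    have "integral ?C V = integral (cbox 0 R) (%r. integral (cbox 0 (2 * pi)) (%\<theta>. V (r, \<theta>)))"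
      by (rule integral_prod_continuous[OF cV])
    \<comment> \<open>The angular primitive determines only \<open>r\<close> times the inner
      integral; the single radius \<open>r = 0\<close> is discarded as a null set.\<close>
    also have "\<dots> = integral (cbox 0 R) (%r. 0)"
      by (rule integral_spike[of "{0}"]) (auto simp: V0[unfolded box_real])
    finally show ?thesis by simp
  qed
  also have "integral ?C U = - 2 * pi * \<beta> y"
  proof -
    have "integral ?C U = integral (cbox 0 R) (%r. integral (cbox 0 (2 * pi)) (%\<theta>. U (r, \<theta>)))"
      by (rule integral_prod_continuous[OF cU])
    also have "\<dots> = integral (cbox 0 (2 * pi)) (%\<theta>. integral (cbox 0 R) (%r. U (r, \<theta>)))"
      by (rule integral_swap_continuous) (simp add: cU)
    also have "(%\<theta>. integral (cbox 0 R) (%r. U (r, \<theta>))) = (%\<theta>. - \<beta> y)"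
    proof
      fix \<theta>
      have "((%r. U (r, \<theta>)) has_integral (\<beta> (y + polar (R, \<theta>)) - \<beta> (y + polar (0, \<theta>)))) {0..R}"
      proof (rule fundamental_theorem_of_calculus)
        fix r :: real
        have "((%r. of_real r * cis \<theta>) has_vector_derivative cis \<theta>) (at r within {0..R})"
          by (auto simp: has_vector_derivative_def scaleR_conv_of_real intro!: derivative_eq_intros)
        from bounded_linear.has_vector_derivative[OF bounded_linear_axis3 this]
        have "((%r. y + polar (r, \<theta>)) has_vector_derivative axis 3 (cis \<theta>)) (at r within {0..R})"
          by (simp add: polar_def has_vector_derivative_add_const add.commute[of y])
        from has_vector_derivative_dird[OF d\<beta> this]
        show "((%r. \<beta> (y + polar (r, \<theta>))) has_vector_derivative U (r, \<theta>)) (at r within {0..R})"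
          unfolding U_def D_def by simp
      qed (use R0 in simp)
      moreover have "\<beta> (y + polar (R, \<theta>)) = 0" using polar_norm(1)[of "(R, \<theta>)" y] R R0 by (intro supp) simp
      moreover have "polar (0, \<theta>) = 0" by (simp add: polar_def axis_def vec_eq_iff)
      ultimately show "integral (cbox 0 R) (%r. U (r, \<theta>)) = - \<beta> y" by (simp add: integral_unique)
    qed
    finally show ?thesis by (simp add: scaleR_conv_of_real)
  qed
  finally show ?thesis by simp
qed

text \<open>The radius |y_3| + 2 reaches every point of the support of \<beta> as seen from
  \<open>y\<close>. Larger radii give the same value, so near each point the transform agrees with
  \<open>cauchy_upto\<close> for one fixed radius.\<close>

definition cauchy :: "(complex^3 => complex) => complex^3 => complex" where
  "cauchy \<beta> y = cauchy_upto (cmod (y $ 3) + 2) \<beta> y"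

definition upd3 :: "complex^3 => complex => complex^3" where
  "upd3 y t = y + axis 3 (t - y $ 3)"

lemma upd3_nth: "upd3 y t $ i = (if i = 3 then t else y $ i)"
  by (auto simp: upd3_def axis_def)

lemma upd3_self [simp]: "upd3 y (y $ 3) = y" "upd3 (upd3 y t) s = upd3 y s"
  by (simp_all add: vec_eq_iff upd3_nth)

lemma smooth_upd3:
  assumes "open S" "smooth_on S f" "smooth_on S g" shows "smooth_on S (%x. upd3 (f x) (g x))"
proof (rule smooth_on_vec[OF assms(1)])
  fix i show "smooth_on S (%x. upd3 (f x) (g x) $ i)"
    by (cases "i = 3") (simp_all add: upd3_nth assms smooth_on_linears(5))
qed

lemma upd3_derivative:
  assumes "F differentiable (at (upd3 y t))" "pb 3 F (upd3 y t) = 0"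
  shows "((%t. F (upd3 y t)) has_field_derivative pd 3 F (upd3 y t)) (at t)"
proof -
  have "((%t. upd3 y t) has_derivative (%w. axis 3 w)) (at t)"
  proof -
    have "((%t. t - y $ 3) has_derivative (%w. w)) (at t)" by (auto intro!: derivative_eq_intros)
    from bounded_linear.has_derivative[OF bounded_linear_axis3 this]
    show ?thesis unfolding upd3_def by (simp add: has_derivative_add_const add.commute[of y])
  qed
  from diff_chain_at[OF this has_derivative_dird[OF assms(1)]]
  have "((%t. F (upd3 y t)) has_derivative (%w. dird F (upd3 y t) (axis 3 w))) (at t)" by (simp add: o_def)
  moreover have "dird F (upd3 y t) (axis 3 w) = pd 3 F (upd3 y t) * w" for w
    unfolding dird_pd_pb[OF assms(1)] by (simp add: sum_3 assms(2) axis_def)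
  ultimately show ?thesis by (simp add: has_field_derivative_def)
qed

definition inv3 :: "complex^3 => complex^3" where "inv3 y = upd3 y (inverse (y $ 3))"

lemma inv3_nth: "inv3 y $ i = (if i = 3 then inverse (y $ 3) else y $ i)"
  by (simp add: inv3_def upd3_nth)

lemma inv3_inv3 [simp]: "inv3 (inv3 y) = y" by (simp add: vec_eq_iff inv3_nth)

lemma open_off_zero: "open off_zero"
  unfolding off_zero_def by (intro open_Collect_neq continuous_intros)

lemma smooth_inv3: "smooth_on off_zero inv3"
  unfolding inv3_def[abs_def]
  by (intro smooth_upd3 smooth_on_id smooth_on_inverse smooth_on_nth open_off_zero) (auto simp: off_zero_def)

lemma smooth_comp_inv3: "smooth f ==> smooth_on off_zero (%y. f (inv3 y))"
  by (rule smooth_on_compose[OF open_off_zero open_UNIV _ _ smooth_inv3]) simp_all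

lemma pb_inv3:
  assumes "y $ 3 \<noteq> 0" "F differentiable (at (inv3 y))"
  shows "pb 3 (%y. F (inv3 y)) y = - pb 3 F (inv3 y) * (cnj (inverse (y $ 3)))\<^sup>2"
    "j \<noteq> 3 ==> pb j (%y. F (inv3 y)) y = pb j F (inv3 y)"
proof -
  define T' where "T' v = (\<chi> i. if i = 3 then - (inverse (y $ 3))\<^sup>2 * v $ 3 else v $ i)" for v :: "complex^3"
  have T: "(inv3 has_derivative T') (at y)"
  proof (rule has_derivative_vec_nth)
    fix i
    have n: "((%x. x $ j) has_derivative (%v. v $ j)) (at y)" for j :: 3
      by (rule bounded_linear_imp_has_derivative[OF bounded_linear_vec_nth])
    show "((%x. inv3 x $ i) has_derivative (%v. T' v $ i)) (at y)"
    proof (cases "i = 3")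
      case True
      then show ?thesis using Deriv.has_derivative_inverse[OF assms(1) n[of 3]]
        by (simp add: inv3_nth T'_def power2_eq_square mult_ac)
    qed (simp add: inv3_nth T'_def n)
  qed
  have J: "T' (J v) = J (T' v)" for v by (simp add: T'_def J_nth vec_eq_iff)
  show "pb 3 (%y. F (inv3 y)) y = - pb 3 F (inv3 y) * (cnj (inverse (y $ 3)))\<^sup>2"
    unfolding pd_compose_holo(2)[OF T J assms(2)] by (simp add: sum_3 T'_def axis_def)
  show "j \<noteq> 3 ==> pb j (%y. F (inv3 y)) y = pb j F (inv3 y)"
    unfolding pd_compose_holo(2)[OF T J assms(2)] using exhaust_3[of j] by (auto simp: sum_3 T'_def axis_def)
qed

context
  fixes \<beta> :: "complex^3 => complex"
  assumes \<beta>: "smooth \<beta>" and supp: "\<And>y. cmod (y $ 3) \<ge> 2 ==> \<beta> y = 0"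
begin

lemma cauchy_upto_eq:
  assumes "R \<ge> cmod (y $ 3) + 2" shows "cauchy_upto R \<beta> y = cauchy \<beta> y"
proof -
  have "integral (cbox (0, 0) (R, 2 * pi)) (%t. \<beta> (y + polar t) * cis (- snd t))
      = integral (cbox (0, 0) (cmod (y $ 3) + 2, 2 * pi)) (%t. \<beta> (y + polar t) * cis (- snd t))"
  proof (rule integral_cbox_eq_support)
    fix t :: "real \<times> real" assume "t \<in> cbox (0, 0) (R, 2 * pi)" "t \<notin> cbox (0, 0) (cmod (y $ 3) + 2, 2 * pi)"
    then have "\<bar>fst t\<bar> \<ge> cmod (y $ 3) + 2" by (auto simp: cbox_Pair_eq)
    then have "\<beta> (y + polar t) = 0" using polar_norm(1)[of t y] by (intro supp) simp
    then show "\<beta> (y + polar t) * cis (- snd t) = 0" by simp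
  qed (use assms in \<open>auto simp: cbox_Pair_eq\<close>)
  then show ?thesis by (simp add: cauchy_def cauchy_upto_def)
qed

lemma cauchy_local:
  fixes x :: "complex^3"
  defines "N \<equiv> {y. cmod (y $ 3) < cmod (x $ 3) + 1}"
  shows "open N" "x \<in> N" "\<And>y. y \<in> N ==> cauchy \<beta> y = cauchy_upto (cmod (x $ 3) + 3) \<beta> y"
proof -
  show "open N" unfolding N_def by (intro open_Collect_less continuous_intros)
  show "x \<in> N" by (simp add: N_def)
  fix y assume "y \<in> N" then show "cauchy \<beta> y = cauchy_upto (cmod (x $ 3) + 3) \<beta> y"
    by (intro cauchy_upto_eq[symmetric]) (simp add: N_def)
qed

lemma smooth_cauchy: "smooth (cauchy \<beta>)"
proof (rule smooth_on_locally)
  fix y0 :: "complex^3"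
  note l = cauchy_local[where x = y0]
  have "smooth_on {y. cmod (y $ 3) < cmod (y0 $ 3) + 1} (cauchy \<beta>)"
    by (subst smooth_on_cong[OF l(1) l(3)]) (auto intro: smooth_on_subset[OF smooth_cauchy_upto(1)[OF \<beta>]])
  then show "\<exists>T. open T \<and> y0 \<in> T \<and> smooth_on T (cauchy \<beta>)" using l(1,2) by blast
qed

lemma pb_cauchy: "pb 3 (cauchy \<beta>) y = \<beta> y"
proof -
  note l = cauchy_local[where x = y]
  have "pb 3 (cauchy \<beta>) y = pb 3 (cauchy_upto (cmod (y $ 3) + 3) \<beta>) y"
    by (rule pd_cong_open(2)[OF l(1,2)]) (rule l(3))
  also have "\<dots> = \<beta> y" by (rule pb_cauchy_upto[OF \<beta> supp]) simp_all
  finally show ?thesis .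
qed

text \<open>Seen from a point with |t| > 2, the support of \<beta> lies between the radii |t| - 2
  and |t| + 2. In polar coordinates that box has area 8 \<pi> for every \<open>t\<close>.\<close>

lemma cauchy_bounded: "\<exists>B. \<forall>t. cmod t > 2 \<longrightarrow> cmod (cauchy \<beta> (upd3 y t)) \<le> B"
proof -
  have cu: "continuous_on S (%t. upd3 y t)" for S
    unfolding upd3_def by (intro continuous_intros linear_continuous_on_compose[OF _ bounded_linear.linear[OF bounded_linear_axis3]])
  have "compact ((%t. \<beta> (upd3 y t)) ` cball 0 2)"
    using continuous_on_compose2[OF smooth_on_continuous[OF \<beta>] cu] by (intro compact_continuous_image) auto
  then obtain B where B: "\<And>t. t \<in> cball 0 2 ==> cmod (\<beta> (upd3 y t)) \<le> B"
    using compact_imp_bounded bounded_iff by (metis imageI)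
  have B0: "B \<ge> 0" using B[of 0] norm_ge_zero order_trans by (metis centre_in_cball zero_le_numeral)
  have B': "cmod (\<beta> (upd3 y t)) \<le> B" for t
    using B[of t] supp[of "upd3 y t"] B0 by (cases "cmod t \<le> 2") (auto simp: upd3_nth)
  have "cmod (cauchy \<beta> (upd3 y t)) \<le> B * (8 * pi) / pi" if t: "cmod t > 2" for t
  proof -
    define f where "f p = \<beta> (upd3 y t + polar p) * cis (- snd p)" for p
    have "integral (cbox (0, 0) (cmod t + 2, 2 * pi)) f = integral (cbox (cmod t - 2, 0) (cmod t + 2, 2 * pi)) f"
    proof (rule integral_cbox_eq_support)
      fix p :: "real \<times> real" assume "p \<in> cbox (0, 0) (cmod t + 2, 2 * pi)" "p \<notin> cbox (cmod t - 2, 0) (cmod t + 2, 2 * pi)"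
      then have "\<bar>fst p\<bar> \<le> cmod t - 2" by (auto simp: cbox_Pair_eq)
      then have "\<beta> (upd3 y t + polar p) = 0" using polar_norm(2)[of "upd3 y t" p] by (intro supp) (simp add: upd3_nth)
      then show "f p = 0" by (simp add: f_def)
    qed (use t in \<open>auto simp: cbox_Pair_eq\<close>)
    moreover have "cmod (integral (cbox (cmod t - 2, 0) (cmod t + 2, 2 * pi)) f) \<le> B * Henstock_Kurzweil_Integration.content (cbox (cmod t - 2, 0) (cmod t + 2, 2 * pi))"
    proof (rule has_integral_bound[OF B0 integrable_integral])
      have "continuous_on S (%p. upd3 y t + polar p)" for S
        using continuous_on_subset[OF smooth_on_continuous[OF smooth_polar]] by (intro continuous_intros) auto
      from continuous_on_compose2[OF smooth_on_continuous[OF \<beta>] this]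
      show "f integrable_on cbox (cmod t - 2, 0) (cmod t + 2, 2 * pi)"
        unfolding f_def[abs_def] by (intro integrable_continuous continuous_intros) auto
      fix p
      have "upd3 y t + polar p = upd3 y ((upd3 y t + polar p) $ 3)" by (auto simp: vec_eq_iff upd3_nth polar_def axis_def)
      then show "cmod (f p) \<le> B" using B' by (metis f_def mult.right_neutral norm_cis norm_mult)
    qed
    moreover have "Henstock_Kurzweil_Integration.content (cbox (cmod t - 2, 0) (cmod t + 2, 2 * pi)) = 8 * pi" by (simp add: content_Pair)
    ultimately have "cmod (integral (cbox (0, 0) (cmod t + 2, 2 * pi)) f) \<le> B * (8 * pi)" by simp
    then have "cmod (integral (cbox (0, 0) (cmod t + 2, 2 * pi)) f) / pi \<le> B * (8 * pi) / pi"
      by (rule divide_right_mono) simp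
    then show ?thesis
      by (simp add: cauchy_def cauchy_upto_def f_def[symmetric] upd3_nth norm_divide)
  qed
  then show ?thesis by blast
qed

definition circle4 :: "real => complex" where "circle4 x = circlepath 0 (1/4) x"

lemma circle4: "cmod (circle4 x) = 1/4"
  by (simp add: circle4_def circlepath norm_mult)

text \<open>The continuation of the Cauchy transform over the point at infinity by Cauchy's integral
  formula in s = 1/t, on the circle of radius 1/4 parametrised by [0, 1]. As a parameter integral it
  is jointly smooth in all coordinates.\<close>

definition ext :: "complex^3 => complex" where
  "ext y = integral (cbox 0 1) (%x. cauchy \<beta> (upd3 y (inverse (circle4 x))) * (circle4 x / (circle4 x - y $ 3)))"

lemma smooth_ext: "smooth_on {y. cmod (y $ 3) < 1/4} ext"
proof -
  define S where "S = {y::complex^3. cmod (y $ 3) < 1/4}"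
  have S: "open S" unfolding S_def by (intro open_Collect_less continuous_intros)
  have o: "open (S \<times> (UNIV::real set))" by (rule open_Times[OF S open_UNIV])
  have f1: "smooth_on (S \<times> (UNIV::real set)) fst" and f2: "smooth_on (S \<times> (UNIV::real set)) snd"
    by (rule smooth_on_subset[OF smooth_fst_snd(1)] smooth_on_subset[OF smooth_fst_snd(2)]; simp)+
  have c4: "circle4 = (%x. (1/4) * cis (2 * pi * x))"
    by (simp add: circle4_def circlepath fun_eq_iff cis_conv_exp mult_ac)
  have sc: "smooth_on (S \<times> (UNIV::real set)) (%p. circle4 (snd p))"
    unfolding c4 by (intro smooth_on_mult smooth_on_const smooth_on_cis f2 o)
  have nz: "circle4 x \<noteq> 0" for x using circle4[of x] by auto
  have "smooth_on (S \<times> (UNIV::real set)) (%p. cauchy \<beta> (upd3 (fst p) (inverse (circle4 (snd p)))))"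
    by (rule smooth_on_compose[OF o open_UNIV _ smooth_cauchy]) (simp_all add: smooth_upd3 o f1 smooth_on_inverse sc nz)
  moreover have "circle4 (snd p) - fst p $ 3 \<noteq> 0" if "p \<in> S \<times> (UNIV::real set)" for p
    using that circle4[of "snd p"] by (auto simp: S_def)
  ultimately have "smooth_on (S \<times> (UNIV::real set)) (%p. cauchy \<beta> (upd3 (fst p) (inverse (circle4 (snd p)))) * (circle4 (snd p) / (circle4 (snd p) - fst p $ 3)))"
    by (intro smooth_on_mult smooth_on_divide smooth_on_diff smooth_on_linears(5) sc f1 o)
  from smooth_on_integral[OF S open_UNIV _ this, of 0 1] show ?thesis
    unfolding S_def[symmetric] ext_def[abs_def] by simp
qed

text \<open>Where |t| \<ge> 2 the function \<beta> vanishes, so the transform is holomorphic in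
  \<open>t\<close>. In s = 1/t it is holomorphic and bounded on a punctured disc of radius 1/2,
  hence extends, and Cauchy's formula returns its values.\<close>

lemma ext_eq:
  assumes y: "y $ 3 \<noteq> 0" "cmod (y $ 3) < 1/4"
  shows "ext y = cauchy \<beta> (inv3 y)"
proof -
  define F where "F s = cauchy \<beta> (upd3 y (inverse s))" for s
  have hol: "F holomorphic_on ball 0 (1/2) - {0}"
  proof (rule holomorphic_onI)
    fix s assume s: "s \<in> ball 0 (1/2) - {0::complex}"
    then have "cmod (inverse s) \<ge> 2" by (auto simp: norm_inverse norm_divide field_simps)
    then have "pb 3 (cauchy \<beta>) (upd3 y (inverse s)) = 0" unfolding pb_cauchy by (intro supp) (simp add: upd3_nth)
    then have "((%t. cauchy \<beta> (upd3 y t)) has_field_derivative pd 3 (cauchy \<beta>) (upd3 y (inverse s))) (at (inverse s))"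
      by (intro upd3_derivative smooth_onD[OF smooth_cauchy]) simp_all
    from DERIV_chain2[OF this DERIV_inverse[of s]] s
    have "(F has_field_derivative pd 3 (cauchy \<beta>) (upd3 y (inverse s)) * - (inverse s ^ Suc (Suc 0))) (at s)"
      unfolding F_def by simp
    then show "F field_differentiable (at s within ball 0 (1/2) - {0})"
      using field_differentiable_at_within field_differentiable_def by blast
  qed
  obtain B where B: "\<And>t. cmod t > 2 ==> cmod (cauchy \<beta> (upd3 y t)) \<le> B" using cauchy_bounded[of y] by blast
  have "eventually (%s::complex. s \<in> ball 0 (1/2) - {0}) (at 0)"
    by (rule eventually_at_in_open) auto
  then have "eventually (%s. cmod (F s) \<le> B) (at 0)"
  proof eventually_elim
    case (elim s)
    then show ?case unfolding F_def by (intro B) (auto simp: norm_inverse norm_divide field_simps)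
  qed
  then obtain g where g: "g holomorphic_on ball 0 (1/2)" "\<And>s. s \<in> ball 0 (1/2) - {0} ==> g s = F s"
    using holomorphic_on_extend_bounded[OF hol] by auto
  have "((%u. g u / (u - y $ 3)) has_contour_integral (2 * of_real pi * \<i> * g (y $ 3))) (circlepath 0 (1/4))"
    by (rule Cauchy_integral_circlepath_simple[OF holomorphic_on_subset[OF g(1)]]) (use y in auto)
  then have "((%x. g (circle4 x) / (circle4 x - y $ 3) * (2 * pi * \<i> * circle4 x)) has_integral (2 * of_real pi * \<i> * g (y $ 3))) {0..1}"
    unfolding has_contour_integral_def circle4_def

  proof (rule has_integral_eq[rotated])
    fix x :: real assume "x \<in> {0..1}"
    then show "g (circlepath 0 (1/4) x) / (circlepath 0 (1/4) x - y $ 3) * vector_derivative (circlepath 0 (1/4)) (at x within {0..1})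
        = g (circlepath 0 (1/4) x) / (circlepath 0 (1/4) x - y $ 3) * (2 * pi * \<i> * circlepath 0 (1/4) x)"
      using vector_derivative_circlepath01[of x 0 "1/4"] by (simp only: atLeastAtMost_iff) (simp add: circlepath)
  qed
  from has_integral_mult_right[OF this, of "inverse (2 * of_real pi * \<i>)"]
  have "((%x. g (circle4 x) * (circle4 x / (circle4 x - y $ 3))) has_integral g (y $ 3)) {0..1}"
    by (simp add: field_simps)
  moreover have "g (circle4 x) = F (circle4 x)" for x
    using circle4[of x] by (intro g(2)) auto
  ultimately have "ext y = g (y $ 3)" unfolding ext_def F_def by (simp add: integral_unique)
  also have "\<dots> = F (y $ 3)" using y by (intro g(2)) auto
  finally show ?thesis by (simp add: F_def inv3_def)
qed

definition cauchy_inv :: "complex^3 => complex" where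
  "cauchy_inv y = (if cmod (y $ 3) < 1/4 then ext y else cauchy \<beta> (inv3 y))"

lemma cauchy_inv_eq: "y $ 3 \<noteq> 0 ==> cauchy_inv y = cauchy \<beta> (inv3 y)"
  by (simp add: cauchy_inv_def ext_eq)

lemma smooth_cauchy_inv: "smooth cauchy_inv"
proof (rule smooth_on_locally)
  fix y :: "complex^3"
  show "\<exists>T. open T \<and> y \<in> T \<and> smooth_on T cauchy_inv"
  proof (cases "y $ 3 = 0")
    case True
    have S: "open {y::complex^3. cmod (y $ 3) < 1/4}" by (intro open_Collect_less continuous_intros)
    have "smooth_on {y. cmod (y $ 3) < 1/4} cauchy_inv"
      by (subst smooth_on_cong[OF S, of _ ext]) (use smooth_ext in \<open>simp_all add: cauchy_inv_def\<close>)
    then show ?thesis using S True by (intro exI[of _ "{y. cmod (y $ 3) < 1/4}"]) simp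
  next
    case False
    have "smooth_on off_zero cauchy_inv"
      by (subst smooth_on_cong[OF open_off_zero, of _ "%y. cauchy \<beta> (inv3 y)"])
        (simp_all add: cauchy_inv_eq off_zero_def smooth_comp_inv3[OF smooth_cauchy, unfolded off_zero_def])
    then show ?thesis using open_off_zero False by (intro exI[of _ off_zero]) (simp add: off_zero_def)
  qed
qed

end

text \<open>Cut off, and solve near \<open>0\<close> and near \<open>\<infinity>\<close> by the Cauchy transform.\<close>

lemma dbar_fibres:
  assumes a1: "smooth a1" and a2: "smooth a2"
    and rel: "\<And>y. y $ 3 \<noteq> 0 ==> a1 y = - a2 (inv3 y) * (cnj (inverse (y $ 3)))\<^sup>2"
  obtains F1 F2 where "smooth F1" "smooth F2" "\<And>y. pb 3 F1 y = a1 y" "\<And>y. pb 3 F2 y = a2 y"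
    "\<And>y. y $ 3 \<noteq> 0 ==> F1 y = F2 (inv3 y)" "\<And>y. y $ 3 = 0 ==> F2 y = 0"
proof -
  have n3: "smooth_on S (%y::complex^3. y $ 3)" if "open S" for S by (rule smooth_on_nth[OF that])
  have sb: "smooth_on S (%y. complex_of_real (bump (f y)))" if "open S" "smooth_on S f" for S and f :: "complex^3 => complex"
    by (intro smooth_on_linears(4) smooth_on_compose[OF that(1) open_UNIV _ smooth_bump that(2)] that(1)) simp
  define \<beta>1 where "\<beta>1 y = of_real (bump (y $ 3)) * a1 y" for y
  \<comment> \<open>The complementary cutoff in the inverted coordinate. At \<open>y $ 3 = 0\<close>
    the convention \<open>inverse 0 = 0\<close> would make the factor \<open>1 - bump 0 = 0\<close>,
    while near 0 it is 1; hence the case distinction.\<close>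
  define \<beta>2 where "\<beta>2 y = (if y $ 3 = 0 then a2 y else (1 - of_real (bump (inverse (y $ 3)))) * a2 y)" for y
  have \<beta>1: "smooth \<beta>1" unfolding \<beta>1_def[abs_def] by (intro smooth_on_mult sb n3 a1 open_UNIV)
  have supp1: "\<beta>1 y = 0" if "cmod (y $ 3) \<ge> 2" for y using that by (simp add: \<beta>1_def bump_0)
  have supp2: "\<beta>2 y = 0" if "cmod (y $ 3) \<ge> 2" for y
  proof -
    have "cmod (inverse (y $ 3)) \<le> 1" using that by (simp add: norm_inverse inverse_le_1_iff)
    then show ?thesis using that by (auto simp: \<beta>2_def bump_1)
  qed
  have \<beta>2: "smooth \<beta>2"
  proof (rule smooth_on_locally)
    fix y :: "complex^3"
    show "\<exists>T. open T \<and> y \<in> T \<and> smooth_on T \<beta>2"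
    proof (cases "y $ 3 = 0")
      case True
      define S where "S = {y::complex^3. cmod (y $ 3) < 1/2}"
      have S: "open S" unfolding S_def by (intro open_Collect_less continuous_intros)
      have "\<beta>2 x = a2 x" if "x \<in> S" for x
      proof (cases "x $ 3 = 0")
        case False
        then have "cmod (inverse (x $ 3)) \<ge> 2" using that by (simp add: S_def norm_inverse norm_divide field_simps)
        then show ?thesis by (simp add: \<beta>2_def bump_0)
      qed (simp add: \<beta>2_def)
      then have "smooth_on S \<beta>2" using smooth_on_cong[OF S, of \<beta>2 a2] smooth_on_subset[OF a2] by auto
      then show ?thesis using S True by (intro exI[of _ S]) (simp add: S_def)
    next
      case False
      have "smooth_on off_zero (%y. (1 - of_real (bump (inverse (y $ 3)))) * a2 y)"
        by (intro smooth_on_mult smooth_on_diff smooth_on_const sb smooth_on_inverse n3 open_off_zero smooth_on_subset[OF a2])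
          (auto simp: off_zero_def)
      then have "smooth_on off_zero \<beta>2"
        by (subst smooth_on_cong[OF open_off_zero]) (auto simp: \<beta>2_def off_zero_def)
      then show ?thesis using open_off_zero False by (intro exI[of _ off_zero]) (simp add: off_zero_def)
    qed
  qed
  have sum\<beta>: "\<beta>1 y - \<beta>2 (inv3 y) * (cnj (inverse (y $ 3)))\<^sup>2 = a1 y" "\<beta>2 (inv3 y) * (cnj (inverse (y $ 3)))\<^sup>2 = - (a1 y - \<beta>1 y)" if "y $ 3 \<noteq> 0" for y
    using that rel[OF that] by (simp_all add: \<beta>1_def \<beta>2_def inv3_nth algebra_simps)
  have rel': "a2 y = - a1 (inv3 y) * (cnj (inverse (y $ 3)))\<^sup>2" if "y $ 3 \<noteq> 0" for y
    using rel[of "inv3 y"] that by (simp add: inv3_nth power_inverse)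
  have sum\<beta>2: "\<beta>2 y - \<beta>1 (inv3 y) * (cnj (inverse (y $ 3)))\<^sup>2 = a2 y" if "y $ 3 \<noteq> 0" for y
    using that rel'[OF that] by (simp add: \<beta>1_def \<beta>2_def inv3_nth algebra_simps)
  have pbi: "pb 3 (cauchy_inv \<beta>) y = (if y $ 3 = 0 then 0 else - \<beta> (inv3 y) * (cnj (inverse (y $ 3)))\<^sup>2)"
    if \<beta>: "smooth \<beta>" and supp: "\<And>y. cmod (y $ 3) \<ge> 2 ==> \<beta> y = 0" for \<beta> y
  proof -
    have off: "pb 3 (cauchy_inv \<beta>) x = - \<beta> (inv3 x) * (cnj (inverse (x $ 3)))\<^sup>2" if x: "x $ 3 \<noteq> 0" for x
    proof -
      have "pb 3 (cauchy_inv \<beta>) x = pb 3 (%y. cauchy \<beta> (inv3 y)) x"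
        by (rule pd_cong_open(2)[OF open_off_zero]) (use x cauchy_inv_eq[OF \<beta> supp] in \<open>auto simp: off_zero_def\<close>)
      also have "\<dots> = - \<beta> (inv3 x) * (cnj (inverse (x $ 3)))\<^sup>2"
        using pb_inv3(1)[OF x smooth_onD[OF smooth_cauchy[OF \<beta> supp]]] pb_cauchy[OF \<beta> supp] by simp
      finally show ?thesis .
    qed
    show ?thesis
    proof (cases "y $ 3 = 0")
      case True
      \<comment> \<open>At infinity the derivative is found as a limit: it vanishes at all nearby
        finite points because they are outside the support of \<beta>.\<close>
      have "continuous_on UNIV (%t. pb 3 (cauchy_inv \<beta>) (upd3 y t))"
        by (rule smooth_on_continuous[OF smooth_on_compose[OF open_UNIV open_UNIV _ smooth_on_pb[OF open_UNIV smooth_cauchy_inv[OF \<beta> supp]] smooth_upd3]])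
          (auto intro: smooth_on_const smooth_on_id)
      then have "isCont (%t. pb 3 (cauchy_inv \<beta>) (upd3 y t)) 0"
        by (simp add: continuous_on_eq_continuous_at)
      then have lim: "((%t. pb 3 (cauchy_inv \<beta>) (upd3 y t)) \<longlongrightarrow> pb 3 (cauchy_inv \<beta>) y) (at 0)"
        using True upd3_self(1)[of y] by (simp add: isCont_def)
      have "\<forall>\<^sub>F t in at 0. pb 3 (cauchy_inv \<beta>) (upd3 y t) = 0"
        unfolding eventually_at
      proof (intro exI[of _ "1/2"] conjI ballI impI)
        fix t :: complex assume t: "t \<noteq> 0 \<and> dist t 0 < 1/2"
        then have "\<beta> (inv3 (upd3 y t)) = 0" by (intro supp) (simp add: inv3_nth upd3_nth norm_inverse norm_divide field_simps)
        then show "pb 3 (cauchy_inv \<beta>) (upd3 y t) = 0" using off[of "upd3 y t"] t by (simp add: upd3_nth)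
      qed simp
      from tendsto_eventually[OF this] lim show ?thesis using True tendsto_unique[OF at_neq_bot] by auto
    qed (simp add: off)
  qed
  define f1 where "f1 y = cauchy \<beta>1 y + cauchy_inv \<beta>2 y" for y
  define f2 where "f2 y = cauchy \<beta>2 y + cauchy_inv \<beta>1 y" for y
  have s: "smooth (cauchy \<beta>1)" "smooth (cauchy \<beta>2)" "smooth (cauchy_inv \<beta>1)" "smooth (cauchy_inv \<beta>2)"
    by (rule smooth_cauchy[OF \<beta>1], erule supp1, rule smooth_cauchy[OF \<beta>2], erule supp2,
        rule smooth_cauchy_inv[OF \<beta>1], erule supp1, rule smooth_cauchy_inv[OF \<beta>2], erule supp2)
  have pc: "pb 3 (cauchy \<beta>1) y = \<beta>1 y" "pb 3 (cauchy \<beta>2) y = \<beta>2 y" for y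
    by (rule pb_cauchy[OF \<beta>1], erule supp1, rule pb_cauchy[OF \<beta>2], erule supp2)
  have pi: "pb 3 (cauchy_inv \<beta>1) y = (if y $ 3 = 0 then 0 else - \<beta>1 (inv3 y) * (cnj (inverse (y $ 3)))\<^sup>2)"
    "pb 3 (cauchy_inv \<beta>2) y = (if y $ 3 = 0 then 0 else - \<beta>2 (inv3 y) * (cnj (inverse (y $ 3)))\<^sup>2)" for y
    by (rule pbi[OF \<beta>1], erule supp1, rule pbi[OF \<beta>2], erule supp2)
  have ci: "cauchy_inv \<beta>1 y = cauchy \<beta>1 (inv3 y)" "cauchy_inv \<beta>2 y = cauchy \<beta>2 (inv3 y)" if "y $ 3 \<noteq> 0" for y
    by (rule cauchy_inv_eq[OF \<beta>1 _ that], erule supp1, rule cauchy_inv_eq[OF \<beta>2 _ that], erule supp2)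
  have sf: "smooth f1" "smooth f2" unfolding f1_def[abs_def] f2_def[abs_def] by (rule smooth_on_add[OF open_UNIV s(1) s(4)] smooth_on_add[OF open_UNIV s(2) s(3)])+
  have d: "f differentiable (at y)" if "smooth f" for f :: "complex^3 => complex" and y
    by (rule smooth_onD[OF that]) simp
  have p1: "pb 3 f1 y = a1 y" for y
  proof -
    have "\<beta>1 y = a1 y" if "y $ 3 = 0" using that by (simp add: \<beta>1_def bump_1)
    then show ?thesis unfolding f1_def[abs_def] pd_add(2)[OF d[OF s(1)] d[OF s(4)]] pc pi
      using sum\<beta>(1)[of y] by simp
  qed
  have p2: "pb 3 f2 y = a2 y" for y
  proof -
    have "\<beta>2 y = a2 y" if "y $ 3 = 0" using that by (simp add: \<beta>2_def)
    then show ?thesis unfolding f2_def[abs_def] pd_add(2)[OF d[OF s(2)] d[OF s(3)]] pc pi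
      using sum\<beta>2[of y] by simp
  qed
  \<comment> \<open>The value of \<open>f2\<close> at infinity, constant along each fibre.
    Subtracting it normalises the solution and does not change its \<open>pb 3\<close>.\<close>
  define n where "n y = f2 (upd3 y 0)" for y
  have sn: "smooth n" unfolding n_def[abs_def]
    by (rule smooth_on_compose[OF open_UNIV open_UNIV _ sf(2) smooth_upd3]) (auto intro: smooth_on_const smooth_on_id)
  have pn: "pb 3 n y = 0" for y
  proof -
    have e: "n (y + r *\<^sub>R axis 3 w) = n y" for r w unfolding n_def by (rule arg_cong[of _ _ f2]) (simp add: vec_eq_iff upd3_nth axis_def)
    have "dird n y (axis 3 w) = 0" for w
    proof -
      have "((%r. y + r *\<^sub>R axis 3 w) has_vector_derivative axis 3 w) (at 0)"
        unfolding has_vector_derivative_def by (auto intro!: derivative_eq_intros)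
      from has_vector_derivative_dird[OF d[OF sn] this]
      have "((%r. n (y + r *\<^sub>R axis 3 w)) has_vector_derivative dird n y (axis 3 w)) (at 0)" by simp
      then show ?thesis unfolding e by (metis has_vector_derivative_const vector_derivative_unique_at)
    qed
    then show ?thesis unfolding pb_def by simp
  qed
  show thesis
  proof (rule that[of "%y. f1 y - n y" "%y. f2 y - n y"])
    show "smooth (%y. f1 y - n y)" "smooth (%y. f2 y - n y)" by (intro smooth_on_diff sf sn open_UNIV)+
    show "pb 3 (%y. f1 y - n y) y = a1 y" "pb 3 (%y. f2 y - n y) y = a2 y" for y
      unfolding pd_diff(2)[OF d[OF sf(1)] d[OF sn]] pd_diff(2)[OF d[OF sf(2)] d[OF sn]] by (simp_all add: p1 p2 pn)
    show "f1 y - n y = f2 (inv3 y) - n (inv3 y)" if "y $ 3 \<noteq> 0" for y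
    proof -
      have "upd3 (inv3 y) 0 = upd3 y 0" by (simp add: vec_eq_iff upd3_nth inv3_nth)
      moreover have "inv3 y $ 3 \<noteq> 0" using that by (simp add: inv3_nth)
      ultimately show ?thesis using that
        by (simp add: f1_def f2_def n_def ci)
    qed
    show "f2 y - n y = 0" if "y $ 3 = 0" for y using upd3_self(1)[of y] that by (simp add: n_def)
  qed
qed

section \<open>Holomorphy potentials of vertical fields\<close>

lemma continuous_upd3: "continuous_on S (%t. upd3 y t)"
  by (rule continuous_on_subset[OF smooth_on_continuous[OF smooth_upd3[OF open_UNIV smooth_on_const smooth_on_id]]]) simp_all

text \<open>On each fibre \<open>F1\<close> is entire and tends to the value 0 of \<open>F2\<close>
  at infinity, so it vanishes by Liouville. This is the uniqueness statement behind all gluing of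
  potentials.\<close>

lemma fibre_liouville:
  assumes S: "open S" "\<And>y t. y \<in> S ==> upd3 y t \<in> S"
    and F1: "smooth_on S F1" "\<And>y. y \<in> S ==> pb 3 F1 y = 0"
    and F2: "continuous_on S F2" "\<And>y. y \<in> S ==> y $ 3 = 0 ==> F2 y = 0"
    and rel: "\<And>y. y \<in> S ==> y $ 3 \<noteq> 0 ==> F1 y = F2 (inv3 y)"
  shows "y \<in> S ==> F1 y = 0" "y \<in> S ==> F2 y = 0"
proof -
  show 1: "F1 y = 0" if y: "y \<in> S" for y
  proof -
    define h where "h t = F1 (upd3 y t)" for t
    have "(h has_field_derivative pd 3 F1 (upd3 y t)) (at t)" for t
      unfolding h_def[abs_def] using S(2)[OF y] by (intro upd3_derivative smooth_onD[OF F1(1)] F1(2))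
    then have hol: "h holomorphic_on UNIV"
      by (intro holomorphic_onI) (use field_differentiable_at_within field_differentiable_def in blast)
    have "continuous_on UNIV (%s. F2 (upd3 y s))"
      by (rule continuous_on_compose2[OF F2(1) continuous_upd3]) (use S(2)[OF y] in auto)
    then have "isCont (%s. F2 (upd3 y s)) 0" by (simp add: continuous_on_eq_continuous_at)
    from isCont_tendsto_compose[OF this tendsto_inverse_0]
    have "((%t. F2 (upd3 y (inverse t))) \<longlongrightarrow> 0) at_infinity"
      using F2(2)[OF S(2)[OF y, of 0]] by (simp add: upd3_nth)
    moreover have "\<forall>\<^sub>F t in at_infinity. F2 (upd3 y (inverse t)) = h t"
      unfolding eventually_at_infinity
    proof (intro exI[of _ 1] allI impI)
      fix t :: complex assume "1 \<le> norm t"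
      then have "t \<noteq> 0" by auto
      then show "F2 (upd3 y (inverse t)) = h t"
        using rel[OF S(2)[OF y, of t]] by (simp add: h_def inv3_def upd3_nth)
    qed
    ultimately have "(h \<longlongrightarrow> 0) at_infinity" by (rule Lim_transform_eventually)
    from Liouville_weak_0[OF hol this, of "y $ 3"] show ?thesis by (simp add: h_def)
  qed
  assume y: "y \<in> S"
  show "F2 y = 0"
  proof (cases "y $ 3 = 0")
    case False
    have "inv3 y \<in> S" unfolding inv3_def by (rule S(2)[OF y])
    then show ?thesis using rel[of "inv3 y"] 1[of "inv3 y"] False by (simp add: inv3_nth)
  qed (use F2(2) y in simp)
qed

context chart_change begin

lemma H_eq: "z \<in> O' ==> herm g k l z = (SUM b. (SUM a. M z $ a $ k * herm g' a b (T z)) * cnj (M z $ b $ l))"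
  using arg_cong[OF Hm_eq, of z "%A. A $ k $ l"]
  by (simp add: c.Hm_def c'.Hm_def matrix_matrix_mult_def transpose_def cm_nth)

end

text \<open>Only the component \<open>l = 3\<close> of the system is solved. For another
  \<open>l\<close> the defect is holomorphic along the fibre by commuting derivatives and the
  Kaehler symmetry of \<open>herm\<close>, and it vanishes at infinity by the normalisation of
  \<open>f2\<close>; so Liouville makes it 0.\<close>

lemma fibre_potential:
  assumes "chart_change g1 g2 inv3 off_zero"
    and \<sigma>: "smooth \<sigma>" "\<And>l y. pb l \<sigma> y = 0" "\<And>y t. \<sigma> (upd3 y t) = \<sigma> y"
  obtains f1 f2 where "smooth f1" "smooth f2"
    "\<And>l y. pb l f1 y = \<sigma> y * herm g1 3 l y" "\<And>l y. pb l f2 y = - \<sigma> y * (y $ 3)\<^sup>2 * herm g2 3 l y"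
    "\<And>y. y $ 3 \<noteq> 0 ==> f1 y = f2 (inv3 y)" "\<And>y. y $ 3 = 0 ==> f2 y = 0"
proof -
  interpret chart_change g1 g2 inv3 off_zero by fact
  \<comment> \<open>In the coordinate s = 1/t the field \<sigma> \<partial>_t becomes -\<sigma> s^2
    \<partial>_s.\<close>
  define v2 where "v2 y = - \<sigma> y * (y $ 3)\<^sup>2" for y
  have sv2: "smooth v2" unfolding v2_def[abs_def] power2_eq_square
    by (intro smooth_on_mult smooth_on_minus smooth_on_nth \<sigma> open_UNIV)
  have d: "f differentiable (at y)" if "smooth f" for f :: "complex^3 => complex" and y
    by (rule smooth_onD[OF that]) simp
  have sy3: "smooth (%y::complex^3. y $ 3)" by (rule smooth_on_nth[OF open_UNIV])
  have M: "M y $ a $ i = (if a = i then (if a = 3 then - (inverse (y $ 3))\<^sup>2 else 1) else 0)" if y: "y \<in> off_zero" for y a i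
  proof (cases "a = 3")
    case True
    have "pd i (%z. inverse (z $ 3)) y = - (inverse (y $ 3))\<^sup>2 * (if i = 3 then 1 else 0)"
      using pd_inverse(1)[OF d[OF sy3], of y i] y by (simp add: off_zero_def pd_nth power2_eq_square)
    then show ?thesis using True by (auto simp: M_def inv3_nth)
  qed (auto simp: M_def inv3_nth pd_nth)
  have H: "herm g1 k l y = M y $ k $ k * herm g2 k l (inv3 y) * cnj (M y $ l $ l)" if y: "y \<in> off_zero" for k l y
  proof -
    have "herm g1 k l y = (SUM b. (SUM a. if a = k then M y $ k $ k * herm g2 a b (inv3 y) else 0) * cnj (if b = l then M y $ l $ l else 0))"
      unfolding H_eq[OF y] by (intro sum.cong refl arg_cong2[of _ _ _ _ "(*)"]) (auto simp: M[OF y])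
    then show ?thesis by (simp add: if_distrib cong: if_cong)
  qed
  have nz3: "y $ 3 \<noteq> 0 \<longleftrightarrow> y \<in> off_zero" for y :: "complex^3" by (simp add: off_zero_def)
  have \<sigma>inv: "\<sigma> (inv3 y) = \<sigma> y" for y by (simp add: inv3_def \<sigma>(3))
  define v where "v i y = (if i then \<sigma> y else v2 y)" for i y
  have vH: "\<sigma> y * herm g1 3 l y = v2 (inv3 y) * herm g2 3 l (inv3 y) * cnj (M y $ l $ l)" if y: "y \<in> off_zero" for l y
    unfolding H[OF y] using M[OF y, of 3 3] by (simp add: v2_def \<sigma>inv inv3_nth)
  obtain f1 f2 where f: "smooth f1" "smooth f2" "\<And>y. pb 3 f1 y = \<sigma> y * herm g1 3 3 y" "\<And>y. pb 3 f2 y = v2 y * herm g2 3 3 y"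
    "\<And>y. y $ 3 \<noteq> 0 ==> f1 y = f2 (inv3 y)" "\<And>y. y $ 3 = 0 ==> f2 y = 0"
  proof (rule dbar_fibres[of "%y. \<sigma> y * herm g1 3 3 y" "%y. v2 y * herm g2 3 3 y"])
    show "smooth (%y. \<sigma> y * herm g1 3 3 y)" "smooth (%y. v2 y * herm g2 3 3 y)"
      by (intro smooth_on_mult \<sigma> sv2 c.smooth_H c'.smooth_H open_UNIV)+
    show "\<sigma> y * herm g1 3 3 y = - (v2 (inv3 y) * herm g2 3 3 (inv3 y)) * (cnj (inverse (y $ 3)))\<^sup>2" if "y $ 3 \<noteq> 0" for y
      using vH[of y 3] M[of y 3 3] that by (simp add: nz3)
  qed blast
  have main: "pb l f1 y - \<sigma> y * herm g1 3 l y = 0 \<and> pb l f2 y - v2 y * herm g2 3 l y = 0" if l: "l \<noteq> 3" for l y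
  proof -
    let ?D1 = "%y. pb l f1 y - \<sigma> y * herm g1 3 l y" and ?D2 = "%y. pb l f2 y - v2 y * herm g2 3 l y"
    have s1: "smooth ?D1" and s2: "smooth ?D2"
      by (intro smooth_on_diff smooth_on_mult smooth_on_pb f \<sigma> sv2 c.smooth_H c'.smooth_H open_UNIV)+
    have p1: "pb 3 ?D1 y = 0" for y
    proof -
      have "pb 3 ?D1 y = pb l (pb 3 f1) y - \<sigma> y * pb 3 (herm g1 3 l) y"
        using pd_diff(2)[of "pb l f1" y "%y. \<sigma> y * herm g1 3 l y" 3] pd_mult(2)[of \<sigma> y "herm g1 3 l" 3] pd_commute(2)[OF open_UNIV _ f(1), of y 3 l]
          d[OF smooth_on_pb[OF open_UNIV f(1)]] d[OF smooth_on_mult[OF open_UNIV \<sigma>(1) c.smooth_H]] d[OF \<sigma>(1)] d[OF c.smooth_H]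
        by (simp add: \<sigma>(2))
      also have "pb l (pb 3 f1) y = \<sigma> y * pb l (herm g1 3 3) y"
        unfolding f(3)[abs_def] using pd_mult(2)[of \<sigma> y "herm g1 3 3" l] d[OF \<sigma>(1)] d[OF c.smooth_H] by (simp add: \<sigma>(2))
      finally show ?thesis using c.pb_H_commute[of l 3 3 y] by simp
    qed
    \<comment> \<open>On \<open>y $ 3 = 0\<close> the potential is constantly 0, so its tangential
      derivatives vanish, and so does the field.\<close>
    have z2: "?D2 y = 0" if y: "y $ 3 = 0" for y
    proof -
      have e: "f2 (y + r *\<^sub>R axis l w) = 0" for r w using y l by (intro f(6)) (simp add: axis_def)
      have "dird f2 y (axis l w) = 0" for w
      proof -
        have "((%r. y + r *\<^sub>R axis l w) has_vector_derivative axis l w) (at 0)"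
          unfolding has_vector_derivative_def by (auto intro!: derivative_eq_intros)
        from has_vector_derivative_dird[OF d[OF f(2)] this]
        have "((%r. f2 (y + r *\<^sub>R axis l w)) has_vector_derivative dird f2 y (axis l w)) (at 0)" by simp
        then show ?thesis unfolding e by (metis has_vector_derivative_const vector_derivative_unique_at)
      qed
      then show ?thesis using y by (simp add: pb_def v2_def)
    qed
    have rel: "?D1 y = ?D2 (inv3 y)" if y: "y $ 3 \<noteq> 0" for y
    proof -
      have "pb l f1 y = pb l (%y. f2 (inv3 y)) y"
        by (rule pd_cong_open(2)[OF open_off_zero]) (use y f(5) in \<open>auto simp: off_zero_def\<close>)
      also have "\<dots> = pb l f2 (inv3 y)" by (rule pb_inv3(2)[OF y d[OF f(2)] l])
      finally show ?thesis using vH[of y l] M[of y l l] l y by (simp add: nz3)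
    qed
    show ?thesis
      using fibre_liouville[OF open_UNIV UNIV_I s1 p1 smooth_on_continuous[OF s2] z2 rel UNIV_I] by simp
  qed
  show thesis
  proof (rule that[OF f(1,2)])
    show "pb l f1 y = \<sigma> y * herm g1 3 l y" for l y using main[of l y] f(3) by (cases "l = 3") (simp_all add: eq_neg_iff_add_eq_0)
    show "pb l f2 y = - \<sigma> y * (y $ 3)\<^sup>2 * herm g2 3 l y" for l y
      using main[of l y] f(4)[of y] unfolding v2_def by (cases "l = 3") (simp_all add: eq_neg_iff_add_eq_0)
  qed (use f in auto)
qed

section \<open>Change of charts on the projective bundle\<close>

lemma smooth_on_powi [smooth_intros]:
  fixes f :: "'a::euclidean_space => complex"
  assumes "open S" "smooth_on S f" "\<And>y. y \<in> S ==> f y \<noteq> 0"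
  shows "smooth_on S (%y. f y powi n)"
  unfolding power_int_def by (cases "n \<ge> 0") (auto intro!: smooth_on_power smooth_on_inverse assms)

lemma smooth_aff: "open S ==> smooth_on S (%y::complex^3. aff i (y $ r) $ s)"
  by (cases "s = i") (auto simp: aff_def intro!: smooth_on_const smooth_on_nth)

lemma smooth_fibre_coord: "smooth_on (PB_overlap i j k i' j' k') (%y. fibre_coord p q i j k i' j' y r)"
proof (cases "r = 1")
  case False
  then show ?thesis unfolding fibre_coord_def
    by (simp, intro smooth_on_mult smooth_on_powi smooth_on_inverse smooth_aff open_PB_overlap) (auto simp: PB_overlap_def)
qed (simp add: fibre_coord_def smooth_aff open_PB_overlap)

lemma smooth_PB_trans: "smooth_on (PB_overlap i j k i' j' k') (%y. PB_trans p q i j k i' j' k' y $ a)"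
proof -
  have nz: "fibre_coord p q i j k i' j' y k' \<noteq> 0" if "y \<in> PB_overlap i j k i' j' k'" for y
    using that by (cases k' rule: two_cases) (auto simp: PB_overlap_def fibre_coord_def)
  note o = open_PB_overlap[of i j k i' j' k']
  have "\<forall>a. smooth_on (PB_overlap i j k i' j' k') (%y. PB_trans p q i j k i' j' k' y $ a)"
    unfolding forall_3 PB_trans_def vector_3
    by (intro conjI smooth_on_mult smooth_on_inverse smooth_aff smooth_fibre_coord o nz) (auto simp: PB_overlap_def)
  then show ?thesis by simp
qed

lemma dird_vec_nth: "(F has_derivative F') (at z) ==> dird (%y. F y $ a) z v = F' v $ a"
  by (rule dird_eqI[OF bounded_linear.has_derivative[OF bounded_linear_vec_nth]])

lemma chart_change_PB:
  assumes "kahler_metric (PB p q) g"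
  shows "chart_change (g (PB_chart p q i j k)) (g (PB_chart p q i' j' k')) (PB_trans p q i j k i' j' k') (PB_overlap i j k i' j' k')"
proof -
  have A: "PB_chart p q i j k \<in> PB p q" for i j k by (auto simp: PB_def)
  have K: "kahler_chart3 (g (PB_chart p q i j k))" for i j k
    unfolding kahler_chart3_def kahler_chart_def
    using assms A[of i j k] unfolding kahler_metric_def riemannian_metric_def by blast
  let ?T = "PB_trans p q i j k i' j' k'" and ?O = "PB_overlap i j k i' j' k'"
  have D: "\<exists>T'. (?T has_derivative T') (at z) \<and> (\<forall>v. T' (J v) = J (T' v))" if "z \<in> ?O" for z
    using holo_on_PB_trans that unfolding holo_on_def by blast
  have pb0: "pb l (%z. ?T z $ a) z = 0" if z: "z \<in> ?O" for l a z
  proof -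
    obtain T' where T': "(?T has_derivative T') (at z)" "\<And>v. T' (J v) = J (T' v)" using D[OF z] by blast
    show ?thesis unfolding pb_def dird_vec_nth[OF T'(1)] axis_i T'(2) by (simp add: J_def)
  qed
  have pull: "g (PB_chart p q i j k) z u v = g (PB_chart p q i' j' k') (?T z) (dird ?T z u) (dird ?T z v)" if z: "z \<in> ?O" for z u v
  proof -
    have "dird (transition (PB_chart p q i j k) (PB_chart p q i' j' k')) z = dird ?T z"
      by (rule dird_cong_open[OF open_PB_overlap z]) (rule transition_PB)
    moreover have "\<forall>\<psi>\<in>PB p q. \<forall>\<phi>\<in>PB p q. \<forall>z\<in>overlap \<psi> \<phi>. \<forall>u v. g \<psi> z u v = g \<phi> (transition \<psi> \<phi> z) (dird (transition \<psi> \<phi>) z u) (dird (transition \<psi> \<phi>) z v)"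
      using assms unfolding kahler_metric_def riemannian_metric_def by blast
    from this[rule_format, OF A A, unfolded overlap_PB, OF z]
    have "g (PB_chart p q i j k) z u v = g (PB_chart p q i' j' k') (transition (PB_chart p q i j k) (PB_chart p q i' j' k') z)
        (dird (transition (PB_chart p q i j k) (PB_chart p q i' j' k')) z u) (dird (transition (PB_chart p q i j k) (PB_chart p q i' j' k')) z v)" .
    ultimately show ?thesis by (simp add: transition_PB[OF z])
  qed
  show ?thesis
    by (intro chart_change.intro chart_change_axioms.intro K open_PB_overlap smooth_PB_trans pb0 pull)
qed

lemma other_simps [simp]: "other 1 = 2" "other 2 = 1" by (simp_all add: other_def)

lemma aff_same [simp]: "aff i x $ i = 1" "aff i x $ other i = x" "aff (other i) x $ i = x"
  by (cases i rule: two_cases; simp add: aff_def other_def)+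

lemma aff_numeral [simp]: "aff 1 x $ 2 = x" "aff 2 x $ 1 = x" by (simp_all add: aff_def)

text \<open>The cocycle of O(p, q). The fibre coordinate is multiplied by it in the charts with
  \<open>k = 1\<close> and by its inverse in those with \<open>k = 2\<close>.\<close>

definition fibre_factor :: "int => int => 2 => 2 => 2 => 2 => complex^3 => complex" where
  "fibre_factor p q i j i' j' y = inverse (aff i (y$1) $ i') powi p * inverse (aff j (y$2) $ j') powi q"

lemma PB_trans_same_fibre:
  "PB_trans p q i j k i' j' k y = vector [aff i (y$1) $ other i' * inverse (aff i (y$1) $ i'), aff j (y$2) $ other j' * inverse (aff j (y$2) $ j'),
     (if k = 1 then fibre_factor p q i j i' j' y else inverse (fibre_factor p q i j i' j' y)) * y $ 3]"
  by (cases k rule: two_cases) (simp_all add: PB_trans_def fibre_coord_def fibre_factor_def mult.commute)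

lemma PB_overlap_same_fibre: "PB_overlap i j k i' j' k = {y. aff i (y$1) $ i' \<noteq> 0 \<and> aff j (y$2) $ j' \<noteq> 0}"
  by (simp add: PB_overlap_def)

lemma PB_trans_flip_fibre: "PB_trans p q i j k i j (other k) = inv3"
proof
  fix y show "PB_trans p q i j k i j (other k) y = inv3 y"
    by (cases k rule: two_cases) (simp_all add: PB_trans_def fibre_coord_def vec_eq_iff forall_3 inv3_nth)
qed

lemma PB_overlap_flip_fibre: "PB_overlap i j k i j (other k) = off_zero"
  by (simp add: PB_overlap_def off_zero_def)

lemma off_zero_overlap: "fibre_factor p q i j i' j' y \<noteq> 0" if "y \<in> PB_overlap i j k i' j' k"
  using that by (simp add: PB_overlap_def fibre_factor_def)

section \<open>The divergence theorem on the projective bundle\<close>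

lemma vector_3_eq: "(vector [a, b, c] :: 'a::zero^3) = (\<chi> i. if i = 1 then a else if i = 2 then b else c)"
  by (simp add: vec_eq_iff forall_3)

lemma cont3_vector:
  assumes "continuous_on UNIV F" "continuous_on UNIV x" "continuous_on UNIV y" "continuous_on UNIV z"
  shows "continuous_on UNIV (%p. F (vector [x p, y p, z p] :: complex^3))"
proof (rule continuous_on_compose2[OF assms(1)])
  have "continuous_on UNIV (%p. if i = 1 then x p else if i = 2 then y p else z p)" for i :: 3
    using assms by (cases "i = 1"; cases "i = 2") simp_all
  then show "continuous_on UNIV (%p. vector [x p, y p, z p] :: complex^3)"
    unfolding vector_3_eq by (rule continuous_on_vec_lambda)
qed simp

lemma smooth_slice:
  assumes "smooth (F :: complex^3 => complex)"
  shows "smooth (%a. F (vector [a, b, c]))" "smooth (%a. F (vector [b, a, c]))" "smooth (%a. F (vector [b, c, a]))"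
proof -
  have v: "smooth (%a. vector [x a, y a, z a] :: complex^3)"
    if "smooth x" "smooth y" "smooth z" for x y z :: "complex => complex"
  proof -
    have "\<forall>i. smooth (%a. (vector [x a, y a, z a] :: complex^3) $ i)" unfolding forall_3 vector_3 using that by simp
    then show ?thesis by (intro smooth_on_vec open_UNIV) simp
  qed
  show "smooth (%a. F (vector [a, b, c]))" "smooth (%a. F (vector [b, a, c]))" "smooth (%a. F (vector [b, c, a]))"
    by (rule smooth_on_compose[OF open_UNIV open_UNIV _ assms v]; simp add: smooth_on_const smooth_on_id)+
qed

lemma dird_slice:
  assumes F: "smooth (F :: complex^3 => complex)"
  shows "dird (%a. F (vector [a, b, c])) a w = dird F (vector [a, b, c]) (axis 1 w)"
    "dird (%a. F (vector [b, a, c])) a w = dird F (vector [b, a, c]) (axis 2 w)"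
    "dird (%a. F (vector [b, c, a])) a w = dird F (vector [b, c, a]) (axis 3 w)"
proof -
  have d: "F differentiable (at z)" for z by (rule smooth_onD[OF F]) simp
  have ch: "dird (%a. F (m a)) a w = dird F (m a) (axis i w)" if "\<And>a. m a = y + axis i a" for m i and y :: "complex^3" and a
  proof (rule dird_eqI)
    have "bounded_linear (%w. axis i w :: complex^3)"
    proof (rule linear_conv_bounded_linear[THEN iffD1], rule linearI)
      show "axis i (r *\<^sub>R b) = r *\<^sub>R (axis i b :: complex^3)" for r and b :: complex by (simp add: vec_eq_iff axis_def)
    qed (simp add: vec_eq_iff axis_def)
    then have "(m has_derivative (%w. axis i w)) (at a)"
      unfolding that by (auto intro!: derivative_eq_intros bounded_linear_imp_has_derivative)
    from diff_chain_at[OF this has_derivative_dird[OF d]]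
    show "((%a. F (m a)) has_derivative (%w. dird F (m a) (axis i w))) (at a)" by (simp add: o_def)
  qed
  have "(vector [a, b, c] :: complex^3) = vector [0, b, c] + axis 1 a" "(vector [b, a, c] :: complex^3) = vector [b, 0, c] + axis 2 a"
    "(vector [b, c, a] :: complex^3) = vector [b, c, 0] + axis 3 a" for a :: complex
    unfolding vec_eq_iff forall_3 by (simp_all add: axis_def)
  note e = this
  show "dird (%a. F (vector [a, b, c])) a w = dird F (vector [a, b, c]) (axis 1 w)" by (rule ch[OF e(1)])
  show "dird (%a. F (vector [b, a, c])) a w = dird F (vector [b, a, c]) (axis 2 w)" by (rule ch[OF e(2)])
  show "dird (%a. F (vector [b, c, a])) a w = dird F (vector [b, c, a]) (axis 3 w)" by (rule ch[OF e(3)])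
qed

lemma cont3_slice:
  assumes "continuous_on UNIV F"
  shows "cont3 (%a b c. F (vector [a, b, c] :: complex^3))" "cont3 (%a b c. F (vector [b, a, c]))" "cont3 (%a b c. F (vector [b, c, a]))"
    "cont3 (%a b c. F (vector [a, c, b]))" "cont3 (%a b c. F (vector [c, a, b]))" "cont3 (%a b c. F (vector [c, b, a]))"
  unfolding cont3_def by (rule cont3_vector[OF assms]; intro continuous_intros)+

lemma tri_pd:
  assumes F: "smooth (F :: complex^3 => complex)"
  shows "tri (%a b c. pd 1 F (vector [a, b, c])) = bdry (%a b c. cnj a * F (vector [a, b, c])) / 2"
    "tri (%a b c. pd 2 F (vector [a, b, c])) = bdry (%a b c. cnj a * F (vector [b, a, c])) / 2"
    "tri (%a b c. pd 3 F (vector [a, b, c])) = bdry (%a b c. cnj a * F (vector [b, c, a])) / 2"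
proof -
  note cF = smooth_on_continuous[OF F]
  have cp: "continuous_on UNIV (%z. pd i F z)" for i by (rule smooth_on_continuous[OF smooth_on_pd[OF open_UNIV F]])
  show "tri (%a b c. pd 1 F (vector [a, b, c])) = bdry (%a b c. cnj a * F (vector [a, b, c])) / 2"
    by (rule tri_stokes[OF cont3_slice(1)[OF cF] smooth_slice(1)[OF F] cont3_slice(1)[OF cp]]) (simp add: dird_slice[OF F] pd_def)
  have "tri (%a b c. pd 2 F (vector [b, a, c])) = bdry (%a b c. cnj a * F (vector [b, a, c])) / 2"
    by (rule tri_stokes[OF cont3_slice(2)[OF cF] smooth_slice(2)[OF F] cont3_slice(2)[OF cp]]) (simp add: dird_slice[OF F] pd_def)
  moreover have "tri (%a b c. pd 2 F (vector [b, a, c])) = tri (%a b c. pd 2 F (vector [a, b, c]))"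
    by (rule tri_swap12[OF cont3_slice(1)[OF cp]])
  ultimately show "tri (%a b c. pd 2 F (vector [a, b, c])) = bdry (%a b c. cnj a * F (vector [b, a, c])) / 2" by simp
  have "tri (%a b c. pd 3 F (vector [b, c, a])) = bdry (%a b c. cnj a * F (vector [b, c, a])) / 2"
    by (rule tri_stokes[OF cont3_slice(3)[OF cF] smooth_slice(3)[OF F] cont3_slice(3)[OF cp]]) (simp add: dird_slice[OF F] pd_def)
  moreover have "tri (%a b c. pd 3 F (vector [b, c, a])) = tri (%a b c. pd 3 F (vector [a, c, b]))"
    using tri_swap12[OF cont3_slice(4)[OF cp]] .
  moreover have "tri (%a b c. pd 3 F (vector [a, c, b])) = tri (%a b c. pd 3 F (vector [a, b, c]))"
    by (rule tri_swap23[OF cont3_slice(1)[OF cp]])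
  ultimately show "tri (%a b c. pd 3 F (vector [a, b, c])) = bdry (%a b c. cnj a * F (vector [b, c, a])) / 2" by simp
qed

text \<open>The gluing hypotheses say that the normal component of the vector density changes under
  a \<mapsto> 1/a with the factor -(1/a)^2, after the phase \<open>w\<close> in the fibre coordinate
  is taken into account. So the two fluxes through each common face cancel.\<close>

lemma divergence_theorem:
  fixes X :: "2 => 2 => 2 => 3 => complex^3 => complex"
  assumes X: "\<And>i j k l. smooth (X i j k l)"
    and w: "\<And>i k. continuous_on UNIV (w i k)" "\<And>i k a. cmod a = 1 ==> cmod (w i k a) = 1"
    and glue1: "\<And>j k a b c. cmod a = 1 ==> X 2 j k 1 (vector [cnj a, b, w 1 k a * c]) = - (cnj a)\<^sup>2 * X 1 j k 1 (vector [a, b, c])"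
    and glue2: "\<And>i k a b c. cmod a = 1 ==> X i 2 k 2 (vector [b, cnj a, w 2 k a * c]) = - (cnj a)\<^sup>2 * X i 1 k 2 (vector [b, a, c])"
    and glue3: "\<And>i j a b c. cmod a = 1 ==> X i j 2 3 (vector [b, c, cnj a]) = - (cnj a)\<^sup>2 * X i j 1 3 (vector [b, c, a])"
  shows "(SUM i j k. tri (%a b c. SUM l. pd l (X i j k l) (vector [a, b, c]))) = 0"
proof -
  have cX: "continuous_on UNIV (X i j k l)" for i j k l by (rule smooth_on_continuous[OF X])
  have cp: "continuous_on UNIV (%z. pd l (X i j k l') z)" for i j k l l' by (rule smooth_on_continuous[OF smooth_on_pd[OF open_UNIV X]])
  define B1 where "B1 i j k = bdry (%a b c. cnj a * X i j k 1 (vector [a, b, c]))" for i j k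
  define B2 where "B2 i j k = bdry (%a b c. cnj a * X i j k 2 (vector [b, a, c]))" for i j k
  define B3 where "B3 i j k = bdry (%a b c. cnj a * X i j k 3 (vector [b, c, a]))" for i j k
  have t: "tri (%a b c. SUM l. pd l (X i j k l) (vector [a, b, c])) = (B1 i j k + B2 i j k + B3 i j k) / 2" for i j k
  proof -
    have "tri (%a b c. SUM l. pd l (X i j k l) (vector [a, b, c])) =
      tri (%a b c. pd 1 (X i j k 1) (vector [a, b, c]) + pd 2 (X i j k 2) (vector [a, b, c]) + pd 3 (X i j k 3) (vector [a, b, c]))"
      by (simp add: sum_3)
    also have "\<dots> = tri (%a b c. pd 1 (X i j k 1) (vector [a, b, c]) + pd 2 (X i j k 2) (vector [a, b, c])) + tri (%a b c. pd 3 (X i j k 3) (vector [a, b, c]))"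
      by (rule tri_add[OF cont3_slice(1) cont3_slice(1)]) (intro continuous_intros cp)+
    also have "tri (%a b c. pd 1 (X i j k 1) (vector [a, b, c]) + pd 2 (X i j k 2) (vector [a, b, c])) =
        tri (%a b c. pd 1 (X i j k 1) (vector [a, b, c])) + tri (%a b c. pd 2 (X i j k 2) (vector [a, b, c]))"
      by (rule tri_add[OF cont3_slice(1) cont3_slice(1)]) (intro continuous_intros cp)+
    finally show ?thesis unfolding tri_pd[OF X] B1_def B2_def B3_def by (simp add: add_divide_distrib)
  qed
  have 1: "B1 2 j k = - B1 1 j k" for j k
    unfolding B1_def by (rule bdry_glue[OF cont3_slice(1)[OF cX] cont3_slice(1)[OF cX] w glue1])
  have 2: "B2 i 2 k = - B2 i 1 k" for i k
    unfolding B2_def by (rule bdry_glue[OF cont3_slice(2)[OF cX] cont3_slice(2)[OF cX] w glue2])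
  have 3: "B3 i j 2 = - B3 i j 1" for i j
    unfolding B3_def
    by (rule bdry_glue[OF cont3_slice(3)[OF cX] cont3_slice(3)[OF cX], of "%_. 1"]) (simp_all add: glue3)
  show ?thesis unfolding t unfolding sum_2 1 2 3 by (simp add: field_simps)
qed

lemma pd_axis_const:
  fixes F :: "complex^'n::finite => complex"
  assumes "F differentiable (at y)" "\<And>w. F (y + axis l w) = F y"
  shows "pd l F y = 0" "pb l F y = 0"
proof -
  have "dird F y (axis l w) = 0" for w
  proof -
    have "((%r. y + r *\<^sub>R axis l w) has_vector_derivative axis l w) (at 0)"
      unfolding has_vector_derivative_def by (auto intro!: derivative_eq_intros)
    then have "((%r. F (y + r *\<^sub>R axis l w)) has_vector_derivative dird F (y + 0 *\<^sub>R axis l w) (axis l w)) (at 0)"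
      by (rule has_vector_derivative_dird[rotated]) (use assms in simp)
    moreover have "r *\<^sub>R axis l w = axis l (r *\<^sub>R w)" for r by (simp add: vec_eq_iff axis_def)
    ultimately have "((%r. F y) has_vector_derivative dird F (y + 0 *\<^sub>R axis l w) (axis l w)) (at 0)" using assms(2) by simp
    then show ?thesis by (simp only: scaleR_zero_left add_0_right) (metis has_vector_derivative_const vector_derivative_unique_at)
  qed
  then show "pd l F y = 0" "pb l F y = 0" by (simp_all add: pd_def pb_def)
qed

section \<open>Sections of O(p, q), their vertical fields and global potentials\<close>

locale PB_kahler =
  fixes p q :: int and g :: "(PB_point, 3) metric_field"
  assumes kahler: "kahler_metric (PB p q) g" and pq: "0 \<le> p" "0 < q"
begin

abbreviation gg :: "2 => 2 => 2 => complex^3 => complex^3 => complex^3 => real" where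
  "gg i j k \<equiv> g (PB_chart p q i j k)"

text \<open>The monomial section u_1^p v_1^q in affine coordinates; it is constantly 1 in the charts
  with \<open>i = j = 1\<close>.\<close>

definition sec :: "2 => 2 => complex^3 => complex" where
  "sec i j y = (aff i (y $ 1) $ 1) ^ nat p * (aff j (y $ 2) $ 1) ^ nat q"

text \<open>Translation along the fibres by the section. In the inverted coordinate the field has a
  double zero at the section at infinity, and this double zero yields the final
  contradiction.\<close>

definition vfield :: "2 => 2 => 2 => complex^3 => complex" where
  "vfield i j k y = (if k = 1 then sec i j y else - sec i j y * (y $ 3)\<^sup>2)"

lemmas change = chart_change_PB[OF kahler]

lemma chart: "kahler_chart3 (gg i j k)"
  using change[of i j k i j k] by (rule chart_change.axioms(1))

lemma smooth_sec: "smooth (sec i j)"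
  unfolding sec_def[abs_def] by (intro smooth_on_mult smooth_on_power smooth_aff open_UNIV)

lemma pb_aff: "pb l (%y::complex^3. aff i (y $ r) $ s) y = 0"
  by (cases "s = i") (simp_all add: aff_def pd_const pd_nth)

lemma pb_power: "f differentiable (at y) ==> pb l f y = 0 ==> pb l (%y::complex^3. f y ^ n) y = 0 \<and> (%y. f y ^ n) differentiable (at y)"
  by (induction n) (simp_all add: pd_const pd_mult)

lemma pb_sec: "pb l (sec i j) y = 0"
proof -
  have d: "(%y::complex^3. aff i (y $ r) $ s) differentiable (at y)" for i s r y
    by (rule smooth_onD[OF smooth_aff[OF open_UNIV]]) simp
  note * = pb_power[OF d pb_aff]
  show ?thesis unfolding sec_def[abs_def]
    using pd_mult(2)[OF *[THEN conjunct2] *[THEN conjunct2]] *[THEN conjunct1] by simp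
qed

lemma sec_trans:
  assumes "y \<in> PB_overlap i j k i' j' k"
  shows "sec i' j' (PB_trans p q i j k i' j' k y) = fibre_factor p q i j i' j' y * sec i j y"
proof -
  have "aff i (y$1) $ i' \<noteq> 0" "aff j (y$2) $ j' \<noteq> 0" using assms by (auto simp: PB_overlap_def)
  then show ?thesis using pq
    by (simp add: sec_def PB_trans_same_fibre aff_scale fibre_factor_def power_int_def power_mult_distrib)
qed

lemma inv3_trans: "inv3 (PB_trans p q i j 1 i' j' 1 y) = PB_trans p q i j 2 i' j' 2 (inv3 y)"
  by (simp add: PB_trans_same_fibre vec_eq_iff forall_3 inv3_nth fibre_factor_def)

lemma smooth_comp_trans:
  assumes "smooth f"
  shows "smooth_on (PB_overlap i j k i' j' k') (%y. f (PB_trans p q i j k i' j' k' y))"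
  by (rule smooth_on_compose[OF open_PB_overlap open_UNIV _ assms smooth_on_vec[OF open_PB_overlap smooth_PB_trans]]) simp

lemma smooth_fibre_factor: "smooth_on (PB_overlap i j k i' j' k') (fibre_factor p q i j i' j')"
  unfolding fibre_factor_def[abs_def]
  by (intro smooth_on_mult smooth_on_powi smooth_on_inverse smooth_aff open_PB_overlap) (auto simp: PB_overlap_def)

text \<open>Over each base chart \<open>fibre_potential\<close> applies. On an overlap the
  difference of two potentials is holomorphic along the fibres, because field and metric transform
  compatibly, and vanishes at infinity; \<open>fibre_liouville\<close> makes it 0.\<close>

lemma potentials:
  obtains f where "\<And>i j k. smooth (f i j k)" "\<And>i j k l y. pb l (f i j k) y = vfield i j k y * herm (gg i j k) 3 l y"
    "\<And>i j y. y $ 3 \<noteq> 0 ==> f i j 1 y = f i j 2 (inv3 y)" "\<And>i j y. y $ 3 = 0 ==> f i j 2 y = 0"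
    "\<And>i j k i' j' y. y \<in> PB_overlap i j k i' j' k ==> f i j k y = f i' j' k (PB_trans p q i j k i' j' k y)"
proof -
  define ok where "ok i j f1 f2 \<longleftrightarrow> smooth f1 \<and> smooth f2 \<and> (\<forall>l y. pb l f1 y = vfield i j 1 y * herm (gg i j 1) 3 l y)
      \<and> (\<forall>l y. pb l f2 y = vfield i j 2 y * herm (gg i j 2) 3 l y) \<and> (\<forall>y. y $ 3 \<noteq> 0 \<longrightarrow> f1 y = f2 (inv3 y)) \<and> (\<forall>y. y $ 3 = 0 \<longrightarrow> f2 y = 0)" for i j f1 f2
  have ex: "\<exists>f1 f2. ok i j f1 f2" for i j
  proof -
    have c: "chart_change (gg i j 1) (gg i j 2) inv3 off_zero"
      using change[of i j 1 i j 2] PB_trans_flip_fibre[of p q i j 1] PB_overlap_flip_fibre[of i j 1] by simp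
    have e: "sec i j (upd3 y t) = sec i j y" for y t by (simp add: sec_def upd3_nth)
    obtain f1 f2 where "smooth f1" "smooth f2"
      "\<And>l y. pb l f1 y = sec i j y * herm (gg i j 1) 3 l y" "\<And>l y. pb l f2 y = - sec i j y * (y $ 3)\<^sup>2 * herm (gg i j 2) 3 l y"
      "\<And>y. y $ 3 \<noteq> 0 ==> f1 y = f2 (inv3 y)" "\<And>y. y $ 3 = 0 ==> f2 y = 0"
      by (rule fibre_potential[OF c smooth_sec pb_sec e]) (rule that; assumption)
    then have "ok i j f1 f2" unfolding ok_def vfield_def by simp
    then show ?thesis by blast
  qed
  obtain f1 f2 where "\<And>i j. ok i j (f1 i j) (f2 i j)"
    using ex by metis
  note f12 = this[unfolded ok_def]
  define f where "f i j k = (if k = 1 then f1 i j else f2 i j)" for i j and k :: 2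
  have sf: "smooth (f i j k)" for i j k using f12[of i j] by (simp add: f_def)
  have pf: "pb l (f i j k) y = vfield i j k y * herm (gg i j k) 3 l y" for i j k l y
    using f12[of i j] by (cases k rule: two_cases) (simp_all add: f_def)
  have relf: "f i j 1 y = f i j 2 (inv3 y)" if "y $ 3 \<noteq> 0" for i j y using f12[of i j] that by (simp add: f_def)
  have zf: "f i j 2 y = 0" if "y $ 3 = 0" for i j y using f12[of i j] that by (simp add: f_def)
  have gf: "f i j k y = f i' j' k (PB_trans p q i j k i' j' k y)" if y: "y \<in> PB_overlap i j k i' j' k" for i j k i' j' y
  proof -
    define S where "S = PB_overlap i j 1 i' j' 1"
    have S2: "PB_overlap i j k i' j' k = S" for k by (simp add: S_def PB_overlap_same_fibre)
    define T where "T = (%k. PB_trans p q i j k i' j' k)"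
    interpret chart_change "gg i j 1" "gg i' j' 1" "T 1" S unfolding T_def S_def by (rule change)
    have So: "open S" unfolding S_def by (rule open_PB_overlap)
    have Su: "y \<in> S ==> upd3 y t \<in> S" for y t by (simp add: S_def PB_overlap_same_fibre upd3_nth)
    have sT: "smooth_on S (%y. f i' j' k (T k y))" for k
      using smooth_comp_trans[OF sf, of i j k i' j' k] by (simp add: S2 T_def)
    have dS: "F differentiable (at y)" if "smooth_on S F" "y \<in> S" for F :: "complex^3 => complex" and y
      by (rule smooth_onD[OF that])
    let ?m = "fibre_factor p q i j i' j'"
    have sm: "smooth_on S ?m" unfolding S_def by (rule smooth_fibre_factor)
    have sy3: "smooth_on S (%y. y $ 3)" by (rule smooth_on_nth[OF So])
    have M3: "M y $ a $ 3 = (if a = 3 then ?m y else 0)" if y: "y \<in> S" for y a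
    proof (cases "a = 3")
      case True
      have "pd 3 ?m y = 0" by (rule pd_axis_const[OF dS[OF sm y]]) (simp add: fibre_factor_def axis_def)
      then have "pd 3 (%y. ?m y * y $ 3) y = ?m y" using pd_mult(1)[OF dS[OF sm y] dS[OF sy3 y], of 3] by (simp add: pd_nth)
      moreover have "(%y. T 1 y $ 3) = (%y. ?m y * y $ 3)" by (simp add: T_def PB_trans_same_fibre)
      ultimately show ?thesis using True by (simp add: M_def)
    next
      case False
      have "\<forall>a. a \<noteq> 3 \<longrightarrow> T 1 (y + axis 3 w) $ a = T 1 y $ a" for w
        unfolding forall_3 by (simp add: T_def PB_trans_same_fibre axis_def)
      then have "pd 3 (%y. T 1 y $ a) y = 0" using False by (intro pd_axis_const dS[OF smooth_T y]) simp
      then show ?thesis using False by (simp add: M_def)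
    qed
    let ?F1 = "%y. f i j 1 y - f i' j' 1 (T 1 y)" and ?F2 = "%y. f i j 2 y - f i' j' 2 (T 2 y)"
    have sS: "smooth_on S (f i j k)" for k by (rule smooth_on_subset[OF sf]) simp
    have s1: "smooth_on S ?F1" and s2: "smooth_on S ?F2" by (intro smooth_on_diff sS sT So)+
    have p1: "pb 3 ?F1 y = 0" if y: "y \<in> S" for y
    proof -
      have d: "f i' j' 1 differentiable (at (T 1 y))" by (rule smooth_onD[OF sf]) simp
      have "pb 3 (%y. f i' j' 1 (T 1 y)) y = sec i' j' (T 1 y) * herm (gg i' j' 1) 3 3 (T 1 y) * cnj (?m y)"
        unfolding pd_T(2)[OF y d] by (simp add: sum_3 M3[OF y] pf vfield_def)
      moreover have "sec i' j' (T 1 y) = ?m y * sec i j y" unfolding T_def by (rule sec_trans) (use y S_def in simp)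
      moreover have "herm (gg i j 1) 3 3 y = ?m y * herm (gg i' j' 1) 3 3 (T 1 y) * cnj (?m y)"
        unfolding H_eq[OF y] by (simp add: sum_3 M3[OF y])
      moreover have "pb 3 (f i j 1) y = sec i j y * herm (gg i j 1) 3 3 y" by (simp add: pf vfield_def)
      ultimately show ?thesis using pd_diff(2)[OF dS[OF sS y] dS[OF sT y], of 3 1 1] by simp
    qed
    have T3: "T k y $ 3 = (if k = 1 then ?m y else inverse (?m y)) * y $ 3" for k y by (simp add: T_def PB_trans_same_fibre)
    have z2: "?F2 y = 0" if "y \<in> S" "y $ 3 = 0" for y using that by (simp add: zf T3)
    have mnz: "?m y \<noteq> 0" if "y \<in> S" for y using off_zero_overlap that S_def by blast
    have rel: "?F1 y = ?F2 (inv3 y)" if "y \<in> S" "y $ 3 \<noteq> 0" for y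
    proof -
      have "T 1 y $ 3 \<noteq> 0" using that mnz by (simp add: T3)
      then show ?thesis using relf[of y i j] relf[of "T 1 y" i' j'] that inv3_trans[of i j i' j' y] by (simp add: T_def)
    qed
    have l: "?F1 y = 0" "?F2 y = 0" if "y \<in> S" for y
      by (rule fibre_liouville[of S ?F1 ?F2]; (rule So s1 smooth_on_continuous[OF s2] that | erule Su p1 | erule (1) z2 | erule (1) rel))+
    have yS: "y \<in> S" using y by (simp only: S2)
    have "f i j 1 y = f i' j' 1 (T 1 y)" "f i j 2 y = f i' j' 2 (T 2 y)"
      using l(1)[OF yS] l(2)[OF yS] by (simp_all only: right_minus_eq)
    then have "f i j k y = f i' j' k (T k y)" by (cases k rule: two_cases) (simp_all only:)
    then show ?thesis by (simp only: T_def)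
  qed
  show thesis by (rule that[of f, OF sf pf relf zf gf])
qed

end

section \<open>Flux densities on the faces of the unit polydiscs\<close>

context chart_change begin

text \<open>The row \<open>r\<close> of the Jacobian has the single entry -(1/z_r)^2, which on the
  unit circle is -(cnj z_r)^2, and the density factor |det M|^2 is 1.\<close>

lemma P_Q_glue:
  assumes f: "smooth f" and f': "smooth f'" and fT: "\<And>z. z \<in> O' ==> f z = f' (T z)"
    and z: "z \<in> O'" and Tr: "\<And>y. y \<in> O' ==> T y $ r = inverse (y $ r)" and zr: "cmod (z $ r) = 1" and det: "cmod (det (M z)) = 1"
  shows "c'.P f' r (T z) = - (cnj (z $ r))\<^sup>2 * c.P f r z"
    "cnj (c'.Q f' r (T z)) = - (cnj (z $ r))\<^sup>2 * cnj (c.Q f r z)"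
proof -
  have d1: "det (M z) * cnj (det (M z)) = 1" using det by (simp add: complex_norm_square[symmetric])
  have ic: "inverse (z $ r) = cnj (z $ r)" using zr by (simp add: inverse_complex_def complex_eq_iff cmod_def)
  have "(%y::complex^3. y $ r) differentiable (at z)"
    by (rule smooth_onD[OF smooth_on_nth[OF open_UNIV]]) simp
  then have "pd k (%y. inverse (y $ r)) z = - (cnj (z $ r))\<^sup>2 * (if k = r then 1 else 0)" for k
    using pd_inverse(1)[of "%y. y $ r" z k] zr by (cases "z $ r = 0") (auto simp: pd_nth ic power2_eq_square)
  then have Mr: "M z $ r $ k = - (cnj (z $ r))\<^sup>2 * (if k = r then 1 else 0)" for k
    using pd_cong_open(1)[OF open_O z, of "%z. T z $ r" "%y. inverse (y $ r)" k] Tr by (simp add: M_def)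
  have s: "(SUM k. - (cnj (z $ r))\<^sup>2 * (if k = r then 1 else 0) * F k) = - (cnj (z $ r))\<^sup>2 * F r" for F :: "3 => complex"
    by (simp add: if_distrib if_distribR cong: if_cong)
  show "c'.P f' r (T z) = - (cnj (z $ r))\<^sup>2 * c.P f r z"
    using P_Q_eq(1)[OF f f' fT z, of r] unfolding d1 Mr s by simp
  have "c'.Q f' r (T z) = (SUM k. cnj (M z $ r $ k) * c.Q f k z)"
    using P_Q_eq(2)[OF f f' fT z, of r] unfolding d1 by simp
  then have "cnj (c'.Q f' r (T z)) = (SUM k. M z $ r $ k * cnj (c.Q f k z))" by simp
  then show "cnj (c'.Q f' r (T z)) = - (cnj (z $ r))\<^sup>2 * cnj (c.Q f r z)" unfolding Mr s .
qed

text \<open>The rows \<open>r\<close> and \<open>r'\<close> of the Jacobian have only diagonal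
  entries, so the determinant is the product of the diagonal whatever derivatives of
  \<open>W\<close> stand in the third row.\<close>

lemma det_M_flip:
  assumes z: "z \<in> O'" and r: "r \<noteq> 3" "r' \<noteq> 3" "r \<noteq> r'"
    and Tr: "\<And>y. y \<in> O' ==> T y $ r = inverse (y $ r)" and Tr': "\<And>y. y \<in> O' ==> T y $ r' = y $ r'"
    and T3: "\<And>y. y \<in> O' ==> T y $ 3 = W y * y $ 3" and W: "smooth_on O' W" "\<And>w. W (z + axis 3 w) = W z"
    and zr: "cmod (z $ r) = 1" and Wz: "cmod (W z) = 1"
  shows "cmod (det (M z)) = 1"
proof -
  have d: "(%y::complex^3. y $ a) differentiable (at z)" for a
    by (rule smooth_onD[OF smooth_on_nth[OF open_UNIV]]) simp
  have Mr: "M z $ r $ k = - (inverse (z $ r))\<^sup>2 * (if k = r then 1 else 0)" for k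
    using pd_cong_open(1)[OF open_O z, of "%z. T z $ r" "%y. inverse (y $ r)" k] Tr pd_inverse(1)[OF d, of r k] zr
    by (cases "z $ r = 0") (auto simp: M_def pd_nth power2_eq_square)
  have Mr': "M z $ r' $ k = (if k = r' then 1 else 0)" for k
    using pd_cong_open(1)[OF open_O z, of "%z. T z $ r'" "%y. y $ r'" k] Tr' by (simp add: M_def pd_nth)
  have dW: "W differentiable (at z)" by (rule smooth_onD[OF W(1) z])
  have M33: "M z $ 3 $ 3 = W z"
    using pd_cong_open(1)[OF open_O z, of "%z. T z $ 3" "%y. W y * y $ 3" 3] T3 pd_mult(1)[OF dW d[of 3], of 3] pd_axis_const(1)[OF dW W(2)]
    by (simp add: M_def pd_nth)
  have n1: "cmod ((inverse (z $ r))\<^sup>2) = 1" using zr by (simp add: norm_power norm_inverse)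
  have "(r = 1 \<and> r' = 2) \<or> (r = 2 \<and> r' = 1)" using r exhaust_3[of r] exhaust_3[of r'] by auto
  then have "det (M z) = - (inverse (z $ r))\<^sup>2 * W z"
    using Mr[of 1] Mr[of 2] Mr[of 3] Mr'[of 1] Mr'[of 2] Mr'[of 3] M33 unfolding det_3 by auto
  then show ?thesis using n1 Wz by (simp only: norm_mult norm_minus_cancel mult_1)
qed

end

lemma sum_nonneg_zero:
  fixes d :: "2 => 2 => 2 => real"
  assumes "\<And>i j k. d i j k \<ge> 0" "(SUM i j k. d i j k) = 0"
  shows "d i j k = 0"
proof -
  have "\<forall>i\<in>UNIV. (SUM j k. d i j k) = 0"
    using assms by (subst (asm) sum_nonneg_eq_0_iff) (auto intro!: sum_nonneg)
  then have "\<forall>j\<in>UNIV. (SUM k. d i j k) = 0"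
    using assms(1) by (subst (asm) sum_nonneg_eq_0_iff) (auto intro!: sum_nonneg)
  then show ?thesis using assms(1) by (subst (asm) sum_nonneg_eq_0_iff) auto
qed

context PB_kahler begin

lemma vfield_holo: "smooth (vfield i j k)" "pb l (vfield i j k) y = 0"
proof -
  have sy3: "smooth (%y::complex^3. y $ 3)" by (rule smooth_on_nth[OF open_UNIV])
  have d: "f differentiable (at y)" if "smooth f" for f :: "complex^3 => complex" and y
    by (rule smooth_onD[OF that]) simp
  have s: "smooth (%y. - sec i j y * (y $ 3 * y $ 3))"
    by (intro smooth_on_mult smooth_on_minus smooth_sec sy3 open_UNIV)
  have "pb l (%y. - sec i j y * (y $ 3 * y $ 3)) y = 0"
    using pd_mult(2)[of "%y. - sec i j y" y "%y. y $ 3 * y $ 3" l] pd_mult(2)[of "%y. y $ 3" y "%y. y $ 3" l] pd_uminus(2)[of "sec i j" y l]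
      d[OF smooth_sec] d[OF sy3] d[OF smooth_on_minus[OF open_UNIV smooth_sec]] d[OF smooth_on_mult[OF open_UNIV sy3 sy3]]
    by (simp add: pb_sec pd_nth)
  then show "smooth (vfield i j k)" "pb l (vfield i j k) y = 0"
    unfolding vfield_def[abs_def] using s smooth_sec pb_sec by (cases "k = 1"; simp add: power2_eq_square)+
qed

text \<open>The vertical factor of the transition maps exchanging the two charts of one factor, on the circle \<open>|a| = 1\<close>.\<close>

definition wcirc :: "3 => 2 => complex => complex" where
  "wcirc r k a = (if k = 1 then cnj a else a) ^ (if r = 1 then nat p else nat q)"

lemma wcirc: "continuous_on UNIV (wcirc r k)" "cmod a = 1 ==> cmod (wcirc r k a) = 1"
  unfolding wcirc_def[abs_def] by (cases "k = 1"; auto intro!: continuous_intros simp: norm_power)+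

lemma flip1:
  assumes a: "cmod a = 1" and z: "z = vector [a, b, c]"
  shows "z \<in> PB_overlap 1 j k 2 j k \<and> PB_trans p q 1 j k 2 j k z = vector [cnj a, b, wcirc 1 k a * c] \<and>
    cmod (det (chart_change.M (PB_trans p q 1 j k 2 j k) z)) = 1"
proof -
  interpret cc: chart_change "gg 1 j k" "gg 2 j k" "PB_trans p q 1 j k 2 j k" "PB_overlap 1 j k 2 j k" by (rule change)
  let ?m = "fibre_factor p q 1 j 2 j"
  have zO: "z \<in> PB_overlap 1 j k 2 j k" using a by (auto simp: PB_overlap_def z)
  have ic: "inverse a = cnj a" using a by (simp add: inverse_complex_def complex_eq_iff cmod_def)
  have m: "?m z = cnj a ^ nat p" using pq by (simp add: fibre_factor_def z ic power_int_def)
  have w: "(if k = 1 then ?m z else inverse (?m z)) = wcirc 1 k a"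
    using ic unfolding m wcirc_def by (simp add: power_inverse[symmetric]) (metis inverse_inverse_eq)
  have "cmod (det (cc.M z)) = 1"
  proof (rule cc.det_M_flip[OF zO, of 1 2 "%y. if k = 1 then ?m y else inverse (?m y)"])
    show "smooth_on (PB_overlap 1 j k 2 j k) (%y. if k = 1 then ?m y else inverse (?m y))"
      using smooth_fibre_factor[of 1 j k 2 j k] off_zero_overlap[of _ 1 j k 2 j]
      by (cases "k = 1") (auto intro!: smooth_on_inverse open_PB_overlap)
    show "cmod (if k = 1 then ?m z else inverse (?m z)) = 1" unfolding w by (rule wcirc(2)[OF a])
  qed (use a in \<open>simp_all add: PB_trans_same_fibre fibre_factor_def axis_def z\<close>)
  moreover have "PB_trans p q 1 j k 2 j k z = vector [cnj a, b, wcirc 1 k a * c]"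
    unfolding PB_trans_same_fibre w by (simp add: z ic)
  ultimately show ?thesis using zO by simp
qed

lemma flip2:
  assumes a: "cmod a = 1" and z: "z = vector [b, a, c]"
  shows "z \<in> PB_overlap i 1 k i 2 k \<and> PB_trans p q i 1 k i 2 k z = vector [b, cnj a, wcirc 2 k a * c] \<and>
    cmod (det (chart_change.M (PB_trans p q i 1 k i 2 k) z)) = 1"
proof -
  interpret cc: chart_change "gg i 1 k" "gg i 2 k" "PB_trans p q i 1 k i 2 k" "PB_overlap i 1 k i 2 k" by (rule change)
  let ?m = "fibre_factor p q i 1 i 2"
  have zO: "z \<in> PB_overlap i 1 k i 2 k" using a by (auto simp: PB_overlap_def z)
  have ic: "inverse a = cnj a" using a by (simp add: inverse_complex_def complex_eq_iff cmod_def)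
  have m: "?m z = cnj a ^ nat q" using pq by (simp add: fibre_factor_def z ic power_int_def)
  have w: "(if k = 1 then ?m z else inverse (?m z)) = wcirc 2 k a"
    using ic unfolding m wcirc_def by (simp add: power_inverse[symmetric]) (metis inverse_inverse_eq)
  have "cmod (det (cc.M z)) = 1"
  proof (rule cc.det_M_flip[OF zO, of 2 1 "%y. if k = 1 then ?m y else inverse (?m y)"])
    show "smooth_on (PB_overlap i 1 k i 2 k) (%y. if k = 1 then ?m y else inverse (?m y))"
      using smooth_fibre_factor[of i 1 k i 2 k] off_zero_overlap[of _ i 1 k i 2]
      by (cases "k = 1") (auto intro!: smooth_on_inverse open_PB_overlap)
    show "cmod (if k = 1 then ?m z else inverse (?m z)) = 1" unfolding w by (rule wcirc(2)[OF a])
  qed (use a in \<open>simp_all add: PB_trans_same_fibre fibre_factor_def axis_def z\<close>)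
  moreover have "PB_trans p q i 1 k i 2 k z = vector [b, cnj a, wcirc 2 k a * c]"
    unfolding PB_trans_same_fibre w by (simp add: z ic)
  ultimately show ?thesis using zO by simp
qed

lemma flip3:
  assumes a: "cmod a = 1" and z: "z = vector [b, c, a]"
  shows "z \<in> PB_overlap i j 1 i j 2 \<and> PB_trans p q i j 1 i j 2 z = vector [b, c, cnj a] \<and>
    cmod (det (chart_change.M (PB_trans p q i j 1 i j 2) z)) = 1"
proof -
  interpret cc: chart_change "gg i j 1" "gg i j 2" "PB_trans p q i j 1 i j 2" "PB_overlap i j 1 i j 2" by (rule change)
  have zO: "z \<in> PB_overlap i j 1 i j 2" using a by (auto simp: PB_overlap_def z)
  have T: "PB_trans p q i j 1 i j 2 = inv3" using PB_trans_flip_fibre[of p q i j 1] by simp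
  have ic: "inverse a = cnj a" using a by (simp add: inverse_complex_def complex_eq_iff cmod_def)
  have d: "(%y::complex^3. y $ 3) differentiable (at z)"
    by (rule smooth_onD[OF smooth_on_nth[OF open_UNIV]]) simp
  have "pd 3 (%y. inverse (y $ 3)) z = - (cnj a)\<^sup>2"
    using pd_inverse(1)[OF d, of 3] a by (cases "a = 0") (auto simp: z pd_nth ic)
  then have "det (cc.M z) = - (cnj a)\<^sup>2"
    unfolding det_3 cc.M_def by (simp add: T inv3_nth pd_nth)
  then have "cmod (det (cc.M z)) = 1" using a by (simp add: norm_power)
  moreover have "inv3 z = vector [b, c, cnj a]" by (simp add: vec_eq_iff forall_3 inv3_nth z ic)
  ultimately show ?thesis using zO T by simp
qed

end

section \<open>Constant scalar curvature makes the gradient of the conjugate potential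
  holomorphic\<close>

lemma (in kahler_chart3) const_scalar:
  assumes "scalar_curvature g z = s"
  shows "(SUM m k. K m k z * \<rho> k m z) = of_real (- s / 4)"
proof -
  define X where "X = (SUM m k. K m k z * \<rho> k m z)"
  have "cnj X = (SUM m k. K k m z * \<rho> m k z)" by (simp only: X_def cnj_sum complex_cnj_mult K_cnj rho_cnj)
  also have "\<dots> = X" unfolding X_def by (rule sum.swap)
  finally have "Im X = 0" by (simp add: complex_eq_iff)
  moreover have "s = - 4 * Re X" using scalar_curvature_eq[of z] assms by (simp only: X_def \<rho>_def)
  ultimately show ?thesis unfolding X_def[symmetric] by (simp add: complex_eq_iff)
qed

locale PB_csc = PB_kahler +
  assumes csc: "constant_scalar_curvature (PB p q) g"
begin

lemma const: "\<exists>s. \<forall>i j k z. (SUM m l. kahler_chart.K (gg i j k) m l z * kahler_chart3.\<rho> (gg i j k) l m z) = s"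
proof -
  obtain s where s: "\<forall>\<psi>\<in>PB p q. \<forall>z. scalar_curvature (g \<psi>) z = s" using csc unfolding constant_scalar_curvature_def by blast
  have "scalar_curvature (gg i j k) z = s" for i j k z using s by (auto simp: PB_def)
  then show ?thesis by (intro exI allI) (rule kahler_chart3.const_scalar[OF chart])
qed

text \<open>The density \<open>qq\<close> is nonnegative and is the sum of two divergences. Its
  integrals over the eight unit polydiscs add up to 0, so each vanishes, and with it the
  dbar-derivative on each unit polydisc; the tensor law spreads this to the full charts.\<close>

lemma holomorphic_gradient:
  obtains f where "\<And>i j k. smooth (f i j k)" "\<And>i j k l y. pb l (f i j k) y = vfield i j k y * herm (gg i j k) 3 l y"
    "\<And>i j y. y $ 3 = 0 ==> f i j 2 y = 0"
    "\<And>i j k i' j' k' y. y \<in> PB_overlap i j k i' j' k' ==> k = k' \<or> i = i' \<and> j = j' ==> f i j k y = f i' j' k' (PB_trans p q i j k i' j' k' y)"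
    "\<And>i j k a l z. pb l (kahler_chart3.grad (gg i j k) (%y. cnj (f i j k y)) a) z = 0"
proof -
  obtain s where s: "\<And>i j k z. (SUM m l. kahler_chart.K (gg i j k) m l z * kahler_chart3.\<rho> (gg i j k) l m z) = s"
    using const by blast
  obtain f where f: "\<And>i j k. smooth (f i j k)" "\<And>i j k l y. pb l (f i j k) y = vfield i j k y * herm (gg i j k) 3 l y"
    and f12: "\<And>i j y. y $ 3 \<noteq> 0 ==> f i j 1 y = f i j 2 (inv3 y)" and f0: "\<And>i j y. y $ 3 = 0 ==> f i j 2 y = 0"
    and fs: "\<And>i j k i' j' y. y \<in> PB_overlap i j k i' j' k ==> f i j k y = f i' j' k (PB_trans p q i j k i' j' k y)"
    by (rule potentials) (rule that; assumption)
  have glue: "f i j k y = f i' j' k' (PB_trans p q i j k i' j' k' y)"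
    if y: "y \<in> PB_overlap i j k i' j' k'" and k: "k = k' \<or> i = i' \<and> j = j'" for i j k i' j' k' y
  proof (cases "k = k'")
    case True then show ?thesis using fs y by simp
  next
    case False
    then have e: "k' = other k" "i' = i" "j' = j" using k exhaust_2[of k] exhaust_2[of k'] by (auto simp: other_def)
    have y3: "y $ 3 \<noteq> 0" using y unfolding e PB_overlap_flip_fibre by (simp add: off_zero_def)
    have "f i j k y = f i j (other k) (inv3 y)"
    proof (cases k rule: two_cases)
      case 2 then show ?thesis using f12[of "inv3 y" i j] y3 by (simp add: inv3_nth)
    qed (use f12 y3 in simp)
    then show ?thesis unfolding e PB_trans_flip_fibre .
  qed
  define u where "u i j k y = cnj (f i j k y)" for i j k y
  let ?grad = "%i j k. kahler_chart3.grad (gg i j k)" and ?G = "%i j k. kahler_chart3.G (gg i j k)"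
  let ?P = "%i j k. kahler_chart3.P (gg i j k) (f i j k)" and ?Q = "%i j k. kahler_chart3.Q (gg i j k) (f i j k)"
  \<comment> \<open>The equation for the potential inverts to say that the gradient of
    \<open>f\<close> is the vertical field itself.\<close>
  have holo: "pb l (?grad i j k (f i j k) a) z = 0" for i j k a l z
  proof -
    interpret c: kahler_chart3 "gg i j k" by (rule chart)
    have "c.grad (f i j k) a y = (if a = 3 then vfield i j k y else 0)" for y
    proof -
      have "c.grad (f i j k) a y = vfield i j k y * (SUM l. c.H 3 l y * c.K l a y)"
        unfolding c.grad_def f(2) sum_distrib_left by (simp only: mult.assoc)
      then show ?thesis unfolding c.H_K by auto
    qed
    then have e: "c.grad (f i j k) a = (if a = 3 then vfield i j k else (%_. 0))" by auto
    show ?thesis unfolding e by (simp add: vfield_holo pd_const)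
  qed
  define qq where "qq i j k z = ?G i j k z * (SUM a b. pb b (?grad i j k (u i j k) a) z * cnj (pb a (?grad i j k (u i j k) b) z))" for i j k z
  have sP: "smooth (?P i j k a)" and sQ: "smooth (?Q i j k a)"
    and div: "(SUM a. pd a (?P i j k a) z) + (SUM b. pb b (?Q i j k b) z) = qq i j k z" for i j k a z
    unfolding qq_def u_def[abs_def]
    by (rule kahler_chart3.smooth_P[OF chart s f(1) holo], rule kahler_chart3.smooth_Q[OF chart s f(1) holo],
        rule kahler_chart3.div_P_Q[OF chart s f(1) holo])
  have su: "smooth (u i j k)" for i j k unfolding u_def[abs_def] by (rule smooth_on_linears(1)[OF open_UNIV f(1)])
  have nn: "qq i j k z \<in> \<real>" "Re (qq i j k z) \<ge> 0" "qq i j k z = 0 ==> pb b (?grad i j k (u i j k) a) z = 0" for i j k z a b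
    unfolding qq_def
    by (rule kahler_chart3.dbar_grad_norm(1)[OF chart su], rule kahler_chart3.dbar_grad_norm(2)[OF chart su],
        rule kahler_chart3.dbar_grad_norm(3)[OF chart su])
  have glueX: "?P i' j' k' r (PB_trans p q i j k i' j' k' z) = - (cnj (z $ r))\<^sup>2 * ?P i j k r z \<and>
      cnj (?Q i' j' k' r (PB_trans p q i j k i' j' k' z)) = - (cnj (z $ r))\<^sup>2 * cnj (?Q i j k r z)"
    if z: "z \<in> PB_overlap i j k i' j' k'" and k: "k = k' \<or> i = i' \<and> j = j'"
      and Tr: "\<And>y. y \<in> PB_overlap i j k i' j' k' ==> PB_trans p q i j k i' j' k' y $ r = inverse (y $ r)"
      and zr: "cmod (z $ r) = 1"
      and det: "cmod (det (chart_change.M (PB_trans p q i j k i' j' k') z)) = 1" for i j k i' j' k' r z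
  proof -
    interpret cc: chart_change "gg i j k" "gg i' j' k'" "PB_trans p q i j k i' j' k'" "PB_overlap i j k i' j' k'" by (rule change)
    have fT: "f i j k y = f i' j' k' (PB_trans p q i j k i' j' k' y)" if "y \<in> PB_overlap i j k i' j' k'" for y
      by (rule glue[OF that k])
    show ?thesis by (rule conjI[OF cc.P_Q_glue[OF f(1) f(1) fT z Tr zr det]]; assumption)
  qed
  have divP: "(SUM i j k. tri (%a b c. SUM l. pd l (?P i j k l) (vector [a, b, c]))) = 0"
  proof (rule divergence_theorem[OF sP wcirc])
    show "?P 2 j k 1 (vector [cnj a, b, wcirc 1 k a * c]) = - (cnj a)\<^sup>2 * ?P 1 j k 1 (vector [a, b, c])"
      if "cmod a = 1" for j k a b c
      using glueX[of "vector [a, b, c]" 1 j k 2 j k 1] flip1[OF that refl, where j = j and k = k and b = b and c = c] that by (simp add: PB_trans_same_fibre)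
    show "?P i 2 k 2 (vector [b, cnj a, wcirc 2 k a * c]) = - (cnj a)\<^sup>2 * ?P i 1 k 2 (vector [b, a, c])"
      if "cmod a = 1" for i k a b c
      using glueX[of "vector [b, a, c]" i 1 k i 2 k 2] flip2[OF that refl, where i = i and k = k and b = b and c = c] that by (simp add: PB_trans_same_fibre)
    show "?P i j 2 3 (vector [b, c, cnj a]) = - (cnj a)\<^sup>2 * ?P i j 1 3 (vector [b, c, a])"
      if "cmod a = 1" for i j a b c
      using glueX[of "vector [b, c, a]" i j 1 i j 2 3] flip3[OF that refl, where i = i and j = j and b = b and c = c] that PB_trans_flip_fibre[of p q i j 1] by (simp add: inv3_nth)
  qed
  \<comment> \<open>The divergence theorem is stated for \<open>pd\<close>, so the (0,1) density
    \<open>Q\<close> enters through its conjugate.\<close>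
  define Q' where "Q' i j k l z = cnj (?Q i j k l z)" for i j k l z
  have sQ': "smooth (Q' i j k l)" for i j k l unfolding Q'_def[abs_def] by (rule smooth_on_linears(1)[OF open_UNIV sQ])
  have divQ': "(SUM i j k. tri (%a b c. SUM l. pd l (Q' i j k l) (vector [a, b, c]))) = 0"
  proof (rule divergence_theorem[OF sQ' wcirc])
    show "Q' 2 j k 1 (vector [cnj a, b, wcirc 1 k a * c]) = - (cnj a)\<^sup>2 * Q' 1 j k 1 (vector [a, b, c])"
      if "cmod a = 1" for j k a b c
      using glueX[of "vector [a, b, c]" 1 j k 2 j k 1] flip1[OF that refl, where j = j and k = k and b = b and c = c] that by (simp add: PB_trans_same_fibre Q'_def)
    show "Q' i 2 k 2 (vector [b, cnj a, wcirc 2 k a * c]) = - (cnj a)\<^sup>2 * Q' i 1 k 2 (vector [b, a, c])"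
      if "cmod a = 1" for i k a b c
      using glueX[of "vector [b, a, c]" i 1 k i 2 k 2] flip2[OF that refl, where i = i and k = k and b = b and c = c] that by (simp add: PB_trans_same_fibre Q'_def)
    show "Q' i j 2 3 (vector [b, c, cnj a]) = - (cnj a)\<^sup>2 * Q' i j 1 3 (vector [b, c, a])"
      if "cmod a = 1" for i j a b c
      using glueX[of "vector [b, c, a]" i j 1 i j 2 3] flip3[OF that refl, where i = i and j = j and b = b and c = c] that PB_trans_flip_fibre[of p q i j 1] by (simp add: inv3_nth Q'_def)
  qed
  have cqq: "continuous_on UNIV (qq i j k)" for i j k
  proof -
    have "qq i j k = (%z. (SUM a. pd a (?P i j k a) z) + (SUM b. pb b (?Q i j k b) z))" by (rule ext) (rule div[symmetric])
    then show ?thesis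
      by (simp only:) (intro continuous_intros smooth_on_continuous[OF smooth_on_pd[OF open_UNIV sP]] smooth_on_continuous[OF smooth_on_pb[OF open_UNIV sQ]])
  qed
  have tqq: "tri (%a b c. qq i j k (vector [a, b, c])) = tri (%a b c. SUM l. pd l (?P i j k l) (vector [a, b, c]))
      + cnj (tri (%a b c. SUM l. pd l (Q' i j k l) (vector [a, b, c])))" for i j k
  proof -
    have dQ: "?Q i j k l differentiable (at z)" for l z by (rule smooth_onD[OF sQ]) simp
    have "(SUM b. pb b (?Q i j k b) z) = cnj (SUM l. pd l (Q' i j k l) z)" for z
      unfolding Q'_def[abs_def] pd_cnj(1)[OF dQ] by simp
    then have "qq i j k z = (SUM l. pd l (?P i j k l) z) + cnj (SUM l. pd l (Q' i j k l) z)" for z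
      using div[of i j k z] by simp
    then have "tri (%a b c. qq i j k (vector [a, b, c])) = tri (%a b c. (SUM l. pd l (?P i j k l) (vector [a, b, c])) + cnj (SUM l. pd l (Q' i j k l) (vector [a, b, c])))"
      by (simp only:)
    also have "\<dots> = tri (%a b c. SUM l. pd l (?P i j k l) (vector [a, b, c])) + tri (%a b c. cnj (SUM l. pd l (Q' i j k l) (vector [a, b, c])))"
    proof (rule tri_add)
      show "cont3 (%a b c. SUM l. pd l (?P i j k l) (vector [a, b, c]))"
        by (rule cont3_slice(1)[of "%z. SUM l. pd l (?P i j k l) z"]) (intro continuous_intros smooth_on_continuous[OF smooth_on_pd[OF open_UNIV sP]])
      show "cont3 (%a b c. cnj (SUM l. pd l (Q' i j k l) (vector [a, b, c])))"
        by (rule cont3_slice(1)[of "%z. cnj (SUM l. pd l (Q' i j k l) z)"]) (intro continuous_intros smooth_on_continuous[OF smooth_on_pd[OF open_UNIV sQ']])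
    qed
    finally show ?thesis by (simp only: tri_cnj)
  qed
  have rq: "qq i j k z = of_real (Re (qq i j k z))" for i j k z using nn(1)[of i j k z] by (simp add: complex_is_Real_iff complex_eq_iff)
  have "\<exists>d. \<forall>i j k. d i j k \<ge> 0 \<and> tri (%a b c. qq i j k (vector [a, b, c])) = of_real (d i j k)"
  proof -
    have "\<exists>d\<ge>0. tri (%a b c. qq i j k (vector [a, b, c])) = of_real d" for i j k
      by (rule tri_zero(1)[OF cont3_slice(1)[OF cqq] rq nn(2)])
    then show ?thesis by metis
  qed
  then obtain d where d: "\<And>i j k. d i j k \<ge> (0::real)" "\<And>i j k. tri (%a b c. qq i j k (vector [a, b, c])) = of_real (d i j k)" by blast
  have "(SUM i j k. tri (%a b c. qq i j k (vector [a, b, c]))) = 0"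
    unfolding tqq sum.distrib divP using arg_cong[OF divQ', of cnj] by (simp only: cnj_sum complex_cnj_zero add_0)
  then have "complex_of_real (SUM i j k. d i j k) = 0" unfolding d(2) by (simp only: of_real_sum)
  then have "d i j k = 0" for i j k by (intro sum_nonneg_zero[of d] d(1)) (simp only: of_real_eq_0_iff)
  then have t0: "tri (%a b c. qq i j k (vector [a, b, c])) = 0" for i j k by (simp add: d(2))
  have poly: "qq i j k (vector [a, b, c]) = 0" if "cmod a \<le> 1" "cmod b \<le> 1" "cmod c \<le> 1" for i j k a b c
    by (rule tri_zero(2)[OF cont3_slice(1)[OF cqq] rq nn(2) t0 that])
  let ?D = "%i j k z. \<forall>a b. pb b (?grad i j k (u i j k) a) z = 0"
  have D1: "?D i j k z" if "cmod (z $ 1) \<le> 1" "cmod (z $ 2) \<le> 1" "cmod (z $ 3) \<le> 1" for i j k z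
  proof -
    have "z = vector [z $ 1, z $ 2, z $ 3]" by (simp add: vec_eq_iff forall_3)
    then show ?thesis using nn(3) poly[OF that] by metis
  qed
  \<comment> \<open>The dbar-derivative of the gradient changes by invertible matrices, so its
    vanishing passes between charts.\<close>
  have step: "?D i j k z" if z: "z \<in> PB_overlap i j k i' j' k'" and k: "k = k' \<or> i = i' \<and> j = j'"
      and D': "?D i' j' k' (PB_trans p q i j k i' j' k' z)" for i j k i' j' k' z
  proof -
    interpret cc: chart_change "gg i j k" "gg i' j' k'" "PB_trans p q i j k i' j' k'" "PB_overlap i j k i' j' k'" by (rule change)
    have uT: "u i j k y = u i' j' k' (PB_trans p q i j k i' j' k' y)" if "y \<in> PB_overlap i j k i' j' k'" for y
      unfolding u_def by (rule arg_cong[of _ _ cnj]) (rule glue[OF that k])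
    have "cc.c'.dbar_grad (u i' j' k') (PB_trans p q i j k i' j' k' z) = 0"
      using D' by (simp add: cc.c'.dbar_grad_def vec_eq_iff)
    then have "cc.M z ** cc.c.dbar_grad (u i j k) z = 0"
      using cc.dbar_grad_eq[OF su su uT z] by (simp add: matrix_matrix_mult_def vec_eq_iff)
    moreover obtain N where "N ** cc.M z = mat 1"
      using cc.det_M[OF z] invertible_det_nz[of "cc.M z"] unfolding invertible_def by blast
    ultimately have "cc.c.dbar_grad (u i j k) z = 0"
      by (metis matrix_mul_assoc matrix_mul_lid mult.commute times0_right)
    then show ?thesis by (simp add: cc.c.dbar_grad_def vec_eq_iff)
  qed
  have inv_le: "cmod (inverse x) \<le> 1" if "\<not> cmod x \<le> 1" for x using that by (simp add: norm_inverse inverse_le_1_iff)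
  \<comment> \<open>The fibre coordinate is freed before the base coordinates, because a change of
    base chart rescales it and can take it out of the unit disc.\<close>
  have D2: "?D i j k z" if z: "cmod (z $ 1) \<le> 1" "cmod (z $ 2) \<le> 1" for i j k z
  proof (cases "cmod (z $ 3) \<le> 1")
    case False
    show ?thesis
    proof (rule step)
      show "z \<in> PB_overlap i j k i j (other k)" unfolding PB_overlap_flip_fibre off_zero_def using False by auto
      show "?D i j (other k) (PB_trans p q i j k i j (other k) z)"
        unfolding PB_trans_flip_fibre by (rule D1) (use z inv_le[OF False] in \<open>simp_all add: inv3_nth\<close>)
    qed simp
  qed (rule D1[OF z])
  have D3: "?D i j k z" for i j k z
  proof -
    define i' where "i' = (if cmod (z $ 1) \<le> 1 then i else other i)"
    define j' where "j' = (if cmod (z $ 2) \<le> 1 then j else other j)"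
    have i'_nz: "aff i (z $ 1) $ i' \<noteq> 0" and ni: "cmod (aff i (z$1) $ other i' * inverse (aff i (z$1) $ i')) \<le> 1"
      using inv_le[of "z $ 1"] by (cases i rule: two_cases; auto simp: i'_def)+
    have j'_nz: "aff j (z $ 2) $ j' \<noteq> 0" and nj: "cmod (aff j (z$2) $ other j' * inverse (aff j (z$2) $ j')) \<le> 1"
      using inv_le[of "z $ 2"] by (cases j rule: two_cases; auto simp: j'_def)+
    show ?thesis
    proof (rule step)
      show "z \<in> PB_overlap i j k i' j' k" using i'_nz j'_nz by (simp add: PB_overlap_def)
      show "?D i' j' k (PB_trans p q i j k i' j' k z)"
        by (rule D2) (use ni nj in \<open>simp_all add: PB_trans_same_fibre\<close>)
    qed simp
  qed
  show thesis
    by (rule that[of f, OF f(1) f(2) f0 glue]) (assumption | use D3 in \<open>simp only: u_def[abs_def]\<close>)+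
qed

end

section \<open>The contradiction along the section at infinity\<close>

lemma holomorphic_slice:
  assumes F: "smooth (F :: complex^3 => complex)" and pb: "\<And>z. pb 2 F z = 0"
  shows "(%a. F (vector [b, a, c])) holomorphic_on UNIV"
proof (rule holomorphic_onI)
  fix a :: complex
  let ?z = "vector [b, a, c] :: complex^3"
  have dF: "F differentiable (at ?z)" by (rule smooth_onD[OF F]) simp
  have "dird (%a. F (vector [b, a, c])) a = (%w. pd 2 F ?z * w)"
    unfolding dird_slice(2)[OF F] dird_pd_pb[OF dF] sum_3 by (simp add: pb axis_def)
  then have "((%a. F (vector [b, a, c])) has_field_derivative pd 2 F ?z) (at a)"
    using smooth_on_has_derivative[OF smooth_slice(2)[OF F, of b c], of a] by (simp add: has_field_derivative_def)
  then show "(%a. F (vector [b, a, c])) field_differentiable (at a within UNIV)"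
    using field_differentiable_def by blast
qed

lemma (in kahler_chart3) H_sum_zero:
  assumes "\<And>k. (SUM i. H i k z * x i) = 0"
  shows "x m = 0"
proof -
  have "0 = (SUM k. (SUM i. H i k z * x i) * K k m z)" by (simp add: assms)
  also have "\<dots> = (SUM i. x i * (SUM k. H i k z * K k m z))"
    unfolding sum_distrib_left sum_distrib_right by (subst sum.swap) (intro sum.cong refl, simp only: mult_ac)
  also have "\<dots> = x m" unfolding H_K by (simp add: if_distrib cong: if_cong)
  finally show ?thesis by simp
qed

lemma (in kahler_chart3) H_pos: "H k k z \<noteq> 0"
proof
  assume "H k k z = 0"
  then have "g z (axis k 1) (axis k 1) = 0" by (simp add: herm_def complex_eq_iff)
  moreover have "axis k 1 \<noteq> (0 :: complex^3)" by (simp add: axis_eq_0_iff)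
  ultimately show False using pos[of "axis k 1" z] by simp
qed

context PB_csc begin

text \<open>In the chart with \<open>i = j = 1\<close>, \<open>k = 2\<close> the vertical field is
  -z_3^2 \<partial>_3. The derivative dbar_3 dbar_3 \<partial>_3 of the conjugate potential at the
  origin is computed twice: it is 0 through the holomorphic gradient, which vanishes there together
  with its \<partial>_3 derivative, and -2 H_33 through the double zero of the field.\<close>

theorem contradiction: False
proof -
  obtain f where f: "\<And>i j k. smooth (f i j k)" "\<And>i j k l y. pb l (f i j k) y = vfield i j k y * herm (gg i j k) 3 l y"
    and f0: "\<And>i j y. y $ 3 = 0 ==> f i j 2 y = 0"
    and glue: "\<And>i j k i' j' k' y. y \<in> PB_overlap i j k i' j' k' ==> k = k' \<or> i = i' \<and> j = j' ==> f i j k y = f i' j' k' (PB_trans p q i j k i' j' k' y)"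
    and holo: "\<And>i j k a l z. pb l (kahler_chart3.grad (gg i j k) (%y. cnj (f i j k y)) a) z = 0"
    by (rule holomorphic_gradient) (rule that; assumption)
  define u where "u j y = cnj (f 1 j 2 y)" for j y
  have su: "smooth (u j)" for j unfolding u_def[abs_def] by (rule smooth_on_linears(1)[OF open_UNIV f(1)])
  interpret cc: chart_change "gg 1 1 2" "gg 1 2 2" "PB_trans p q 1 1 2 1 2 2" "PB_overlap 1 1 2 1 2 2" by (rule change)
  define W where "W a = cc.c.grad (u 1) a" for a
  define W' where "W' a = cc.c'.grad (u 2) a" for a
  have pW: "pb l (W a) z = 0" and pW': "pb l (W' a) z = 0" for l a z
    unfolding W_def W'_def u_def[abs_def] by (rule holo)+
  have sW: "smooth (W a)" and sW': "smooth (W' a)" for a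
    unfolding W_def W'_def by (rule cc.c.smooth_grad[OF su] cc.c'.smooth_grad[OF su])+
  have d: "F differentiable (at z)" if "smooth F" for F :: "complex^3 => complex" and z
    by (rule smooth_onD[OF that]) simp
  have dy: "(%y::complex^3. y $ r) differentiable (at z)" for r z by (rule d[OF smooth_on_nth[OF open_UNIV]])
  \<comment> \<open>The vertical component of the gradient along the line y_1 = y_3 = 0. Between the
    two charts of the second factor it behaves as a section of O(-q).\<close>
  define h where "h t = W 3 (vector [0, t, 0])" for t
  define h' where "h' t = W' 3 (vector [0, t, 0])" for t
  have hol: "h holomorphic_on UNIV" unfolding h_def[abs_def] by (rule holomorphic_slice[OF sW pW])
  have ch': "continuous_on UNIV h'" unfolding h'_def[abs_def]
    by (rule holomorphic_on_imp_continuous_on[OF holomorphic_slice[OF sW' pW']])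
  have rel: "h t = (inverse t) ^ nat q * h' (inverse t)" if t: "t \<noteq> 0" for t
  proof -
    define z where "z = (vector [0, t, 0] :: complex^3)"
    have z: "z \<in> PB_overlap 1 1 2 1 2 2" using t by (simp add: PB_overlap_def z_def)
    have Tz: "PB_trans p q 1 1 2 1 2 2 z = vector [0, inverse t, 0]"
      by (simp add: PB_trans_same_fibre z_def)
    let ?w = "%y. inverse (fibre_factor p q 1 1 1 2 y)"
    have sw: "smooth_on (PB_overlap 1 1 2 1 2 2) ?w"
      by (rule smooth_on_inverse[OF open_PB_overlap smooth_fibre_factor off_zero_overlap])
    have dw: "?w differentiable (at z)" by (rule smooth_onD[OF sw z])
    have wz: "?w z = t ^ nat q" using pq by (simp add: fibre_factor_def z_def power_int_def power_inverse)
    \<comment> \<open>The third row also contains derivatives of the cocycle, but they are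
      multiplied by the fibre coordinate, which is 0 here.\<close>
    have M: "cc.M z $ 3 $ k = (if k = 3 then t ^ nat q else 0)" for k
      using pd_mult(1)[OF dw dy, of k 3] wz by (simp add: cc.M_def PB_trans_same_fibre pd_nth z_def)
    have uT: "u 1 y = u 2 (PB_trans p q 1 1 2 1 2 2 y)" if "y \<in> PB_overlap 1 1 2 1 2 2" for y
      unfolding u_def by (rule arg_cong[of _ _ cnj]) (rule glue[OF that], simp)
    have "cc.c'.gradv (u 2) (PB_trans p q 1 1 2 1 2 2 z) = cc.M z *v cc.c.gradv (u 1) z"
      by (rule cc.gradv_eq[OF su su uT z])
    from arg_cong[OF this, of "%v. v $ 3"]
    have "W' 3 (PB_trans p q 1 1 2 1 2 2 z) = (SUM k. cc.M z $ 3 $ k * W k z)"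
      by (simp add: cc.c.gradv_def cc.c'.gradv_def W_def W'_def matrix_vector_mult_def)
    then have "h' (inverse t) = t ^ nat q * h t"
      unfolding M Tz by (simp add: sum_3 h_def h'_def z_def)
    then show ?thesis using t by (simp add: power_inverse)
  qed
  have "(h \<longlongrightarrow> 0) at_infinity"
  proof -
    have "isCont (%s. s ^ nat q * h' s) 0"
      using ch' by (intro continuous_intros) (simp add: continuous_on_eq_continuous_at)
    from isCont_tendsto_compose[OF this tendsto_inverse_0]
    have "((%t. (inverse t) ^ nat q * h' (inverse t)) \<longlongrightarrow> 0) at_infinity" using pq by (simp add: zero_power)
    moreover have "\<forall>\<^sub>F t in at_infinity. (inverse t) ^ nat q * h' (inverse t) = h t"
      unfolding eventually_at_infinity
    proof (intro exI[of _ 1] allI impI)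
      fix t :: complex assume "1 \<le> norm t"
      then have "t \<noteq> 0" by auto
      from rel[OF this] show "(inverse t) ^ nat q * h' (inverse t) = h t" by simp
    qed
    ultimately show ?thesis by (rule Lim_transform_eventually)
  qed
  from Liouville_weak_0[OF hol this, of 0] have "W 3 (vector [0, 0, 0]) = 0" by (simp add: h_def)
  moreover have "(vector [0, 0, 0] :: complex^3) = 0" by (simp add: vec_eq_iff forall_3)
  ultimately have W3: "W 3 0 = 0" by simp
  have pbu: "pb k (u 1) z = (SUM i. cc.c.H i k z * W i z)" for k z unfolding W_def by (rule cc.c.H_grad[symmetric])
  have pu0: "pb k (u 1) 0 = 0" if "k \<noteq> 3" for k
  proof -
    have "pd k (f 1 1 2) 0 = 0"
      by (rule pd_axis_const(1)[OF d[OF f(1)]]) (use that in \<open>simp add: f0 axis_def\<close>)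
    then show ?thesis using pd_cnj(2)[OF d[OF f(1)], of k 1 1 2 0] by (simp add: u_def[abs_def])
  qed
  \<comment> \<open>The Hermitian square of W pairs H W with W. At the origin the components 1 and 2
    of H W vanish as tangential derivatives of the potential, and component 3 of W is 0;
    definiteness does the rest.\<close>
  have W0: "W i 0 = 0" for i
  proof -
    define w where "w = (\<chi> i. W i 0)"
    have "(SUM k l. cc.c.H k l 0 * w $ k * cnj (w $ l)) = (SUM l. (SUM k. cc.c.H k l 0 * W k 0) * cnj (W l 0))"
      unfolding sum_distrib_right w_def by (subst sum.swap) simp
    also have "\<dots> = 0" unfolding pbu[symmetric] sum_3 using pu0[of 1] pu0[of 2] W3 by simp
    finally have "gg 1 1 2 0 w w = 0" by (subst cc.c.g_eq) simp
    then have "w = 0" using cc.c.pos[of w 0] by fastforce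
    then show ?thesis by (simp add: w_def vec_eq_iff)
  qed
  have H: "smooth (cc.c.H k l)" for k l by (rule cc.c.smooth_H)
  have pdu: "pd 3 (u 1) = (%z. - (cnj (z $ 3))\<^sup>2 * cc.c.H 3 3 z)"
  proof
    fix z
    have "pd 3 (u 1) z = cnj (vfield 1 1 2 z * cc.c.H 3 3 z)"
      unfolding u_def[abs_def] pd_cnj(1)[OF d[OF f(1)]] f(2) ..
    then show "pd 3 (u 1) z = - (cnj (z $ 3))\<^sup>2 * cc.c.H 3 3 z"
      by (simp add: vfield_def sec_def cc.c.H_cnj aff_def)
  qed
  define c3 where "c3 z = - (cnj (z $ 3))\<^sup>2" for z :: "complex^3"
  have sc: "smooth (%z::complex^3. cnj (z $ 3))" by (intro smooth_on_linears(1) smooth_on_nth open_UNIV)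
  have sc3: "smooth c3" unfolding c3_def[abs_def] power2_eq_square by (intro smooth_on_minus smooth_on_mult sc open_UNIV)
  have pc: "pb k (%z::complex^3. cnj (z $ 3)) z = (if k = 3 then 1 else 0)" for k z
    using pd_cnj(2)[OF dy, of k 3 z] by (simp add: pd_nth)
  have pc3: "pb k c3 z = (if k = 3 then - 2 * cnj (z $ 3) else 0)" for k z
  proof -
    have "pb k c3 z = - pb k (%z. cnj (z $ 3) * cnj (z $ 3)) z"
      unfolding c3_def[abs_def] power2_eq_square by (rule pd_uminus(2)[OF d]) (intro smooth_on_mult sc open_UNIV)
    then show ?thesis using pd_mult(2)[OF d[OF sc] d[OF sc], of k z] by (simp add: pc)
  qed
  have pbpd: "pb k (pd 3 (u 1)) z = (if k = 3 then - 2 * cnj (z $ 3) else 0) * cc.c.H 3 3 z + c3 z * pb k (cc.c.H 3 3) z" for k z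
    unfolding pdu c3_def[symmetric] pd_mult(2)[OF d[OF sc3] d[OF H]] pc3 ..
  have pdpb: "pb k (pd 3 (u 1)) z = (SUM i. pd 3 (cc.c.H i k) z * W i z + cc.c.H i k z * pd 3 (W i) z)" for k z
  proof -
    have "pb k (pd 3 (u 1)) z = pd 3 (pb k (u 1)) z" by (rule pd_commute(3)[OF open_UNIV UNIV_I su])
    also have "\<dots> = pd 3 (%z. SUM i. cc.c.H i k z * W i z) z" unfolding pbu[abs_def] ..
    also have "\<dots> = (SUM i. pd 3 (%z. cc.c.H i k z * W i z) z)"
      by (rule pd_sum(1)) (intro d smooth_on_mult H sW open_UNIV)
    finally show ?thesis unfolding pd_mult(1)[OF d[OF H] d[OF sW]] .
  qed
  \<comment> \<open>Differentiating H W = dbar u in z_3, the terms with W vanish at the origin and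
    the right-hand side vanishes by the double zero, so H applied to the derivative of W is
    0.\<close>
  have dW0: "pd 3 (W i) 0 = 0" for i
  proof (rule cc.c.H_sum_zero[of 0 "%i. pd 3 (W i) 0"])
    fix k
    show "(SUM i. cc.c.H i k 0 * pd 3 (W i) 0) = 0"
      using pdpb[of k 0] pbpd[of k 0] by (cases "k = 3") (simp_all add: W0 c3_def)
  qed
  have sdW: "smooth (%z. pd 3 (W i) z)" for i by (rule smooth_on_pd[OF open_UNIV sW])
  have sdH: "smooth (%z. pd 3 (cc.c.H k l) z)" for k l by (rule smooth_on_pd[OF open_UNIV H])
  have pbdW: "pb 3 (%z. pd 3 (W i) z) z = 0" for i z
    using pd_commute(3)[OF open_UNIV UNIV_I sW, of 3 3 i z] unfolding pW[abs_def] by (simp add: pd_const)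
  have "pb 3 (pb 3 (pd 3 (u 1))) 0 = 0"
  proof -
    have "pb 3 (pb 3 (pd 3 (u 1))) 0 = (SUM i. pb 3 (%z. pd 3 (cc.c.H i 3) z * W i z + cc.c.H i 3 z * pd 3 (W i) z) 0)"
      unfolding pdpb[abs_def] by (rule pd_sum(2)) (intro d smooth_on_add smooth_on_mult sdH sdW H sW open_UNIV)
    also have "\<dots> = 0"
    proof (intro sum.neutral ballI)
      fix i
      show "pb 3 (%z. pd 3 (cc.c.H i 3) z * W i z + cc.c.H i 3 z * pd 3 (W i) z) 0 = 0"
        unfolding pd_add(2)[OF d[OF smooth_on_mult[OF open_UNIV sdH sW]] d[OF smooth_on_mult[OF open_UNIV H sdW]]]
          pd_mult(2)[OF d[OF sdH] d[OF sW]] pd_mult(2)[OF d[OF H] d[OF sdW]] pW pbdW by (simp add: W0 dW0)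
    qed
    finally show ?thesis .
  qed
  \<comment> \<open>Two dbar_3 derivatives remove the factor -(cnj z_3)^2 exactly.\<close>
  moreover have "pb 3 (pb 3 (pd 3 (u 1))) 0 = - 2 * cc.c.H 3 3 0"
  proof -
    have s2c: "smooth (%z::complex^3. - 2 * cnj (z $ 3))" by (intro smooth_on_mult smooth_on_const sc open_UNIV)
    have spH: "smooth (%z. pb 3 (cc.c.H 3 3) z)" by (rule smooth_on_pb[OF open_UNIV H])
    have p2c: "pb 3 (%z::complex^3. - 2 * cnj (z $ 3)) 0 = - 2"
      using pd_mult(2)[OF d[OF smooth_on_const[OF open_UNIV, of "-2"]] d[OF sc], of 3 0] by (simp add: pd_const pc)
    have "pb 3 (pb 3 (pd 3 (u 1))) 0 = pb 3 (%z. - 2 * cnj (z $ 3) * cc.c.H 3 3 z + c3 z * pb 3 (cc.c.H 3 3) z) 0"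
      unfolding pbpd[abs_def] by simp
    also have "\<dots> = - 2 * cc.c.H 3 3 0"
      unfolding pd_add(2)[OF d[OF smooth_on_mult[OF open_UNIV s2c H]] d[OF smooth_on_mult[OF open_UNIV sc3 spH]]]
        pd_mult(2)[OF d[OF s2c] d[OF H]] pd_mult(2)[OF d[OF sc3] d[OF spH]] p2c pc3 by (simp add: c3_def)
    finally show ?thesis .
  qed
  ultimately show False using cc.c.H_pos[of 3 0] by simp
qed

end

theorem no_csc:
  assumes "p \<ge> 0" "q > 0" "kahler_metric (PB p q) g" "constant_scalar_curvature (PB p q) g"
  shows False
proof -
  interpret PB_csc p q g by standard (use assms in auto)
  show False by (rule contradiction)
qed

section \<open>The momentum profile\<close>

text \<open>A quartic h q that vanishes at x = -1 and x = 1, with derivatives 2 q(-1) and -2 q(1)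
  there, has the form (1 - x^2) (q + \<kappa> (1 - x^2)); \<kappa> is its one free
  coefficient.\<close>

locale profile =
  fixes \<beta> \<delta> a c \<kappa> :: real
  assumes pos: "-1 \<le> x ==> x \<le> 1 ==> \<beta> * x + a > 0" "-1 \<le> x ==> x \<le> 1 ==> \<delta> * x + c > 0"
    and E_pos: "-1 \<le> x ==> x \<le> 1 ==> (\<beta> * x + a) * (\<delta> * x + c) + \<kappa> * (1 - x\<^sup>2) > 0"
begin

definition q :: "real => real" where "q x = (\<beta> * x + a) * (\<delta> * x + c)"
definition e :: "real => real" where "e x = q x + \<kappa> * (1 - x\<^sup>2)"
definition h :: "real => real" where "h x = (1 - x\<^sup>2) * e x / q x"

text \<open>Open and without the bound x \<ge> -1, which leaves room to continue the profile across
  the zero section.\<close>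

definition good :: "real set" where "good = {x. x < 1 \<and> \<beta> * x + a > 0 \<and> \<delta> * x + c > 0 \<and> e x > 0}"

lemma q_pos: "-1 \<le> x ==> x \<le> 1 ==> q x > 0" "x \<in> good ==> q x > 0"
  using pos by (auto simp: q_def good_def)

lemma e_pos: "-1 \<le> x ==> x \<le> 1 ==> e x > 0" using E_pos by (simp add: e_def q_def)

lemma open_good: "open good"
  unfolding good_def e_def q_def by (intro open_Collect_conj open_Collect_less continuous_intros)

text \<open>\<open>x\<close> as a function of the squared norm \<open>r\<close> on the fibres inverts \<open>r = (1 + x) / (1 - x) * exp (k x)\<close>,
  which solves \<open>dr / r = 2 dx / h\<close>; it continues beyond the zero section \<open>r = 0\<close>, \<open>x = -1\<close>.\<close>

lemma profile_exists:
  obtains S \<xi> d k where "open S" "{0..} \<subseteq> S" "smooth_on S \<xi>" "smooth_on S d" "\<And>r. r \<in> S ==> (\<xi> has_real_derivative d r) (at r)"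
    "\<And>r. r \<ge> 0 ==> d r > 0" "\<And>r. r \<ge> 0 ==> -1 \<le> \<xi> r \<and> \<xi> r < 1" "\<And>r. r > 0 ==> -1 < \<xi> r"
    "\<And>r. r \<ge> 0 ==> h (\<xi> r) = 2 * r * d r"
    "k 0 = 0" "\<And>x. -1 < x ==> x < 1 ==> (k has_real_derivative - 2 * \<kappa> / e x) (at x)"
    "\<And>x. -1 < x ==> x < 1 ==> \<xi> ((1 + x) / (1 - x) * exp (k x)) = x"
proof -
  obtain \<epsilon> where \<epsilon>: "\<epsilon> > 0" "cball (-1) \<epsilon> \<subseteq> good"
  proof -
    have "-1 \<in> good" using pos[of "-1"] e_pos[of "-1"] by (simp add: good_def)
    then show thesis using open_contains_cball[of good] open_good that by blast
  qed
  define l where "l = -1 - \<epsilon>"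
  define I where "I = {l<..<1}"
  have I: "open I" "x \<in> I ==> x \<in> good" for x
  proof -
    assume x: "x \<in> I"
    show "x \<in> good"
    proof (cases "x \<ge> -1")
      case True then show ?thesis using x pos[of x] e_pos[of x] by (auto simp: good_def I_def)
    next
      case False
      then have "x \<in> cball (-1) \<epsilon>" using x by (auto simp: I_def l_def dist_real_def)
      then show ?thesis using \<epsilon>(2) by blast
    qed
  qed (simp add: I_def)
  have e_nz: "e x > 0" if "x \<in> {l..1}" for x
  proof (cases "x \<ge> -1")
    case True then show ?thesis using that e_pos[of x] by auto
  next
    case False
    then have "x \<in> cball (-1) \<epsilon>" using that by (auto simp: l_def dist_real_def)
    then show ?thesis using \<epsilon>(2) by (auto simp: good_def)
  qed
  \<comment> \<open>Partial fractions: 2/h = 2/(1 - x^2) - 2 \<kappa>/e. The singular part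
    integrates to the logarithm of (1 + x)/(1 - x); the exponent \<open>k\<close> integrates the
    rest and stays bounded up to x = 1.\<close>
  have "continuous_on {l..1} (%x. - 2 * \<kappa> / e x)"
    using e_nz by (auto simp: e_def q_def intro!: continuous_intros less_imp_neq[THEN not_sym])
  then obtain k0 where k0: "\<And>x. x \<in> {l..1} ==> (k0 has_vector_derivative (- 2 * \<kappa> / e x)) (at x within {l..1})"
    by (rule antiderivative_continuous) blast
  define k where "k x = k0 x - k0 0" for x
  have kd: "(k has_real_derivative - 2 * \<kappa> / e x) (at x)" if x: "x \<in> I" for x
  proof -
    have "(k0 has_real_derivative - 2 * \<kappa> / e x) (at x within {l..1})"
      using k0[of x] x by (auto simp: I_def has_real_derivative_iff_has_vector_derivative)
    then have "(k0 has_real_derivative - 2 * \<kappa> / e x) (at x)"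
      using x at_within_interior[of x "{l..1}"] by (auto simp: I_def interior_atLeastAtMost_real)
    then show ?thesis unfolding k_def by (auto intro!: derivative_eq_intros)
  qed
  have ck: "continuous_on {0..1} k"
  proof -
    have "continuous_on {l..1} k0" using k0 by (intro continuous_on_vector_derivative) auto
    then show ?thesis unfolding k_def[abs_def] using \<epsilon>(1) by (intro continuous_intros) (auto intro: continuous_on_subset simp: l_def)
  qed
  define R where "R x = (1 + x) / (1 - x) * exp (k x)" for x
  \<comment> \<open>This is h/(2 R), the derivative of \<xi> as a function of x; the zeros at x = -1
    are cancelled, so it is smooth and positive there.\<close>
  define D where "D x = (1 - x)\<^sup>2 * e x * exp (- k x) / (2 * q x)" for x
  have D_pos: "D x > 0" if "x \<in> I" for x
    using I(2)[OF that] that q_pos(2)[of x] e_nz[of x] by (auto simp: D_def good_def I_def)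
  have Rd: "(R has_real_derivative inverse (D x)) (at x)" if x: "x \<in> I" for x
  proof -
    have nz: "1 - x \<noteq> 0" "q x > 0" "e x > 0" using x I(2)[OF x] q_pos(2)[of x] e_nz[of x] by (auto simp: I_def good_def)
    have "(R has_real_derivative (2 / (1 - x)\<^sup>2 * exp (k x) + (1 + x) / (1 - x) * (exp (k x) * (- 2 * \<kappa> / e x)))) (at x)"
    proof -
      have 1: "((%x. (1 + x) / (1 - x)) has_real_derivative 2 / (1 - x)\<^sup>2) (at x)"
        using nz(1) by (auto intro!: derivative_eq_intros simp: power2_eq_square)
      have 2: "((%x. exp (k x)) has_real_derivative exp (k x) * (- 2 * \<kappa> / e x)) (at x)"
        by (rule DERIV_chain2[OF DERIV_exp kd[OF x]])
      from DERIV_mult[OF 1 2] show ?thesis unfolding R_def[abs_def] by (simp add: algebra_simps)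
    qed
    moreover have "2 / (1 - x)\<^sup>2 * exp (k x) + (1 + x) / (1 - x) * (exp (k x) * (- 2 * \<kappa> / e x)) = exp (k x) * (2 * (e x - \<kappa> * (1 - x\<^sup>2)) / ((1 - x)\<^sup>2 * e x))"
      using nz by (simp add: divide_simps) (simp add: algebra_simps power2_eq_square power3_eq_cube)
    moreover have "\<dots> = inverse (D x)" unfolding D_def e_def[of x] using nz by (simp add: exp_minus field_simps e_def)
    ultimately show ?thesis by simp
  qed
  have cR: "continuous_on I R" using Rd by (intro continuous_at_imp_continuous_on) (auto intro: DERIV_isCont)
  have mono: "R x < R y" if "x \<in> I" "y \<in> I" "x < y" for x y
  proof (rule DERIV_pos_imp_increasing[OF \<open>x < y\<close>])
    fix z assume "x \<le> z" "z \<le> y"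
    then have "z \<in> I" using that by (auto simp: I_def)
    then show "\<exists>d. (R has_real_derivative d) (at z) \<and> 0 < d" using Rd D_pos by (intro exI[of _ "inverse (D z)"]) auto
  qed
  have inj: "inj_on R I"
  proof (rule inj_onI)
    fix x y assume "x \<in> I" "y \<in> I" "R x = R y"
    then show "x = y" using mono[of x y] mono[of y x] by (cases x y rule: linorder_cases) auto
  qed
  define S where "S = R ` I"
  define \<xi> where "\<xi> = the_inv_into I R"
  have \<xi>R: "\<xi> (R x) = x" if "x \<in> I" for x unfolding \<xi>_def using the_inv_into_f_f[OF inj that] .
  have \<xi>I: "\<xi> r \<in> I" "R (\<xi> r) = r" if "r \<in> S" for r using that \<xi>R by (auto simp: S_def)
  have So: "open S" unfolding S_def by (rule invariance_of_domain[OF cR I(1) inj])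
  have \<xi>d: "(\<xi> has_real_derivative D (\<xi> r)) (at r)" if r: "r \<in> S" for r
    using has_field_derivative_inverse_strong[OF Rd[OF \<xi>I(1)[OF r]] _ I(1) \<xi>I(1)[OF r] cR \<xi>R] D_pos[OF \<xi>I(1)[OF r]] \<xi>I(2)[OF r]
    by auto
  have sxi: "smooth_on I (%x. x)" by (rule smooth_on_id[OF I(1)])
  have sq: "smooth_on I q" "smooth_on I e"
    unfolding e_def[abs_def] q_def[abs_def] by (intro smooth_on_add smooth_on_mult smooth_on_diff smooth_on_power smooth_on_const sxi I(1))+
  have e_nzI: "e x \<noteq> 0" if "x \<in> I" for x using e_nz[of x] that by (simp add: I_def)
  have sk: "smooth_on I k"
    by (rule smooth_on_real_derivI[OF I(1), of k "%x. - 2 * \<kappa> / e x"], erule kd, rule smooth_on_divide[OF I(1) smooth_on_const[OF I(1)] sq(2)], erule e_nzI)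
  have sD: "smooth_on I D" unfolding D_def[abs_def]
    by (intro smooth_on_divide smooth_on_mult smooth_on_exp smooth_on_minus smooth_on_power smooth_on_diff smooth_on_const sk sq sxi I(1))
      (use q_pos(2) I(2) in force)
  have s\<xi>: "smooth_on S \<xi>" by (rule smooth_on_ode[OF So I(1) _ sD \<xi>d]) (use \<xi>I in auto)
  have zI: "-1 \<in> I" "0 \<in> I" "x \<in> I" if "-1 < x" "x < 1" for x using that \<epsilon>(1) by (auto simp: I_def l_def)
  have m1I: "-1 \<in> I" using \<epsilon>(1) by (auto simp: I_def l_def)
  have R1: "R (-1) = 0" by (simp add: R_def)
  have sub: "{0..} \<subseteq> S"
  proof
    fix r :: real assume "r \<in> {0..}"
    then have r: "r \<ge> 0" by simp
    obtain B where B: "\<And>x. x \<in> {0..1} ==> B \<le> k x"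
      using continuous_attains_inf[OF compact_Icc _ ck] by (metis atLeastAtMost_iff empty_iff order_refl zero_le_one)
    \<comment> \<open>Chosen so that 1/(1 - x) - 1 = r exp(-B); as \<open>B\<close> bounds
      \<open>k\<close> from below on [0, 1], this gives \<open>R x \<ge> r\<close>.\<close>
    define x where "x = 1 - 1 / (1 + r * exp (- B))"
    have p: "1 + r * exp (- B) > 0" using r by (simp add: add_pos_nonneg)
    then have x: "0 \<le> x" "x < 1" using r by (auto simp: x_def field_simps)
    have "r = (1 / (1 - x) - 1) * exp B" using p by (simp add: x_def exp_minus field_simps)
    also have "\<dots> \<le> (1 + x) / (1 - x) * exp (k x)"
    proof (rule mult_mono)
      show "1 / (1 - x) - 1 \<le> (1 + x) / (1 - x)" using x by (simp add: field_simps)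
      show "exp B \<le> exp (k x)" using B[of x] x by simp
    qed (use x in auto)
    finally have "r \<le> R x" by (simp add: R_def)
    moreover have "continuous_on {-1..x} R" by (rule continuous_on_subset[OF cR]) (use x \<epsilon>(1) in \<open>auto simp: I_def l_def\<close>)
    ultimately obtain y where "y \<ge> -1" "y \<le> x" "R y = r" using IVT'[of R "-1" r x] R1 r x by auto
    then show "r \<in> S" unfolding S_def using x \<epsilon>(1) by (intro image_eqI[of _ _ y]) (auto simp: I_def l_def)
  qed
  have ge: "-1 \<le> \<xi> r" if "r \<ge> 0" for r
    using mono[of "\<xi> r" "-1"] \<xi>I[of r] sub that m1I R1 by (cases "\<xi> r < -1") auto
  have lt: "\<xi> r < 1" if "r \<ge> 0" for r using \<xi>I(1)[of r] sub that by (auto simp: I_def)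
  have gt: "-1 < \<xi> r" if "r > 0" for r
  proof -
    have "\<xi> r \<noteq> -1" using \<xi>I(2)[of r] subsetD[OF sub, of r] that R1 by auto
    then show ?thesis using ge[of r] that by auto
  qed
  show thesis
  proof (rule that[of S \<xi> "%r. D (\<xi> r)" k])
    show "smooth_on S (%r. D (\<xi> r))" by (rule smooth_on_compose[OF So I(1) _ sD s\<xi>]) (use \<xi>I in auto)
    show "h (\<xi> r) = 2 * r * D (\<xi> r)" if "r \<ge> 0" for r
    proof -
      define x where "x = \<xi> r"
      have "x \<in> I" "r = R x" using \<xi>I[of r] sub that by (auto simp: x_def)
      have "R x * D x = ((1 + x) / (1 - x) * (1 - x)\<^sup>2) * (exp (k x) * exp (- k x)) * e x / (2 * q x)" by (simp add: R_def D_def)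
      also have "(1 + x) / (1 - x) * (1 - x)\<^sup>2 = 1 - x\<^sup>2" using \<open>x \<in> I\<close> by (simp add: I_def power2_eq_square field_simps)
      also have "exp (k x) * exp (- k x) = 1" by (simp add: exp_minus)
      finally show ?thesis using \<open>r = R x\<close> unfolding x_def[symmetric] h_def by simp
    qed
    show "D (\<xi> r) > 0" if "r \<ge> 0" for r using D_pos \<xi>I(1) sub that by auto
    show "-1 \<le> \<xi> r \<and> \<xi> r < 1" if "r \<ge> 0" for r using ge lt that by auto
    show "(k has_real_derivative - 2 * \<kappa> / e x) (at x)" "\<xi> ((1 + x) / (1 - x) * exp (k x)) = x" if "-1 < x" "x < 1" for x
      using kd[OF zI(3)[OF that]] \<xi>R[OF zI(3)[OF that]] by (auto simp: R_def)
  qed (use So sub s\<xi> \<xi>d gt in \<open>auto simp: k_def\<close>)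
qed

end

section \<open>Kaehler metrics from hermitian matrices\<close>

definition herm_form :: "('n => 'n => complex^'n => complex) => complex^'n::finite => complex^'n => complex^'n => real" where
  "herm_form H z u v = Re (SUM k l. H k l z * u $ k * cnj (v $ l))"

lemma herm_herm_form:
  assumes "\<And>k l z. cnj (H k l z) = H l k z"
  shows "herm (herm_form H) k l z = H k l z"
proof -
  have "(SUM k' l'. H k' l' z * axis k 1 $ k' * cnj (axis l b $ l')) = H k l z * cnj b" for b :: complex
  proof -
    have "(SUM l'. H k' l' z * axis k 1 $ k' * cnj (axis l b $ l')) = (if k' = k then H k l z * cnj b else 0)" for k'
    proof -
      have "H k' l' z * axis k 1 $ k' * cnj (axis l b $ l') = (if l' = l then if k' = k then H k l z * cnj b else 0 else 0)" for l'
        by (auto simp: axis_def)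
      then show ?thesis by simp
    qed
    then show ?thesis by simp
  qed
  then have "herm_form H z (axis k 1) (axis l b) = Re (H k l z * cnj b)" for b by (simp add: herm_form_def)
  then show ?thesis unfolding herm_def axis_i[symmetric] by (simp add: complex_eq_iff)
qed

text \<open>A converse to \<open>pd_H_commute\<close>. With \<open>A\<close> the
  \<partial>-derivative of the form, the Kaehler symmetry exchanges its first two arguments, and in
  the cyclic sum for d\<omega> each term then meets its own conjugate with the opposite
  sign.\<close>

lemma kahler_chart_herm_form:
  fixes H :: "'n => 'n => complex^'n::finite => complex"
  assumes smooth: "\<And>k l. smooth (H k l)" and cnj: "\<And>k l z. cnj (H k l z) = H l k z"
    and pos: "\<And>z v. v \<noteq> 0 ==> herm_form H z v v > 0"
    and closed: "\<And>i j l z. pd i (H j l) z = pd j (H i l) z"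
  shows "kahler_chart (herm_form H)"
proof
  fix z u v :: "complex^'n"
  show "smooth (%z. herm_form H z u v)"
    unfolding herm_form_def by (intro smooth_on_linears(2) smooth_on_sum smooth_on_mult smooth_on_const smooth open_UNIV)
  show "bilinear (herm_form H z)"
  proof -
    have 1: "herm_form H z (u + u') v = herm_form H z u v + herm_form H z u' v" "herm_form H z v (u + u') = herm_form H z v u + herm_form H z v u'" for u u' v
      unfolding herm_form_def vector_add_component complex_cnj_add distrib_left distrib_right sum.distrib by simp_all
    have 2: "herm_form H z (r *\<^sub>R u) v = r *\<^sub>R herm_form H z u v" "herm_form H z v (r *\<^sub>R u) = r *\<^sub>R herm_form H z v u" for r u v
    proof -
      have e: "r *\<^sub>R Re S = Re (of_real r * S)" for S by simp
      show "herm_form H z (r *\<^sub>R u) v = r *\<^sub>R herm_form H z u v" "herm_form H z v (r *\<^sub>R u) = r *\<^sub>R herm_form H z v u"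
        unfolding herm_form_def e sum_distrib_left vector_scaleR_component scaleR_conv_of_real[where 'a=complex] complex_cnj_mult complex_cnj_complex_of_real
        by (intro arg_cong[of _ _ Re] sum.cong refl, simp only: mult_ac)+
    qed
    show ?thesis unfolding bilinear_def by (intro conjI allI linearI 1 2)
  qed
  show "herm_form H z u v = herm_form H z v u"
  proof -
    have "(SUM k l. H k l z * u $ k * cnj (v $ l)) = cnj (SUM k l. H k l z * v $ k * cnj (u $ l))"
      by (subst sum.swap) (simp add: cnj mult_ac)
    from arg_cong[OF this, of Re] show ?thesis by (simp only: herm_form_def cnj.sel)
  qed
  show "u \<noteq> 0 ==> herm_form H z u u > 0" by (rule pos)
  show "herm_form H z (J u) (J v) = herm_form H z u v"
    unfolding herm_form_def J_def by (intro arg_cong[of _ _ Re] sum.cong refl) (simp add: algebra_simps)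
  fix w
  define A where "A u v w = (SUM k l. (SUM i. pd i (H k l) z * u $ i) * v $ k * cnj (w $ l))" for u v w
  have A_sym: "A u v w = A v u w" for u v w
  proof -
    have e: "A u v w = (SUM l k i. pd i (H k l) z * u $ i * v $ k * cnj (w $ l))" for u v w
      unfolding A_def sum_distrib_right by (rule sum.swap)
    show ?thesis unfolding e
    proof (rule sum.cong[OF refl])
      fix l
      have "(SUM k i. pd i (H k l) z * u $ i * v $ k * cnj (w $ l)) = (SUM i k. pd i (H k l) z * u $ i * v $ k * cnj (w $ l))"
        by (rule sum.swap)
      also have "\<dots> = (SUM k i. pd i (H k l) z * v $ i * u $ k * cnj (w $ l))"
      proof (intro sum.cong refl)
        fix k i
        show "pd k (H i l) z * u $ k * v $ i * cnj (w $ l) = pd i (H k l) z * v $ i * u $ k * cnj (w $ l)"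
          using closed[of k i l z] by (simp only: mult_ac)
      qed
      finally show "(SUM k i. pd i (H k l) z * u $ i * v $ k * cnj (w $ l)) = (SUM k i. pd i (H k l) z * v $ i * u $ k * cnj (w $ l))" .
    qed
  qed
  have d: "H k l differentiable (at z)" for k l by (rule smooth_onD[OF smooth]) simp
  have pbH: "pb i (H k l) z = cnj (pd i (H l k) z)" for i k l
    using pd_cnj(2)[OF d, of i l k] by (simp add: cnj)
  have D: "dird (%y. fundamental_form (herm_form H) y v w) z u = Re (\<i> * (A u v w + cnj (A u w v)))" for u v w
  proof (rule dird_eqI)
    have "((%y. herm_form H y (J v) w) has_derivative
        (%u. Re (SUM k l. dird (H k l) z u * J v $ k * cnj (w $ l)))) (at z)"
      unfolding herm_form_def
      by (intro has_derivative_Re has_derivative_sum has_derivative_mult_left has_derivative_dird d)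
    moreover have "(SUM k l. dird (H k l) z u * J v $ k * cnj (w $ l)) = \<i> * (A u v w + cnj (A u w v))" for u
    proof -
      have 1: "dird (H k l) z u = (SUM i. pd i (H k l) z * u $ i) + cnj (SUM i. pd i (H l k) z * u $ i)" for k l
        unfolding dird_pd_pb[OF d] pbH by (simp add: sum.distrib)
      have 2: "cnj (A u w v) = (SUM k l. cnj (SUM i. pd i (H l k) z * u $ i) * v $ k * cnj (w $ l))"
        unfolding A_def by (subst sum.swap) (simp add: mult_ac)
      show ?thesis unfolding 1 2 unfolding A_def distrib_left sum_distrib_left sum.distrib[symmetric]
        by (intro sum.cong refl) (simp only: J_def vector_smult_component distrib_left distrib_right mult_ac)
    qed
    ultimately show "((%y. fundamental_form (herm_form H) y v w) has_derivative (%u. Re (\<i> * (A u v w + cnj (A u w v))))) (at z)"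
      by (simp only: fundamental_form_def)
  qed
  show "dird (%y. fundamental_form (herm_form H) y v w) z u + dird (%y. fundamental_form (herm_form H) y w u) z v
      + dird (%y. fundamental_form (herm_form H) y u v) z w = 0"
  proof -
    \<comment> \<open>The imaginary parts of \<open>x\<close> and \<open>cnj x\<close> are opposite,
      and likewise for \<open>y\<close> and \<open>z\<close>.\<close>
    have "Re (\<i> * (x + cnj z)) + Re (\<i> * (y + cnj x)) + Re (\<i> * (z + cnj y)) = 0" for x y z by simp
    then show ?thesis unfolding D A_sym[of u w v] A_sym[of v u w] A_sym[of w v u] .
  qed
qed

text \<open>Identities obtained on the principal orbits pass to the zero section by continuity along
  the third coordinate.\<close>

lemma eq_off_zero:
  fixes F G :: "complex^3 => 'b::real_normed_vector"
  assumes "open S" "continuous_on S F" "continuous_on S G" "\<And>z. z \<in> S ==> z \<in> off_zero ==> F z = G z" "z \<in> S"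
  shows "F z = G z"
proof (cases "z \<in> off_zero")
  case False
  then have z3: "z $ 3 = 0" by (simp add: off_zero_def)
  define U where "U = (%t. upd3 z t) -` S"
  have oU: "open U" unfolding U_def by (rule open_vimage[OF assms(1) continuous_upd3])
  have zU: "0 \<in> U" using assms(5) z3 upd3_self(1)[of z] by (simp add: U_def)
  have c: "((%t. K (upd3 z t)) \<longlongrightarrow> K z) (at 0)" if "continuous_on S K" for K :: "complex^3 => 'b"
  proof -
    have "continuous_on U (%t. K (upd3 z t))"
      by (rule continuous_on_compose2[OF that continuous_upd3]) (auto simp: U_def)
    then have "isCont (%t. K (upd3 z t)) 0" using oU zU by (simp add: continuous_on_eq_continuous_at)
    then show ?thesis using z3 upd3_self(1)[of z] by (simp add: isCont_def)
  qed
  have "\<forall>\<^sub>F t in at 0. t \<in> U - {0}" by (rule eventually_at_in_open[OF oU zU])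
  then have "\<forall>\<^sub>F t in at 0. F (upd3 z t) = G (upd3 z t)"
    by eventually_elim (auto intro!: assms(4) simp: U_def off_zero_def upd3_nth)
  from tendsto_cong[OF this] c[OF assms(2)] have "((%t. G (upd3 z t)) \<longlongrightarrow> F z) (at 0)" by simp
  then show ?thesis using tendsto_unique[OF at_neq_bot _ c[OF assms(3)]] by blast
qed (use assms in simp)

section \<open>The metric in a chart\<close>

text \<open>What \<open>profile_exists\<close> provides for one end of the fibre. \<open>S\<close>
  is an open neighbourhood of [0, \<infinity>), so the derivatives at the section
  \<open>r = 0\<close> are two-sided.\<close>

locale fibre_metric = profile +
  fixes S :: "real set" and \<xi> d :: "real => real"
  assumes S: "open S" "{0..} \<subseteq> S" and smooth_\<xi>: "smooth_on S \<xi>" and smooth_d: "smooth_on S d"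
    and \<xi>_deriv: "r \<in> S ==> (\<xi> has_real_derivative d r) (at r)"
    and d_pos: "r \<ge> 0 ==> d r > 0" and \<xi>_range: "r \<ge> 0 ==> -1 \<le> \<xi> r" "r \<ge> 0 ==> \<xi> r < 1" "r > 0 ==> -1 < \<xi> r"
    and h_\<xi>: "r \<ge> 0 ==> h (\<xi> r) = 2 * r * d r"
begin

definition nn :: "3 => complex^3 => real" where "nn i z = 1 + (cmod (z $ i))\<^sup>2"
definition L :: "3 => complex^3 => real" where "L i z = ln (nn i z)"
text \<open>For \<beta> = -p/2 and \<delta> = -q/2 this is (1 + |z_1|^2)^(-p) (1 + |z_2|^2)^(-q),
  the Hermitian metric of O(p, q); \<open>rho\<close> is then the squared norm on the
  fibres.\<close>

definition sg :: "complex^3 => real" where "sg z = exp (2 * \<beta> * L 1 z + 2 * \<delta> * L 2 z)"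
definition rho :: "complex^3 => real" where "rho z = (cmod (z $ 3))\<^sup>2 * sg z"
definition X :: "complex^3 => real" where "X z = \<xi> (rho z)"
definition lam :: "3 => 3 => complex^3 => complex" where "lam i k z = (if k = i then cnj (z $ i) * inverse (of_real (nn i z)) else 0)"
definition al :: "3 => complex^3 => complex" where "al k z = of_real (2 * \<beta>) * lam 1 k z + of_real (2 * \<delta>) * lam 2 k z"
text \<open>z_3 times \<partial>_k log rho, multiplied out so that it is smooth at z_3 = 0.\<close>

definition ec :: "3 => complex^3 => complex" where "ec k z = (if k = 3 then 1 else 0) + z $ 3 * al k z"
definition k0 :: "complex^3 => real" where "k0 z = 2 * d (rho z) * sg z"
definition A1 :: "complex^3 => real" where "A1 z = 4 * (\<beta> * X z + a) * inverse ((nn 1 z)\<^sup>2)"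
definition A2 :: "complex^3 => real" where "A2 z = 4 * (\<delta> * X z + c) * inverse ((nn 2 z)\<^sup>2)"
text \<open>The first summand is h times \<partial> log rho times its conjugate. Since h = 2 rho d,
  the poles at z_3 = 0 cancel and the smooth factor \<open>k0\<close> remains; the other two are the
  multiples of the round metrics.\<close>

definition Hf :: "3 => 3 => complex^3 => complex" where
  "Hf k l z = of_real (k0 z) * ec k z * cnj (ec l z) + (if k = 1 \<and> l = 1 then of_real (A1 z) else 0) + (if k = 2 \<and> l = 2 then of_real (A2 z) else 0)"
definition gm :: "complex^3 => complex^3 => complex^3 => real" where "gm = herm_form Hf"

lemma nn_pos: "nn i z > 0" by (simp add: nn_def add_pos_nonneg)
lemma sg_pos: "sg z > 0" by (simp add: sg_def)
lemma rho_nonneg: "rho z \<ge> 0" using sg_pos[of z] by (simp add: rho_def)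
lemma rho_S: "rho z \<in> S" using S(2) rho_nonneg by auto
lemma rho_pos: "z \<in> off_zero ==> rho z > 0" using sg_pos[of z] by (simp add: rho_def off_zero_def)

lemma nn_of_real: "complex_of_real (nn i z) = 1 + z $ i * cnj (z $ i)"
  by (simp only: nn_def of_real_add of_real_1 complex_norm_square)

lemma smooth_nn: "smooth (nn i)"
  unfolding nn_def[abs_def] cmod_power2
  by (intro smooth_on_add smooth_on_power smooth_on_linears(2,3) smooth_on_nth smooth_on_const open_UNIV)

lemma smooth_L: "smooth (L i)"
  unfolding L_def[abs_def] by (intro smooth_on_ln smooth_nn nn_pos open_UNIV)

lemma smooth_sg: "smooth sg"
  unfolding sg_def[abs_def] by (intro smooth_on_exp smooth_on_add smooth_on_mult smooth_on_const smooth_L open_UNIV)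

lemma smooth_rho: "smooth rho"
  unfolding rho_def[abs_def] cmod_power2
  by (intro smooth_on_add smooth_on_mult smooth_on_power smooth_on_linears(2,3) smooth_on_nth smooth_sg open_UNIV)

lemma smooth_X: "smooth X"
  unfolding X_def[abs_def] by (rule smooth_on_compose[OF open_UNIV S(1) _ smooth_\<xi> smooth_rho]) (auto simp: rho_S)

lemma smooth_lam: "smooth (lam i k)"
proof (cases "k = i")
  case True
  then show ?thesis unfolding lam_def[abs_def]
    by (simp, intro smooth_on_mult smooth_on_inverse smooth_on_linears(1,4) smooth_on_nth smooth_nn open_UNIV)
      (use nn_pos in \<open>simp add: less_imp_neq[THEN not_sym]\<close>)
qed (simp add: lam_def[abs_def] smooth_on_const)

lemma smooth_al: "smooth (al k)"
  unfolding al_def[abs_def] by (intro smooth_on_add smooth_on_mult smooth_on_const smooth_lam open_UNIV)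

lemma smooth_ec: "smooth (ec k)"
  unfolding ec_def[abs_def] by (intro smooth_on_add smooth_on_mult smooth_on_const smooth_on_nth smooth_al open_UNIV)

lemma smooth_k0: "smooth k0"
  unfolding k0_def[abs_def]
  by (intro smooth_on_mult smooth_on_const smooth_sg smooth_on_compose[OF open_UNIV S(1) _ smooth_d smooth_rho] open_UNIV) (auto simp: rho_S)

lemma smooth_A: "smooth A1" "smooth A2"
  unfolding A1_def[abs_def] A2_def[abs_def]
  by (intro smooth_on_mult smooth_on_inverse smooth_on_power smooth_on_add smooth_on_const smooth_X smooth_nn open_UNIV,
      use nn_pos in \<open>simp add: less_imp_neq[THEN not_sym]\<close>)+

lemma smooth_Hf: "smooth (Hf k l)"
proof -
  have sif: "smooth (%z. if P then complex_of_real (A z) else 0)" if "smooth A" for P and A :: "complex^3 => real"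
    using that by (cases P) (simp_all add: smooth_on_const smooth_on_linears(4))
  show ?thesis unfolding Hf_def[abs_def]
    by (intro smooth_on_add smooth_on_mult sif smooth_on_linears(1) smooth_on_linears(4)[OF open_UNIV smooth_k0] smooth_ec smooth_A open_UNIV)
qed

lemma A_pos: "A1 z > 0" "A2 z > 0"
proof -
  have x: "-1 \<le> X z" "X z \<le> 1" using \<xi>_range(1,2)[OF rho_nonneg, of z] by (simp_all add: X_def less_imp_le)
  show "A1 z > 0" "A2 z > 0" unfolding A1_def A2_def using pos(1)[OF x] pos(2)[OF x] nn_pos[of 1 z] nn_pos[of 2 z]
    by (simp_all add: zero_less_mult_iff)
qed

lemma k0_pos: "k0 z > 0" unfolding k0_def using d_pos[OF rho_nonneg] sg_pos by simp

lemma gm_eq: "gm z u v = k0 z * Re ((SUM k. ec k z * u $ k) * cnj (SUM k. ec k z * v $ k)) + A1 z * (u $ 1 \<bullet> v $ 1) + A2 z * (u $ 2 \<bullet> v $ 2)"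
proof -
  have i: "x \<bullet> y = Re (x * cnj y)" for x y :: complex by (simp add: inner_complex_def)
  have "(SUM k l. Hf k l z * u $ k * cnj (v $ l)) = of_real (k0 z) * ((SUM k. ec k z * u $ k) * cnj (SUM k. ec k z * v $ k))
      + of_real (A1 z) * (u $ 1 * cnj (v $ 1)) + of_real (A2 z) * (u $ 2 * cnj (v $ 2))"
    by (simp add: Hf_def sum_3 algebra_simps)
  moreover have "Re (of_real x * P + of_real y * Q + of_real w * R) = x * Re P + y * Re Q + w * Re R" for x y w P Q R by simp
  ultimately show ?thesis by (simp only: gm_def herm_form_def i)
qed

lemma Hf_cnj: "cnj (Hf k l z) = Hf l k z" by (simp add: Hf_def mult_ac)

lemma gm_pos: "v \<noteq> 0 ==> gm z v v > 0"
proof -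
  assume v: "v \<noteq> 0"
  have i: "Re (x * cnj x) = (cmod x)\<^sup>2" "x \<bullet> x = (cmod x)\<^sup>2" for x :: complex by (simp_all add: complex_norm_square[symmetric] power2_norm_eq_inner)
  define w where "w = (SUM k. ec k z * v $ k)"
  have g: "gm z v v = k0 z * (cmod w)\<^sup>2 + A1 z * (cmod (v $ 1))\<^sup>2 + A2 z * (cmod (v $ 2))\<^sup>2"
    unfolding gm_eq i w_def ..
  have n: "k0 z * (cmod w)\<^sup>2 \<ge> 0" "A1 z * (cmod (v $ 1))\<^sup>2 \<ge> 0" "A2 z * (cmod (v $ 2))\<^sup>2 \<ge> 0"
    using k0_pos A_pos by (simp_all add: less_imp_le)
  have "gm z v v \<noteq> 0"
  proof
    assume "gm z v v = 0"
    then have "k0 z * (cmod w)\<^sup>2 = 0" "A1 z * (cmod (v $ 1))\<^sup>2 = 0" "A2 z * (cmod (v $ 2))\<^sup>2 = 0" using n g by linarith+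
    then have 0: "w = 0" "v $ 1 = 0" "v $ 2 = 0" using k0_pos[of z] A_pos[of z] by simp_all
    then have "v $ 3 = 0" unfolding w_def by (simp add: sum_3 ec_def al_def lam_def)
    then show False using v 0 by (simp add: vec_eq_iff forall_3)
  qed
  then show ?thesis using n g by linarith
qed

lemma d_at: "smooth f ==> f differentiable (at z)"
  by (rule smooth_onD[OF _ UNIV_I])

lemma dy: "(%y::complex^3. y $ r) differentiable (at z)" by (rule d_at[OF smooth_on_nth[OF open_UNIV]])
lemma dcy: "(%y::complex^3. cnj (y $ r)) differentiable (at z)" by (rule d_at) (intro smooth_on_linears(1) smooth_on_nth open_UNIV)
lemma dreal: "smooth f ==> (%z. complex_of_real (f z)) differentiable (at z)"
  by (rule d_at[OF smooth_on_linears(4)[OF open_UNIV]])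

lemma pd_cy: "pd k (%y::complex^3. cnj (y $ r)) z = 0" "pb k (%y::complex^3. cnj (y $ r)) z = (if k = r then 1 else 0)"
  using pd_cnj[OF dy, of k r z] by (simp_all add: pd_nth)

lemma pd_abs2: "pd k (%z::complex^3. z $ i * cnj (z $ i)) z = (if k = i then cnj (z $ i) else 0)"
  using pd_mult(1)[OF dy dcy, of k i i z] by (simp add: pd_nth pd_cy)

lemma pd_nn: "pd k (%z. complex_of_real (nn i z)) z = (if k = i then cnj (z $ i) else 0)"
proof -
  have "(%z::complex^3. z $ i * cnj (z $ i)) differentiable (at z)" using dy dcy by (rule differentiable_mult)
  from pd_add(1)[OF differentiable_const this, of k 1] show ?thesis unfolding nn_of_real[abs_def] by (simp add: pd_abs2 pd_const)
qed

lemma pd_L: "pd k (%z. complex_of_real (L i z)) z = lam i k z"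
  unfolding L_def
  using pd_of_real_compose(1)[OF dreal[OF smooth_nn] refl DERIV_ln[OF nn_pos], of k i z] by (simp add: pd_nn lam_def of_real_inverse mult.commute)

lemma pb_lam: "pb k (lam i l) z = (if k = i \<and> l = i then of_real (inverse ((nn i z)\<^sup>2)) else 0)"
proof (cases "l = i")
  case True
  have nz: "complex_of_real (nn i z) \<noteq> 0" for z using nn_pos[of i z] by simp
  have inv: "pb k (%z. inverse (complex_of_real (nn i z))) z = - (if k = i then z $ i else 0) * (inverse (of_real (nn i z)))\<^sup>2"
    using pd_inverse(2)[OF dreal[OF smooth_nn] nz, of k] pd_cnj(2)[OF dreal[OF smooth_nn], of k i z] by (simp add: pd_nn)
  have "(%z. inverse (complex_of_real (nn i z))) differentiable (at z)"
    by (rule d_at) (intro smooth_on_inverse smooth_on_linears(4) smooth_nn nz open_UNIV)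
  then have "pb k (lam i l) z = (if k = i then inverse (of_real (nn i z)) - cnj (z $ i) * z $ i * (inverse (of_real (nn i z)))\<^sup>2 else 0)"
    using pd_mult(2)[OF dcy, of "%z. inverse (complex_of_real (nn i z))" z k i] True
    by (simp add: lam_def[abs_def] pd_cy inv)
  also have "inverse (of_real (nn i z)) - cnj (z $ i) * z $ i * (inverse (of_real (nn i z)))\<^sup>2 = complex_of_real (inverse ((nn i z)\<^sup>2))"
  proof -
    have "inverse n - w * (inverse n)\<^sup>2 = inverse (n\<^sup>2)" if "n = 1 + w" "n \<noteq> 0" for n w :: complex
      proof -
      have "w = n - 1" using that by simp
      then show ?thesis using that(2) by (simp add: field_simps power2_eq_square)
    qed
    then show ?thesis using nn_of_real[of i z] nz[of z] by (simp add: mult.commute)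
  qed
  finally show ?thesis using True by simp
qed (simp add: lam_def[abs_def] pd_const)

lemma pd_sg: "pd k (%z. complex_of_real (sg z)) z = of_real (sg z) * al k z"
proof -
  let ?f = "%z. 2 * \<beta> * L 1 z + 2 * \<delta> * L 2 z"
  have s: "smooth ?f" by (intro smooth_on_add smooth_on_mult smooth_on_const smooth_L open_UNIV)
  have "pd k (%z. complex_of_real (?f z)) z = al k z"
  proof -
    have c: "pd k (%z. of_real (2 * b) * complex_of_real (L i z)) z = of_real (2 * b) * lam i k z" for b i
      unfolding pd_mult(1)[OF differentiable_const dreal[OF smooth_L]] by (simp add: pd_const pd_L)
    have dd: "(%z. of_real (2 * b) * complex_of_real (L i z)) differentiable (at z)" for b i
      by (rule differentiable_mult[OF differentiable_const dreal[OF smooth_L]])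
    show ?thesis using pd_add(1)[OF dd dd, of k \<beta> 1 \<delta> 2] unfolding c by (simp add: al_def)
  qed
  then show ?thesis unfolding sg_def using pd_of_real_compose(1)[OF dreal[OF s] refl DERIV_exp, of k z] by simp
qed

lemma pd_rho: "pd k (%z. complex_of_real (rho z)) z = cnj (z $ 3) * of_real (sg z) * ec k z"
proof -
  have e: "complex_of_real (rho z) = (z $ 3 * cnj (z $ 3)) * of_real (sg z)" for z by (simp only: rho_def of_real_mult complex_norm_square)
  have "(%z::complex^3. z $ 3 * cnj (z $ 3)) differentiable (at z)" using dy dcy by (rule differentiable_mult)
  from pd_mult(1)[OF this dreal[OF smooth_sg], of k] show ?thesis
    unfolding e pd_abs2 pd_sg by (simp add: ec_def algebra_simps)
qed

lemma pd_X: "pd k (%z. complex_of_real (X z)) z = of_real (d (rho z)) * (cnj (z $ 3) * of_real (sg z) * ec k z)"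
  unfolding X_def using pd_of_real_compose(1)[OF dreal[OF smooth_rho] refl \<xi>_deriv[OF rho_S], of k z] by (simp add: pd_rho)

text \<open>\<partial>_k log rho off the zero section. The imaginary part of the form with these
  coefficients will be the connection form.\<close>

definition eta :: "3 => complex^3 => complex" where "eta k z = (if k = 3 then inverse (z $ 3) else 0) + al k z"

lemma eta_ec: "z \<in> off_zero ==> eta k z = ec k z * inverse (z $ 3)"
  by (simp add: eta_def ec_def off_zero_def field_simps)

lemma smooth_ieta: "smooth_on off_zero (%z. if k = 3 then inverse (z $ 3) else 0)"
proof (cases "k = 3")
  case True
  then show ?thesis by (simp, intro smooth_on_inverse smooth_on_nth open_off_zero) (simp add: off_zero_def)
qed (simp add: smooth_on_const open_off_zero)

lemma smooth_eta: "smooth_on off_zero (eta k)"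
  unfolding eta_def[abs_def]
  by (intro smooth_on_add smooth_ieta smooth_on_subset[OF smooth_al] open_off_zero) simp_all

lemma d_off: "smooth_on off_zero f ==> z \<in> off_zero ==> f differentiable (at z)"
  by (rule smooth_onD)

lemma pb_al: "pb k (al l) z = (if k = 1 \<and> l = 1 then of_real (2 * \<beta> * inverse ((nn 1 z)\<^sup>2)) else 0) + (if k = 2 \<and> l = 2 then of_real (2 * \<delta> * inverse ((nn 2 z)\<^sup>2)) else 0)"
proof -
  have c: "pb k (%z. of_real (2 * b) * lam i l z) z = of_real (2 * b) * pb k (lam i l) z" for b i
    unfolding pd_mult(2)[OF differentiable_const d_at[OF smooth_lam]] by (simp add: pd_const)
  have dd: "(%z. of_real (2 * b) * lam i l z) differentiable (at z)" for b i
    by (rule differentiable_mult[OF differentiable_const d_at[OF smooth_lam]])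
  show ?thesis unfolding al_def[abs_def] using pd_add(2)[OF dd dd, of k \<beta> 1 \<delta> 2] unfolding c pb_lam by simp
qed

lemma pb_eta: "z \<in> off_zero ==> pb k (eta l) z = pb k (al l) z"
proof -
  assume z: "z \<in> off_zero"
  have "pb k (%z. inverse (z $ 3)) z = 0" using pd_inverse(2)[OF dy[of 3 z], of k] z by (simp add: off_zero_def pd_nth)
  then have 0: "pb k (%z. if l = 3 then inverse (z $ 3) else 0) z = 0" by (cases "l = 3") (simp_all add: pd_const)
  from pd_add(2)[OF d_off[OF smooth_ieta[of l] z] d_at[OF smooth_al[of l]], of k] show ?thesis unfolding eta_def[abs_def] 0 by simp
qed

text \<open>Off the zero section the matrix is \<open>\<partial>\<^sub>j B\<^sub>l\<close> for the following \<open>B\<close>.\<close>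

definition B :: "3 => complex^3 => complex" where
  "B l z = of_real (2 * X z) * cnj (eta l z) + of_real (4 * a) * cnj (lam 1 l z) + of_real (4 * c) * cnj (lam 2 l z)"

lemma smooth_B: "smooth_on off_zero (B l)"
  unfolding B_def[abs_def]
  by (intro smooth_on_add smooth_on_mult smooth_on_const smooth_on_linears(1,4) smooth_eta
      smooth_on_subset[OF smooth_X] smooth_on_subset[OF smooth_lam] open_off_zero) simp_all

lemma Hf_B:
  assumes z: "z \<in> off_zero" shows "pd j (B l) z = Hf j l z"
proof -
  have sX2: "smooth (%z. 2 * X z)" by (intro smooth_on_mult smooth_on_const smooth_X open_UNIV)
  have pX2: "pd j (%z. complex_of_real (2 * X z)) z = of_real (2 * d (rho z)) * (cnj (z $ 3) * of_real (sg z) * ec j z)"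
    using pd_mult(1)[OF differentiable_const dreal[OF smooth_X], of j 2 z] by (simp add: pd_const pd_X)
  have sce: "smooth_on off_zero (%z. cnj (eta l z))" by (rule smooth_on_linears(1)[OF open_off_zero smooth_eta])
  have scl: "smooth (%z. cnj (lam i l z))" for i by (rule smooth_on_linears(1)[OF open_UNIV smooth_lam])
  have 1: "pd j (%z. of_real (2 * X z) * cnj (eta l z)) z = of_real (2 * d (rho z)) * (cnj (z $ 3) * of_real (sg z) * ec j z) * cnj (eta l z) + of_real (2 * X z) * cnj (pb j (al l) z)"
    unfolding pd_mult(1)[OF dreal[OF sX2] d_off[OF sce z]] pX2 pd_cnj(1)[OF d_off[OF smooth_eta z]] pb_eta[OF z] ..
  have 2: "pd j (%z. of_real r * cnj (lam i l z)) z = of_real r * cnj (pb j (lam i l) z)" for r i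
    unfolding pd_mult(1)[OF differentiable_const d_at[OF scl]] pd_cnj(1)[OF d_at[OF smooth_lam]] by (simp add: pd_const)
  have d1: "(%z. of_real (2 * X z) * cnj (eta l z)) differentiable (at z)"
    by (rule differentiable_mult[OF dreal[OF sX2] d_off[OF sce z]])
  have d2: "(%z. of_real r * cnj (lam i l z)) differentiable (at z)" for r i
    by (rule differentiable_mult[OF differentiable_const d_at[OF scl]])
  have "pd j (B l) z = of_real (2 * d (rho z)) * (cnj (z $ 3) * of_real (sg z) * ec j z) * cnj (eta l z) + of_real (2 * X z) * cnj (pb j (al l) z)
      + of_real (4 * a) * cnj (pb j (lam 1 l) z) + of_real (4 * c) * cnj (pb j (lam 2 l) z)"
    unfolding B_def[abs_def] pd_add(1)[OF differentiable_add[OF d1 d2] d2] pd_add(1)[OF d1 d2] 1 2 ..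
  also have "of_real (2 * d (rho z)) * (cnj (z $ 3) * of_real (sg z) * ec j z) * cnj (eta l z) = of_real (k0 z) * ec j z * cnj (ec l z)"
    unfolding eta_ec[OF z] k0_def using z by (simp add: off_zero_def)
  also have "of_real (k0 z) * ec j z * cnj (ec l z) + of_real (2 * X z) * cnj (pb j (al l) z) + of_real (4 * a) * cnj (pb j (lam 1 l) z) + of_real (4 * c) * cnj (pb j (lam 2 l) z) = Hf j l z"
    unfolding pb_al pb_lam Hf_def A1_def A2_def by (auto simp: algebra_simps)
  finally show ?thesis .
qed

text \<open>Off the zero section both sides are the same second derivative of \<open>B l\<close>;
  the zero section follows by continuity.\<close>

lemma Hf_closed: "pd i (Hf j l) z = pd j (Hf i l) z"
proof (rule eq_off_zero[OF open_UNIV _ _ _ UNIV_I])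
  show "continuous_on UNIV (pd i (Hf j l))" "continuous_on UNIV (pd j (Hf i l))"
    by (rule smooth_on_continuous[OF smooth_on_pd[OF open_UNIV smooth_Hf]])+
  fix z assume z: "z \<in> off_zero"
  have "pd i (Hf j l) z = pd i (pd j (B l)) z" by (rule pd_cong_open(1)[OF open_off_zero z]) (simp add: Hf_B)
  also have "\<dots> = pd j (pd i (B l)) z" by (rule pd_commute(1)[OF open_off_zero z smooth_B])
  also have "\<dots> = pd j (Hf i l) z" by (rule pd_cong_open(1)[OF open_off_zero z]) (simp add: Hf_B)
  finally show "pd i (Hf j l) z = pd j (Hf i l) z" .
qed

lemma gm_kahler: "kahler_chart3 gm"
  unfolding kahler_chart3_def gm_def
  by (rule kahler_chart_herm_form[OF smooth_Hf Hf_cnj gm_pos[unfolded gm_def] Hf_closed])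

end

text \<open>Both matrices are diagonal in the same coframe dz_1, dz_2, \<open>e\<close>, so the
  trace is the sum of the quotients of their coefficients.\<close>

lemma (in kahler_chart3) trace_K:
  fixes e :: "3 => complex"
  assumes H: "\<And>k l. H k l z = h0 * e k * cnj (e l) + (if k = 1 \<and> l = 1 then h1 else 0) + (if k = 2 \<and> l = 2 then h2 else 0)"
    and e3: "e 3 = 1" and nz: "h0 \<noteq> 0" "h1 \<noteq> 0" "h2 \<noteq> 0"
    and r: "\<And>k m. r k m = c0 * e k * cnj (e m) + (if k = 1 \<and> m = 1 then c1 else 0) + (if k = 2 \<and> m = 2 then c2 else 0)"
  shows "(SUM m k. K m k z * r k m) = c0 / h0 + c1 / h1 + c2 / h2"
proof -
  \<comment> \<open>The frame dual to the coframe dz_1, dz_2, \<open>e\<close>; in it the inverse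
    matrix \<open>K'\<close> is diagonal.\<close>
  define f where "f i k = (if i = 3 then if k = 3 then 1 else 0 else if k = i then 1 else if k = 3 then - e i else 0)" for i k :: 3
  define K' where "K' l m = cnj (f 1 l) * f 1 m / h1 + cnj (f 2 l) * f 2 m / h2 + cnj (f 3 l) * f 3 m / h0" for l m
  have "(SUM l. H k l z * K' l m) = (if k = m then 1 else 0)" for k m
  proof -
    have "\<forall>k m. (SUM l. H k l z * K' l m) = (if k = m then 1 else 0)"
      unfolding forall_3 sum_3 H K'_def f_def using nz e3 by (simp add: field_simps)
    then show ?thesis by blast
  qed
  then have KK: "K k m z = K' k m" for k m by (rule K_unique)
  show ?thesis unfolding sum_3 r KK K'_def f_def using nz e3 by (simp add: field_simps)
qed

section \<open>Determinant, Ricci form and scalar curvature of the fibre metric\<close>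

context fibre_metric begin

sublocale g: kahler_chart3 gm by (rule gm_kahler)

lemma herm_gm: "g.H k l z = Hf k l z"
  unfolding gm_def by (rule herm_herm_form[OF Hf_cnj])

definition psi :: "real => real" where "psi x = (1 - x\<^sup>2) * e x"
definition psi' :: "real => real" where
  "psi' x = - 2 * x * e x + (1 - x\<^sup>2) * (\<beta> * (\<delta> * x + c) + \<delta> * (\<beta> * x + a) - 2 * \<kappa> * x)"
definition psi'' :: "real => real" where
  "psi'' x = - 2 * e x - 4 * x * (\<beta> * (\<delta> * x + c) + \<delta> * (\<beta> * x + a) - 2 * \<kappa> * x) + (1 - x\<^sup>2) * (2 * \<beta> * \<delta> - 2 * \<kappa>)"

lemma q_deriv: "(q has_real_derivative \<beta> * (\<delta> * x + c) + \<delta> * (\<beta> * x + a)) (at x)"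
  unfolding q_def[abs_def] by (auto intro!: derivative_eq_intros simp: algebra_simps)

lemma e_deriv: "(e has_real_derivative \<beta> * (\<delta> * x + c) + \<delta> * (\<beta> * x + a) - 2 * \<kappa> * x) (at x)"
  unfolding e_def[abs_def] by (auto intro!: derivative_eq_intros q_deriv)

lemma psi_deriv: "(psi has_real_derivative psi' x) (at x)"
  unfolding psi_def[abs_def] psi'_def by (auto intro!: derivative_eq_intros e_deriv)

lemma psi'_deriv: "(psi' has_real_derivative psi'' x) (at x)"
  unfolding psi'_def[abs_def] psi''_def by (auto intro!: derivative_eq_intros e_deriv simp: algebra_simps power2_eq_square)

lemma X_range: "-1 \<le> X z" "X z < 1" "z \<in> off_zero ==> -1 < X z"
  using \<xi>_range(1,2)[OF rho_nonneg] \<xi>_range(3)[OF rho_pos] by (simp_all add: X_def)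

lemma qX: "q (X z) > 0" using q_pos(1)[of "X z"] X_range[of z] by simp

lemma psi_X: "z \<in> off_zero ==> psi (X z) > 0"
proof -
  assume z: "z \<in> off_zero"
  have "(X z)\<^sup>2 < 1" using X_range(3)[OF z] X_range(2)[of z] by (simp add: power2_less_1_iff abs_less_iff)
  then show ?thesis using e_pos[of "X z"] X_range[of z] by (simp add: psi_def)
qed

lemma psi_h: "psi (X z) = q (X z) * (2 * rho z * d (rho z))"
  using h_\<xi>[OF rho_nonneg, of z] qX[of z] by (simp add: psi_def h_def X_def[symmetric] field_simps)

lemma det_gm: "g.G z = of_real (k0 z * A1 z * A2 z)"
proof -
  have "g.G z = of_real (k0 z) * of_real (A1 z) * of_real (A2 z)"
    unfolding g.G_expand herm_gm Hf_def by (simp add: ec_def al_def lam_def algebra_simps)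
  then show ?thesis by simp
qed

text \<open>The logarithm of the volume density. It comes from k0 |z_3|^2 = psi/q and A1 A2 = 16
  q/(nn_1^2 nn_2^2), where the factors q cancel.\<close>

definition ell :: "complex^3 => real" where
  "ell z = ln (psi (X z)) - ln ((cmod (z $ 3))\<^sup>2) - 2 * L 1 z - 2 * L 2 z + ln 16"

lemma det_exp: "z \<in> off_zero ==> k0 z * A1 z * A2 z = exp (ell z)"
proof -
  assume z: "z \<in> off_zero"
  have t: "(cmod (z $ 3))\<^sup>2 > 0" using z by (simp add: off_zero_def)
  have "exp (ell z) = psi (X z) / (cmod (z $ 3))\<^sup>2 / (nn 1 z)\<^sup>2 / (nn 2 z)\<^sup>2 * 16"
    unfolding ell_def exp_add exp_diff using psi_X[OF z] t nn_pos[of 1 z] nn_pos[of 2 z]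
    by (simp add: L_def exp_double)
  also have "\<dots> = k0 z * A1 z * A2 z"
    unfolding psi_h A1_def A2_def k0_def q_def rho_def using t nn_pos[of 1 z] nn_pos[of 2 z] by (simp add: divide_simps) (simp add: algebra_simps)
  finally show ?thesis by simp
qed

text \<open>The derivative of log psi with respect to log rho, because dx/d(log rho) = h/2 and psi =
  h q.\<close>

definition yy :: "real => real" where "yy x = psi' x / (2 * q x)"
definition yy' :: "real => real" where "yy' x = psi'' x / (2 * q x) - psi' x * (\<beta> * (\<delta> * x + c) + \<delta> * (\<beta> * x + a)) / (2 * (q x)\<^sup>2)"

lemma yy_deriv: "q x \<noteq> 0 ==> (yy has_real_derivative yy' x) (at x)"
  unfolding yy_def[abs_def] yy'_def
  by (auto intro!: derivative_eq_intros psi'_deriv q_deriv simp: field_simps power2_eq_square)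

lemma pd_X_eta: "z \<in> off_zero ==> pd k (%z. complex_of_real (X z)) z = of_real (rho z * d (rho z)) * eta k z"
  unfolding pd_X eta_ec rho_def
  by (simp only: of_real_mult complex_norm_square) (simp add: off_zero_def)

lemma smooth_ell:
  shows "smooth_on off_zero (%z. ln (psi (X z)))" "smooth_on off_zero (%z. ln ((cmod (z $ 3))\<^sup>2))"
proof -
  have sX: "smooth_on off_zero X" by (rule smooth_on_subset[OF smooth_X]) simp
  have "smooth_on off_zero (%z. psi (X z))" unfolding psi_def e_def q_def
    by (intro smooth_on_add smooth_on_mult smooth_on_diff smooth_on_power smooth_on_const sX open_off_zero)
  then show "smooth_on off_zero (%z. ln (psi (X z)))" by (rule smooth_on_ln[OF open_off_zero]) (rule psi_X)
  have "smooth_on off_zero (%z::complex^3. (cmod (z $ 3))\<^sup>2)" unfolding cmod_power2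
    by (intro smooth_on_add smooth_on_power smooth_on_linears(2,3) smooth_on_nth open_off_zero)
  then show "smooth_on off_zero (%z. ln ((cmod (z $ 3))\<^sup>2))"
    by (rule smooth_on_ln[OF open_off_zero]) (simp add: off_zero_def)
qed

lemma tau_gm:
  assumes z: "z \<in> off_zero"
  shows "g.\<tau> k z = of_real (yy (X z)) * eta k z - (if k = 3 then inverse (z $ 3) else 0) - 2 * lam 1 k z - 2 * lam 2 k z"
proof -
  have dr: "(%z. complex_of_real (f z)) differentiable (at z)" if "smooth_on off_zero f" for f
    by (rule d_off[OF smooth_on_linears(4)[OF open_off_zero that] z])
  have sL: "smooth_on off_zero (%z. 2 * L i z)" for i
    by (rule smooth_on_subset[OF smooth_on_mult[OF open_UNIV smooth_on_const[OF open_UNIV] smooth_L]]) simp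
  have se: "smooth_on off_zero (%z. ln (psi (X z)) - ln ((cmod (z $ 3))\<^sup>2))" "smooth_on off_zero (%z. ln (psi (X z)) - ln ((cmod (z $ 3))\<^sup>2) - 2 * L 1 z)"
    "smooth_on off_zero (%z. ln (psi (X z)) - ln ((cmod (z $ 3))\<^sup>2) - 2 * L 1 z - 2 * L 2 z)"
    by (intro smooth_on_diff smooth_ell sL open_off_zero)+
  have sell: "smooth_on off_zero ell" unfolding ell_def[abs_def]
    by (intro smooth_on_add se smooth_on_const open_off_zero)
  have p1: "pd k (%z. complex_of_real (ln (psi (X z)))) z = of_real (yy (X z)) * eta k z"
  proof -
    have D: "((%x. ln (psi x)) has_real_derivative psi' (X z) / psi (X z)) (at (X z))"
      using DERIV_chain2[OF DERIV_ln[OF psi_X[OF z]] psi_deriv] by (simp add: divide_inverse mult.commute)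
    have "psi' (X z) / psi (X z) * (rho z * d (rho z)) = yy (X z)"
      unfolding yy_def psi_h using rho_pos[OF z] d_pos[OF rho_nonneg, of z] qX[of z] by (simp add: field_simps)
    then have "of_real (yy (X z)) = complex_of_real (psi' (X z) / psi (X z)) * of_real (rho z * d (rho z))" by (simp only: of_real_mult[symmetric])
    then show ?thesis
      using pd_of_real_compose(1)[OF dreal[OF smooth_X] refl D, of k] by (simp only: pd_X_eta[OF z] mult.assoc)
  qed
  have p2: "pd k (%z. complex_of_real (ln ((cmod (z $ 3))\<^sup>2))) z = (if k = 3 then inverse (z $ 3) else 0)"
  proof -
    have s: "smooth (%z::complex^3. (cmod (z $ 3))\<^sup>2)" unfolding cmod_power2
      by (intro smooth_on_add smooth_on_power smooth_on_linears(2,3) smooth_on_nth open_UNIV)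
    have t: "(cmod (z $ 3))\<^sup>2 > 0" using z by (simp add: off_zero_def)
    have "pd k (%z. complex_of_real (ln ((cmod (z $ 3))\<^sup>2))) z = of_real (inverse ((cmod (z $ 3))\<^sup>2)) * (if k = 3 then cnj (z $ 3) else 0)"
      using pd_of_real_compose(1)[OF dreal[OF s] refl DERIV_ln[OF t], of k] pd_abs2[of k 3 z] by (simp only: complex_norm_square)
    then show ?thesis unfolding of_real_inverse complex_norm_square using z by (simp add: off_zero_def)
  qed
  have p3: "pd k (%z. complex_of_real (2 * L i z)) z = 2 * lam i k z" for i
    unfolding of_real_mult using pd_mult(1)[OF differentiable_const dreal[OF smooth_L]] by (simp add: pd_const pd_L)
  have "pd k (%z. complex_of_real (ell z)) z = of_real (yy (X z)) * eta k z - (if k = 3 then inverse (z $ 3) else 0) - 2 * lam 1 k z - 2 * lam 2 k z"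
    unfolding ell_def of_real_add of_real_diff
    unfolding pd_add(1)[OF dr[OF se(3), unfolded of_real_diff] differentiable_const] pd_diff(1)[OF dr[OF se(2), unfolded of_real_diff] dr[OF sL]]
      pd_diff(1)[OF dr[OF se(1), unfolded of_real_diff] dr[OF sL]] pd_diff(1)[OF dr[OF smooth_ell(1)] dr[OF smooth_ell(2)]] p1 p2 p3
    by (simp add: pd_const)
  moreover have "pd k g.G z = g.G z * pd k (%z. complex_of_real (ell z)) z"
  proof -
    have "pd k g.G z = pd k (%z. complex_of_real (exp (ell z))) z"
      by (rule pd_cong_open(1)[OF open_off_zero z]) (simp add: det_gm det_exp)
    also have "\<dots> = of_real (exp (ell z)) * pd k (%z. complex_of_real (ell z)) z"
      using pd_of_real_compose(1)[OF dr[OF sell] refl DERIV_exp, of k] by simp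
    finally show ?thesis by (simp add: det_gm det_exp[OF z])
  qed
  ultimately show ?thesis using g.pd_G[of k z] g.G_nz[of z] by simp
qed

lemma rho_gm:
  assumes z: "z \<in> off_zero"
  shows "g.\<rho> k m z = of_real (yy' (X z) * rho z * d (rho z)) * eta k z * cnj (eta m z)
    + (if k = 1 \<and> m = 1 then of_real ((2 * \<beta> * yy (X z) - 2) * inverse ((nn 1 z)\<^sup>2)) else 0)
    + (if k = 2 \<and> m = 2 then of_real ((2 * \<delta> * yy (X z) - 2) * inverse ((nn 2 z)\<^sup>2)) else 0)"
proof -
  have dyy: "(%z. complex_of_real (yy (X z))) differentiable (at z)"
  proof -
    have nz: "2 * ((\<beta> * X z + a) * (\<delta> * X z + c)) \<noteq> 0" for z
      using qX[of z] unfolding q_def by (metis less_irrefl mult_eq_0_iff zero_neq_numeral)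
    have "smooth (%z. yy (X z))" unfolding yy_def psi'_def e_def q_def
      by (intro smooth_on_divide smooth_on_add smooth_on_mult smooth_on_diff smooth_on_power smooth_on_const smooth_X open_UNIV nz)
    then show ?thesis by (rule dreal)
  qed
  have py: "pb m (%z. complex_of_real (yy (X z))) z = of_real (yy' (X z)) * (of_real (rho z * d (rho z)) * cnj (eta m z))"
  proof -
    have "pb m (%z. complex_of_real (X z)) z = cnj (pd m (%z. complex_of_real (X z)) z)"
      using pd_cnj(2)[OF dreal[OF smooth_X], of m z] by simp
    then have pX: "pb m (%z. complex_of_real (X z)) z = of_real (rho z * d (rho z)) * cnj (eta m z)"
      unfolding pd_X_eta[OF z] by simp
    have D: "(yy has_real_derivative yy' (X z)) (at (X z))" using qX[of z] by (intro yy_deriv) simp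
    show ?thesis using pd_of_real_compose(2)[OF dreal[OF smooth_X] refl D, of m] unfolding pX .
  qed
  note deta = d_off[OF smooth_eta z] and dieta = d_off[OF smooth_ieta z]
  have dl: "(%z. 2 * lam i k z) differentiable (at z)" for i by (rule differentiable_mult[OF differentiable_const d_at[OF smooth_lam]])
  have pl: "pb m (%z. 2 * lam i k z) z = 2 * pb m (lam i k) z" for i
    unfolding pd_mult(2)[OF differentiable_const d_at[OF smooth_lam]] by (simp add: pd_const)
  have pie: "pb m (%z. if k = 3 then inverse (z $ 3) else 0) z = 0"
    using pd_inverse(2)[OF dy[of 3 z], of m] z by (cases "k = 3") (simp_all add: off_zero_def pd_nth pd_const)
  have "g.\<rho> k m z = pb m (%z. of_real (yy (X z)) * eta k z - (if k = 3 then inverse (z $ 3) else 0) - 2 * lam 1 k z - 2 * lam 2 k z) z"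
    unfolding g.\<rho>_def by (rule pd_cong_open(2)[OF open_off_zero z]) (rule tau_gm)
  also have "\<dots> = of_real (yy' (X z)) * (of_real (rho z * d (rho z)) * cnj (eta m z)) * eta k z + of_real (yy (X z)) * pb m (al k) z
      - 2 * pb m (lam 1 k) z - 2 * pb m (lam 2 k) z"
    unfolding pd_diff(2)[OF differentiable_diff[OF differentiable_diff[OF differentiable_mult[OF dyy deta] dieta] dl] dl]
      pd_diff(2)[OF differentiable_diff[OF differentiable_mult[OF dyy deta] dieta] dl] pd_diff(2)[OF differentiable_mult[OF dyy deta] dieta]
      pd_mult(2)[OF dyy deta] py pl pie pb_eta[OF z] by simp
  finally show ?thesis unfolding pb_al pb_lam by (auto simp: algebra_simps)
qed

text \<open>Tracing the Ricci matrix in the adapted coframe, all first derivatives of psi cancel and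
  the trace becomes (psi'' - 2(\<beta> x + a) - 2(\<delta> x + c))/(4 q). Continuity covers the zero
  section.\<close>

lemma const_scalar_gm:
  assumes csc: "\<And>x. psi'' x = 2 * (\<beta> * x + a) + 2 * (\<delta> * x + c) - s * q x"
  shows "scalar_curvature gm z = s"
proof -
  have off: "(SUM m k. g.K m k z * g.\<rho> k m z) = of_real (- s / 4)" if z: "z \<in> off_zero" for z
  proof -
    let ?x = "X z"
    have z3: "z $ 3 \<noteq> 0" using z by (simp add: off_zero_def)
    have c0: "of_real (yy' ?x * rho z * d (rho z)) * eta k z * cnj (eta m z) = of_real (yy' ?x * d (rho z) * sg z) * ec k z * cnj (ec m z)" for k m
      unfolding eta_ec[OF z] rho_def of_real_mult complex_norm_square using z3 by (simp add: field_simps)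
    have "(SUM m k. g.K m k z * g.\<rho> k m z) = of_real (yy' ?x * d (rho z) * sg z) / of_real (k0 z)
       + of_real ((2 * \<beta> * yy ?x - 2) * inverse ((nn 1 z)\<^sup>2)) / of_real (A1 z) + of_real ((2 * \<delta> * yy ?x - 2) * inverse ((nn 2 z)\<^sup>2)) / of_real (A2 z)"
    proof (rule g.trace_K[of z "of_real (k0 z)" "%k. ec k z"])
      show "ec 3 z = 1" by (simp add: ec_def al_def lam_def)
      show "g.\<rho> k m z = of_real (yy' ?x * d (rho z) * sg z) * ec k z * cnj (ec m z)
        + (if k = 1 \<and> m = 1 then of_real ((2 * \<beta> * yy ?x - 2) * inverse ((nn 1 z)\<^sup>2)) else 0)
        + (if k = 2 \<and> m = 2 then of_real ((2 * \<delta> * yy ?x - 2) * inverse ((nn 2 z)\<^sup>2)) else 0)" for k m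
        unfolding rho_gm[OF z] c0 ..
      show "g.H k l z = of_real (k0 z) * ec k z * cnj (ec l z) + (if k = 1 \<and> l = 1 then of_real (A1 z) else 0) + (if k = 2 \<and> l = 2 then of_real (A2 z) else 0)" for k l
        unfolding herm_gm Hf_def ..
    qed (use k0_pos[of z] A_pos[of z] in auto)
    also have "\<dots> = of_real (yy' ?x * d (rho z) * sg z / k0 z + (2 * \<beta> * yy ?x - 2) * inverse ((nn 1 z)\<^sup>2) / A1 z + (2 * \<delta> * yy ?x - 2) * inverse ((nn 2 z)\<^sup>2) / A2 z)"
      by simp
    also have "yy' ?x * d (rho z) * sg z / k0 z + (2 * \<beta> * yy ?x - 2) * inverse ((nn 1 z)\<^sup>2) / A1 z + (2 * \<delta> * yy ?x - 2) * inverse ((nn 2 z)\<^sup>2) / A2 z = - s / 4"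
    proof -
      have b: "\<beta> * ?x + a > 0" "\<delta> * ?x + c > 0" using pos[of ?x] X_range[of z] by simp_all
      have 1: "yy' ?x * d (rho z) * sg z / k0 z = yy' ?x / 2"
        using d_pos[OF rho_nonneg, of z] sg_pos[of z] by (simp add: k0_def)
      have 2: "(2 * \<beta> * yy ?x - 2) * inverse ((nn 1 z)\<^sup>2) / A1 z = (2 * \<beta> * yy ?x - 2) / (4 * (\<beta> * ?x + a))"
        "(2 * \<delta> * yy ?x - 2) * inverse ((nn 2 z)\<^sup>2) / A2 z = (2 * \<delta> * yy ?x - 2) / (4 * (\<delta> * ?x + c))"
        using nn_pos[of 1 z] nn_pos[of 2 z] by (simp_all add: A1_def A2_def)
      have "yy' ?x / 2 + (2 * \<beta> * yy ?x - 2) / (4 * (\<beta> * ?x + a)) + (2 * \<delta> * yy ?x - 2) / (4 * (\<delta> * ?x + c)) = (psi'' ?x - 2 * (\<beta> * ?x + a) - 2 * (\<delta> * ?x + c)) / (4 * q ?x)"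
      proof -
        have "psi2 / (2 * (u * v)) / 2 - psi1 * (\<beta> * v + \<delta> * u) / (2 * (u * v)\<^sup>2) / 2 + (2 * \<beta> * (psi1 / (2 * (u * v))) - 2) / (4 * u) + (2 * \<delta> * (psi1 / (2 * (u * v))) - 2) / (4 * v)
          = (psi2 - 2 * u - 2 * v) / (4 * (u * v))" if "u > 0" "v > 0" for psi1 psi2 u v :: real
          using that by (simp add: divide_simps) (simp add: algebra_simps power2_eq_square)
        from this[OF b] show ?thesis unfolding yy_def yy'_def q_def diff_divide_distrib[of "psi'' ?x / _"] .
      qed
      also have "\<dots> = - s / 4" unfolding csc using qX[of z] by (simp add: field_simps)
      finally show ?thesis unfolding 1 2 .
    qed
    finally show ?thesis .
  qed
  have "(SUM m k. g.K m k z * g.\<rho> k m z) = of_real (- s / 4)"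
  proof (rule eq_off_zero[OF open_UNIV _ continuous_on_const off UNIV_I])
    show "continuous_on UNIV (%z. SUM m k. g.K m k z * g.\<rho> k m z)"
      by (intro continuous_intros smooth_on_continuous[OF g.smooth_K] smooth_on_continuous[OF g.smooth_rho])
  qed
  then show ?thesis using g.scalar_curvature_eq[of z] by (simp add: g.\<rho>_def)
qed

end

section \<open>The metric on the projective bundle\<close>

lemma E_J: "(SUM k. c k * J u $ k) = \<i> * (SUM k. c k * u $ k :: complex)"
  by (simp add: J_def sum_distrib_left mult_ac)

context fibre_metric begin

definition E :: "complex^3 => complex^3 => complex" where "E z u = (SUM k. eta k z * u $ k)"

lemma gm_off_zero:
  assumes z: "z \<in> off_zero"
  shows "gm z u v = h (X z) * Re (E z u * cnj (E z v)) + (\<beta> * X z + a) * FS (z $ 1) (u $ 1) (v $ 1) + (\<delta> * X z + c) * FS (z $ 2) (u $ 2) (v $ 2)"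
proof -
  have z3: "z $ 3 \<noteq> 0" using z by (simp add: off_zero_def)
  have e: "(SUM k. ec k z * w $ k) = z $ 3 * E z w" for w
    unfolding E_def sum_distrib_left eta_ec[OF z] using z3 by (intro sum.cong refl) (simp add: field_simps)
  have "k0 z * (cmod (z $ 3))\<^sup>2 = h (X z)"
  proof -
    have "k0 z * (cmod (z $ 3))\<^sup>2 = 2 * d (rho z) * ((cmod (z $ 3))\<^sup>2 * sg z)" by (simp add: k0_def)
    also have "\<dots> = h (X z)" unfolding rho_def[symmetric] using h_\<xi>[OF rho_nonneg, of z] by (simp add: X_def[symmetric])
    finally show ?thesis .
  qed
  moreover have "Re (z $ 3 * E z u * cnj (z $ 3 * E z v)) = (cmod (z $ 3))\<^sup>2 * Re (E z u * cnj (E z v))"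
  proof -
    have "z $ 3 * E z u * cnj (z $ 3 * E z v) = of_real ((cmod (z $ 3))\<^sup>2) * (E z u * cnj (E z v))"
      unfolding complex_norm_square by (simp add: mult_ac)
    moreover have "Re (of_real x * w) = x * Re w" for x w by simp
    ultimately show ?thesis by (simp only:)
  qed
  moreover have "A1 z * (u $ 1 \<bullet> v $ 1) = (\<beta> * X z + a) * FS (z $ 1) (u $ 1) (v $ 1)" "A2 z * (u $ 2 \<bullet> v $ 2) = (\<delta> * X z + c) * FS (z $ 2) (u $ 2) (v $ 2)"
    by (simp_all add: A1_def A2_def FS_def nn_def divide_inverse)
  ultimately show ?thesis unfolding gm_eq e by (simp add: mult.assoc[symmetric])
qed

lemma dird_real:
  assumes "f differentiable (at z)" "\<And>k. pd k (%z. complex_of_real (f z)) z = of_real r * cf k"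
  shows "dird f z v = 2 * r * Re (SUM k. cf k * (v :: complex^3) $ k)"
proof -
  have D: "((%z. complex_of_real (f z)) has_derivative (%v. complex_of_real (dird f z v))) (at z)"
    by (rule has_derivative_of_real[OF has_derivative_dird[OF assms(1)]])
  then have df: "(%z. complex_of_real (f z)) differentiable (at z)" by (rule differentiableI)
  have pb: "pb k (%z. complex_of_real (f z)) z = cnj (of_real r * cf k)" for k
    using pd_cnj(2)[OF df, of k] assms(2)[of k] by simp
  have "complex_of_real (dird f z v) = dird (%z. complex_of_real (f z)) z v" by (rule dird_eqI[OF D, symmetric])
  also have "\<dots> = (SUM k. of_real r * cf k * v $ k + cnj (of_real r * cf k) * cnj (v $ k))"
    unfolding dird_pd_pb[OF df] assms(2) pb ..
  also have "\<dots> = of_real r * (SUM k. cf k * v $ k) + cnj (of_real r * (SUM k. cf k * v $ k))"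
    by (simp add: sum.distrib sum_distrib_left mult_ac)
  finally have "complex_of_real (dird f z v) = \<dots>" .
  from arg_cong[OF this, of Re] show ?thesis by simp
qed

lemma dird_X: "z \<in> off_zero ==> dird X z v = h (X z) * Re (E z v)"
proof -
  assume z: "z \<in> off_zero"
  have "dird X z v = 2 * (rho z * d (rho z)) * Re (SUM k. eta k z * v $ k)"
    by (rule dird_real[OF smooth_onD[OF smooth_X UNIV_I] pd_X_eta[OF z]])
  then show ?thesis using h_\<xi>[OF rho_nonneg, of z] by (simp add: E_def X_def[symmetric])
qed

definition lrho :: "complex^3 => real" where "lrho z = ln (rho z)"

lemma smooth_lrho: "smooth_on off_zero lrho"
  unfolding lrho_def[abs_def] by (rule smooth_on_ln[OF open_off_zero smooth_on_subset[OF smooth_rho]]) (simp_all add: rho_pos)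

lemma dird_lrho: "z \<in> off_zero ==> dird lrho z v = 2 * Re (E z v)"
proof -
  assume z: "z \<in> off_zero"
  have "pd k (%z. complex_of_real (lrho z)) z = of_real 1 * eta k z" for k
  proof -
    have "pd k (%z. complex_of_real (lrho z)) z = of_real (inverse (rho z)) * (cnj (z $ 3) * of_real (sg z) * ec k z)"
      unfolding lrho_def using pd_of_real_compose(1)[OF dreal[OF smooth_rho] refl DERIV_ln[OF rho_pos[OF z]], of k] by (simp add: pd_rho)
    then show ?thesis unfolding eta_ec[OF z] rho_def of_real_inverse of_real_mult complex_norm_square
      using z sg_pos[of z] by (simp add: off_zero_def field_simps)
  qed
  from dird_real[OF smooth_onD[OF smooth_lrho z] this] show ?thesis by (simp add: E_def)
qed

lemma E_circle: "z \<in> off_zero ==> E z (circle_field z) = \<i>"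
  by (simp add: E_def sum_3 circle_field_def axis_def eta_def al_def lam_def off_zero_def)

text \<open>The coefficients \<open>eta\<close> are the \<partial>-derivatives of one function, so
  the (2,0) part of their differential is symmetric and drops out. What is left is dbar of
  \<open>al\<close>, a combination of the curvature forms of the two projective lines.\<close>

lemma dird_E:
  assumes z: "z \<in> off_zero"
  shows "dird (%y. Im (E y v)) z u - dird (%y. Im (E y u)) z v
    = \<beta> * FS_form (z $ 1) (u $ 1) (v $ 1) + \<delta> * FS_form (z $ 2) (u $ 2) (v $ 2)"
proof -
  note de = d_off[OF smooth_eta z]
  have D: "dird (%y. Im (E y v)) z u = Im (SUM k. dird (eta k) z u * v $ k)" for u v
    unfolding E_def by (rule dird_eqI) (intro has_derivative_Im has_derivative_sum has_derivative_mult_left has_derivative_dird de)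
  have pe: "pd i (eta k) z = pd k (eta i) z" for i k
  proof -
    define s where "s = (%z. complex_of_real (lrho z))"
    have ss: "smooth_on off_zero s" unfolding s_def by (rule smooth_on_linears(4)[OF open_off_zero smooth_lrho])
    have e: "eta k y = pd k s y" if "y \<in> off_zero" for k y
    proof -
      have "pd k s y = of_real (inverse (rho y)) * (cnj (y $ 3) * of_real (sg y) * ec k y)"
        unfolding s_def lrho_def using pd_of_real_compose(1)[OF dreal[OF smooth_rho] refl DERIV_ln[OF rho_pos[OF that]], of k] by (simp add: pd_rho)
      then show ?thesis unfolding eta_ec[OF that] rho_def of_real_inverse of_real_mult complex_norm_square
        using that sg_pos[of y] by (simp add: off_zero_def field_simps)
    qed
    have "pd i (eta k) z = pd i (pd k s) z" by (rule pd_cong_open(1)[OF open_off_zero z e])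
    also have "\<dots> = pd k (pd i s) z" by (rule pd_commute(1)[OF open_off_zero z ss])
    also have "\<dots> = pd k (eta i) z" by (rule pd_cong_open(1)[OF open_off_zero z e[symmetric]])
    finally show ?thesis .
  qed
  have de_eq: "dird (eta k) z u = (SUM i. pd i (eta k) z * u $ i + pb i (al k) z * cnj (u $ i))" for k u
    unfolding dird_pd_pb[OF de] pb_eta[OF z] ..
  have FSf: "FS_form w x y = 4 * Im (cnj x * y) * inverse ((1 + (cmod w)\<^sup>2)\<^sup>2)" for w x y
    by (simp add: FS_form_def FS_def inner_complex_def divide_inverse algebra_simps)
  have "dird (%y. Im (E y v)) z u - dird (%y. Im (E y u)) z v =
      Im (of_real (2 * \<beta> * inverse ((nn 1 z)\<^sup>2)) * (cnj (u $ 1) * v $ 1 - cnj (v $ 1) * u $ 1)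
        + of_real (2 * \<delta> * inverse ((nn 2 z)\<^sup>2)) * (cnj (u $ 2) * v $ 2 - cnj (v $ 2) * u $ 2))"
  proof -
    have "(SUM k. dird (eta k) z u * v $ k) - (SUM k. dird (eta k) z v * u $ k)
      = of_real (2 * \<beta> * inverse ((nn 1 z)\<^sup>2)) * (cnj (u $ 1) * v $ 1 - cnj (v $ 1) * u $ 1)
        + of_real (2 * \<delta> * inverse ((nn 2 z)\<^sup>2)) * (cnj (u $ 2) * v $ 2 - cnj (v $ 2) * u $ 2)"
      unfolding de_eq pb_al sum_3 using pe[of 1 2] pe[of 1 3] pe[of 2 3] by (simp add: algebra_simps)
    from arg_cong[OF this, of Im] show ?thesis unfolding D by simp
  qed
  also have "\<dots> = \<beta> * FS_form (z $ 1) (u $ 1) (v $ 1) + \<delta> * FS_form (z $ 2) (u $ 2) (v $ 2)"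
  proof -
    have "Im (of_real x * (cnj u * v - cnj v * u) + of_real y * (cnj u' * v' - cnj v' * u')) = 2 * x * Im (cnj u * v) + 2 * y * Im (cnj u' * v')"
      for x y :: real and u v u' v' by (simp add: algebra_simps)
    then show ?thesis unfolding FSf nn_def[symmetric] by (simp only: mult_ac)
  qed
  finally show ?thesis .
qed

text \<open>At x = -1 and x = 1 the \<kappa> term of \<open>e\<close> vanishes, so e/q = 1 and the
  derivative is that of 1 - x^2.\<close>

lemma h_props:
  "smooth_on {-1<..<1} h" "t \<in> {-1<..<1} ==> h t > 0" "h (-1) = 0" "h 1 = 0"
  "(h has_real_derivative 2) (at (-1) within {-1..1})" "(h has_real_derivative -2) (at 1 within {-1..1})"
proof -
  have s: "smooth_on {-1<..<1} (%x::real. x)" by (rule smooth_on_id) simp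
  have nz: "(\<beta> * x + a) * (\<delta> * x + c) \<noteq> 0" if "x \<in> {-1<..<1}" for x using q_pos(1)[of x] that unfolding q_def by auto
  show "smooth_on {-1<..<1} h" unfolding h_def[abs_def] e_def q_def
    by (intro smooth_on_divide smooth_on_add smooth_on_mult smooth_on_diff smooth_on_power smooth_on_const s nz open_greaterThanLessThan)
  show "h t > 0" if "t \<in> {-1<..<1}" for t
  proof -
    have "t\<^sup>2 < 1" using that by (simp add: power2_less_1_iff abs_less_iff)
    then show ?thesis using that q_pos(1)[of t] e_pos[of t] by (simp add: h_def)
  qed
  show "h (-1) = 0" "h 1 = 0" by (simp_all add: h_def)
  have D: "(h has_real_derivative - 2 * x) (at x)" if "x\<^sup>2 = 1" "q x > 0" for x
  proof -
    have ex: "e x = q x" using that by (simp add: e_def)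
    obtain e' q' where eq: "(e has_real_derivative e') (at x)" "(q has_real_derivative q') (at x)" using e_deriv q_deriv by blast
    show ?thesis unfolding h_def[abs_def]
      using that ex by (auto intro!: derivative_eq_intros eq simp: field_simps)
  qed
  show "(h has_real_derivative 2) (at (-1) within {-1..1})" "(h has_real_derivative -2) (at 1 within {-1..1})"
    using D[of "-1"] D[of 1] q_pos(1)[of "-1"] q_pos(1)[of 1] by (auto intro: has_field_derivative_at_within)
qed

end

section \<open>Agreement of the metrics under all changes of chart\<close>

lemma aff_norm: "(cmod (aff i z $ 1))\<^sup>2 + (cmod (aff i z $ 2))\<^sup>2 = 1 + (cmod z)\<^sup>2"
  by (cases i rule: two_cases) (simp_all add: aff_def)

lemma aff_trans_norm:
  assumes "aff i z $ i' \<noteq> 0"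
  shows "1 + (cmod (aff i z $ other i' * inverse (aff i z $ i')))\<^sup>2 = (1 + (cmod z)\<^sup>2) / (cmod (aff i z $ i'))\<^sup>2"
proof -
  have "1 + (cmod (aff i z $ other i' * inverse (aff i z $ i')))\<^sup>2 = (cmod ((inverse (aff i z $ i') *s aff i z) $ 1))\<^sup>2 + (cmod ((inverse (aff i z $ i') *s aff i z) $ 2))\<^sup>2"
    unfolding aff_norm[of i', symmetric] aff_scale[OF assms] ..
  also have "\<dots> = ((cmod (aff i z $ 1))\<^sup>2 + (cmod (aff i z $ 2))\<^sup>2) / (cmod (aff i z $ i'))\<^sup>2"
    by (simp add: norm_mult norm_inverse power_mult_distrib power_inverse divide_inverse algebra_simps)
  finally show ?thesis unfolding aff_norm .
qed

lemma ln_powi: "x > 0 ==> ln (x powi m) = real_of_int m * ln x" for x :: real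
  by (cases "m \<ge> 0") (simp_all add: power_int_def ln_realpow ln_inverse)

text \<open>\<open>m1\<close> serves the charts around the zero section and \<open>m2\<close> those
  around the section at infinity. There the fibre coordinate is inverted, the bundle becomes O(-p,
  -q) and x changes sign, which explains the reversed \<beta>, \<delta> and the relation between
  \<xi> and \<xi>'.\<close>

locale bundle_metric = m1: fibre_metric \<beta> \<delta> a c \<kappa> S \<xi> d + m2: fibre_metric "- \<beta>" "- \<delta>" a c \<kappa> S' \<xi>' d'
  for \<beta> \<delta> a c \<kappa> :: real and S \<xi> d S' \<xi>' d' +
  fixes p q :: int
  assumes \<beta>p: "\<beta> = - real_of_int p / 2" and \<delta>q: "\<delta> = - real_of_int q / 2"
    and \<xi>\<xi>': "r > 0 ==> \<xi>' (inverse r) = - \<xi> r" and \<xi>_surj: "-1 < x ==> x < 1 ==> \<exists>r>0. \<xi> r = x"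
begin

definition LL :: "2 => complex^3 => real" where "LL k y = (if k = 1 then m1.lrho y else - m2.lrho y)"
definition XX :: "2 => complex^3 => real" where "XX k y = (if k = 1 then m1.X y else - m2.X y)"
definition EE :: "2 => complex^3 => complex^3 => complex" where "EE k y u = (if k = 1 then m1.E y u else - m2.E y u)"
definition gk :: "2 => complex^3 => complex^3 => complex^3 => real" where "gk k = (if k = 1 then m1.gm else m2.gm)"

lemma h_minus: "m2.h (- x) = m1.h x"
  by (simp add: m1.h_def m2.h_def m1.e_def m2.e_def m1.q_def m2.q_def)

lemma gk_off_zero:
  assumes "y \<in> off_zero"
  shows "gk k y u v = m1.h (XX k y) * Re (EE k y u * cnj (EE k y v)) + (\<beta> * XX k y + a) * FS (y $ 1) (u $ 1) (v $ 1) + (\<delta> * XX k y + c) * FS (y $ 2) (u $ 2) (v $ 2)"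
  using m1.gm_off_zero[OF assms] m2.gm_off_zero[OF assms] h_minus[of "- m2.X y"]
  by (simp add: gk_def XX_def EE_def)

text \<open>In homogeneous fibre coordinates one formula covers both kinds of charts, so invariance
  is a single computation for all transitions.\<close>

lemma LL_eq:
  assumes "y \<in> off_zero"
  shows "LL k y = ln ((cmod (aff k (y $ 3) $ 2))\<^sup>2) - ln ((cmod (aff k (y $ 3) $ 1))\<^sup>2) + 2 * \<beta> * m1.L 1 y + 2 * \<delta> * m1.L 2 y"
proof -
  have t: "(cmod (y $ 3))\<^sup>2 > 0" using assms by (simp add: off_zero_def)
  have 1: "m1.lrho y = ln ((cmod (y $ 3))\<^sup>2) + 2 * \<beta> * m1.L 1 y + 2 * \<delta> * m1.L 2 y"
    unfolding m1.lrho_def m1.rho_def m1.sg_def using t by (subst ln_mult) auto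
  have 2: "m2.lrho y = ln ((cmod (y $ 3))\<^sup>2) - 2 * \<beta> * m1.L 1 y - 2 * \<delta> * m1.L 2 y"
    unfolding m2.lrho_def m2.rho_def m2.sg_def using t by (subst ln_mult) auto
  show ?thesis by (cases k rule: two_cases) (simp_all add: LL_def 1 2 aff_def)
qed

lemma XX_LL: "y \<in> off_zero ==> XX k y = \<xi> (exp (LL k y))"
  using m1.rho_pos[of y] m2.rho_pos[of y] \<xi>\<xi>'[of "inverse (m2.rho y)"]
  by (simp add: XX_def LL_def m1.lrho_def m2.lrho_def m1.X_def m2.X_def exp_minus)

lemma dird_LL: "y \<in> off_zero ==> dird (LL k) y u = 2 * Re (EE k y u)"
proof -
  assume y: "y \<in> off_zero"
  have "((%y. - m2.lrho y) has_derivative (%u. - dird m2.lrho y u)) (at y)"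
    by (rule has_derivative_minus[OF has_derivative_dird[OF smooth_onD[OF m2.smooth_lrho y]]])
  then have "dird (%y. - m2.lrho y) y u = - dird m2.lrho y u" by (rule dird_eqI)
  then show ?thesis using m1.dird_lrho[OF y] m2.dird_lrho[OF y] unfolding LL_def[abs_def] EE_def by simp
qed

lemma EE_J: "EE k y (J u) = \<i> * EE k y u"
  by (simp add: EE_def m1.E_def m2.E_def E_J)

abbreviation "T \<equiv> PB_trans p q"

lemma L_trans:
  assumes "y \<in> PB_overlap i j k i' j' k'"
  shows "m1.L 1 (T i j k i' j' k' y) = m1.L 1 y - ln ((cmod (aff i (y$1) $ i'))\<^sup>2)" "m1.L 2 (T i j k i' j' k' y) = m1.L 2 y - ln ((cmod (aff j (y$2) $ j'))\<^sup>2)"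
proof -
  have nz: "aff i (y$1) $ i' \<noteq> 0" "aff j (y$2) $ j' \<noteq> 0" using assms by (auto simp: PB_overlap_def)
  have "ln ((1 + (cmod w)\<^sup>2) / (cmod b)\<^sup>2) = ln (1 + (cmod w)\<^sup>2) - ln ((cmod b)\<^sup>2)" if "b \<noteq> 0" for w b
    using that by (subst ln_divide_pos) (auto simp: add_pos_nonneg)
  then show "m1.L 1 (T i j k i' j' k' y) = m1.L 1 y - ln ((cmod (aff i (y$1) $ i'))\<^sup>2)" "m1.L 2 (T i j k i' j' k' y) = m1.L 2 y - ln ((cmod (aff j (y$2) $ j'))\<^sup>2)"
    unfolding m1.L_def m1.nn_def PB_trans_def vector_3 aff_trans_norm[OF nz(1)] aff_trans_norm[OF nz(2)] using nz by blast+
qed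

lemma T_off_zero: "y \<in> PB_overlap i j k i' j' k' ==> y \<in> off_zero ==> T i j k i' j' k' y \<in> off_zero"
  by (cases k rule: two_cases; cases k' rule: two_cases)
    (auto simp: off_zero_def PB_trans_def fibre_coord_def PB_overlap_def aff_def)

text \<open>Scaling the homogeneous fibre coordinates cancels in the difference of logarithms. The
  change of the terms \<open>L\<close> cancels against the cocycle exactly because p = -2 \<beta>
  and q = -2 \<delta>.\<close>

lemma LL_trans:
  assumes y: "y \<in> PB_overlap i j k i' j' k'" "y \<in> off_zero"
  shows "LL k' (T i j k i' j' k' y) = LL k y"
proof -
  let ?a = "aff i (y$1) $ i'" and ?b = "aff j (y$2) $ j'"
  have nz: "?a \<noteq> 0" "?b \<noteq> 0" using y(1) by (auto simp: PB_overlap_def)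
  define F where "F = (\<chi> r. fibre_coord p q i j k i' j' y r)"
  have fnz: "aff k (y$3) $ r \<noteq> 0" for r using y(2) by (cases k rule: two_cases) (auto simp: aff_def off_zero_def)
  have Fnz: "F $ r \<noteq> 0" for r using fnz[of r] fnz[of 2] nz by (auto simp: F_def fibre_coord_def fnz)
  have T3: "aff k' (T i j k i' j' k' y $ 3) = inverse (F $ k') *s F"
    using aff_scale[OF Fnz[of k']] by (simp add: PB_trans_def F_def)
  have lnp: "ln ((cmod (inverse w powi m))\<^sup>2) = - real_of_int m * ln ((cmod w)\<^sup>2)" if "w \<noteq> 0" for w m
    using that by (simp add: norm_power_int norm_inverse ln_realpow ln_inverse ln_powi power_int_mult_distrib)
  have ln2: "ln ((cmod (w * x))\<^sup>2) = ln ((cmod w)\<^sup>2) + ln ((cmod x)\<^sup>2)" if "w \<noteq> 0" "x \<noteq> 0" for w x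
    using that by (simp add: norm_mult power_mult_distrib ln_mult_pos)
  have pq: "real_of_int p = - 2 * \<beta>" "real_of_int q = - 2 * \<delta>" using \<beta>p \<delta>q by simp_all
  have F1: "ln ((cmod (F $ 1))\<^sup>2) = ln ((cmod (aff k (y$3) $ 1))\<^sup>2)" by (simp add: F_def fibre_coord_def)
  have F2: "ln ((cmod (F $ 2))\<^sup>2) = - real_of_int p * ln ((cmod ?a)\<^sup>2) - real_of_int q * ln ((cmod ?b)\<^sup>2) + ln ((cmod (aff k (y$3) $ 2))\<^sup>2)"
  proof -
    have "F $ 2 = inverse ?a powi p * inverse ?b powi q * aff k (y$3) $ 2" by (simp add: F_def fibre_coord_def)
    then show ?thesis using nz fnz[of 2] by (simp only: ln2 lnp mult_eq_0_iff power_int_eq_0_iff inverse_nonzero_iff_nonzero) (simp add: ln2 lnp)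
  qed
  have S: "ln ((cmod ((inverse (F $ k') *s F) $ r))\<^sup>2) = ln ((cmod (inverse (F $ k')))\<^sup>2) + ln ((cmod (F $ r))\<^sup>2)" for r
    using Fnz by (simp only: vector_smult_component ln2 inverse_nonzero_iff_nonzero not_False_eq_True)
  show ?thesis
    unfolding LL_eq[OF T_off_zero[OF y]] LL_eq[OF y(2)] T3 S F1 F2 L_trans[OF y(1)] pq
    by (simp add: algebra_simps)
qed

lemma T_deriv:
  assumes "y \<in> PB_overlap i j k i' j' k'"
  shows "(T i j k i' j' k' has_derivative dird (T i j k i' j' k') y) (at y)" "dird (T i j k i' j' k') y (J v) = J (dird (T i j k i' j' k') y v)"
proof -
  obtain T' where T': "(T i j k i' j' k' has_derivative T') (at y)" "\<And>v. T' (J v) = J (T' v)"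
    using holo_on_PB_trans assms unfolding holo_on_def by blast
  have "dird (T i j k i' j' k') y = T'" using dird_eqI[OF T'(1)] by auto
  then show "(T i j k i' j' k' has_derivative dird (T i j k i' j' k') y) (at y)" "dird (T i j k i' j' k') y (J v) = J (dird (T i j k i' j' k') y v)"
    using T' by simp_all
qed

text \<open>The real part of \<open>EE\<close> is half the differential of the invariant function
  \<open>LL\<close>; complex linearity determines the imaginary part from it.\<close>

lemma EE_trans:
  assumes y: "y \<in> PB_overlap i j k i' j' k'" "y \<in> off_zero"
  shows "EE k' (T i j k i' j' k' y) (dird (T i j k i' j' k') y u) = EE k y u"
proof -
  let ?T = "T i j k i' j' k'"
  have sLL: "smooth_on off_zero (LL k)" for k
    unfolding LL_def[abs_def] by (cases "k = 1") (simp_all add: m1.smooth_lrho m2.smooth_lrho smooth_on_minus open_off_zero)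
  have "Re (EE k' (?T y) (dird ?T y u)) = Re (EE k y u)" for u
  proof -
    have "dird (LL k') (?T y) (dird ?T y u) = dird (%y. LL k' (?T y)) y u"
      using dird_eqI[OF diff_chain_at[OF T_deriv(1)[OF y(1)] has_derivative_dird[OF smooth_onD[OF sLL T_off_zero[OF y]]]]]
      by (simp add: o_def)
    also have "dird (%y. LL k' (?T y)) y = dird (LL k) y"
      by (rule dird_cong_open[OF open_Int[OF open_PB_overlap open_off_zero]]) (use y LL_trans in auto)
    finally show ?thesis by (simp add: dird_LL T_off_zero[OF y] y(2))
  qed
  from this[of u] this[of "J u"] show ?thesis
    unfolding T_deriv(2)[OF y(1)] EE_J by (simp add: complex_eq_iff)
qed

text \<open>On each factor the transition is the identity or an inversion, and inversion is an
  isometry of the round metric.\<close>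

lemma FS_trans:
  assumes y: "y \<in> PB_overlap i j k i' j' k'"
  shows "FS (T i j k i' j' k' y $ 1) (dird (T i j k i' j' k') y u $ 1) (dird (T i j k i' j' k') y v $ 1) = FS (y $ 1) (u $ 1) (v $ 1)"
    "FS (T i j k i' j' k' y $ 2) (dird (T i j k i' j' k') y u $ 2) (dird (T i j k i' j' k') y v $ 2) = FS (y $ 2) (u $ 2) (v $ 2)"
proof -
  let ?T = "T i j k i' j' k'"
  have inv: "FS (inverse w) (- (inverse w * x * inverse w)) (- (inverse w * x' * inverse w)) = FS w x x'" if "w \<noteq> 0" for w x x'
  proof -
    have "(- (inverse w * x * inverse w)) \<bullet> (- (inverse w * x' * inverse w)) = (x \<bullet> x') / (cmod w) ^ 4"
    proof -
      have i: "x \<bullet> y = Re (x * cnj y)" for x y :: complex by (simp add: inner_complex_def)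
      have "- (inverse w * x * inverse w) * cnj (- (inverse w * x' * inverse w)) = of_real (inverse ((cmod w) ^ 4)) * (x * cnj x')"
      proof -
        have "complex_of_real ((cmod w) ^ 4) = (w * cnj w) * (w * cnj w)" unfolding complex_norm_square[symmetric] by (simp add: power4_eq_xxxx power2_eq_square)
        then show ?thesis using that by (simp add: field_simps)
      qed
      moreover have "Re (of_real (inverse n) * w) = Re w / n" for n w by (simp add: divide_inverse del: of_real_inverse)
      ultimately show ?thesis unfolding i by (simp only:)
    qed
    moreover have "(1 + (cmod (inverse w))\<^sup>2)\<^sup>2 = (1 + (cmod w)\<^sup>2)\<^sup>2 / (cmod w) ^ 4"
    proof -
      have "(1 + (inverse n)\<^sup>2)\<^sup>2 = (1 + n\<^sup>2)\<^sup>2 / n ^ 4" if "n \<noteq> 0" for n :: real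
        using that by (simp add: field_simps power2_eq_square power4_eq_xxxx)
      then show ?thesis using that by (simp add: norm_inverse)
    qed
    ultimately show ?thesis using that by (simp add: FS_def)
  qed
  have gen: "FS (?T y $ r) (dird ?T y u $ r) (dird ?T y v $ r) = FS (y $ r) (u $ r) (v $ r)"
    if Tr: "\<And>y. ?T y $ r = aff i0 (y $ r) $ other i0' * inverse (aff i0 (y $ r) $ i0')" and nz: "aff i0 (y $ r) $ i0' \<noteq> 0" for r i0 i0'
  proof -
    have D: "dird ?T y w $ r = dird (%y. ?T y $ r) y w" for w by (rule dird_vec_nth[OF T_deriv(1)[OF y], symmetric])
    show ?thesis
    proof (cases "i0' = i0")
      case True
      then have Ty: "(%y. ?T y $ r) = (%y. y $ r)" by (simp add: Tr)
      have "dird (%y::complex^3. y $ r) y w = w $ r" for w by (rule dird_eqI) (rule bounded_linear_imp_has_derivative[OF bounded_linear_vec_nth])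
      moreover have "?T y $ r = y $ r" by (rule fun_cong[OF Ty])
      ultimately show ?thesis unfolding D Ty by (simp only:)
    next
      case False
      then have i0': "i0' = other i0" "i0 = other i0'" using exhaust_2[of i0] exhaust_2[of i0'] by (auto simp: other_def)
      have a: "aff i0 w $ other i0' = 1" "aff i0 w $ i0' = w" for w
        by (simp only: i0'(2)[symmetric] aff_same(1), simp only: i0'(1) aff_same(2))
      have Ty: "(%y. ?T y $ r) = (%y. inverse (y $ r))" by (simp only: Tr a mult_1)
      have yr: "y $ r \<noteq> 0" using nz unfolding a .
      have "dird (%y::complex^3. inverse (y $ r)) y w = - (inverse (y $ r) * w $ r * inverse (y $ r))" for w
        by (rule dird_eqI) (rule Deriv.has_derivative_inverse[OF yr bounded_linear_imp_has_derivative[OF bounded_linear_vec_nth]])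
      moreover have "?T y $ r = inverse (y $ r)" by (rule fun_cong[OF Ty])
      ultimately show ?thesis unfolding D Ty by (simp only: inv[OF yr])
    qed
  qed
  show "FS (?T y $ 1) (dird ?T y u $ 1) (dird ?T y v $ 1) = FS (y $ 1) (u $ 1) (v $ 1)"
    by (rule gen[of 1 i i']) (use y in \<open>auto simp: PB_trans_def PB_overlap_def\<close>)
  show "FS (?T y $ 2) (dird ?T y u $ 2) (dird ?T y v $ 2) = FS (y $ 2) (u $ 2) (v $ 2)"
    by (rule gen[of 2 j j']) (use y in \<open>auto simp: PB_trans_def PB_overlap_def\<close>)
qed

lemma gk_trans_off:
  assumes y: "y \<in> PB_overlap i j k i' j' k'" "y \<in> off_zero"
  shows "gk k' (T i j k i' j' k' y) (dird (T i j k i' j' k') y u) (dird (T i j k i' j' k') y v) = gk k y u v"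
proof -
  have x: "XX k' (T i j k i' j' k' y) = XX k y" unfolding XX_LL[OF T_off_zero[OF y]] XX_LL[OF y(2)] LL_trans[OF y] by (rule refl)
  have g1: "gk k' (T i j k i' j' k' y) (dird (T i j k i' j' k') y u) (dird (T i j k i' j' k') y v) = m1.h (XX k' (T i j k i' j' k' y)) * Re (EE k' (T i j k i' j' k' y) (dird (T i j k i' j' k') y u) * cnj (EE k' (T i j k i' j' k' y) (dird (T i j k i' j' k') y v)))
      + (\<beta> * XX k' (T i j k i' j' k' y) + a) * FS (T i j k i' j' k' y $ 1) (dird (T i j k i' j' k') y u $ 1) (dird (T i j k i' j' k') y v $ 1) + (\<delta> * XX k' (T i j k i' j' k' y) + c) * FS (T i j k i' j' k' y $ 2) (dird (T i j k i' j' k') y u $ 2) (dird (T i j k i' j' k') y v $ 2)"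
    by (rule gk_off_zero[OF T_off_zero[OF y]])
  have g2: "gk k y u v = m1.h (XX k y) * Re (EE k y u * cnj (EE k y v)) + (\<beta> * XX k y + a) * FS (y $ 1) (u $ 1) (v $ 1) + (\<delta> * XX k y + c) * FS (y $ 2) (u $ 2) (v $ 2)"
    by (rule gk_off_zero[OF y(2)])
  note e = EE_trans[OF y, of u] EE_trans[OF y, of v] FS_trans[OF y(1), of u v]
  show "gk k' (T i j k i' j' k' y) (dird (T i j k i' j' k') y u) (dird (T i j k i' j' k') y v) = gk k y u v"
    by (subst g1, subst g2, subst e(1), subst e(2), subst e(3), subst e(4), subst x, subst x, subst x, rule refl)
qed

lemma gk_trans:
  assumes y: "y \<in> PB_overlap i j k i' j' k'"
  shows "gk k y u v = gk k' (T i j k i' j' k' y) (dird (T i j k i' j' k') y u) (dird (T i j k i' j' k') y v)"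
proof -
  let ?T = "T i j k i' j' k'" and ?O = "PB_overlap i j k i' j' k'"
  define HH where "HH k = (if k = 1 then m1.Hf else m2.Hf)" for k :: 2
  have gH: "gk k = herm_form (HH k)" for k by (simp add: gk_def HH_def m1.gm_def m2.gm_def)
  have sH: "smooth (HH k l m)" for k l m by (simp add: HH_def m1.smooth_Hf m2.smooth_Hf)
  have c1: "continuous_on ?O (%y. gk k y u v)"
    unfolding gH herm_form_def by (intro continuous_intros continuous_on_subset[OF smooth_on_continuous[OF sH]]) auto
  have cT: "continuous_on ?O (%y. dird ?T y w $ l)" for w l
  proof -
    have "continuous_on ?O (%y. dird (%y. ?T y $ l) y w)" by (rule smooth_on_continuous[OF smooth_on_dird[OF smooth_PB_trans]])
    then show ?thesis by (rule continuous_on_eq) (rule dird_vec_nth[OF T_deriv(1)])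
  qed
  have cHT: "continuous_on ?O (%y. HH k' l m (?T y))" for l m
    by (rule smooth_on_continuous[OF smooth_on_compose[OF open_PB_overlap open_UNIV _ sH smooth_on_vec[OF open_PB_overlap smooth_PB_trans]]]) simp
  have c2: "continuous_on ?O (%y. gk k' (?T y) (dird ?T y u) (dird ?T y v))"
    unfolding gH herm_form_def by (intro continuous_intros cHT cT)
  have off: "gk k z u v = gk k' (?T z) (dird ?T z u) (dird ?T z v)" if "z \<in> ?O" "z \<in> off_zero" for z
    by (rule gk_trans_off[OF that, symmetric])
  note inst = eq_off_zero[of ?O "%y. gk k y u v" "%y. gk k' (?T y) (dird ?T y u) (dird ?T y v)" y]
  show ?thesis by (rule inst, rule open_PB_overlap, rule c1, rule c2, erule off, assumption, rule y)
qed

end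

section \<open>The global metric field and the coordinate x\<close>

context bundle_metric begin

text \<open>A metric field takes arbitrary inverse charts as indices, so the kind of chart is
  recovered by comparison with the charts \<open>k = 1\<close>; every other index receives the
  second local metric.\<close>

definition gf :: "(PB_point, 3) metric_field" where
  "gf \<psi> = (if \<exists>i j. \<psi> = PB_chart p q i j 1 then m1.gm else m2.gm)"

text \<open>A chart with \<open>k = 2\<close> is never one with \<open>k = 1\<close>, since its
  origin lies on the section at infinity, which the latter charts omit.\<close>

lemma gf_chart: "gf (PB_chart p q i j k) = gk k"
proof (cases k rule: two_cases)
  case 1
  then show ?thesis by (auto simp: gf_def gk_def)
next
  case 2
  have "PB_chart p q i j 2 \<noteq> PB_chart p q i' j' 1" for i' j'
  proof
    assume e: "PB_chart p q i j 2 = PB_chart p q i' j' 1"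
    have "overlap (PB_chart p q i j 2) (PB_chart p q i' j' 1) = UNIV" unfolding e by (auto simp: overlap_def)
    then have "(0 :: complex^3) \<in> PB_overlap i j 2 i' j' 1" unfolding overlap_PB by simp
    then show False by (simp add: PB_overlap_def)
  qed
  then show ?thesis using 2 by (auto simp: gf_def gk_def)
qed

lemma gk_kahler: "kahler_chart (gk k)"
  using m1.gm_kahler m2.gm_kahler unfolding kahler_chart3_def gk_def by simp

lemma PB_cases: "\<psi> \<in> PB p q ==> \<exists>i j k. \<psi> = PB_chart p q i j k" by (auto simp: PB_def)

theorem kahler_gf: "kahler_metric (PB p q) gf"
proof -
  have tr: "gf \<psi> z u v = gf \<phi> (transition \<psi> \<phi> z) (dird (transition \<psi> \<phi>) z u) (dird (transition \<psi> \<phi>) z v)"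
    if \<psi>\<phi>: "\<psi> \<in> PB p q" "\<phi> \<in> PB p q" and z: "z \<in> overlap \<psi> \<phi>" for \<psi> \<phi> z u v
  proof -
    obtain i j k i' j' k' where c: "\<psi> = PB_chart p q i j k" "\<phi> = PB_chart p q i' j' k'"
      using PB_cases[OF \<psi>\<phi>(1)] PB_cases[OF \<psi>\<phi>(2)] by blast
    have z': "z \<in> PB_overlap i j k i' j' k'" using z unfolding c overlap_PB .
    have "dird (transition \<psi> \<phi>) z = dird (PB_trans p q i j k i' j' k') z"
      unfolding c by (rule dird_cong_open[OF open_PB_overlap z']) (rule transition_PB)
    then show ?thesis using gk_trans[OF z', of u v] transition_PB[OF z', of p q] unfolding c gf_chart by simp
  qed
  note k = kahler_chart.smooth[OF gk_kahler] kahler_chart.bilinear[OF gk_kahler] kahler_chart.sym[OF gk_kahler]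
    kahler_chart.pos[OF gk_kahler] kahler_chart.J_inv[OF gk_kahler] kahler_chart.closed[OF gk_kahler]
  have A: "\<And>u v. smooth (%z. gf \<psi> z u v)" "\<And>z. bilinear (gf \<psi> z)" "\<And>z u v. gf \<psi> z u v = gf \<psi> z v u" "\<And>z u. u \<noteq> 0 ==> gf \<psi> z u u > 0"
    "\<And>z u v. gf \<psi> z (J u) (J v) = gf \<psi> z u v"
    "\<And>z u v w. dird (%y. fundamental_form (gf \<psi>) y v w) z u + dird (%y. fundamental_form (gf \<psi>) y w u) z v + dird (%y. fundamental_form (gf \<psi>) y u v) z w = 0"
    if \<psi>: "\<psi> \<in> PB p q" for \<psi>
  proof -
    obtain i j k where c: "\<psi> = PB_chart p q i j k" using PB_cases[OF \<psi>] by blast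
    show "\<And>u v. smooth (%z. gf \<psi> z u v)" unfolding c gf_chart by (rule k(1))
    show "\<And>z. bilinear (gf \<psi> z)" unfolding c gf_chart by (rule k(2))
    show "\<And>z u v. gf \<psi> z u v = gf \<psi> z v u" unfolding c gf_chart by (rule k(3))
    show "\<And>z u. u \<noteq> 0 ==> gf \<psi> z u u > 0" unfolding c gf_chart by (rule k(4))
    show "\<And>z u v. gf \<psi> z (J u) (J v) = gf \<psi> z u v" unfolding c gf_chart by (rule k(5))
    show "\<And>z u v w. dird (%y. fundamental_form (gf \<psi>) y v w) z u + dird (%y. fundamental_form (gf \<psi>) y w u) z v + dird (%y. fundamental_form (gf \<psi>) y u v) z w = 0"
      unfolding c gf_chart by (rule k(6))
  qed
  show ?thesis unfolding kahler_metric_def riemannian_metric_def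
    by (intro conjI ballI allI impI A tr)
qed

lemma X_chart:
  assumes "PB_chart p q i j 1 y = PB_chart p q i' j' 1 y'"
  shows "m1.X y = m1.X y'"
proof -
  have y: "y \<in> PB_overlap i j 1 i' j' 1" unfolding overlap_PB[of p q, symmetric] overlap_def using assms by (metis mem_Collect_eq rangeI)
  have y': "y' = T i j 1 i' j' 1 y"
    using PB_chart_tr[OF y, of p q] assms inj_PB_chart[of p q i' j' 1] by (metis injD)
  show ?thesis
  proof (cases "y \<in> off_zero")
    case True
    then show ?thesis using XX_LL[OF True, of 1] XX_LL[OF T_off_zero[OF y True], of 1] LL_trans[OF y True] unfolding y' by (simp add: XX_def)
  next
    case False
    then have "y $ 3 = 0" by (simp add: off_zero_def)
    moreover then have "y' $ 3 = 0" unfolding y' PB_trans_same_fibre by simp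
    ultimately show ?thesis by (simp add: m1.X_def m1.rho_def)
  qed
qed

text \<open>Well defined on the union of the charts \<open>k = 1\<close> by \<open>X_chart\<close>;
  its values on the section at infinity are unspecified.\<close>

definition xf :: "PB_point => real" where "xf P = (THE r. \<exists>i j y. P = PB_chart p q i j 1 y \<and> r = m1.X y)"

lemma xf_chart: "xf (PB_chart p q i j 1 y) = m1.X y"
  unfolding xf_def using X_chart by (intro the_equality) blast+

theorem cohomogeneity_gf: "cohomogeneity_one_form p q a c m1.h gf"
proof -
  have bd: "- real_of_int p / 2 = \<beta>" "- real_of_int q / 2 = \<delta>" using \<beta>p \<delta>q by simp_all
  have img: "xf ` principal p q = {-1<..<1}"
  proof (intro equalityI subsetI)
    fix t assume "t \<in> xf ` principal p q"
    then obtain i j y where "t = xf (PB_chart p q i j 1 y)" "y \<in> off_zero" by (auto simp: principal_def)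
    then show "t \<in> {-1<..<1}" using m1.X_range(2)[of y] m1.X_range(3)[of y] by (simp add: xf_chart)
  next
    fix t :: real assume "t \<in> {-1<..<1}"
    then obtain r where r: "r > 0" "\<xi> r = t" using \<xi>_surj[of t] by auto
    \<comment> \<open>Over the origin of the base the Hermitian metric is 1, so this point has
      squared norm \<open>r\<close>.\<close>
    define y :: "complex^3" where "y = axis 3 (of_real (sqrt r))"
    have "m1.rho y = r" using r by (simp add: m1.rho_def m1.sg_def m1.L_def m1.nn_def y_def axis_def)
    then have "t = xf (PB_chart p q 1 1 1 y)" using r by (simp add: xf_chart m1.X_def)
    moreover have "y \<in> off_zero" using r by (simp add: y_def off_zero_def axis_def)
    ultimately show "t \<in> xf ` principal p q" unfolding principal_def by blast
  qed
  have X: "xf \<circ> PB_chart p q i j 1 = m1.X" for i j by (simp add: fun_eq_iff xf_chart)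
  have sX: "smooth_on off_zero m1.X" by (rule smooth_on_subset[OF m1.smooth_X]) simp
  have body: "dird m1.X y (circle_field y) = 0 \<and> Im (m1.E y (circle_field y)) = 1 \<and>
      (\<forall>v. dird m1.X y (J v) = - m1.h (m1.X y) * Im (m1.E y v)) \<and>
      (\<forall>u v. dird (%y. Im (m1.E y v)) y u - dird (%y. Im (m1.E y u)) y v = \<beta> * FS_form (y $ 1) (u $ 1) (v $ 1) + \<delta> * FS_form (y $ 2) (u $ 2) (v $ 2)) \<and>
      (\<forall>u v. gf (PB_chart p q i j 1) y u v = dird m1.X y u * dird m1.X y v / m1.h (m1.X y) + m1.h (m1.X y) * Im (m1.E y u) * Im (m1.E y v)
         + (\<beta> * m1.X y + a) * FS (y $ 1) (u $ 1) (v $ 1) + (\<delta> * m1.X y + c) * FS (y $ 2) (u $ 2) (v $ 2))" if y: "y \<in> off_zero" for i j y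
  proof (intro conjI allI)
    have hp: "m1.h (m1.X y) > 0" using m1.h_props(2)[of "m1.X y"] m1.X_range(2)[of y] m1.X_range(3)[OF y] by simp
    show "dird m1.X y (circle_field y) = 0" "Im (m1.E y (circle_field y)) = 1"
      unfolding m1.dird_X[OF y] m1.E_circle[OF y] by simp_all
    fix u v
    have "m1.E y (J v) = \<i> * m1.E y v" unfolding m1.E_def by (rule E_J)
    then show "dird m1.X y (J v) = - m1.h (m1.X y) * Im (m1.E y v)" unfolding m1.dird_X[OF y] by simp
    show "dird (%y. Im (m1.E y v)) y u - dird (%y. Im (m1.E y u)) y v = \<beta> * FS_form (y $ 1) (u $ 1) (v $ 1) + \<delta> * FS_form (y $ 2) (u $ 2) (v $ 2)"
      by (rule m1.dird_E[OF y])
    have "h * Re (w * cnj x) = h * Re w * (h * Re x) / h + h * Im w * Im x" if "h > 0" for h w x using that by (simp add: field_simps)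
    from this[OF hp] show "gf (PB_chart p q i j 1) y u v = dird m1.X y u * dird m1.X y v / m1.h (m1.X y) + m1.h (m1.X y) * Im (m1.E y u) * Im (m1.E y v)
         + (\<beta> * m1.X y + a) * FS (y $ 1) (u $ 1) (v $ 1) + (\<delta> * m1.X y + c) * FS (y $ 2) (u $ 2) (v $ 2)"
      unfolding gf_chart gk_def m1.dird_X[OF y] using m1.gm_off_zero[OF y, of u v] by simp
  qed
  have ex: "\<exists>(x :: PB_point => real) (\<theta> :: 2 => 2 => complex^3 => complex^3 => real).
         x ` principal p q = {-1<..<1} \<and>
         (\<forall>i j. let \<psi> = PB_chart p q i j 1; X = x \<circ> \<psi> in
            smooth_on off_zero X \<and>
            (\<forall>y\<in>off_zero.
               dird X y (circle_field y) = 0 \<and>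
               \<theta> i j y (circle_field y) = 1 \<and>
               (\<forall>v. dird X y (J v) = - m1.h (X y) * \<theta> i j y v) \<and>
               (\<forall>u v. dird (%y. \<theta> i j y v) y u - dird (%y. \<theta> i j y u) y v =
                        \<beta> * FS_form (y $ 1) (u $ 1) (v $ 1) + \<delta> * FS_form (y $ 2) (u $ 2) (v $ 2)) \<and>
               (\<forall>u v. gf \<psi> y u v =
                        dird X y u * dird X y v / m1.h (X y)
                        + m1.h (X y) * \<theta> i j y u * \<theta> i j y v
                        + (\<beta> * X y + a) * FS (y $ 1) (u $ 1) (v $ 1)
                        + (\<delta> * X y + c) * FS (y $ 2) (u $ 2) (v $ 2))))"
    unfolding Let_def
    by (rule exI[of _ xf], rule exI[of _ "%i j y v. Im (m1.E y v)"]) (unfold X, intro conjI allI ballI img sX body[THEN conjunct1]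
        body[THEN conjunct2, THEN conjunct1] body[THEN conjunct2, THEN conjunct2, THEN conjunct1, rule_format]
        body[THEN conjunct2, THEN conjunct2, THEN conjunct2, THEN conjunct1, rule_format] body[THEN conjunct2, THEN conjunct2, THEN conjunct2, THEN conjunct2, rule_format]; assumption)
  show ?thesis
    unfolding cohomogeneity_one_form_def bd
    unfolding Let_def[of \<beta>] Let_def[of \<delta>]
    by (intro conjI ballI m1.h_props ex) (use m1.pos in auto)
qed

theorem csc_gf:
  assumes csc: "\<And>x. m1.psi'' x = 2 * (\<beta> * x + a) + 2 * (\<delta> * x + c) - s * m1.q x"
  shows "(a, c) \<in> csc_parameters p q"
proof -
  have "m2.psi'' x = m1.psi'' (- x)" "m2.q x = m1.q (- x)" for x
    by (simp_all add: m1.psi''_def m2.psi''_def m1.e_def m2.e_def m1.q_def m2.q_def algebra_simps)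
  then have csc2: "m2.psi'' x = 2 * (- \<beta> * x + a) + 2 * (- \<delta> * x + c) - s * m2.q x" for x using csc[of "- x"] by simp
  have sc: "scalar_curvature (gf \<psi>) z = s" if \<psi>: "\<psi> \<in> PB p q" for \<psi> z
  proof -
    obtain i j k where "\<psi> = PB_chart p q i j k" using PB_cases[OF \<psi>] by blast
    then show ?thesis unfolding gf_def using m1.const_scalar_gm[OF csc] m2.const_scalar_gm[OF csc2] by simp
  qed
  have grad: "gradient (gf \<psi>) (scalar_curvature (gf \<psi>)) = (%z. 0)" if \<psi>: "\<psi> \<in> PB p q" for \<psi>
  proof
    fix z
    obtain i j k where c: "\<psi> = PB_chart p q i j k" using PB_cases[OF \<psi>] by blast
    have "scalar_curvature (gf \<psi>) = (%z. s)" using sc[OF \<psi>] by blast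
    then have d: "dird (scalar_curvature (gf \<psi>)) z w = 0" for w by (simp add: dird_eqI[OF has_derivative_const])
    interpret kahler_chart "gf \<psi>" unfolding c gf_chart by (rule gk_kahler)
    have b0: "gf \<psi> z 0 w = 0" for w using bilinear bilinear_lzero by blast
    show "gradient (gf \<psi>) (scalar_curvature (gf \<psi>)) z = 0"
      unfolding gradient_def
    proof (rule sharp_eqI)
      show "gf \<psi> z 0 w = dird (scalar_curvature (gf \<psi>)) z w" for w by (simp only: d b0)
      show "v' = 0" if "\<And>w. gf \<psi> z v' w = gf \<psi> z 0 w" for v' by (rule g_unique[OF that])
    qed
  qed
  have "extremal (PB p q) gf" unfolding extremal_def
  proof
    fix \<psi> assume "\<psi> \<in> PB p q"
    then show "holo_on UNIV (gradient (gf \<psi>) (scalar_curvature (gf \<psi>)))"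
      unfolding grad[OF \<open>\<psi> \<in> PB p q\<close>] holo_on_def
      by (intro ballI exI[of _ "%_. 0"]) (simp add: J_def)
  qed
  moreover have "constant_scalar_curvature (PB p q) gf" unfolding constant_scalar_curvature_def using sc by blast
  ultimately show ?thesis unfolding csc_parameters_def extremal_family_def
    using kahler_gf cohomogeneity_gf by auto
qed

end

section \<open>Parameters of constant scalar curvature\<close>

lemma profile_minus:
  assumes "profile \<beta> \<delta> a c \<kappa>" shows "profile (- \<beta>) (- \<delta>) a c \<kappa>"
proof -
  interpret p: profile \<beta> \<delta> a c \<kappa> by fact
  show ?thesis
  proof
    fix x :: real assume "-1 \<le> x" "x \<le> 1"
    then show "- \<beta> * x + a > 0" "- \<delta> * x + c > 0" "(- \<beta> * x + a) * (- \<delta> * x + c) + \<kappa> * (1 - x\<^sup>2) > 0"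
      using p.pos[of "- x"] p.E_pos[of "- x"] by simp_all
  qed
qed

text \<open>The two ends match because k'(-x) = -k(x): the sum k'(-x) + k(x) has derivative 0 and
  vanishes at 0 by the normalisation. Hence the squared norm of the reflected profile at -x is the
  inverse of the original one at x.\<close>

lemma bundle_metric_exists:
  assumes "profile \<beta> \<delta> a c \<kappa>" and pq: "\<beta> = - real_of_int p / 2" "\<delta> = - real_of_int q / 2"
  obtains S \<xi> d S' \<xi>' d' where "bundle_metric \<beta> \<delta> a c \<kappa> S \<xi> d S' \<xi>' d' p q"
proof -
  interpret p1: profile \<beta> \<delta> a c \<kappa> by fact
  interpret p2: profile "- \<beta>" "- \<delta>" a c \<kappa> by (rule profile_minus) fact
  obtain S \<xi> d k where 1: "open S" "{0..} \<subseteq> S" "smooth_on S \<xi>" "smooth_on S d" "\<And>r. r \<in> S ==> (\<xi> has_real_derivative d r) (at r)"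
    "\<And>r. r \<ge> 0 ==> d r > 0" "\<And>r. r \<ge> 0 ==> -1 \<le> \<xi> r \<and> \<xi> r < 1" "\<And>r. r > 0 ==> -1 < \<xi> r"
    "\<And>r. r \<ge> 0 ==> p1.h (\<xi> r) = 2 * r * d r"
    and k: "k 0 = 0" "\<And>x. -1 < x ==> x < 1 ==> (k has_real_derivative - 2 * \<kappa> / p1.e x) (at x)"
    "\<And>x. -1 < x ==> x < 1 ==> \<xi> ((1 + x) / (1 - x) * exp (k x)) = x"
    by (rule p1.profile_exists) (rule that; assumption)
  obtain S' \<xi>' d' k' where 2: "open S'" "{0..} \<subseteq> S'" "smooth_on S' \<xi>'" "smooth_on S' d'" "\<And>r. r \<in> S' ==> (\<xi>' has_real_derivative d' r) (at r)"
    "\<And>r. r \<ge> 0 ==> d' r > 0" "\<And>r. r \<ge> 0 ==> -1 \<le> \<xi>' r \<and> \<xi>' r < 1" "\<And>r. r > 0 ==> -1 < \<xi>' r"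
    "\<And>r. r \<ge> 0 ==> p2.h (\<xi>' r) = 2 * r * d' r"
    and k': "k' 0 = 0" "\<And>x. -1 < x ==> x < 1 ==> (k' has_real_derivative - 2 * \<kappa> / p2.e x) (at x)"
    "\<And>x. -1 < x ==> x < 1 ==> \<xi>' ((1 + x) / (1 - x) * exp (k' x)) = x"
    by (rule p2.profile_exists) (rule that; assumption)
  have kk': "k' (- x) = - k x" if x: "-1 < x" "x < 1" for x
  proof -
    have "((%x. k' (- x) + k x) has_real_derivative 0) (at y)" if y: "-1 < y" "y < 1" for y
    proof -
      have "((%x. k' (- x)) has_real_derivative - 2 * \<kappa> / p2.e (- y) * (- 1)) (at y)"
        by (rule DERIV_chain2[OF k'(2)]) (use y in \<open>auto intro!: derivative_eq_intros\<close>)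
      moreover have "p2.e (- y) = p1.e y" by (simp add: p1.e_def p2.e_def p1.q_def p2.q_def)
      ultimately show ?thesis using DERIV_add[OF _ k(2)[OF y]] by fastforce
    qed
    then have "k' (- x) + k x = k' (- 0) + k 0"
      by (intro DERIV_isconst3[of "-1" 1 x 0 "%x. k' (- x) + k x"]) (use x in auto)
    then show ?thesis using k(1) k'(1) by simp
  qed
  have inj: "r = r'" if "\<xi> r = \<xi> r'" "r > 0" "r' > 0" for r r'
  proof -
    have "\<xi> x < \<xi> y" if "0 < x" "x < y" for x y
    proof (rule DERIV_pos_imp_increasing[OF that(2)])
      fix z assume "x \<le> z" "z \<le> y"
      then have "z \<in> S" "d z > 0" using 1(2,6) that by auto
      then show "\<exists>d. (\<xi> has_real_derivative d) (at z) \<and> 0 < d" using 1(5) by blast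
    qed
    then show ?thesis using that by (metis less_irrefl linorder_neqE_linordered_idom)
  qed
  have rel: "\<xi>' (inverse r) = - \<xi> r" if r: "r > 0" for r
  proof -
    define x where "x = \<xi> r"
    have x: "-1 < x" "x < 1" using 1(7)[of r] 1(8)[of r] r by (simp_all add: x_def)
    have r_eq: "r = (1 + x) / (1 - x) * exp (k x)" by (rule inj) (use k(3)[OF x] x r in \<open>simp_all add: x_def[symmetric]\<close>)
    have "inverse r = (1 + - x) / (1 - - x) * exp (k' (- x))"
      unfolding r_eq kk'[OF x] exp_minus by (simp add: divide_inverse mult_ac)
    then show ?thesis using k'(3)[of "- x"] x by (simp add: x_def)
  qed
  have surj: "\<exists>r>0. \<xi> r = x" if "-1 < x" "x < 1" for x
    using k(3)[OF that] that by (intro exI[of _ "(1 + x) / (1 - x) * exp (k x)"]) simp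
  have "fibre_metric \<beta> \<delta> a c \<kappa> S \<xi> d" by unfold_locales (use 1 in auto)
  moreover have "fibre_metric (- \<beta>) (- \<delta>) a c \<kappa> S' \<xi>' d'" by unfold_locales (use 2 in auto)
  ultimately have "bundle_metric \<beta> \<delta> a c \<kappa> S \<xi> d S' \<xi>' d' p q"
    unfolding bundle_metric_def bundle_metric_axioms_def using rel surj pq by blast
  then show thesis by (rule that)
qed

text \<open>The equations \<open>eqs\<close> are the coefficients of x^2, x and 1 in psi'' =
  2(\<beta> x + a) + 2(\<delta> x + c) - s q, the last one after eliminating \<kappa> by means of
  the first.\<close>

lemma csc_parameters_I:
  assumes pq: "\<beta> = - real_of_int p / 2" "\<delta> = - real_of_int q / 2"
    and prof: "profile \<beta> \<delta> a c \<kappa>"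
    and eqs: "12 * \<kappa> = \<beta> * \<delta> * (12 - s)" "(s - 6) * (\<beta> * c + \<delta> * a) = 2 * (\<beta> + \<delta>)"
      "s * (a * c + \<beta> * \<delta> / 3) = 2 * (a + c + a * c + \<beta> * \<delta>)"
  shows "(a, c) \<in> csc_parameters p q"
proof -
  obtain S \<xi> d S' \<xi>' d' where "bundle_metric \<beta> \<delta> a c \<kappa> S \<xi> d S' \<xi>' d' p q"
    by (rule bundle_metric_exists[OF prof pq])
  then interpret bundle_metric \<beta> \<delta> a c \<kappa> S \<xi> d S' \<xi>' d' p q .
  show ?thesis
  proof (rule csc_gf)
    fix x
    have "s * (3 * a * c + \<beta> * \<delta>) = 6 * (a + c + a * c + \<beta> * \<delta>)" using eqs(3) by (simp add: algebra_simps)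
    then show "m1.psi'' x = 2 * (\<beta> * x + a) + 2 * (\<delta> * x + c) - s * m1.q x"
      unfolding m1.psi''_def m1.e_def m1.q_def using eqs(1,2) by algebra
  qed
qed

text \<open>With \<beta> = \<delta> = \<kappa> = 0 the profile is 1 - x^2 and the metric a product
  of three round spheres; s = 2/a + 2/c + 2 is the sum of their scalar curvatures.\<close>

lemma csc_parameters_product: "{0<..} \<times> {0<..} \<subseteq> csc_parameters 0 0"
proof clarify
  fix a c :: real assume ac: "0 < a" "0 < c"
  have "profile 0 0 a c 0" by standard (use ac in auto)
  then show "(a, c) \<in> csc_parameters 0 0"
    by (rule csc_parameters_I[where s = "2 * (a + c + a * c) / (a * c)", rotated 2]) (use ac in \<open>auto simp: field_simps\<close>)
qed

text \<open>Here \<beta> = p/2, so the profile is taken with -\<beta>. The constant coefficient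
  determines \<open>s\<close> and the quadratic one \<kappa>; substituting \<open>s\<close> into the
  linear coefficient gives \<open>eq\<close>.\<close>

lemma csc_parameters_mixed:
  assumes pq: "\<beta> = real_of_int p / 2" "\<delta> = - real_of_int q / 2" and pos: "\<beta> > 0" "\<delta> > 0"
    and ac: "a > \<beta>" "c > \<delta>"
    and eq: "\<delta> * (2 * c - 1) * a\<^sup>2 - 2 * \<beta> * c\<^sup>2 * a + (\<beta> * c\<^sup>2 - \<beta> * \<delta> * (\<delta> - \<beta>) / 3) = 0"
  shows "(a, c) \<in> csc_parameters p q"
proof -
  define N where "N = a * c - \<beta> * \<delta> / 3"
  have "a * c > \<beta> * \<delta>" using ac pos by (intro mult_strict_mono) auto
  moreover have "\<beta> * \<delta> > 0" using pos by simp
  ultimately have N: "N > 0" and P: "a * c - \<beta> * \<delta> > 0" "a > 0" "c > 0" using pos ac unfolding N_def by linarith+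
  define s where "s = 2 * (a + c + a * c - \<beta> * \<delta>) / N"
  have s: "s > 0" "s * N = 2 * (a + c + a * c - \<beta> * \<delta>)" using N P by (simp_all add: s_def)
  define \<kappa> where "\<kappa> = - \<beta> * \<delta> * (12 - s) / 12"
  have k: "\<kappa> + \<beta> * \<delta> \<ge> 0" using s(1) pos by (simp add: \<kappa>_def field_simps)
  have prof: "profile (- \<beta>) \<delta> a c \<kappa>"
  proof
    fix x :: real assume x: "-1 \<le> x" "x \<le> 1"
    have "\<beta> * x \<le> \<beta>" "\<delta> * x \<ge> - \<delta>" using pos x mult_left_mono[of x 1 \<beta>] mult_left_mono[of "-1" x \<delta>] by auto
    then show "- \<beta> * x + a > 0" "\<delta> * x + c > 0" using ac by auto
    have x2: "1 - x\<^sup>2 \<ge> 0" using x by (simp add: abs_square_le_1 abs_le_iff)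
    \<comment> \<open>This is the linear interpolation of the values of q at x = -1 and x = 1, both
      positive.\<close>
    have lin: "(\<delta> * a - \<beta> * c) * x + (a * c - \<beta> * \<delta>) > 0"
    proof -
      have e: "(a - \<beta>) * (c + \<delta>) > 0" "(a + \<beta>) * (c - \<delta>) > 0" using ac pos by simp_all
      have "(1 + x) * ((a - \<beta>) * (c + \<delta>)) \<ge> 0" "(1 - x) * ((a + \<beta>) * (c - \<delta>)) \<ge> 0" using e x by simp_all
      moreover have "(1 + x) * ((a - \<beta>) * (c + \<delta>)) > 0 \<or> (1 - x) * ((a + \<beta>) * (c - \<delta>)) > 0"
        using e x by (cases "x = -1") auto
      ultimately have "(1 + x) * ((a - \<beta>) * (c + \<delta>)) + (1 - x) * ((a + \<beta>) * (c - \<delta>)) > 0" by linarith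
      then show ?thesis by (simp add: algebra_simps)
    qed
    \<comment> \<open>q exceeds its linear interpolation by \<beta> \<delta> (1 - x^2), and \<kappa>
      + \<beta> \<delta> = \<beta> \<delta> s/12 is nonnegative because s > 0.\<close>
    have "(- \<beta> * x + a) * (\<delta> * x + c) + \<kappa> * (1 - x\<^sup>2) = ((\<delta> * a - \<beta> * c) * x + (a * c - \<beta> * \<delta>)) + (\<kappa> + \<beta> * \<delta>) * (1 - x\<^sup>2)"
      by (simp add: algebra_simps power2_eq_square)
    also have "\<dots> > 0" using lin k x2 by (simp add: add_pos_nonneg)
    finally show "(- \<beta> * x + a) * (\<delta> * x + c) + \<kappa> * (1 - x\<^sup>2) > 0" .
  qed
  show ?thesis
  proof (rule csc_parameters_I[OF _ _ prof])
    show "12 * \<kappa> = - \<beta> * \<delta> * (12 - s)" by (simp add: \<kappa>_def)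
    show "s * (a * c + - \<beta> * \<delta> / 3) = 2 * (a + c + a * c + - \<beta> * \<delta>)" using s(2) by (simp add: N_def)
    have "N * ((s - 6) * (- \<beta> * c + \<delta> * a) - 2 * (- \<beta> + \<delta>)) = (s * N - 6 * N) * (- \<beta> * c + \<delta> * a) - 2 * (- \<beta> + \<delta>) * N"
      by (simp add: algebra_simps)
    also have "\<dots> = - 2 * (\<delta> * (2 * c - 1) * a\<^sup>2 - 2 * \<beta> * c\<^sup>2 * a + (\<beta> * c\<^sup>2 - \<beta> * \<delta> * (\<delta> - \<beta>) / 3))"
      by (subst s(2)) (simp add: N_def algebra_simps power2_eq_square add_divide_distrib diff_divide_distrib)
    finally show "(s - 6) * (- \<beta> * c + \<delta> * a) = 2 * (- \<beta> + \<delta>)" using eq N by simp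
  qed (use pq in auto)
qed

text \<open>The condition is quadratic in \<open>a\<close> with coefficients depending on
  \<open>c\<close>. For large \<open>c\<close> its larger root is real and exceeds \<beta>; with
  \<open>c\<close> as the parameter of the curve, injectivity is immediate.\<close>

lemma csc_curve:
  assumes "p > 0" "q < 0"
  shows "\<exists>\<gamma> :: real => real \<times> real. continuous_on {0<..<1} \<gamma> \<and> inj_on \<gamma> {0<..<1} \<and> \<gamma> ` {0<..<1} \<subseteq> csc_parameters p q"
proof -
  define \<beta> \<delta> where bd: "\<beta> = real_of_int p / 2" "\<delta> = - real_of_int q / 2"
  have pos: "\<beta> > 0" "\<delta> > 0" using assms by (simp_all add: bd)
  \<comment> \<open>With \<beta> c \<ge> 4 \<delta> + 3 \<beta> \<delta> the leading term of
    \<open>D\<close> dominates, so \<open>D c \<ge> 0\<close>; and c \<ge> 3 \<delta> gives both c >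
    \<delta> and \<delta> (2 c - 1) < c^2, hence \<open>A c > \<beta>\<close>.\<close>
  define C0 where "C0 = 1 + 3 * \<delta> + 4 * \<delta> / \<beta>"
  \<comment> \<open>A quarter of the discriminant of the quadratic equation for
    \<open>a\<close>.\<close>
  define D where "D c = \<beta>\<^sup>2 * c ^ 4 - \<delta> * (2 * c - 1) * (\<beta> * c\<^sup>2 - \<beta> * \<delta> * (\<delta> - \<beta>) / 3)" for c
  define A where "A c = (\<beta> * c\<^sup>2 + sqrt (D c)) / (\<delta> * (2 * c - 1))" for c
  have main: "c > 1" "D c \<ge> 0" "A c > \<beta>" "c > \<delta>" if c: "c \<ge> C0" for c
  proof -
    have C0: "C0 \<ge> 1 + 3 * \<delta>" using pos by (simp add: C0_def)
    then show c1: "c > 1" and cd: "c > \<delta>" using c pos by auto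
    have bc: "\<beta> * c \<ge> 4 * \<delta> + 3 * \<beta> * \<delta>"
    proof -
      have "\<beta> * c \<ge> \<beta> * C0" using c pos by simp
      also have "\<beta> * C0 = \<beta> + 3 * \<beta> * \<delta> + 4 * \<delta>" using pos by (simp add: C0_def field_simps)
      finally show ?thesis using pos by simp
    qed
    have "D c \<ge> \<beta>\<^sup>2 * c ^ 4 - \<delta> * (2 * c) * (\<beta> * c\<^sup>2 + \<beta> * \<delta> * \<beta> / 3)"
    proof -
      have "\<beta> * c\<^sup>2 - \<beta> * \<delta> * (\<delta> - \<beta>) / 3 \<le> \<beta> * c\<^sup>2 + \<beta> * \<delta> * \<beta> / 3" using pos by (simp add: field_simps)
      moreover have "0 \<le> \<beta> * c\<^sup>2 + \<beta> * \<delta> * \<beta> / 3" using pos by simp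
      ultimately have "(2 * c - 1) * (\<beta> * c\<^sup>2 - \<beta> * \<delta> * (\<delta> - \<beta>) / 3) \<le> (2 * c) * (\<beta> * c\<^sup>2 + \<beta> * \<delta> * \<beta> / 3)"
        using c1 by (intro order_trans[OF mult_left_mono mult_right_mono]) auto
      then show ?thesis using pos unfolding D_def by (simp add: mult.assoc)
    qed
    moreover have "\<beta>\<^sup>2 * c ^ 4 - \<delta> * (2 * c) * (\<beta> * c\<^sup>2 + \<beta> * \<delta> * \<beta> / 3) \<ge> 0"
    proof -
      have "\<beta> * c ^ 3 \<ge> (4 * \<delta> + 3 * \<beta> * \<delta>) * c\<^sup>2" using mult_right_mono[OF bc, of "c\<^sup>2"] by (simp add: power3_eq_cube power2_eq_square mult.assoc)
      moreover have "\<beta> * \<delta> * c\<^sup>2 \<ge> \<beta> * \<delta> * \<delta>"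
      proof -
        have "c\<^sup>2 \<ge> c" using c1 by (simp add: power2_eq_square)
        then show ?thesis using cd pos by (intro mult_left_mono) auto
      qed
      moreover have "(4 * \<delta> + 3 * \<beta> * \<delta>) * c\<^sup>2 = 4 * (\<delta> * c\<^sup>2) + 3 * (\<beta> * \<delta> * c\<^sup>2)" by (simp add: algebra_simps)
      moreover have "2 * \<delta> * (c\<^sup>2 + \<delta> * \<beta> / 3) = 2 * (\<delta> * c\<^sup>2) + 2 / 3 * (\<beta> * \<delta> * \<delta>)" by (simp add: algebra_simps)
      moreover have "\<delta> * c\<^sup>2 \<ge> 0" "\<beta> * \<delta> * \<delta> \<ge> 0" using pos by simp_all
      ultimately have "\<beta> * c ^ 3 - 2 * \<delta> * (c\<^sup>2 + \<delta> * \<beta> / 3) \<ge> 0" by linarith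
      then have "\<beta> * c * (\<beta> * c ^ 3 - 2 * \<delta> * (c\<^sup>2 + \<delta> * \<beta> / 3)) \<ge> 0" using pos c1 by simp
      then show ?thesis by (simp add: algebra_simps power2_eq_square power3_eq_cube power4_eq_xxxx)
    qed
    ultimately show D: "D c \<ge> 0" by linarith
    have "\<beta> * (\<delta> * (2 * c - 1)) < \<beta> * c\<^sup>2"
    proof -
      have "\<delta> * (2 * c - 1) < \<delta> * (3 * c)" using pos c1 by simp
      also have "\<dots> \<le> c * c" using c C0 pos c1 by (simp add: mult.commute[of \<delta>] mult.assoc)
      finally show ?thesis using pos by (simp add: power2_eq_square)
    qed
    also have "\<dots> \<le> \<beta> * c\<^sup>2 + sqrt (D c)" using D by simp
    finally show "A c > \<beta>" using pos c1 by (simp add: A_def pos_less_divide_eq)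
  qed
  define \<gamma> where "\<gamma> t = (A (C0 + t), C0 + t)" for t
  have "\<gamma> t \<in> csc_parameters p q" if t: "t \<in> {0<..<1}" for t
  proof -
    define c where "c = C0 + t"
    have c: "c \<ge> C0" using t by (simp add: c_def)
    note m = main[OF c]
    have n: "\<delta> * (2 * c - 1) > 0" using pos m by simp
    have sq: "(sqrt (D c))\<^sup>2 = D c" using m(2) by simp
    have q: "n * a\<^sup>2 - 2 * b * a + e = 0" if "a = (b + r) / n" "n > 0" "r\<^sup>2 = b\<^sup>2 - n * e" for n a b e r :: real
    proof -
      have "n * a - b = r" using that by (simp add: field_simps)
      then have "(n * a - b)\<^sup>2 = b\<^sup>2 - n * e" using that by simp
      then have "n * (n * a\<^sup>2 - 2 * b * a + e) = 0" by (simp add: algebra_simps power2_eq_square)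
      then show ?thesis using that by simp
    qed
    have "(\<delta> * (2 * c - 1)) * (A c)\<^sup>2 - 2 * (\<beta> * c\<^sup>2) * A c + (\<beta> * c\<^sup>2 - \<beta> * \<delta> * (\<delta> - \<beta>) / 3) = 0"
      by (rule q[OF A_def n], unfold sq, simp add: D_def power_mult_distrib)
    then have "(A c, c) \<in> csc_parameters p q"
      by (intro csc_parameters_mixed[OF bd pos m(3,4)]) (simp add: mult.assoc)
    then show ?thesis by (simp add: \<gamma>_def c_def)
  qed
  moreover have "continuous_on {0<..<1} \<gamma>"
  proof -
    have "\<delta> * (2 * (C0 + t) - 1) \<noteq> 0" if "t \<in> {0<..<1}" for t using main(1)[of "C0 + t"] pos that by auto
    then show ?thesis unfolding \<gamma>_def[abs_def] A_def D_def by (intro continuous_intros) auto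
  qed
  moreover have "inj_on \<gamma> {0<..<1}" by (auto simp: inj_on_def \<gamma>_def)
  ultimately show ?thesis by blast
qed

section \<open>The product case\<close>

lemma PB_pt_00: "PB_pt 0 0 u v f = CP1_pt u \<times> CP1_pt v \<times> CP1_pt f"
proof -
  have "vector [n * f $ 1, n * f $ 2] = n *s f" for n by (simp add: vec_eq_iff forall_2)
  then show ?thesis unfolding PB_pt_def CP1_pt_def by auto
qed

lemma holo_on_cong: "open S ==> (\<And>z. z \<in> S ==> f z = g z) ==> holo_on S f ==> holo_on S g"
  unfolding holo_on_def by (metis has_derivative_transform_within_open)

definition CP_chart :: "2 => 2 => 2 => complex^3 => (complex^2) set \<times> (complex^2) set \<times> (complex^2) set" where
  "CP_chart i j k y = (CP1_pt (aff i (y $ 1)), CP1_pt (aff j (y $ 2)), CP1_pt (aff k (y $ 3)))"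

text \<open>For p = q = 0 a point of the bundle is, as a set, the Cartesian product of three points
  of the projective line. The maps are the projections and the product, and both atlases have the
  same transitions.\<close>

lemma biholomorphic_product: "biholomorphic (PB 0 0) CP1_cubed"
proof -
  define F where "F t = (fst ` t, (fst \<circ> snd) ` t, (snd \<circ> snd) ` t)" for t :: "((complex^2) \<times> (complex^2) \<times> (complex^2)) set"
  define F' where "F' t = fst t \<times> fst (snd t) \<times> snd (snd t)" for t :: "(complex^2) set \<times> (complex^2) set \<times> (complex^2) set"
  let ?A = "PB 0 0" and ?B = CP1_cubed
  have B: "?B = {CP_chart i j k | i j k. True}" unfolding CP1_cubed_def CP_chart_def[abs_def] ..
  have ne: "CP1_pt u \<noteq> {}" for u by (auto simp: CP1_pt_def intro: exI[of _ 1])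
  have F'C: "F' (CP_chart i j k y) = PB_chart 0 0 i j k y" for i j k y
    by (simp add: F'_def CP_chart_def PB_chart_def PB_pt_00)
  have FP: "F (PB_chart 0 0 i j k y) = CP_chart i j k y" for i j k y
  proof -
    have 1: "fst ` (A \<times> B \<times> C) = A" "(fst \<circ> snd) ` (A \<times> B \<times> C) = B" "(snd \<circ> snd) ` (A \<times> B \<times> C) = C"
      if "A \<noteq> {}" "B \<noteq> {}" "C \<noteq> {}" for A B C :: "(complex^2) set" using that by force+
    show ?thesis unfolding F_def PB_chart_def PB_pt_00 CP_chart_def 1[OF ne ne ne] ..
  qed
  have FPc: "F \<circ> PB_chart 0 0 i j k = CP_chart i j k" and F'Cc: "F' \<circ> CP_chart i j k = PB_chart 0 0 i j k" for i j k
    by (simp_all add: fun_eq_iff FP F'C)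
  have iff: "CP_chart i j k y = CP_chart i' j' k' y' \<longleftrightarrow> PB_chart 0 0 i j k y = PB_chart 0 0 i' j' k' y'" for i j k y i' j' k' y'
    by (metis FP F'C)
  have ov: "overlap (CP_chart i j k) (CP_chart i' j' k') = PB_overlap i j k i' j' k'" for i j k i' j' k'
    unfolding overlap_PB[of 0 0, symmetric] overlap_def image_iff using iff by blast
  have tr: "transition (CP_chart i j k) (CP_chart i' j' k') y = PB_trans 0 0 i j k i' j' k' y" if "y \<in> PB_overlap i j k i' j' k'" for i j k i' j' k' y
  proof -
    have "inj (CP_chart i' j' k')" using inj_PB_chart[of 0 0 i' j' k'] iff unfolding inj_def by blast
    moreover have "CP_chart i' j' k' (PB_trans 0 0 i j k i' j' k' y) = CP_chart i j k y" unfolding iff by (rule PB_chart_tr[OF that])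
    ultimately show ?thesis by (simp add: transition_def inv_f_eq)
  qed
  have pA: "points ?A = {PB_chart 0 0 i j k y | i j k y. True}" unfolding points_def PB_def by blast
  have pB: "points ?B = {CP_chart i j k y | i j k y. True}" unfolding points_def B by blast
  have hF: "holo_map ?A ?B F"
    unfolding holo_map_def
  proof (intro conjI ballI)
    show "F ` points ?A \<subseteq> points ?B" unfolding pA pB using FP by blast
    fix \<psi> \<phi> assume "\<psi> \<in> ?A" "\<phi> \<in> ?B"
    then obtain i j k i' j' k' where c: "\<psi> = PB_chart 0 0 i j k" "\<phi> = CP_chart i' j' k'" unfolding PB_def B by blast
    show "open (overlap (F \<circ> \<psi>) \<phi>)" unfolding c FPc ov by (rule open_PB_overlap)
    show "holo_on (overlap (F \<circ> \<psi>) \<phi>) (transition (F \<circ> \<psi>) \<phi>)"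
      unfolding c FPc ov by (rule holo_on_cong[OF open_PB_overlap _ holo_on_PB_trans]) (rule tr[symmetric])
  qed
  have hF': "holo_map ?B ?A F'"
    unfolding holo_map_def
  proof (intro conjI ballI)
    show "F' ` points ?B \<subseteq> points ?A" unfolding pA pB using F'C by blast
    fix \<psi> \<phi> assume "\<psi> \<in> ?B" "\<phi> \<in> ?A"
    then obtain i j k i' j' k' where c: "\<psi> = CP_chart i j k" "\<phi> = PB_chart 0 0 i' j' k'" unfolding PB_def B by blast
    show "open (overlap (F' \<circ> \<psi>) \<phi>)" unfolding c F'Cc overlap_PB by (rule open_PB_overlap)
    show "holo_on (overlap (F' \<circ> \<psi>) \<phi>) (transition (F' \<circ> \<psi>) \<phi>)"
      unfolding c F'Cc overlap_PB by (rule holo_on_cong[OF open_PB_overlap _ holo_on_PB_trans]) (rule transition_PB[symmetric])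
  qed
  have "\<forall>x\<in>points ?A. F' (F x) = x" unfolding pA by (auto simp: FP F'C)
  moreover have "\<forall>y\<in>points ?B. F (F' y) = y" unfolding pB by (auto simp: FP F'C)
  ultimately show ?thesis unfolding biholomorphic_def using hF hF' by blast
qed

section \<open>Different parameters give different metrics\<close>

text \<open>If the solution stayed below \<open>L\<close>, its speed would be bounded below by the
  positive minimum of \<open>H\<close> on the compact interval from its value at 0 to
  \<open>L\<close>.\<close>

lemma autonomous_reaches:
  fixes \<phi> :: "real => real"
  assumes H: "continuous_on {-1<..<1} H" "\<And>x. -1 < x ==> x < 1 ==> H x > 0"
    and \<phi>: "\<And>s. (\<phi> has_real_derivative H (\<phi> s)) (at s)" "\<And>s. -1 < \<phi> s" "\<And>s. \<phi> s < 1" and L: "L < 1"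
  shows "\<exists>s. \<phi> s > L"
proof (rule ccontr)
  assume "\<not> ?thesis"
  then have le: "\<phi> s \<le> L" for s by (simp add: not_less)
  have mono: "\<phi> s \<le> \<phi> t" if "s \<le> t" for s t
    by (rule DERIV_nonneg_imp_nondecreasing[OF that]) (use \<phi> H(2) in \<open>blast intro: less_imp_le\<close>)
  have sub: "{\<phi> 0..L} \<subseteq> {-1<..<1}" using \<phi>(2)[of 0] L by auto
  obtain x0 where x0: "x0 \<in> {\<phi> 0..L}" "\<And>x. x \<in> {\<phi> 0..L} ==> H x0 \<le> H x"
    using continuous_attains_inf[OF compact_Icc _ continuous_on_subset[OF H(1) sub]] le[of 0] by auto
  have m: "H x0 > 0" using H(2) x0(1) sub by auto
  \<comment> \<open>In this time the solution would grow by at least 3, more than the length 2 of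
    its interval.\<close>
  define s where "s = 3 / H x0"
  have s: "s > 0" using m by (simp add: s_def)
  obtain z where z: "0 < z" "z < s" "\<phi> s - \<phi> 0 = (s - 0) * H (\<phi> z)" using MVT2[OF s \<phi>(1)] by blast
  have "\<phi> z \<in> {\<phi> 0..L}" using mono[of 0 z] le z by auto
  then have "s * H x0 \<le> \<phi> s - \<phi> 0" using z x0(2) s by simp
  moreover have "s * H x0 = 3" using m by (simp add: s_def)
  ultimately show False using \<phi>(3)[of s] \<phi>(2)[of 0] by linarith
qed

lemma autonomous_reaches':
  fixes \<phi> :: "real => real"
  assumes H: "continuous_on {-1<..<1} H" "\<And>x. -1 < x ==> x < 1 ==> H x > 0"
    and \<phi>: "\<And>s. (\<phi> has_real_derivative H (\<phi> s)) (at s)" "\<And>s. -1 < \<phi> s" "\<And>s. \<phi> s < 1" and L: "L > -1"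
  shows "\<exists>s. \<phi> s < L"
proof -
  have "\<exists>s. - \<phi> (- s) > - L"
  proof (rule autonomous_reaches[where H = "%x. H (- x)"])
    show "continuous_on {-1<..<1} (%x. H (- x))" by (rule continuous_on_compose2[OF H(1)]) (auto intro!: continuous_intros)
    show "((%s. - \<phi> (- s)) has_real_derivative H (- (- \<phi> (- s)))) (at s)" for s
    proof -
      have "((%s. \<phi> (- s)) has_real_derivative H (\<phi> (- s)) * (- 1)) (at s)"
        by (rule DERIV_chain2[OF \<phi>(1)]) (auto intro!: derivative_eq_intros)
      from DERIV_minus[OF this] show ?thesis by simp
    qed
  qed (use H(2) \<phi> L in auto)
  then show ?thesis by auto
qed

text \<open>\<open>J\<close> sends the radial field \<open>axis 3 (y $ 3)\<close> to the circle
  field, so along it x grows at the rate h(x). This autonomous equation is the means of comparing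
  two metrics.\<close>

lemma cohomogeneity_chart:
  assumes "cohomogeneity_one_form p q a c h g"
  defines "\<psi> \<equiv> PB_chart p q 1 1 1"
  obtains X \<theta> where "continuous_on {-1<..<1} h" "\<And>x. -1 < x ==> x < 1 ==> h x > 0"
    "\<And>y. y \<in> off_zero ==> X differentiable (at y)" "\<And>y. y \<in> off_zero ==> -1 < X y" "\<And>y. y \<in> off_zero ==> X y < 1"
    "\<And>y. y \<in> off_zero ==> dird X y (axis 3 (y $ 3)) = h (X y)" "\<And>y. y \<in> off_zero ==> g \<psi> y (circle_field y) (circle_field y) = h (X y)"
    "\<And>y v. y \<in> off_zero ==> dird X y (J v) = - h (X y) * \<theta> y v"
    "\<And>y u v. y \<in> off_zero ==> g \<psi> y u v = dird X y u * dird X y v / h (X y) + h (X y) * \<theta> y u * \<theta> y v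
        + (- real_of_int p / 2 * X y + a) * FS (y $ 1) (u $ 1) (v $ 1) + (- real_of_int q / 2 * X y + c) * FS (y $ 2) (u $ 2) (v $ 2)"
proof -
  obtain x \<theta> where h: "smooth_on {-1<..<1} h" "\<forall>t\<in>{-1<..<1}. h t > 0" and img: "x ` principal p q = {-1<..<1}"
    and sm: "smooth_on off_zero (x \<circ> \<psi>)"
    and all: "\<forall>y\<in>off_zero. dird (x \<circ> \<psi>) y (circle_field y) = 0 \<and> \<theta> y (circle_field y) = 1 \<and>
               (\<forall>v. dird (x \<circ> \<psi>) y (J v) = - h ((x \<circ> \<psi>) y) * \<theta> y v) \<and>
               (\<forall>u v. g \<psi> y u v = dird (x \<circ> \<psi>) y u * dird (x \<circ> \<psi>) y v / h ((x \<circ> \<psi>) y) + h ((x \<circ> \<psi>) y) * \<theta> y u * \<theta> y v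
                        + (- real_of_int p / 2 * (x \<circ> \<psi>) y + a) * FS (y $ 1) (u $ 1) (v $ 1) + (- real_of_int q / 2 * (x \<circ> \<psi>) y + c) * FS (y $ 2) (u $ 2) (v $ 2))"
  proof -
    from assms(1) obtain x \<theta> where 1: "smooth_on {-1<..<1} h" "\<forall>t\<in>{-1<..<1}. h t > 0" "x ` principal p q = {-1<..<1}"
      and 2: "\<forall>i j. let \<psi> = PB_chart p q i j 1; X = x \<circ> \<psi> in
            smooth_on off_zero X \<and>
            (\<forall>y\<in>off_zero.
               dird X y (circle_field y) = 0 \<and>
               \<theta> i j y (circle_field y) = 1 \<and>
               (\<forall>v. dird X y (J v) = - h (X y) * \<theta> i j y v) \<and>
               (\<forall>u v. dird (%y. \<theta> i j y v) y u - dird (%y. \<theta> i j y u) y v =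
                        - real_of_int p / 2 * FS_form (y $ 1) (u $ 1) (v $ 1) + - real_of_int q / 2 * FS_form (y $ 2) (u $ 2) (v $ 2)) \<and>
               (\<forall>u v. g \<psi> y u v =
                        dird X y u * dird X y v / h (X y)
                        + h (X y) * \<theta> i j y u * \<theta> i j y v
                        + (- real_of_int p / 2 * X y + a) * FS (y $ 1) (u $ 1) (v $ 1)
                        + (- real_of_int q / 2 * X y + c) * FS (y $ 2) (u $ 2) (v $ 2)))"
      unfolding cohomogeneity_one_form_def Let_def apply (elim conjE exE) subgoal premises pr for x \<theta> apply (rule pr(1)) apply (rule pr(3)) apply (rule pr(4)) apply (rule pr(9)) apply (rule pr(10)) done done
    from 2[rule_format, of 1 1, unfolded Let_def] show thesis
      by (intro that[OF 1, of "\<theta> 1 1"]) (simp_all add: \<psi>_def)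
  qed
  define X where "X = x \<circ> \<psi>"
  note all = all[folded X_def, rule_format]
  have dX: "X differentiable (at y)" if "y \<in> off_zero" for y using smooth_onD[OF sm that] by (simp add: X_def)
  have Xr: "-1 < X y" "X y < 1" if "y \<in> off_zero" for y
  proof -
    have "\<psi> y \<in> principal p q" using that by (auto simp: principal_def \<psi>_def)
    then have "x (\<psi> y) \<in> {-1<..<1}" using img by blast
    then show "-1 < X y" "X y < 1" by (simp_all add: X_def)
  qed
  show thesis
  proof (rule that[of X \<theta>])
    show "continuous_on {-1<..<1} h" by (rule smooth_on_continuous[OF h(1)])
    show "h x > 0" if "-1 < x" "x < 1" for x using h(2) that by auto
    fix y assume y: "y \<in> off_zero"
    have "dird X y (J (circle_field y)) = - h (X y)" using all[OF y] by simp
    moreover have "J (circle_field y) = - axis 3 (y $ 3)" by (simp add: J_def circle_field_def vec_eq_iff axis_def)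
    moreover have "dird X y (- axis 3 (y $ 3)) = - dird X y (axis 3 (y $ 3))" by (rule linear_neg[OF dird_linear[OF dX[OF y]]])
    ultimately show "dird X y (axis 3 (y $ 3)) = h (X y)" by simp
    show "g \<psi> y (circle_field y) (circle_field y) = h (X y)"
      using all[OF y] by (simp add: circle_field_def axis_def FS_def)
  qed (use all dX Xr in blast)+
qed

text \<open>The length of the circle field gives h'(x') = r h(x), so along radial flow lines x' is r
  x plus a constant. Both coordinates sweep out all of (-1, 1), which forces r = 1 and x' = x; then
  the parameters are read off at one point.\<close>

lemma effective: "parameters_effective p q"
  unfolding parameters_effective_def
proof (intro allI impI notI, elim conjE)
  fix ac ac' g g'
  assume "g \<in> extremal_family p q ac" "g' \<in> extremal_family p q ac'" and ne: "ac \<noteq> ac'" and scale: "same_up_to_scale (PB p q) g g'"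
  then obtain h h' where f: "cohomogeneity_one_form p q (fst ac) (snd ac) h g" and f': "cohomogeneity_one_form p q (fst ac') (snd ac') h' g'"
    unfolding extremal_family_def by blast
  define \<psi> where "\<psi> = PB_chart p q 1 1 1"
  have "\<psi> \<in> PB p q" by (auto simp: \<psi>_def PB_def)
  then obtain r where r: "r > 0" "\<And>z u v. g' \<psi> z u v = r * g \<psi> z u v" using scale unfolding same_up_to_scale_def by blast
  obtain X \<theta> where h: "continuous_on {-1<..<1} h" "\<And>x. -1 < x ==> x < 1 ==> h x > 0"
    and X: "\<And>y. y \<in> off_zero ==> X differentiable (at y)" "\<And>y. y \<in> off_zero ==> -1 < X y" "\<And>y. y \<in> off_zero ==> X y < 1"
    "\<And>y. y \<in> off_zero ==> dird X y (axis 3 (y $ 3)) = h (X y)" "\<And>y. y \<in> off_zero ==> g \<psi> y (circle_field y) (circle_field y) = h (X y)"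
    "\<And>y v. y \<in> off_zero ==> dird X y (J v) = - h (X y) * \<theta> y v"
    "\<And>y u v. y \<in> off_zero ==> g \<psi> y u v = dird X y u * dird X y v / h (X y) + h (X y) * \<theta> y u * \<theta> y v
        + (- real_of_int p / 2 * X y + fst ac) * FS (y $ 1) (u $ 1) (v $ 1) + (- real_of_int q / 2 * X y + snd ac) * FS (y $ 2) (u $ 2) (v $ 2)"
    by (rule cohomogeneity_chart[OF f, folded \<psi>_def]) (rule that; assumption)
  obtain X' \<theta>' where h': "continuous_on {-1<..<1} h'" "\<And>x. -1 < x ==> x < 1 ==> h' x > 0"
    and X': "\<And>y. y \<in> off_zero ==> X' differentiable (at y)" "\<And>y. y \<in> off_zero ==> -1 < X' y" "\<And>y. y \<in> off_zero ==> X' y < 1"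
    "\<And>y. y \<in> off_zero ==> dird X' y (axis 3 (y $ 3)) = h' (X' y)" "\<And>y. y \<in> off_zero ==> g' \<psi> y (circle_field y) (circle_field y) = h' (X' y)"
    "\<And>y v. y \<in> off_zero ==> dird X' y (J v) = - h' (X' y) * \<theta>' y v"
    "\<And>y u v. y \<in> off_zero ==> g' \<psi> y u v = dird X' y u * dird X' y v / h' (X' y) + h' (X' y) * \<theta>' y u * \<theta>' y v
        + (- real_of_int p / 2 * X' y + fst ac') * FS (y $ 1) (u $ 1) (v $ 1) + (- real_of_int q / 2 * X' y + snd ac') * FS (y $ 2) (u $ 2) (v $ 2)"
    by (rule cohomogeneity_chart[OF f', folded \<psi>_def]) (rule that; assumption)
  have hh: "h' (X' y) = r * h (X y)" if "y \<in> off_zero" for y using X(5)[OF that] X'(5)[OF that] r(2) by metis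
  have eq: "r = 1 \<and> X' y = X y" if y: "y \<in> off_zero" for y
  proof -
    \<comment> \<open>The flow line of the radial field through \<open>y\<close>, defined for all
      times.\<close>
    define \<gamma> where "\<gamma> s = upd3 y (exp s *\<^sub>R (y $ 3))" for s :: real
    have \<gamma>: "\<gamma> s \<in> off_zero" for s using y by (simp add: \<gamma>_def off_zero_def upd3_nth)
    have \<gamma>d: "(\<gamma> has_vector_derivative axis 3 (\<gamma> s $ 3)) (at s)" for s
    proof -
      have "((%s. exp s *\<^sub>R (y $ 3)) has_vector_derivative exp s *\<^sub>R (y $ 3)) (at s)"
        by (rule has_vector_derivative_scaleR[OF DERIV_exp has_vector_derivative_const, simplified])
      then have "((%s. exp s *\<^sub>R (y $ 3) - y $ 3) has_vector_derivative exp s *\<^sub>R (y $ 3)) (at s)"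
        using has_vector_derivative_diff[OF _ has_vector_derivative_const] by fastforce
      from bounded_linear.has_vector_derivative[OF bounded_linear_axis3 this]
      show ?thesis unfolding \<gamma>_def upd3_def by (simp add: has_vector_derivative_add_const add.commute[of y] axis_def)
    qed
    have D: "((%s. X (\<gamma> s)) has_real_derivative h (X (\<gamma> s))) (at s)" and D': "((%s. X' (\<gamma> s)) has_real_derivative h' (X' (\<gamma> s))) (at s)" for s
      using has_vector_derivative_dird[OF X(1)[OF \<gamma>] \<gamma>d] has_vector_derivative_dird[OF X'(1)[OF \<gamma>] \<gamma>d] X(4)[OF \<gamma>] X'(4)[OF \<gamma>]
      by (simp_all add: has_real_derivative_iff_has_vector_derivative)
    define k where "k = X' (\<gamma> 0) - r * X (\<gamma> 0)"
    have k: "X' (\<gamma> s) = r * X (\<gamma> s) + k" for s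
    proof -
      have "((%s. X' (\<gamma> s) - r * X (\<gamma> s)) has_real_derivative 0) (at t)" for t
        using DERIV_diff[OF D'[of t] DERIV_cmult[OF D[of t], of r]] hh[OF \<gamma>, of t] by simp
      then have "X' (\<gamma> s) - r * X (\<gamma> s) = X' (\<gamma> 0) - r * X (\<gamma> 0)" using DERIV_isconst_all[of "%s. X' (\<gamma> s) - r * X (\<gamma> s)"] by blast
      then show ?thesis by (simp add: k_def)
    qed
    have re: "\<exists>s. X (\<gamma> s) > L" if "L < 1" for L
      by (rule autonomous_reaches[OF h(1) _ D X(2)[OF \<gamma>] X(3)[OF \<gamma>] that]) (rule h(2))
    have re': "\<exists>s. X' (\<gamma> s) > L" if "L < 1" for L
      by (rule autonomous_reaches[OF h'(1) _ D' X'(2)[OF \<gamma>] X'(3)[OF \<gamma>] that]) (rule h'(2))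
    have lo: "\<exists>s. X (\<gamma> s) < L" if "L > -1" for L
      by (rule autonomous_reaches'[OF h(1) _ D X(2)[OF \<gamma>] X(3)[OF \<gamma>] that]) (rule h(2))
    have lo': "\<exists>s. X' (\<gamma> s) < L" if "L > -1" for L
      by (rule autonomous_reaches'[OF h'(1) _ D' X'(2)[OF \<gamma>] X'(3)[OF \<gamma>] that]) (rule h'(2))
    \<comment> \<open>This and the next three inequalities compare the suprema and infima of both
      sides of X' = r X + k.\<close>
    have 1: "r + k \<ge> 1"
    proof (rule ccontr)
      assume "\<not> 1 \<le> r + k"
      then obtain s where "X' (\<gamma> s) > r + k" using re'[of "r + k"] by auto
      moreover have "r * X (\<gamma> s) < r * 1" using X(3)[OF \<gamma>] r(1) by (intro mult_strict_left_mono)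
      ultimately show False using k[of s] by simp
    qed
    have 2: "r + k \<le> 1"
    proof (rule ccontr)
      assume "\<not> r + k \<le> 1"
      then have "(1 - k) / r < 1" using r(1) by (simp add: field_simps)
      from re[OF this] obtain s where "(1 - k) / r < X (\<gamma> s)" by blast
      then have "1 < r * X (\<gamma> s) + k" using r(1) by (simp add: field_simps)
      then show False using k[of s] X'(3)[OF \<gamma>, of s] by simp
    qed
    have 3: "- r + k \<le> -1"
    proof (rule ccontr)
      assume "\<not> - r + k \<le> -1"
      then obtain s where "X' (\<gamma> s) < - r + k" using lo'[of "- r + k"] by auto
      moreover have "r * (-1) < r * X (\<gamma> s)" using X(2)[OF \<gamma>] r(1) by (intro mult_strict_left_mono)
      ultimately show False using k[of s] by simp
    qed
    have 4: "- r + k \<ge> -1"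
    proof (rule ccontr)
      assume "\<not> - r + k \<ge> -1"
      then have "(-1 - k) / r > -1" using r(1) by (simp add: field_simps)
      from lo[OF this] obtain s where "X (\<gamma> s) < (-1 - k) / r" by blast
      then have "r * X (\<gamma> s) + k < -1" using r(1) by (simp add: field_simps)
      then show False using k[of s] X'(2)[OF \<gamma>, of s] by simp
    qed
    have rk: "r = 1" "k = 0" using 1 2 3 4 by linarith+
    have "\<gamma> 0 = y" by (simp add: \<gamma>_def)
    then show ?thesis using rk k[of 0] by simp
  qed
  define y :: "complex^3" where "y = axis 3 1"
  have y: "y \<in> off_zero" by (simp add: y_def off_zero_def axis_def)
  have r1: "r = 1" using eq[OF y] by simp
  have Xy: "X' y = X y" and hy: "h' (X y) = h (X y)" using eq[OF y] hh[OF y] by simp_all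
  have hp: "h (X y) > 0" using h(2) X(2,3) y by blast
  have dXX: "dird X' y = dird X y" by (rule dird_cong_open[OF open_off_zero y]) (use eq in blast)
  \<comment> \<open>Where h is nonzero the connection form is determined by dX composed with
    \<open>J\<close>.\<close>
  have th: "\<theta>' y v = \<theta> y v" for v using X(6)[OF y, of v] X'(6)[OF y, of v] hp unfolding dXX Xy hy by simp
  have gg: "g' \<psi> y u u = g \<psi> y u u" for u using r(2) r1 by simp
  \<comment> \<open>On \<open>axis 1 1\<close> the round metric of the second factor vanishes and
    that of the first does not, so equality of the metrics isolates the first parameter.\<close>
  have "fst ac' = fst ac" using gg[of "axis 1 1"] unfolding X(7)[OF y] X'(7)[OF y] dXX Xy hy th by (simp add: axis_def y_def FS_def)
  moreover have "snd ac' = snd ac" using gg[of "axis 2 1"] unfolding X(7)[OF y] X'(7)[OF y] dXX Xy hy th by (simp add: axis_def y_def FS_def)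
  ultimately show False using ne by (simp add: prod_eq_iff)
qed

theorem theorem8p14:
  fixes p q :: int
  shows "(p = 0 \<and> q = 0 \<longrightarrow>
            biholomorphic (PB p q) CP1_cubed \<and>
            {0<..} \<times> {0<..} \<subseteq> csc_parameters p q \<and>
            parameters_effective p q) \<and>
         (p > 0 \<and> q < 0 \<longrightarrow>
            (\<exists>\<gamma> :: real \<Rightarrow> real \<times> real.
               continuous_on {0<..<1} \<gamma> \<and> inj_on \<gamma> {0<..<1} \<and>
               \<gamma> ` {0<..<1} \<subseteq> csc_parameters p q) \<and>
            parameters_effective p q) \<and>
         (p \<ge> 0 \<and> q > 0 \<longrightarrow>
            \<not> (\<exists>g. kahler_metric (PB p q) g \<and> constant_scalar_curvature (PB p q) g))"
proof (intro conjI impI)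
  assume 0: "p = 0 \<and> q = 0"
  show "biholomorphic (PB p q) CP1_cubed" using 0 by (simp add: biholomorphic_product)
  show "{0<..} \<times> {0<..} \<subseteq> csc_parameters p q" using 0 csc_parameters_product by simp
next
  assume "p > 0 \<and> q < 0"
  then show "\<exists>\<gamma> :: real => real \<times> real. continuous_on {0<..<1} \<gamma> \<and> inj_on \<gamma> {0<..<1} \<and> \<gamma> ` {0<..<1} \<subseteq> csc_parameters p q"
    by (elim conjE) (rule csc_curve)
next
  assume "p \<ge> 0 \<and> q > 0"
  then show "\<not> (\<exists>g. kahler_metric (PB p q) g \<and> constant_scalar_curvature (PB p q) g)" using no_csc[of p q] by metis
qed (rule effective)+

end
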